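(* Suppose Assumption (A1) holds, and let $[(G_n,\xi^n)]$, $n\in\mathbb N$, and $[(G,\xi)]$ be a.s. finitely dissociable $\mathcal G_*[\bar{\mathcal K},\mathcal K\times\mathcal X]$-valued random elements such that $[(G,\xi)]$ satisfies Assumption (A2). If $[(G_n,\xi^n)]\Rightarrow[(G,\xi)]$ (convergence in distribution) in $\mathcal G_*[\bar{\mathcal K},\mathcal K\times\mathcal X]$, then the strong solutions satisfy $[(G_n,X^{G_n,\xi^n})]\Rightarrow[(G,X^{G,\xi})]$ in $\mathcal G_*[\bar{\mathcal K},\mathcal K\times\mathcal D]$.
   Context: Setting. $\mathcal X\subseteq\mathbb Z$ is a countable state space with the discrete topology; $\mathcal J\subseteq\{i-j:i,j\in\mathcal X,i\ne j\}$ is the set of allowed jumps, equipped with a finite measure $\varsigma$ with $\varsigma(\{j\})>0$ for all $j\in\mathcal J$ and $\sum_{j}|j|\varsigma(\{j\})<\infty$. $\bar{\mathcal K},\mathcal K$ are Polish spaces (edge and vertex mark spaces). All graphs are simple and locally finite. A $(\bar{\mathcal K},\mathcal K)$-graph is a graph $G=(V,E)$, possibly with a distinguished root $o\in V$, together with marks $\bar\kappa\in\bar{\mathcal K}^E$, $\kappa\in\mathcal K^V$; a $(\bar{\mathcal K},\mathcal K\times\mathcal X)$-graph $(G,\xi)$ additionally carries vertex marks $\xi\in\mathcal X^V$ (initial conditions). For $v\in V$, $N_v$ is the set of neighbours of $v$ and $\mathrm{cl}_v=\{v\}\cup N_v$; $G[U]$ is the induced subgraph on $U$. $\mathcal D=D([0,\infty);\mathcal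 X)$ is the space of càdlàg paths with the Skorokhod J1 topology on compacts, $\mathcal D^U$ the product space. Jump rates. For each $j\in\mathcal J$, each $(\bar{\mathcal K},\mathcal K)$-graph $G$ and $v\in V_G$ there is a function $r^{G,v}_j:\mathbb R_+\times\mathcal D^{V_G}\to\mathbb R_+$. Standing Assumption: for each $j$ there is a family of Borel functions $\bar r^H_j:\mathbb R_+\times\mathcal D^{V_H}\times\bar{\mathcal K}^{E_H}\times\mathcal K^{V_H}\to\mathbb R_+$ indexed by finite rooted graphs $H$ of radius 1, which is invariant under rooted graph isomorphisms (with arguments permuted accordingly) and predictable ($\bar r^H_j(t,x,\cdot,\cdot)=\bar r^H_j(t,y,\cdot,\cdot)$ whenever $x(s)=y(s)$ for all $s\in[0,t)$), such that $r^{G,v}_j(t,x)=\bar r^{H_v}_j(t,x|_{\mathrm{cl}_v},\bar\kappa|_{E(H_v)},\kappa|_{\mathrm{cl}_v})$, where $H_v=G[\mathrm{cl}_v]$ rooted at $v$. SDE. Given initial data $(G,\xi)$, the SDE is $(\ast)\quad X_v(t)=\xi_v+\int_{(0,t]\times\mathbb R_+\times\mathcal J} j\,\mathbf 1\{r\le r^{G,v}_j(s,X)\}\,N_v(ds,dr,dj),\quad v\in V_G,\ t\ge0.$ Driving noise: on a complete filtered probability space $(\Omega,\mathcal F,\mathbb F,P)$ satisfying the usual conditions on which $(G,\xi)$ is $\mathcal F_0$-measurable, a family $N^G=(N_v)_{v\in V_G}$ (viewed as vertex marks of $G$) such that (i) conditionally on $\mathcal F_0$ the $N_v$ are i.i.d.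 Poisson random measures on $\mathbb R_+^2\times\mathcal J$ with intensity $\mathrm{Leb}^2\otimes\varsigma$; (ii) for $t>0$ and Borel $A\subseteq(t,\infty)\times\mathbb R_+\times\mathcal J$, $(G,N^G(A))$ is conditionally independent of $\mathcal F_t$ given $\mathcal F_0$; (iii) $N_v$ is $\mathbb F$-adapted for each $\mathcal F_0$-measurable vertex $v$. A weak solution is such a space and noise together with $\mathbb F$-adapted $\mathcal D$-valued vertex marks $X$ satisfying $(\ast)$ a.s. A strong solution is a weak solution in which $\mathbb F$ is the augmented (complete, right-continuous) filtration generated by $(G,\xi)$ and the restrictions of $N^G$ to $[0,t]\times\mathbb R_+\times\mathcal J$. Pathwise uniqueness: any two weak solutions on the same space with the same filtration and noise coincide a.s. Uniqueness in law: any two weak solutions for initial data with the same law have the same law. The SDE is well-posed if a weak solution exists and uniqueness in law holds, and strongly well-posed if a weak solution exists and pathwise uniqueness holds. Isomorphism classes. Two rooted marked graphs are isomorphic if there is a bijection of vertex sets preserving adjacency, root and all marks. For a rooted marked graph $G$, $[G]$ denotes the isomorphism class of the connected component of the root; $\mathcal G_*[\bar{\mathcal K},\mathcal K]$ is the space of such classes, with the local topology: $[G_n]\to[G]$ iff for each $m\in\mathbb N$ there is $n_m$ and, for $n>n_m$, rooted graph isomorphisms $\varphi_{n,m}$ from the (unmarked) ball $B_m(G)$ of radius $m$ around the root onto $B_m(G_n)$ with $\kappa^n_{\varphi_{n,m}(v)}\to\kappa_v$ and $\bar\kappa^n_{\varphi_{n,m}(e)}\to\bar\kappa_e$ for all vertices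 $v$ and edges $e$ of $B_m(G)$. This space is Polish. The SDE is (strongly) well-posed for random initial data $[(G,\xi)]$ if there is a random graph $(G,\xi)$ lying a.s. in $[(G,\xi)]$ for which it is (strongly) well-posed; a strong (resp. weak) solution for $[(G,\xi)]$ is the class $[(G,X)]$ of a strong (resp. weak) solution for such a representative. In $\mathcal G_*[\bar{\mathcal K},\mathcal K\times\mathcal D]$ a solution is viewed as the graph with vertex marks $(\kappa_v,X_v)$. Assumption (A1): there is a family of constants $C_{k,T}\in(0,\infty)$, $k\in\mathbb N$, $T\in\mathbb R_+$, non-decreasing in each index, such that for every $(\bar{\mathcal K},\mathcal K)$-graph $G$, $v\in V_G$, $j\in\mathcal J$, $x\in\mathcal D^{V_G}$, $T\ge0$ and $t\in[0,T]$, $r^{G,v}_j(t,x)\le C_{|\mathrm{cl}_v|,T}$. Finite dissociability (relative to the constants $C_{k,T}$ of (A1)). A deterministic graph $G$ (marks ignored) is finitely dissociable if for every $T\in(0,\infty)$ there is $\Delta\in(0,T]$ such that the following holds: if $(N_v)_{v\in V_G}$ are i.i.d. Poisson random measures on $\mathbb R_+^2\times\mathcal J$ with intensity $\mathrm{Leb}^2\otimes\varsigma$ and a vertex $v$ is called active when $N_v((0,\Delta]\times(0,C_{|\mathrm{cl}_v|,T}]\times\mathcal J)>0$, then a.s. every connected component of the subgraph of $G$ induced by the active vertices is finite. This property depends only on the isomorphism class; a random class is a.s. finitely dissociable if its realization is finitely dissociable a.s. Assumption (A2) for random initial data $[(G,\xi)]$: if $(G,X)=(V,E,o,\bar\kappa,\kappa,X)$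 is any representative of a strong solution for $[(G,\xi)]$, then a.s., for every $j\in\mathcal J$, $v\in V$ and Lebesgue-a.e. $t\ge0$, the point $(\bar\kappa,\kappa)$ is a continuity point of the map $\bar{\mathcal K}^E\times\mathcal K^V\ni(\bar\vartheta,\vartheta)\mapsto r^{(V,E,o,\bar\vartheta,\vartheta),v}_j(t,X)$ (product topologies). *)

theory Defs
  imports "HOL-Analysis.Analysis" "HOL-Probability.Probability"
begin

text \<open>Edges are 2-element subsets of the vertex set; edge marks are indexed by edges,
vertex marks by vertices. Values of the mark functions outside the edge/vertex set are
irrelevant junk.\<close>

record ('e,'m) mgraph =
  verts :: "nat set"
  edges :: "nat set set"
  root  :: nat
  emark :: "nat set \<Rightarrow> 'e"
  vmark :: "nat \<Rightarrow> 'm"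

definition nbrs :: "nat set set \<Rightarrow> nat \<Rightarrow> nat set" where
  "nbrs E v = {u. u \<noteq> v \<and> {u, v} \<in> E}"

definition clos :: "nat set set \<Rightarrow> nat \<Rightarrow> nat set" where
  "clos E v = insert v (nbrs E v)"

definition induced_edges :: "nat set set \<Rightarrow> nat set \<Rightarrow> nat set set" where
  "induced_edges E U = {e \<in> E. e \<subseteq> U}"

fun ballv :: "nat set set \<Rightarrow> nat \<Rightarrow> nat \<Rightarrow> nat set" where
  "ballv E r 0 = {r}"
| "ballv E r (Suc m) = ballv E r m \<union> (\<Union>u\<in>ballv E r m. nbrs E u)"

definition compv :: "nat set set \<Rightarrow> nat \<Rightarrow> nat set" where
  "compv E r = (\<Union>m. ballv E r m)"

definition wf_graph :: "('m \<Rightarrow> bool) \<Rightarrow> ('e,'m) mgraph \<Rightarrow> bool" where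
  "wf_graph ok G \<longleftrightarrow>
     root G \<in> verts G \<and>
     (\<forall>e\<in>edges G. \<exists>u w. u \<noteq> w \<and> e = {u, w} \<and> u \<in> verts G \<and> w \<in> verts G) \<and>
     (\<forall>v\<in>verts G. finite (nbrs (edges G) v)) \<and>
     verts G = compv (edges G) (root G) \<and>
     (\<forall>v\<in>verts G. ok (vmark G v))"

definition rooted_iso :: "(nat \<Rightarrow> nat) \<Rightarrow> nat set \<Rightarrow> nat set set \<Rightarrow> nat \<Rightarrow>
    nat set \<Rightarrow> nat set set \<Rightarrow> nat \<Rightarrow> bool" where
  "rooted_iso \<phi> U E r U' E' r' \<longleftrightarrow>
     bij_betw \<phi> U U' \<and> \<phi> r = r' \<and>
     (\<forall>u\<in>U. \<forall>w\<in>U. ({u, w} \<in> E \<longleftrightarrow> {\<phi> u, \<phi> w} \<in> E'))"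

definition marked_iso :: "('e,'m) mgraph \<Rightarrow> ('e,'m) mgraph \<Rightarrow> bool" where
  "marked_iso G H \<longleftrightarrow> (\<exists>\<phi>.
     rooted_iso \<phi> (verts G) (edges G) (root G) (verts H) (edges H) (root H) \<and>
     (\<forall>v\<in>verts G. vmark H (\<phi> v) = vmark G v) \<and>
     (\<forall>e\<in>edges G. emark H (\<phi> ` e) = emark G e))"

definition local_conv :: "((nat \<Rightarrow> 'm) \<Rightarrow> 'm \<Rightarrow> bool) \<Rightarrow>
    (nat \<Rightarrow> ('e::topological_space,'m) mgraph) \<Rightarrow> ('e,'m) mgraph \<Rightarrow> bool" where
  "local_conv mconv Gs G \<longleftrightarrow> (\<forall>m. \<exists>\<phi> :: nat \<Rightarrow> nat \<Rightarrow> nat. \<exists>n0.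
     (\<forall>n>n0. rooted_iso (\<phi> n) (ballv (edges G) (root G) m) (edges G) (root G)
                (ballv (edges (Gs n)) (root (Gs n)) m) (edges (Gs n)) (root (Gs n))) \<and>
     (\<forall>v\<in>ballv (edges G) (root G) m. mconv (\<lambda>n. vmark (Gs n) (\<phi> n v)) (vmark G v)) \<and>
     (\<forall>e\<in>induced_edges (edges G) (ballv (edges G) (root G) m).
        (\<lambda>n. emark (Gs n) (\<phi> n ` e)) \<longlonglongrightarrow> emark G e))"

text \<open>Bounded continuous real functions on the space of isomorphism classes, represented
as isomorphism-invariant functions on well-formed representatives.\<close>
definition test_fun :: "('m \<Rightarrow> bool) \<Rightarrow> ((nat \<Rightarrow> 'm) \<Rightarrow> 'm \<Rightarrow> bool) \<Rightarrow>
    (('e::topological_space,'m) mgraph \<Rightarrow> real) \<Rightarrow> bool" where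
  "test_fun ok mconv f \<longleftrightarrow>
     (\<exists>B. \<forall>G. wf_graph ok G \<longrightarrow> \<bar>f G\<bar> \<le> B) \<and>
     (\<forall>G H. wf_graph ok G \<and> wf_graph ok H \<and> marked_iso G H \<longrightarrow> f G = f H) \<and>
     (\<forall>Gs G. (\<forall>n. wf_graph ok (Gs n)) \<and> wf_graph ok G \<and> local_conv mconv Gs G
              \<longrightarrow> (\<lambda>n. f (Gs n)) \<longlonglongrightarrow> f G)"

definition conv_distr :: "('m \<Rightarrow> bool) \<Rightarrow> ((nat \<Rightarrow> 'm) \<Rightarrow> 'm \<Rightarrow> bool) \<Rightarrow>
    (nat \<Rightarrow> 'w measure) \<Rightarrow> (nat \<Rightarrow> 'w \<Rightarrow> ('e::topological_space,'m) mgraph) \<Rightarrow>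
    'v measure \<Rightarrow> ('v \<Rightarrow> ('e,'m) mgraph) \<Rightarrow> bool" where
  "conv_distr ok mconv Ms Gs M G \<longleftrightarrow>
     (\<forall>f. test_fun ok mconv f \<longrightarrow>
        (\<lambda>n. \<integral>\<omega>. f (Gs n \<omega>) \<partial>Ms n) \<longlonglongrightarrow> (\<integral>\<omega>. f (G \<omega>) \<partial>M))"

type_synonym path = "real \<Rightarrow> int"

definition Dpath :: "int set \<Rightarrow> path \<Rightarrow> bool" where
  "Dpath S x \<longleftrightarrow> (\<forall>t\<ge>0. x t \<in> S) \<and> (\<forall>t<0. x t = x 0) \<and>
     (\<forall>t\<ge>0. continuous (at_right t) x) \<and> (\<forall>t>0. \<exists>l. (x \<longlongrightarrow> l) (at_left t))"

definition time_change :: "(real \<Rightarrow> real) \<Rightarrow> bool" where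
  "time_change lam \<longleftrightarrow> strict_mono_on {0..} lam \<and> continuous_on {0..} lam \<and> lam ` {0..} = {0..}"

text \<open>J1 convergence on compacts (Ethier--Kurtz, Prop. 3.5.3).\<close>
definition skor_conv :: "(nat \<Rightarrow> path) \<Rightarrow> path \<Rightarrow> bool" where
  "skor_conv xs x \<longleftrightarrow> (\<exists>lams. (\<forall>n. time_change (lams n)) \<and>
     (\<forall>T>0. \<forall>\<epsilon>>0. \<exists>N. \<forall>n\<ge>N. \<forall>t\<in>{0..T}.
        \<bar>lams n t - t\<bar> < \<epsilon> \<and> real_of_int \<bar>xs n (lams n t) - x t\<bar> < \<epsilon>))"

definition pathM :: "path measure" where
  "pathM = sigma UNIV {{x. x t = i} | t i. True}"

definition graphM :: "'e measure \<Rightarrow> 'm measure \<Rightarrow> ('e,'m) mgraph measure" where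
  "graphM eM mM = sigma UNIV
     ({{G. v \<in> verts G} | v. True} \<union> {{G. e \<in> edges G} | e. True} \<union> {{G. root G = v} | v. True} \<union>
      {{G. emark G e \<in> B} | e B. B \<in> sets eM} \<union> {{G. vmark G v \<in> B} | v B. B \<in> sets mM})"

definition jump_setting :: "int set \<Rightarrow> int set \<Rightarrow> (int \<Rightarrow> real) \<Rightarrow> bool" where
  "jump_setting Xs J \<sigma> \<longleftrightarrow> J \<subseteq> {i - k | i k. i \<in> Xs \<and> k \<in> Xs \<and> i \<noteq> k} \<and>
     (\<forall>j\<in>J. \<sigma> j > 0) \<and> \<sigma> summable_on J \<and> (\<lambda>j. real_of_int \<bar>j\<bar> * \<sigma> j) summable_on J"

type_synonym ('e,'k) rbar_fam =
  "int \<Rightarrow> nat set \<times> nat set set \<times> nat \<Rightarrow> real \<Rightarrow> (nat \<Rightarrow> path) \<Rightarrow> (nat set \<Rightarrow> 'e) \<Rightarrow> (nat \<Rightarrow> 'k) \<Rightarrow> real"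

definition radius1 :: "nat set \<times> nat set set \<times> nat \<Rightarrow> bool" where
  "radius1 H \<longleftrightarrow> (case H of (U, E, r) \<Rightarrow>
     finite U \<and> r \<in> U \<and> (\<forall>e\<in>E. \<exists>u w. u \<noteq> w \<and> e = {u, w} \<and> u \<in> U \<and> w \<in> U) \<and>
     (\<forall>u\<in>U. u \<noteq> r \<longrightarrow> {u, r} \<in> E))"

definition rate :: "('e,'k) rbar_fam \<Rightarrow> int \<Rightarrow> nat set set \<Rightarrow> (nat set \<Rightarrow> 'e) \<Rightarrow> (nat \<Rightarrow> 'k) \<Rightarrow>
    nat \<Rightarrow> real \<Rightarrow> (nat \<Rightarrow> path) \<Rightarrow> real" where
  "rate rbar j E eb kap v t x =
     (let U = clos E v; EU = induced_edges E U
      in rbar j (U, EU, v) t (restrict x U) (restrict eb EU) (restrict kap U))"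

definition standing_rates :: "int set \<Rightarrow> int set \<Rightarrow>
    ('e::topological_space,'k::topological_space) rbar_fam \<Rightarrow> bool" where
  "standing_rates Xs J rbar \<longleftrightarrow> (\<forall>j\<in>J. \<forall>U E r. radius1 (U, E, r) \<longrightarrow>
     (\<forall>t x eb k. 0 \<le> t \<and> (\<forall>u\<in>U. Dpath Xs (x u)) \<longrightarrow>
        0 \<le> rbar j (U, E, r) t (restrict x U) (restrict eb E) (restrict k U)) \<and>
     (\<lambda>(t, x, eb, k). rbar j (U, E, r) t x eb k) \<in> borel_measurable
        (restrict_space (borel \<Otimes>\<^sub>M (PiM U (\<lambda>_. pathM) \<Otimes>\<^sub>M (PiM E (\<lambda>_. borel) \<Otimes>\<^sub>M PiM U (\<lambda>_. borel))))
           {(t, x, eb, k). 0 \<le> t \<and> (\<forall>u\<in>U. Dpath Xs (x u))}) \<and>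
     (\<forall>t x y eb k. 0 \<le> t \<and> (\<forall>u\<in>U. Dpath Xs (x u) \<and> Dpath Xs (y u)) \<and>
        (\<forall>u\<in>U. \<forall>s. 0 \<le> s \<and> s < t \<longrightarrow> x u s = y u s) \<longrightarrow>
        rbar j (U, E, r) t (restrict x U) (restrict eb E) (restrict k U) =
        rbar j (U, E, r) t (restrict y U) (restrict eb E) (restrict k U)) \<and>
     (\<forall>\<phi> U' E' r'. radius1 (U', E', r') \<and> rooted_iso \<phi> U E r U' E' r' \<longrightarrow>
        (\<forall>t x eb k. 0 \<le> t \<and> (\<forall>u\<in>U'. Dpath Xs (x u)) \<longrightarrow>
           rbar j (U', E', r') t (restrict x U') (restrict eb E') (restrict k U') =
           rbar j (U, E, r) t (restrict (x \<circ> \<phi>) U) (restrict (eb \<circ> (`) \<phi>) E) (restrict (k \<circ> \<phi>) U))))"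

definition A1 :: "int set \<Rightarrow> int set \<Rightarrow> ('e,'k) rbar_fam \<Rightarrow> (nat \<Rightarrow> real \<Rightarrow> real) \<Rightarrow> bool" where
  "A1 Xs J rbar C \<longleftrightarrow>
     (\<forall>k T. 0 \<le> T \<longrightarrow> 0 < C k T) \<and>
     (\<forall>k k' T T'. k \<le> k' \<and> 0 \<le> T \<and> T \<le> T' \<longrightarrow> C k T \<le> C k' T') \<and>
     (\<forall>G :: ('e,'k) mgraph. wf_graph (\<lambda>_. True) G \<longrightarrow>
        (\<forall>v\<in>verts G. \<forall>j\<in>J. \<forall>x. (\<forall>u\<in>verts G. Dpath Xs (x u)) \<longrightarrow>
          (\<forall>T t. 0 \<le> t \<and> t \<le> T \<longrightarrow>
             rate rbar j (edges G) (emark G) (vmark G) v t x \<le> C (card (clos (edges G) v)) T)))"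

type_synonym pt = "real \<times> real \<times> int"

definition intensity :: "int set \<Rightarrow> (int \<Rightarrow> real) \<Rightarrow> pt measure" where
  "intensity J \<sigma> = restrict_space lborel {0..} \<Otimes>\<^sub>M
     (restrict_space lborel {0..} \<Otimes>\<^sub>M point_measure J (\<lambda>j. ennreal (\<sigma> j)))"

definition cnt :: "'a set \<Rightarrow> 'a set \<Rightarrow> enat" where
  "cnt S A = (if finite (S \<inter> A) then enat (card (S \<inter> A)) else \<infinity>)"

definition poisson_prob :: "real \<Rightarrow> nat \<Rightarrow> real" where
  "poisson_prob \<mu> k = exp (- \<mu>) * \<mu> ^ k / fact k"

text \<open>Conditionally on the sigma-algebra F0, the point processes N v (v in V) are i.i.d.
Poisson random measures on R+ x R+ x J with intensity Leb x Leb x sigma (characterised by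
their finite-dimensional distributions on disjoint sets of finite intensity).\<close>
definition cond_iid_PRM :: "'w measure \<Rightarrow> 'w set set \<Rightarrow> ('w \<Rightarrow> nat set) \<Rightarrow>
    ('w \<Rightarrow> nat \<Rightarrow> pt set) \<Rightarrow> int set \<Rightarrow> (int \<Rightarrow> real) \<Rightarrow> bool" where
  "cond_iid_PRM M F0 V N J \<sigma> \<longleftrightarrow>
     (\<forall>v. \<forall>B\<in>sets (intensity J \<sigma>). \<forall>k. {\<omega>\<in>space M. v \<in> V \<omega> \<and> cnt (N \<omega> v) B = k} \<in> sets M) \<and>
     (\<forall>\<omega>\<in>space M. \<forall>v\<in>V \<omega>. N \<omega> v \<subseteq> {0..} \<times> {0..} \<times> J) \<and>
     (\<forall>E\<in>F0. \<forall>F :: nat set. \<forall>m :: nat. \<forall>B :: nat \<Rightarrow> pt set. \<forall>k :: nat \<Rightarrow> nat \<Rightarrow> nat.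
        finite F \<and> E \<subseteq> {\<omega>. F \<subseteq> V \<omega>} \<and>
        (\<forall>i<m. B i \<in> sets (intensity J \<sigma>) \<and> emeasure (intensity J \<sigma>) (B i) < \<infinity>) \<and>
        disjoint_family_on B {..<m} \<longrightarrow>
        measure M (E \<inter> (\<Inter>v\<in>F. \<Inter>i\<in>{..<m}. {\<omega>. cnt (N \<omega> v) (B i) = enat (k v i)})) =
        measure M E * (\<Prod>v\<in>F. \<Prod>i<m. poisson_prob (measure (intensity J \<sigma>) (B i)) (k v i)))"

definition active_set :: "int set \<Rightarrow> (nat \<Rightarrow> real \<Rightarrow> real) \<Rightarrow> real \<Rightarrow> real \<Rightarrow>
    ('e,'m) mgraph \<Rightarrow> (nat \<Rightarrow> pt set) \<Rightarrow> nat set" where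
  "active_set J C T \<Delta> G N = {v\<in>verts G.
     N v \<inter> ({0<..\<Delta>} \<times> {0<..C (card (clos (edges G) v)) T} \<times> J) \<noteq> {}}"

definition fin_dissoc :: "int set \<Rightarrow> (int \<Rightarrow> real) \<Rightarrow> (nat \<Rightarrow> real \<Rightarrow> real) \<Rightarrow>
    ('e,'m) mgraph \<Rightarrow> bool" where
  "fin_dissoc J \<sigma> C G \<longleftrightarrow> (\<forall>T>0. \<exists>\<Delta>. 0 < \<Delta> \<and> \<Delta> \<le> T \<and>
     (\<forall>P :: (nat \<Rightarrow> pt set) measure.
        prob_space P \<and> cond_iid_PRM P {{}, space P} (\<lambda>_. verts G) (\<lambda>\<omega>. \<omega>) J \<sigma> \<longrightarrow>
        (AE \<omega> in P. \<forall>v\<in>active_set J C T \<Delta> G \<omega>.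
           finite (({(u, w). {u, w} \<in> edges G} \<inter> (active_set J C T \<Delta> G \<omega> \<times> active_set J C T \<Delta> G \<omega>))\<^sup>* `` {v}))))"

definition usual_filtration :: "'w measure \<Rightarrow> (real \<Rightarrow> 'w set set) \<Rightarrow> bool" where
  "usual_filtration M F \<longleftrightarrow> prob_space M \<and>
     (\<forall>A B. B \<in> null_sets M \<and> A \<subseteq> B \<longrightarrow> A \<in> sets M) \<and>
     (\<forall>t\<ge>0. sigma_algebra (space M) (F t) \<and> F t \<subseteq> sets M) \<and>
     (\<forall>s t. 0 \<le> s \<and> s \<le> t \<longrightarrow> F s \<subseteq> F t) \<and>
     null_sets M \<subseteq> F 0 \<and>
     (\<forall>t\<ge>0. F t = (\<Inter>s\<in>{t<..}. F s))"

definition cond_indep :: "'w measure \<Rightarrow> 'w set set \<Rightarrow> 'w set set \<Rightarrow> 'w set set \<Rightarrow> bool" where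
  "cond_indep M G0 A B \<longleftrightarrow> (\<forall>E1\<in>A. \<forall>E2\<in>B. AE \<omega> in M.
     real_cond_exp M (sigma (space M) G0) (indicator (E1 \<inter> E2)) \<omega> =
     real_cond_exp M (sigma (space M) G0) (indicator E1) \<omega> *
     real_cond_exp M (sigma (space M) G0) (indicator E2) \<omega>)"

definition graph_events :: "'w measure \<Rightarrow> ('w \<Rightarrow> ('e::topological_space,'k::topological_space \<times> int) mgraph) \<Rightarrow> 'w set set" where
  "graph_events M G = {{\<omega>\<in>space M. G \<omega> \<in> S} | S. S \<in> sets (graphM borel borel)}"

definition noise_events :: "'w measure \<Rightarrow> ('w \<Rightarrow> nat set) \<Rightarrow> ('w \<Rightarrow> nat \<Rightarrow> pt set) \<Rightarrow> pt set \<Rightarrow> 'w set set" where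
  "noise_events M V N A = {{\<omega>\<in>space M. v \<in> V \<omega> \<and> cnt (N \<omega> v) A = k} | v k. True}"

definition used_pts :: "('e,'k) rbar_fam \<Rightarrow> ('e,'k \<times> int) mgraph \<Rightarrow> pt set \<Rightarrow> nat \<Rightarrow> real \<Rightarrow>
    (nat \<Rightarrow> path) \<Rightarrow> pt set" where
  "used_pts rbar G Nv v t x = {p \<in> Nv. 0 < fst p \<and> fst p \<le> t \<and>
     fst (snd p) \<le> rate rbar (snd (snd p)) (edges G) (emark G) (fst \<circ> vmark G) v (fst p) x}"

definition strong_solution :: "int set \<Rightarrow> int set \<Rightarrow> (int \<Rightarrow> real) \<Rightarrow>
    ('e::topological_space,'k::topological_space) rbar_fam \<Rightarrow>
    'w measure \<Rightarrow> (real \<Rightarrow> 'w set set) \<Rightarrow> ('w \<Rightarrow> ('e,'k \<times> int) mgraph) \<Rightarrow>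
    ('w \<Rightarrow> nat \<Rightarrow> pt set) \<Rightarrow> ('w \<Rightarrow> nat \<Rightarrow> path) \<Rightarrow> bool" where
  "strong_solution Xs J \<sigma> rbar M F G N X \<longleftrightarrow>
     usual_filtration M F \<and>
     (\<forall>\<omega>\<in>space M. wf_graph (\<lambda>(k, i). i \<in> Xs) (G \<omega>)) \<and>
     graph_events M G \<subseteq> F 0 \<and>
     cond_iid_PRM M (F 0) (\<lambda>\<omega>. verts (G \<omega>)) N J \<sigma> \<and>
     (\<forall>t>0. \<forall>A\<in>sets (intensity J \<sigma>). A \<subseteq> {t<..} \<times> UNIV \<longrightarrow>
        cond_indep M (F 0)
          (sigma_sets (space M) (graph_events M G \<union> noise_events M (\<lambda>\<omega>. verts (G \<omega>)) N A)) (F t)) \<and>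
     (\<forall>t\<ge>0. \<forall>A\<in>sets (intensity J \<sigma>). A \<subseteq> {..t} \<times> UNIV \<longrightarrow>
        noise_events M (\<lambda>\<omega>. verts (G \<omega>)) N A \<subseteq> F t) \<and>
     (\<forall>\<omega>\<in>space M. \<forall>v\<in>verts (G \<omega>). Dpath Xs (X \<omega> v)) \<and>
     (\<forall>v t s i. 0 \<le> s \<and> s \<le> t \<longrightarrow> {\<omega>\<in>space M. v \<in> verts (G \<omega>) \<and> X \<omega> v s = i} \<in> F t) \<and>
     (AE \<omega> in M. \<forall>v\<in>verts (G \<omega>). \<forall>t\<ge>0.
        finite (used_pts rbar (G \<omega>) (N \<omega> v) v t (X \<omega>)) \<and>
        X \<omega> v t = snd (vmark (G \<omega>) v) + (\<Sum>p\<in>used_pts rbar (G \<omega>) (N \<omega> v) v t (X \<omega>). snd (snd p))) \<and>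
     (\<forall>t\<ge>0. F t = (\<Inter>s\<in>{t<..}. sigma_sets (space M)
        (graph_events M G \<union>
         (\<Union>A\<in>{A\<in>sets (intensity J \<sigma>). A \<subseteq> {..s} \<times> UNIV}. noise_events M (\<lambda>\<omega>. verts (G \<omega>)) N A) \<union>
         null_sets M)))"

definition A2 :: "int set \<Rightarrow> ('e::topological_space,'k::topological_space) rbar_fam \<Rightarrow> 'w measure \<Rightarrow>
    ('w \<Rightarrow> ('e,'k \<times> int) mgraph) \<Rightarrow> ('w \<Rightarrow> nat \<Rightarrow> path) \<Rightarrow> bool" where
  "A2 J rbar M G X \<longleftrightarrow> (AE \<omega> in M. \<forall>j\<in>J. \<forall>v\<in>verts (G \<omega>). AE t in lborel. 0 \<le> t \<longrightarrow>
     ((\<lambda>(eb, kap). rate rbar j (edges (G \<omega>)) eb kap v t (X \<omega>)) \<longlongrightarrow>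
        rate rbar j (edges (G \<omega>)) (emark (G \<omega>)) (fst \<circ> vmark (G \<omega>)) v t (X \<omega>))
       (at (emark (G \<omega>), fst \<circ> vmark (G \<omega>))))"

definition sol_graph :: "('e,'k \<times> int) mgraph \<Rightarrow> (nat \<Rightarrow> path) \<Rightarrow> ('e,'k \<times> path) mgraph" where
  "sol_graph G x = \<lparr>verts = verts G, edges = edges G, root = root G, emark = emark G,
     vmark = (\<lambda>v. (fst (vmark G v), x v))\<rparr>"

definition init_ok :: "int set \<Rightarrow> 'k \<times> int \<Rightarrow> bool" where
  "init_ok Xs m \<longleftrightarrow> snd m \<in> Xs"

definition path_ok :: "int set \<Rightarrow> 'k \<times> path \<Rightarrow> bool" where
  "path_ok Xs m \<longleftrightarrow> Dpath Xs (snd m)"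

definition path_mconv :: "(nat \<Rightarrow> 'k::topological_space \<times> path) \<Rightarrow> 'k \<times> path \<Rightarrow> bool" where
  "path_mconv ms m \<longleftrightarrow> (\<lambda>n. fst (ms n)) \<longlonglongrightarrow> fst m \<and> skor_conv (\<lambda>n. snd (ms n)) (snd m)"

end

theory Submission
  imports Defs
begin

text \<open>The solution is the limit of Picard iterates driven by the noise: finite dissociability says that
  almost surely the value at a vertex up to a time depends on finitely many marks only, so the iteration becomes
  stationary. The mean \<open>g\<^sub>i\<close> of a test function of the \<open>i\<close>-th iterate on a deterministic graph need not be
  continuous in the graph, but its Lipschitz upper envelope \<open>u\<^sub>k(H) = sup {g\<^sub>i(y) - k d(y, H) | y, i \<ge> k}\<close> is, so that
  the expectations along the sequence are asymptotically at most \<open>E u\<^sub>k(G)\<close>. Near-maximisers \<open>y\<^sub>k\<close> of the envelope converge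
  locally to \<open>G\<close>; driving \<open>y\<^sub>k\<close> by the noise of \<open>G\<close>, the iterates on \<open>y\<^sub>k\<close> agree with \<open>X\<close> unless a mark
  falls between two rates that converge to each other by (A2), and the compensator of the noise bounds the probability
  of this event. Hence \<open>E u\<^sub>k(G)\<close> tends to the expectation under \<open>X\<close>. Applied to a test function and to
  its negative this gives the convergence.\<close>

text \<open>The solutions on different graphs live on different probability spaces and (A2) is
  available for the limit only, so every comparison of rates is made on the space that carries
  \<open>G\<close>. The competitors \<open>y\<close> in the envelope are arbitrary deterministic
  graphs, on which the equation need not have a solution; Picard iterates exist on every well-formed
  graph, and this is why the envelope is built from iterates. The number of iterations until a
  vertex becomes stationary has no bound that is uniform over graphs, hence the supremum over all
  \<open>i \<ge> k\<close>. Being deterministic, \<open>y\<close> can be driven by any noise: the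
  i.i.d. law is invariant under injective relabelling, so the noise of \<open>G\<close>, carried
  over by an isomorphism of balls and completed by independent noise on the labels that are not
  vertices, still produces the mean that enters the envelope. Selecting \<open>y\<close> from
  countably many cells makes the choice measurable. The envelope gives one-sided bounds only, which
  is enough because the negative of a test function is a test function.\<close>

section \<open>Balls, closed neighbourhoods and well-formed graphs\<close>

lemma ballv_mono: "m \<le> n \<Longrightarrow> ballv E r m \<subseteq> ballv E r n"
  by (induction n) (auto simp: le_Suc_eq)

lemma root_in_ballv: "r \<in> ballv E r m"
  using ballv_mono[of 0 m E r] by auto

lemma clos_ballv: "v \<in> ballv E r m \<Longrightarrow> clos E v \<subseteq> ballv E r (Suc m)"
  by (auto simp: clos_def)

lemma wf_ballv_verts: "wf_graph ok G \<Longrightarrow> ballv (edges G) (root G) m \<subseteq> verts G"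
  by (auto simp: wf_graph_def compv_def)

lemma wf_verts_ballv: "wf_graph ok G \<Longrightarrow> v \<in> verts G \<Longrightarrow> \<exists>m. v \<in> ballv (edges G) (root G) m"
  by (auto simp: wf_graph_def compv_def)

lemma wf_clos_verts: "wf_graph ok G \<Longrightarrow> v \<in> verts G \<Longrightarrow> clos (edges G) v \<subseteq> verts G"
  by (meson clos_ballv subset_trans wf_ballv_verts wf_verts_ballv)

lemma self_in_clos: "v \<in> clos E v"
  by (simp add: clos_def)

lemma wf_finite_clos: "wf_graph ok G \<Longrightarrow> v \<in> verts G \<Longrightarrow> finite (clos (edges G) v)"
  by (auto simp: clos_def wf_graph_def)

lemma wf_finite_ballv:
  assumes "wf_graph ok G" shows "finite (ballv (edges G) (root G) m)"
proof (induction m)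
  case (Suc m)
  have "ballv (edges G) (root G) m \<subseteq> verts G" using assms by (rule wf_ballv_verts)
  then show ?case using Suc assms by (auto simp: wf_graph_def)
qed simp

lemma wf_edgeE:
  assumes "wf_graph ok G" "e \<in> edges G"
  obtains u w where "u \<noteq> w" "e = {u, w}" "u \<in> verts G" "w \<in> verts G"
  using assms unfolding wf_graph_def by blast

lemma finite_induced: "finite U \<Longrightarrow> finite (induced_edges E U)"
  by (rule finite_subset[of _ "Pow U"]) (auto simp: induced_edges_def)

text \<open>This makes the closed neighbourhood of a vertex an admissible index of the family
  \<open>rbar\<close>.\<close>

lemma wf_radius1:
  assumes "wf_graph ok G" "v \<in> verts G"
  shows "radius1 (clos (edges G) v, induced_edges (edges G) (clos (edges G) v), v)"
  unfolding radius1_def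
proof (clarsimp, intro conjI ballI impI)
  show "finite (clos (edges G) v)" using assms by (rule wf_finite_clos)
  show "v \<in> clos (edges G) v" by (rule self_in_clos)
  show "\<exists>u w. u \<noteq> w \<and> e = {u, w} \<and> u \<in> clos (edges G) v \<and> w \<in> clos (edges G) v"
    if "e \<in> induced_edges (edges G) (clos (edges G) v)" for e
  proof -
    have "e \<in> edges G" "e \<subseteq> clos (edges G) v" using that by (auto simp: induced_edges_def)
    from wf_edgeE[OF assms(1) this(1)] obtain u w where "u \<noteq> w" "e = {u, w}" by metis
    with \<open>e \<subseteq> _\<close> show ?thesis by blast
  qed
  show "{u, v} \<in> induced_edges (edges G) (clos (edges G) v)"
    if "u \<in> clos (edges G) v" "u \<noteq> v" for u
    using that by (auto simp: clos_def induced_edges_def nbrs_def)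
qed

subsection \<open>Isomorphisms of balls\<close>

text \<open>The root is matched and adjacency within \<open>A\<close> is preserved in both
  directions, so each breadth-first layer is carried onto the corresponding one. Hence an
  isomorphism of balls restricts to all smaller balls.\<close>

lemma rooted_iso_ballv:
  assumes iso: "rooted_iso \<phi> A E r A' E' r'"
    and sub: "ballv E r m \<subseteq> A" "ballv E' r' m \<subseteq> A'"
  shows "\<phi> ` ballv E r m = ballv E' r' m"
  using sub
proof (induction m)
  case 0
  then show ?case using iso by (auto simp: rooted_iso_def)
next
  case (Suc m)
  have inj: "inj_on \<phi> A" and im: "\<phi> ` A = A'"
    using iso by (auto simp: rooted_iso_def bij_betw_def)
  have adj: "\<And>u w. u \<in> A \<Longrightarrow> w \<in> A \<Longrightarrow> {u, w} \<in> E \<longleftrightarrow> {\<phi> u, \<phi> w} \<in> E'"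
    using iso by (auto simp: rooted_iso_def)
  have IH: "\<phi> ` ballv E r m = ballv E' r' m"
    using Suc by auto
  show ?case
  proof (intro equalityI subsetI)
    fix y assume "y \<in> \<phi> ` ballv E r (Suc m)"
    then obtain w where w: "w \<in> ballv E r (Suc m)" "y = \<phi> w" by blast
    show "y \<in> ballv E' r' (Suc m)"
    proof (cases "w \<in> ballv E r m")
      case True
      then show ?thesis using IH w by auto
    next
      case False
      then obtain u where u: "u \<in> ballv E r m" "w \<in> nbrs E u" using w by auto
      then have "w \<noteq> u" "{w, u} \<in> E" by (auto simp: nbrs_def)
      moreover have "u \<in> A" "w \<in> A" using u w Suc.prems(1) ballv_mono[of m "Suc m" E r] by auto
      ultimately have "\<phi> w \<noteq> \<phi> u" "{\<phi> w, \<phi> u} \<in> E'" using adj inj by (auto simp: inj_on_def)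
      then have "\<phi> w \<in> nbrs E' (\<phi> u)" by (auto simp: nbrs_def)
      moreover have "\<phi> u \<in> ballv E' r' m" using IH u by auto
      ultimately show ?thesis using w by auto
    qed
  next
    fix y assume y: "y \<in> ballv E' r' (Suc m)"
    then obtain w where w: "w \<in> A" "y = \<phi> w" using Suc.prems(2) im by blast
    show "y \<in> \<phi> ` ballv E r (Suc m)"
    proof (cases "y \<in> ballv E' r' m")
      case True
      then show ?thesis using IH by auto
    next
      case False
      then obtain u' where u': "u' \<in> ballv E' r' m" "y \<in> nbrs E' u'" using y by auto
      then obtain u where u: "u \<in> ballv E r m" "u' = \<phi> u" using IH by auto
      have "y \<noteq> u'" "{y, u'} \<in> E'" using u' by (auto simp: nbrs_def)
      moreover have "u \<in> A" using u Suc.prems(1) ballv_mono[of m "Suc m" E r] by auto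
      ultimately have "w \<in> nbrs E u" using adj w u by (auto simp: nbrs_def)
      then show ?thesis using w u by auto
    qed
  qed
qed

lemma rooted_iso_subset:
  assumes "rooted_iso \<phi> A E r A' E' r'" "B \<subseteq> A" "\<phi> ` B = B'"
  shows "rooted_iso \<phi> B E r B' E' r'"
  using assms unfolding rooted_iso_def bij_betw_def
  by (auto simp: subset_iff intro: inj_on_subset)

lemma rooted_iso_ballv_mono:
  assumes "rooted_iso \<phi> (ballv E r n) E r (ballv E' r' n) E' r'" "m \<le> n"
  shows "rooted_iso \<phi> (ballv E r m) E r (ballv E' r' m) E' r'"
  by (rule rooted_iso_subset[OF assms(1)])
     (use assms(2) ballv_mono rooted_iso_ballv[OF assms(1)] in \<open>auto\<close>)

text \<open>One spare layer is required: a neighbour of a vertex of the \<open>m\<close>-ball may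
  lie at distance \<open>m + 1\<close>, and \<phi> is controlled inside the \<open>n\<close>-ball
  only.\<close>

lemma rooted_iso_nbrs:
  assumes iso: "rooted_iso \<phi> (ballv E r n) E r (ballv E' r' n) E' r'"
    and v: "v \<in> ballv E r m" and mn: "Suc m \<le> n"
  shows "\<phi> ` nbrs E v = nbrs E' (\<phi> v)"
proof -
  let ?A = "ballv E r n"
  have inj: "inj_on \<phi> ?A" and im: "\<phi> ` ?A = ballv E' r' n"
    using iso by (auto simp: rooted_iso_def bij_betw_def)
  have adj: "\<And>u w. u \<in> ?A \<Longrightarrow> w \<in> ?A \<Longrightarrow> {u, w} \<in> E \<longleftrightarrow> {\<phi> u, \<phi> w} \<in> E'"
    using iso by (auto simp: rooted_iso_def)
  have vA: "v \<in> ?A" using v mn ballv_mono[of m n E r] by auto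
  have sub: "nbrs E v \<subseteq> ?A" using v mn ballv_mono[of "Suc m" n E r] by auto
  have "\<phi> v \<in> ballv E' r' m"
    using rooted_iso_ballv[OF rooted_iso_ballv_mono[OF iso, of m]] v mn by auto
  then have sub': "nbrs E' (\<phi> v) \<subseteq> ballv E' r' n" using mn ballv_mono[of "Suc m" n E' r'] by auto
  show ?thesis
  proof (intro equalityI subsetI)
    fix y assume "y \<in> \<phi> ` nbrs E v"
    then obtain w where "w \<in> nbrs E v" "y = \<phi> w" by auto
    moreover then have "w \<in> ?A" using sub by auto
    ultimately show "y \<in> nbrs E' (\<phi> v)" using adj[of w v] vA inj
      by (auto simp: nbrs_def inj_on_def)
  next
    fix y assume y: "y \<in> nbrs E' (\<phi> v)"
    then obtain w where w: "w \<in> ?A" "y = \<phi> w" using sub' im by auto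
    then show "y \<in> \<phi> ` nbrs E v" using adj[of w v] vA y by (auto simp: nbrs_def)
  qed
qed

lemma rooted_iso_clos:
  assumes "rooted_iso \<phi> (ballv E r n) E r (ballv E' r' n) E' r'"
    and "v \<in> ballv E r m" and "Suc m \<le> n"
  shows "\<phi> ` clos E v = clos E' (\<phi> v)"
  using rooted_iso_nbrs[OF assms] by (auto simp: clos_def)

lemma rooted_iso_card_clos:
  assumes "rooted_iso \<phi> (ballv E r n) E r (ballv E' r' n) E' r'"
    and "v \<in> ballv E r m" and "Suc m \<le> n"
  shows "card (clos E' (\<phi> v)) = card (clos E v)"
proof -
  have "clos E v \<subseteq> ballv E r n"
    using clos_ballv[OF assms(2)] ballv_mono[OF assms(3), of E r] by auto
  moreover have "inj_on \<phi> (ballv E r n)" using assms(1) by (auto simp: rooted_iso_def bij_betw_def)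
  ultimately show ?thesis
    unfolding rooted_iso_clos[OF assms, symmetric] by (meson card_image inj_on_subset)
qed

text \<open>\<open>rooted_iso\<close> speaks of pairs of vertices; well-formedness of both graphs
  says that every edge is such a pair, which turns it into a statement about edge sets.\<close>

lemma rooted_iso_induced:
  assumes iso: "rooted_iso \<phi> A (edges G) r A' (edges H) r'"
    and wf: "wf_graph ok G" "wf_graph ok' H" and U: "U \<subseteq> A"
  shows "induced_edges (edges H) (\<phi> ` U) = (\<lambda>e. \<phi> ` e) ` induced_edges (edges G) U"
proof (intro equalityI subsetI)
  have adj: "\<And>u w. u \<in> A \<Longrightarrow> w \<in> A \<Longrightarrow> {u, w} \<in> edges G \<longleftrightarrow> {\<phi> u, \<phi> w} \<in> edges H"
    using iso by (auto simp: rooted_iso_def)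
  {
    fix e assume "e \<in> induced_edges (edges H) (\<phi> ` U)"
    then have e: "e \<in> edges H" "e \<subseteq> \<phi> ` U" by (auto simp: induced_edges_def)
    obtain a b where "e = {a, b}" using wf_edgeE[OF wf(2) e(1)] by metis
    with e obtain u w where uw: "e = {\<phi> u, \<phi> w}" "u \<in> U" "w \<in> U" by auto
    then have "{u, w} \<in> edges G" using adj[of u w] U e by auto
    then show "e \<in> (\<lambda>e. \<phi> ` e) ` induced_edges (edges G) U"
      using uw by (auto simp: induced_edges_def intro!: image_eqI[of _ _ "{u, w}"])
  next
    fix e assume "e \<in> (\<lambda>e. \<phi> ` e) ` induced_edges (edges G) U"
    then obtain d where d: "d \<in> edges G" "d \<subseteq> U" "e = \<phi> ` d" by (auto simp: induced_edges_def)
    obtain a b where "d = {a, b}" using wf_edgeE[OF wf(1) d(1)] by metis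
    then show "e \<in> induced_edges (edges H) (\<phi> ` U)"
      using d adj[of a b] U by (auto simp: induced_edges_def)
  }
qed

subsection \<open>A pseudometric for the local topology\<close>

text \<open>The initial state is an integer, where convergence is eventual equality; only the Polish
  marks are compared by distance.\<close>

definition close_on :: "nat \<Rightarrow> real \<Rightarrow> ('e::metric_space,'k::metric_space \<times> int) mgraph \<Rightarrow>
    ('e,'k \<times> int) mgraph \<Rightarrow> (nat \<Rightarrow> nat) \<Rightarrow> bool" where
  "close_on m \<epsilon> G H \<phi> \<longleftrightarrow>
     rooted_iso \<phi> (ballv (edges G) (root G) m) (edges G) (root G)
       (ballv (edges H) (root H) m) (edges H) (root H) \<and>
     (\<forall>v\<in>ballv (edges G) (root G) m.
        dist (fst (vmark H (\<phi> v))) (fst (vmark G v)) \<le> \<epsilon> \<and> snd (vmark H (\<phi> v)) = snd (vmark G v)) \<and>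
     (\<forall>e\<in>induced_edges (edges G) (ballv (edges G) (root G) m). dist (emark H (\<phi> ` e)) (emark G e) \<le> \<epsilon>)"

lemma close_on_id: "0 \<le> \<epsilon> \<Longrightarrow> close_on m \<epsilon> G G id"
  by (auto simp: close_on_def rooted_iso_def)

lemma close_on_mono:
  assumes "close_on n \<epsilon> G H \<phi>" "m \<le> n" "\<epsilon> \<le> \<epsilon>'"
  shows "close_on m \<epsilon>' G H \<phi>"
proof -
  have sub: "ballv (edges G) (root G) m \<subseteq> ballv (edges G) (root G) n" using assms(2) by (rule ballv_mono)
  have "rooted_iso \<phi> (ballv (edges G) (root G) m) (edges G) (root G)
       (ballv (edges H) (root H) m) (edges H) (root H)"
    using assms(1) unfolding close_on_def by (blast intro: rooted_iso_ballv_mono[OF _ assms(2)])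
  moreover have "dist (fst (vmark H (\<phi> v))) (fst (vmark G v)) \<le> \<epsilon>' \<and> snd (vmark H (\<phi> v)) = snd (vmark G v)"
    if "v \<in> ballv (edges G) (root G) m" for v
    using assms(1,3) sub that unfolding close_on_def by (meson order_trans subsetD)
  moreover have "dist (emark H (\<phi> ` e)) (emark G e) \<le> \<epsilon>'"
    if "e \<in> induced_edges (edges G) (ballv (edges G) (root G) m)" for e
  proof -
    have "e \<in> induced_edges (edges G) (ballv (edges G) (root G) n)"
      using that sub by (auto simp: induced_edges_def)
    then show ?thesis using assms(1,3) unfolding close_on_def by (meson order_trans)
  qed
  ultimately show ?thesis unfolding close_on_def by blast
qed

lemma close_on_sym:
  assumes c: "close_on m \<epsilon> G H \<phi>" and wf: "wf_graph ok G" "wf_graph ok' H"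
  shows "\<exists>\<psi>. close_on m \<epsilon> H G \<psi>"
proof -
  let ?A = "ballv (edges G) (root G) m" and ?B = "ballv (edges H) (root H) m"
  have iso: "rooted_iso \<phi> ?A (edges G) (root G) ?B (edges H) (root H)"
    using c by (auto simp: close_on_def)
  then have inj: "inj_on \<phi> ?A" and im: "\<phi> ` ?A = ?B" by (auto simp: rooted_iso_def bij_betw_def)
  have adj: "\<And>u w. u \<in> ?A \<Longrightarrow> w \<in> ?A \<Longrightarrow> {u, w} \<in> edges G \<longleftrightarrow> {\<phi> u, \<phi> w} \<in> edges H"
    using iso by (auto simp: rooted_iso_def)
  define \<psi> where "\<psi> = inv_into ?A \<phi>"
  have l: "\<And>v. v \<in> ?A \<Longrightarrow> \<psi> (\<phi> v) = v" unfolding \<psi>_def using inj by simp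
  have r: "\<And>v. v \<in> ?B \<Longrightarrow> \<phi> (\<psi> v) = v \<and> \<psi> v \<in> ?A" unfolding \<psi>_def using im
    by (metis f_inv_into_f inv_into_into)
  have "bij_betw \<psi> ?B ?A" unfolding \<psi>_def using inj im by (metis bij_betw_def bij_betw_inv_into)
  moreover have "\<psi> (root H) = root G" using iso l[OF root_in_ballv] by (auto simp: rooted_iso_def)
  moreover have "{u, w} \<in> edges H \<longleftrightarrow> {\<psi> u, \<psi> w} \<in> edges G" if "u \<in> ?B" "w \<in> ?B" for u w
    using adj[of "\<psi> u" "\<psi> w"] r that by auto
  ultimately have "rooted_iso \<psi> ?B (edges H) (root H) ?A (edges G) (root G)"
    by (auto simp: rooted_iso_def)
  moreover have "dist (fst (vmark G (\<psi> v))) (fst (vmark H v)) \<le> \<epsilon> \<and> snd (vmark G (\<psi> v)) = snd (vmark H v)"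
    if "v \<in> ?B" for v
    using c r[OF that] unfolding close_on_def by (metis dist_commute)
  moreover have "dist (emark G (\<psi> ` e)) (emark H e) \<le> \<epsilon>" if e: "e \<in> induced_edges (edges H) ?B" for e
  proof -
    have "e \<in> (\<lambda>e. \<phi> ` e) ` induced_edges (edges G) ?A"
      using rooted_iso_induced[OF iso wf order_refl] e im by simp
    then obtain d where d: "e = \<phi> ` d" "d \<in> induced_edges (edges G) ?A" by auto
    then have "d \<subseteq> ?A" by (auto simp: induced_edges_def)
    then have "\<psi> ` e = d" using d l by (force simp: image_image)
    then show ?thesis using c d unfolding close_on_def by (metis dist_commute)
  qed
  ultimately show ?thesis unfolding close_on_def by blast
qed

lemma close_on_trans:
  assumes 1: "close_on m \<epsilon> G H \<phi>" and 2: "close_on m \<delta> H K \<psi>"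
    and wf: "wf_graph ok G" "wf_graph ok' H"
  shows "close_on m (\<epsilon> + \<delta>) G K (\<psi> \<circ> \<phi>)"
proof -
  let ?A = "ballv (edges G) (root G) m" and ?B = "ballv (edges H) (root H) m"
    and ?C = "ballv (edges K) (root K) m"
  have iso: "rooted_iso \<phi> ?A (edges G) (root G) ?B (edges H) (root H)"
    and iso2: "rooted_iso \<psi> ?B (edges H) (root H) ?C (edges K) (root K)"
    using 1 2 by (auto simp: close_on_def)
  then have im: "\<phi> ` ?A = ?B" by (auto simp: rooted_iso_def bij_betw_def)
  then have mem: "\<And>v. v \<in> ?A \<Longrightarrow> \<phi> v \<in> ?B" by auto
  have "rooted_iso (\<psi> \<circ> \<phi>) ?A (edges G) (root G) ?C (edges K) (root K)"
    using iso iso2 mem bij_betw_trans[of \<phi> ?A ?B \<psi> ?C] unfolding rooted_iso_def comp_apply by simp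
  moreover have "dist (fst (vmark K ((\<psi> \<circ> \<phi>) v))) (fst (vmark G v)) \<le> \<epsilon> + \<delta> \<and>
      snd (vmark K ((\<psi> \<circ> \<phi>) v)) = snd (vmark G v)" if "v \<in> ?A" for v
  proof -
    have "dist (fst (vmark K (\<psi> (\<phi> v)))) (fst (vmark H (\<phi> v))) \<le> \<delta>"
         "dist (fst (vmark H (\<phi> v))) (fst (vmark G v)) \<le> \<epsilon>"
      using 1 2 mem[OF that] that unfolding close_on_def by blast+
    moreover have "snd (vmark K (\<psi> (\<phi> v))) = snd (vmark G v)"
      using 1 2 mem[OF that] that unfolding close_on_def by simp
    ultimately show ?thesis
      using dist_triangle[of "fst (vmark K (\<psi> (\<phi> v)))" "fst (vmark G v)" "fst (vmark H (\<phi> v))"] by auto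
  qed
  moreover have "dist (emark K ((\<psi> \<circ> \<phi>) ` e)) (emark G e) \<le> \<epsilon> + \<delta>"
    if e: "e \<in> induced_edges (edges G) ?A" for e
  proof -
    have "\<phi> ` e \<in> induced_edges (edges H) ?B"
      using rooted_iso_induced[OF iso wf order_refl] e im by simp
    then have "dist (emark K (\<psi> ` \<phi> ` e)) (emark H (\<phi> ` e)) \<le> \<delta>"
         "dist (emark H (\<phi> ` e)) (emark G e) \<le> \<epsilon>"
      using 1 2 e unfolding close_on_def by blast+
    then show ?thesis
      using dist_triangle[of "emark K (\<psi> ` \<phi> ` e)" "emark G e" "emark H (\<phi> ` e)"]
      by (simp only: image_comp[symmetric])
  qed
  ultimately show ?thesis unfolding close_on_def by blast
qed

definition gclose :: "real \<Rightarrow> ('e::metric_space,'k::metric_space \<times> int) mgraph \<Rightarrow> ('e,'k \<times> int) mgraph \<Rightarrow> bool" where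
  "gclose \<epsilon> G H \<longleftrightarrow> (\<exists>\<phi>. close_on (nat \<lceil>1 / \<epsilon>\<rceil>) \<epsilon> G H \<phi>)"

text \<open>A pseudometric for local convergence: tolerance \<epsilon> is tested on the ball of
  radius about \<open>1/\<epsilon>\<close>. The inserted 1 gives a value to pairs for which no
  \<epsilon> works and bounds the distance by 1.\<close>

definition gdist :: "('e::metric_space,'k::metric_space \<times> int) mgraph \<Rightarrow> ('e,'k \<times> int) mgraph \<Rightarrow> real" where
  "gdist G H = Inf (insert 1 {\<epsilon>. 0 < \<epsilon> \<and> gclose \<epsilon> G H})"

lemma radius_antimono: "0 < \<epsilon> \<Longrightarrow> \<epsilon> \<le> \<epsilon>' \<Longrightarrow> nat \<lceil>1 / \<epsilon>'\<rceil> \<le> nat \<lceil>1 / (\<epsilon>::real)\<rceil>"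
  by (intro nat_mono ceiling_mono) (simp add: frac_le)

lemma gclose_mono: "gclose \<epsilon> G H \<Longrightarrow> 0 < \<epsilon> \<Longrightarrow> \<epsilon> \<le> \<epsilon>' \<Longrightarrow> gclose \<epsilon>' G H"
  unfolding gclose_def using close_on_mono radius_antimono by metis

lemma gdist_bdd: "bdd_below (insert 1 {\<epsilon>. 0 < \<epsilon> \<and> gclose \<epsilon> G H})"
  by (rule bdd_belowI[of _ 0]) auto

lemma gdist_nonneg: "0 \<le> gdist G H"
  unfolding gdist_def by (rule cInf_greatest) auto

lemma gdist_le_one: "gdist G H \<le> 1"
  unfolding gdist_def by (rule cInf_lower[OF _ gdist_bdd]) auto

lemma gdist_le: "0 < \<epsilon> \<Longrightarrow> gclose \<epsilon> G H \<Longrightarrow> gdist G H \<le> \<epsilon>"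
  unfolding gdist_def by (rule cInf_lower[OF _ gdist_bdd]) auto

lemma gdist_less_gclose:
  assumes "gdist G H < \<epsilon>" "\<epsilon> \<le> 1" shows "gclose \<epsilon> G H"
proof -
  have "Inf (insert 1 {\<epsilon>. 0 < \<epsilon> \<and> gclose \<epsilon> G H}) < \<epsilon>" using assms by (simp add: gdist_def)
  then obtain \<delta> where "\<delta> \<in> insert 1 {\<epsilon>. 0 < \<epsilon> \<and> gclose \<epsilon> G H}" "\<delta> < \<epsilon>"
    by (subst (asm) cInf_less_iff[OF _ gdist_bdd]) auto
  then show ?thesis using assms gclose_mono[of \<delta> G H \<epsilon>] by auto
qed

lemma gdist_self: "gdist G G = 0"
proof (rule antisym[OF _ gdist_nonneg])
  have "gdist G G \<le> \<epsilon>" if "0 < \<epsilon>" for \<epsilon>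
    by (rule gdist_le[OF that]) (use close_on_id[of \<epsilon>] that in \<open>auto simp: gclose_def\<close>)
  then show "gdist G G \<le> 0" by (rule field_le_epsilon) simp
qed

lemma gdist_sym_le:
  assumes "wf_graph ok G" "wf_graph ok' H" shows "gdist H G \<le> gdist G H"
proof (rule ccontr)
  assume "\<not> ?thesis"
  then obtain \<epsilon> where e: "gdist G H < \<epsilon>" "\<epsilon> < gdist H G" by (meson dense not_le)
  then have "\<epsilon> \<le> 1" using gdist_le_one[of H G] by simp
  then have "gclose \<epsilon> H G" using gdist_less_gclose[OF e(1)] close_on_sym[OF _ assms] by (auto simp: gclose_def)
  then have "gdist H G \<le> \<epsilon>" using e gdist_nonneg[of G H] by (intro gdist_le) auto
  then show False using e by simp
qed

lemma gdist_sym: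
  assumes "wf_graph ok G" "wf_graph ok' H" shows "gdist H G = gdist G H"
  using gdist_sym_le[OF assms] gdist_sym_le[OF assms(2,1)] by simp

text \<open>Composing two isomorphisms adds the tolerances, and the radius \<open>1/(a + b)\<close>
  is below both \<open>1/a\<close> and \<open>1/b\<close>, so both isomorphisms restrict to
  it.\<close>

lemma gdist_triangle:
  assumes wf: "wf_graph ok G" "wf_graph ok' H"
  shows "gdist G K \<le> gdist G H + gdist H K"
proof (rule field_le_epsilon)
  fix d :: real assume d: "0 < d"
  let ?a = "gdist G H + d / 2" and ?b = "gdist H K + d / 2"
  show "gdist G K \<le> gdist G H + gdist H K + d"
  \<comment> \<open>Above 1 the cap on the distance settles the inequality; below it both tolerances
    are at most 1, as \<open>gdist_less_gclose\<close> requires.\<close>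
  proof (cases "?a + ?b \<le> 1")
    case False
    then show ?thesis using gdist_le_one[of G K] by simp
  next
    case True
    have pos: "0 < ?a" "0 < ?b" using d gdist_nonneg[of G H] gdist_nonneg[of H K] by auto
    have "gclose ?a G H" "gclose ?b H K"
      using d True pos by (auto intro!: gdist_less_gclose)
    then obtain \<phi> \<psi> where p: "close_on (nat \<lceil>1 / ?a\<rceil>) ?a G H \<phi>" "close_on (nat \<lceil>1 / ?b\<rceil>) ?b H K \<psi>"
      by (auto simp: gclose_def)
    let ?m = "nat \<lceil>1 / (?a + ?b)\<rceil>"
    have "close_on ?m ?a G H \<phi>" "close_on ?m ?b H K \<psi>"
      using pos by (auto intro!: close_on_mono[OF p(1)] close_on_mono[OF p(2)] radius_antimono)
    then have "close_on ?m (?a + ?b) G K (\<psi> \<circ> \<phi>)" by (rule close_on_trans[OF _ _ wf])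
    then have "gclose (?a + ?b) G K" unfolding gclose_def by blast
    then have "gdist G K \<le> ?a + ?b" using pos by (intro gdist_le) auto
    then show ?thesis by simp
  qed
qed

text \<open>A ball is finite, so the convergence of its marks is uniform on it. Through this lemma
  every function that is Lipschitz in \<open>gdist\<close> becomes continuous for the local
  topology.\<close>

lemma local_conv_gdist:
  fixes G :: "('e::metric_space,'k::metric_space \<times> int) mgraph"
  assumes lc: "local_conv (\<lambda>ms m. ms \<longlonglongrightarrow> m) Gs G" and wf: "wf_graph ok G"
  shows "(\<lambda>n. gdist G (Gs n)) \<longlonglongrightarrow> 0"
proof (rule tendstoI)
  fix \<epsilon> :: real assume e: "0 < \<epsilon>"
  let ?B = "ballv (edges G) (root G) (nat \<lceil>1 / (\<epsilon>/2)\<rceil>)"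
  obtain \<phi> n0 where *: "(\<forall>n>n0. rooted_iso (\<phi> n) ?B (edges G) (root G)
        (ballv (edges (Gs n)) (root (Gs n)) (nat \<lceil>1 / (\<epsilon>/2)\<rceil>)) (edges (Gs n)) (root (Gs n))) \<and>
     (\<forall>v\<in>?B. (\<lambda>n. vmark (Gs n) (\<phi> n v)) \<longlonglongrightarrow> vmark G v) \<and>
     (\<forall>e\<in>induced_edges (edges G) ?B. (\<lambda>n. emark (Gs n) (\<phi> n ` e)) \<longlonglongrightarrow> emark G e)"
    using lc[unfolded local_conv_def, THEN spec[of _ "nat \<lceil>1 / (\<epsilon>/2)\<rceil>"]] by (elim exE) (rule that)
  note iso = *[THEN conjunct1, rule_format] and vm = *[THEN conjunct2, THEN conjunct1, rule_format]
    and em = *[THEN conjunct2, THEN conjunct2, rule_format]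
  have fin: "finite ?B" using wf by (rule wf_finite_ballv)
  have "\<forall>\<^sub>F n in sequentially. \<forall>v\<in>?B. dist (fst (vmark (Gs n) (\<phi> n v))) (fst (vmark G v)) \<le> \<epsilon>/2 \<and>
       snd (vmark (Gs n) (\<phi> n v)) = snd (vmark G v)"
  proof (rule eventually_ball_finite[OF fin], rule ballI)
    fix v assume v: "v \<in> ?B"
    have "(\<lambda>n. fst (vmark (Gs n) (\<phi> n v))) \<longlonglongrightarrow> fst (vmark G v)"
      by (rule tendsto_fst[OF vm[OF v]])
    then have "\<forall>\<^sub>F n in sequentially. dist (fst (vmark (Gs n) (\<phi> n v))) (fst (vmark G v)) < \<epsilon>/2"
      using e by (intro tendstoD) auto
    moreover have "(\<lambda>n. snd (vmark (Gs n) (\<phi> n v))) \<longlonglongrightarrow> snd (vmark G v)"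
      by (rule tendsto_snd[OF vm[OF v]])
    then have "\<forall>\<^sub>F n in sequentially. snd (vmark (Gs n) (\<phi> n v)) = snd (vmark G v)"
      by (simp add: tendsto_discrete)
    ultimately show "\<forall>\<^sub>F n in sequentially. dist (fst (vmark (Gs n) (\<phi> n v))) (fst (vmark G v)) \<le> \<epsilon>/2 \<and>
       snd (vmark (Gs n) (\<phi> n v)) = snd (vmark G v)"
      by eventually_elim auto
  qed
  moreover have "\<forall>\<^sub>F n in sequentially. \<forall>d\<in>induced_edges (edges G) ?B. dist (emark (Gs n) (\<phi> n ` d)) (emark G d) \<le> \<epsilon>/2"
  proof (rule eventually_ball_finite[OF finite_induced[OF fin]], rule ballI)
    fix d assume "d \<in> induced_edges (edges G) ?B"
    then have "\<forall>\<^sub>F n in sequentially. dist (emark (Gs n) (\<phi> n ` d)) (emark G d) < \<epsilon>/2"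
      using e em by (intro tendstoD) auto
    then show "\<forall>\<^sub>F n in sequentially. dist (emark (Gs n) (\<phi> n ` d)) (emark G d) \<le> \<epsilon>/2"
      by eventually_elim auto
  qed
  moreover have "\<forall>\<^sub>F n in sequentially. n > n0" by (rule eventually_gt_at_top)
  ultimately show "\<forall>\<^sub>F n in sequentially. dist (gdist G (Gs n)) 0 < \<epsilon>"
  proof eventually_elim
    case (elim n)
    then have "gclose (\<epsilon>/2) G (Gs n)" unfolding gclose_def close_on_def using iso[of n] by blast
    then have "gdist G (Gs n) \<le> \<epsilon>/2" using e by (intro gdist_le) auto
    then show ?case using e gdist_nonneg[of G "Gs n"] by simp
  qed
qed

lemma marked_iso_gdist:
  assumes iso: "marked_iso G H" and wf: "wf_graph ok G" "wf_graph ok' H"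
  shows "gdist G H = 0"
proof (rule antisym[OF _ gdist_nonneg])
  obtain \<phi> where \<phi>: "rooted_iso \<phi> (verts G) (edges G) (root G) (verts H) (edges H) (root H)"
    and vm: "\<And>v. v \<in> verts G \<Longrightarrow> vmark H (\<phi> v) = vmark G v"
    and em: "\<And>e. e \<in> edges G \<Longrightarrow> emark H (\<phi> ` e) = emark G e"
    using iso unfolding marked_iso_def by blast
  have "gdist G H \<le> \<epsilon>" if e: "0 < \<epsilon>" for \<epsilon>
  proof (rule gdist_le[OF e])
    have "close_on m \<epsilon> G H \<phi>" for m
    proof -
      have sub: "ballv (edges G) (root G) m \<subseteq> verts G" "ballv (edges H) (root H) m \<subseteq> verts H"
        using wf by (auto dest: wf_ballv_verts)
      have "rooted_iso \<phi> (ballv (edges G) (root G) m) (edges G) (root G)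
          (ballv (edges H) (root H) m) (edges H) (root H)"
        by (rule rooted_iso_subset[OF \<phi> sub(1) rooted_iso_ballv[OF \<phi> sub]])
      then show ?thesis using e sub vm em unfolding close_on_def induced_edges_def by auto
    qed
    then show "gclose \<epsilon> G H" by (auto simp: gclose_def)
  qed
  then show "gdist G H \<le> 0" by (rule field_le_epsilon) simp
qed

subsection \<open>Measurability of local structure and a countable cover by small cells\<close>

lemma graphM_space [simp]: "space (graphM eM mM) = UNIV"
  by (simp add: graphM_def)

lemma sets_graphM_gen:
  assumes "A \<in> ({{G. v \<in> verts G} | v. True} \<union> {{G. e \<in> edges G} | e. True} \<union> {{G. root G = v} | v. True} \<union>
      {{G. emark G e \<in> B} | e B. B \<in> sets eM} \<union> {{G. vmark G v \<in> B} | v B. B \<in> sets mM})"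
  shows "A \<in> sets (graphM eM mM)"
  using assms unfolding graphM_def by (simp add: sigma_sets.Basic)

lemma graphM_verts: "{G. v \<in> verts G} \<in> sets (graphM eM mM)"
  and graphM_edges: "{G. e \<in> edges G} \<in> sets (graphM eM mM)"
  and graphM_root: "{G. root G = v} \<in> sets (graphM eM mM)"
  and graphM_emark: "B \<in> sets eM \<Longrightarrow> {G. emark G e \<in> B} \<in> sets (graphM eM mM)"
  and graphM_vmark: "B' \<in> sets mM \<Longrightarrow> {G. vmark G v \<in> B'} \<in> sets (graphM eM mM)"
  by (rule sets_graphM_gen; blast)+

lemma graphM_pred [measurable]:
  "Measurable.pred (graphM eM mM) (\<lambda>G. v \<in> verts G)"
  "Measurable.pred (graphM eM mM) (\<lambda>G. e \<in> edges G)"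
  "Measurable.pred (graphM eM mM) (\<lambda>G. root G = v)"
  by (simp_all add: pred_def graphM_verts graphM_edges graphM_root)

lemma measurable_emark: "(\<lambda>G. emark G e) \<in> measurable (graphM borel mM) borel"
  by (rule measurableI) (auto simp: vimage_def graphM_emark)

lemma measurable_vmark: "(\<lambda>G. vmark G v) \<in> measurable (graphM eM borel) borel"
  by (rule measurableI) (auto simp: vimage_def graphM_vmark)

lemma pred_nbrs [measurable]: "Measurable.pred (graphM eM mM) (\<lambda>G. u \<in> nbrs (edges G) v)"
  unfolding nbrs_def mem_Collect_eq by measurable

lemma pred_ballv [measurable]: "Measurable.pred (graphM eM mM) (\<lambda>G. v \<in> ballv (edges G) (root G) m)"
proof (induction m arbitrary: v)
  case 0
  have eq: "(\<lambda>G. v \<in> ballv (edges G) (root G) 0) = (\<lambda>G. root G = v)" by auto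
  show ?case unfolding eq by measurable
next
  case (Suc m)
  have eq: "(\<lambda>G. v \<in> ballv (edges G) (root G) (Suc m)) =
     (\<lambda>G. v \<in> ballv (edges G) (root G) m \<or> (\<exists>u. u \<in> ballv (edges G) (root G) m \<and> v \<in> nbrs (edges G) u))"
    by auto
  note Suc[measurable]
  show ?case unfolding eq by measurable
qed

lemma pred_clos [measurable]: "Measurable.pred (graphM eM mM) (\<lambda>G. u \<in> clos (edges G) v)"
  unfolding clos_def insert_iff by measurable

lemma pred_ballv_eq: "Measurable.pred (graphM eM mM) (\<lambda>G. ballv (edges G) (root G) m = U)"
  unfolding set_eq_iff by measurable

lemma pred_clos_eq: "Measurable.pred (graphM eM mM) (\<lambda>G. clos (edges G) v = U)"
  unfolding set_eq_iff by measurable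

lemma pred_induced_eq:
  assumes "finite U"
  shows "Measurable.pred (graphM eM mM) (\<lambda>G. induced_edges (edges G) U = EU)"
proof (cases "EU \<subseteq> Pow U")
  case True
  have eq: "(\<lambda>G. induced_edges (edges G) U = EU) = (\<lambda>G::('a,'b) mgraph. \<forall>e\<in>Pow U. e \<in> edges G \<longleftrightarrow> e \<in> EU)"
    using True by (auto simp: induced_edges_def fun_eq_iff)
  have "finite (Pow U)" using assms by simp
  then have "Measurable.pred (graphM eM mM) (\<lambda>G. \<forall>e\<in>Pow U. e \<in> edges G \<longleftrightarrow> e \<in> EU)"
    by (intro pred_intros_finite) measurable
  then show ?thesis unfolding eq .
next
  case False
  then have "(\<lambda>G. induced_edges (edges G) U = EU) = (\<lambda>G::('a,'b) mgraph. False)"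
    by (auto simp: induced_edges_def fun_eq_iff)
  then show ?thesis by simp
qed

text \<open>Vertices are natural numbers, so there are countably many roots, finite balls and finite
  edge sets; the marks on them are approximated from countable dense sets. Two graphs in one cell
  share the labelled ball, so the identity is the isomorphism, and both lie within \<epsilon>/2 of
  the same marks.\<close>

lemma countable_cell_cover:
  fixes \<epsilon> :: real
  assumes e: "0 < \<epsilon>"
  shows "\<exists>A :: nat \<Rightarrow> ('e::polish_space, 'k::polish_space \<times> int) mgraph set.
     (\<forall>n. A n \<in> sets (graphM borel borel)) \<and>
     (\<forall>G. wf_graph ok G \<longrightarrow> (\<exists>n. G \<in> A n)) \<and>
     (\<forall>n G H. G \<in> A n \<longrightarrow> H \<in> A n \<longrightarrow> close_on m \<epsilon> G H id)"
proof -
  obtain De :: "'e set" where De: "countable De" "\<And>X. open X \<Longrightarrow> X \<noteq> {} \<Longrightarrow> \<exists>d\<in>De. d \<in> X"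
    by (rule countable_dense_setE) blast
  obtain Dk :: "'k set" where Dk: "countable Dk" "\<And>X. open X \<Longrightarrow> X \<noteq> {} \<Longrightarrow> \<exists>d\<in>Dk. d \<in> X"
    by (rule countable_dense_setE) blast
  have nearE: "\<exists>d\<in>De. dist x d < \<epsilon>/2" for x
    using De(2)[of "ball x (\<epsilon>/2)"] e by auto
  have nearK: "\<exists>d\<in>Dk. dist x d < \<epsilon>/2" for x
    using Dk(2)[of "ball x (\<epsilon>/2)"] e by auto
  define K where "K = (SIGMA r : (UNIV::nat set). SIGMA U : {U::nat set. finite U}. SIGMA EU : {F. finite F \<and> F \<subseteq> {e::nat set. finite e}}.
      (U \<rightarrow>\<^sub>E (Dk \<times> (UNIV::int set))) \<times> (EU \<rightarrow>\<^sub>E De))"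
  have "countable K" unfolding K_def
  proof (intro countable_SIGMA)
    show "countable {U::nat set. finite U}" by (rule countable_Collect_finite)
    show "countable {F. finite F \<and> F \<subseteq> {e::nat set. finite e}}"
      by (intro countable_Collect_finite_subset countable_Collect_finite)
    show "countable (U \<rightarrow>\<^sub>E Dk \<times> (UNIV::int set))" if "U \<in> {U::nat set. finite U}" for U
      using that Dk(1) by (intro countable_PiE) auto
    show "countable (EU \<rightarrow>\<^sub>E De)" if "EU \<in> {F. finite F \<and> F \<subseteq> {e::nat set. finite e}}" for EU
      using that De(1) by (intro countable_PiE) auto
  qed simp
  then have cK: "countable K" .
  define S where "S = (\<lambda>(r, U, EU, a, b). {G :: ('e,'k \<times> int) mgraph. root G = r \<and> ballv (edges G) (root G) m = U \<and>
     induced_edges (edges G) U = EU \<and> (\<forall>v\<in>U. dist (fst (vmark G v)) (fst (a v)) < \<epsilon>/2 \<and> snd (vmark G v) = snd (a v)) \<and>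
     (\<forall>d\<in>EU. dist (emark G d) (b d) < \<epsilon>/2)})"
  have meas: "S k \<in> sets (graphM borel borel)" if "k \<in> K" for k
  proof -
    obtain r U EU a b where k: "k = (r, U, EU, a, b)" by (cases k) auto
    have fin: "finite U" "finite EU" using that by (auto simp: K_def k)
    have op: "open {p :: 'k \<times> int. dist (fst p) c < \<epsilon>/2 \<and> snd p = i}" for c i
    proof -
      have "{p :: 'k \<times> int. dist (fst p) c < \<epsilon>/2 \<and> snd p = i} = ball c (\<epsilon>/2) \<times> {i}"
        by (auto simp: dist_commute)
      then show ?thesis by (simp only:) (intro open_Times open_ball discrete_topology_class.open_discrete)
    qed
    have op': "open {p :: 'e. dist p c < \<epsilon>/2}" for c
      using open_ball[of c "\<epsilon>/2"] by (simp add: ball_def dist_commute)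
    have 1: "Measurable.pred (graphM borel borel) (\<lambda>G :: ('e,'k \<times> int) mgraph. dist (fst (vmark G v)) (fst (a v)) < \<epsilon>/2 \<and> snd (vmark G v) = snd (a v))" for v
      using graphM_vmark[OF borel_open[OF op[of "fst (a v)" "snd (a v)"]]] by (simp add: pred_def)
    have 2: "Measurable.pred (graphM borel borel) (\<lambda>G :: ('e,'k \<times> int) mgraph. dist (emark G d) (b d) < \<epsilon>/2)" for d
      using graphM_emark[OF borel_open[OF op'[of "b d"]]] by (simp add: pred_def)
    have 3: "Measurable.pred (graphM borel borel) (\<lambda>G :: ('e,'k \<times> int) mgraph. \<forall>v\<in>U. dist (fst (vmark G v)) (fst (a v)) < \<epsilon>/2 \<and> snd (vmark G v) = snd (a v))"
      by (rule pred_intros_finite(3)[OF fin(1) 1])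
    have 4: "Measurable.pred (graphM borel borel) (\<lambda>G :: ('e,'k \<times> int) mgraph. \<forall>d\<in>EU. dist (emark G d) (b d) < \<epsilon>/2)"
      by (rule pred_intros_finite(3)[OF fin(2) 2])
    have conj: "Measurable.pred N P \<Longrightarrow> Measurable.pred N Q \<Longrightarrow> Measurable.pred N (\<lambda>x. P x \<and> Q x)"
      for N :: "('e,'k \<times> int) mgraph measure" and P Q by measurable
    have "Measurable.pred (graphM borel borel) (\<lambda>G :: ('e,'k \<times> int) mgraph. G \<in> S k)"
      unfolding k S_def split mem_Collect_eq
      by (rule conj[OF graphM_pred(3) conj[OF pred_ballv_eq conj[OF pred_induced_eq[OF fin(1)] conj[OF 3 4]]]])
    then show ?thesis by (simp add: pred_def)
  qed
  have cover: "\<exists>k\<in>K. G \<in> S k" if wf: "wf_graph ok G" for G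
  proof -
    let ?U = "ballv (edges G) (root G) m"
    have fU: "finite ?U" using wf by (rule wf_finite_ballv)
    let ?EU = "induced_edges (edges G) ?U"
    have "\<forall>v. \<exists>d. d \<in> Dk \<and> dist (fst (vmark G v)) d < \<epsilon>/2" using nearK by blast
    from choice[OF this] obtain a where a: "\<And>v. a v \<in> Dk" "\<And>v. dist (fst (vmark G v)) (a v) < \<epsilon>/2" by blast
    have "\<forall>d. \<exists>c. c \<in> De \<and> dist (emark G d) c < \<epsilon>/2" using nearE by blast
    from choice[OF this] obtain b where b: "\<And>d. b d \<in> De" "\<And>d. dist (emark G d) (b d) < \<epsilon>/2" by blast
    let ?k = "(root G, ?U, ?EU, restrict (\<lambda>v. (a v, snd (vmark G v))) ?U, restrict b ?EU)"
    have "?EU \<subseteq> {e. finite e}" using fU finite_subset by (auto simp: induced_edges_def)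
    then have "?k \<in> K" using fU finite_induced[OF fU, of "edges G"] a b by (auto simp: K_def)
    moreover have "G \<in> S ?k" using a b by (auto simp: S_def)
    ultimately show ?thesis by blast
  qed
  have small: "close_on m \<epsilon> G H id" if G: "G \<in> S k" and H: "H \<in> S k" for k G H
  proof -
    obtain r U EU a b where k: "k = (r, U, EU, a, b)" by (cases k) auto
    have g: "root G = r" "ballv (edges G) (root G) m = U" "induced_edges (edges G) U = EU"
      "\<And>v. v \<in> U \<Longrightarrow> dist (fst (vmark G v)) (fst (a v)) < \<epsilon>/2 \<and> snd (vmark G v) = snd (a v)"
      "\<And>d. d \<in> EU \<Longrightarrow> dist (emark G d) (b d) < \<epsilon>/2"
      using G by (auto simp: S_def k)
    have h: "root H = r" "ballv (edges H) (root H) m = U" "induced_edges (edges H) U = EU"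
      "\<And>v. v \<in> U \<Longrightarrow> dist (fst (vmark H v)) (fst (a v)) < \<epsilon>/2 \<and> snd (vmark H v) = snd (a v)"
      "\<And>d. d \<in> EU \<Longrightarrow> dist (emark H d) (b d) < \<epsilon>/2"
      using H by (auto simp: S_def k)
    have adj: "{u, w} \<in> edges G \<longleftrightarrow> {u, w} \<in> edges H" if "u \<in> U" "w \<in> U" for u w
    proof -
      have "{u, w} \<in> edges G \<longleftrightarrow> {u, w} \<in> EU" "{u, w} \<in> edges H \<longleftrightarrow> {u, w} \<in> EU"
        using g(3) h(3) that by (auto simp: induced_edges_def)
      then show ?thesis by simp
    qed
    have "rooted_iso id U (edges G) r U (edges H) r" using adj by (auto simp: rooted_iso_def)
    moreover have "dist (fst (vmark H v)) (fst (vmark G v)) \<le> \<epsilon>" if "v \<in> U" for v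
      using g(4)[OF that] h(4)[OF that] dist_triangle2[of "fst (vmark H v)" "fst (vmark G v)" "fst (a v)"] by auto
    moreover have "snd (vmark H v) = snd (vmark G v)" if "v \<in> U" for v
      using g(4)[OF that] h(4)[OF that] by auto
    moreover have "dist (emark H d) (emark G d) \<le> \<epsilon>" if "d \<in> EU" for d
      using g(5)[OF that] h(5)[OF that] dist_triangle2[of "emark H d" "emark G d" "b d"] by auto
    ultimately show ?thesis using g(1-3) h(1-3) unfolding close_on_def by simp
  qed
  define A where "A n = (if n \<in> to_nat_on K ` K then S (from_nat_into K n) else {})" for n
  have "A n \<in> sets (graphM borel borel)" for n
    using meas cK by (auto simp: A_def)
  moreover have "\<exists>n. G \<in> A n" if "wf_graph ok G" for G
    using cover[OF that] cK unfolding A_def by (metis from_nat_into_to_nat_on imageI)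
  moreover have "close_on m \<epsilon> G H id" if "G \<in> A n" "H \<in> A n" for n G H
    using that small by (auto simp: A_def split: if_splits)
  ultimately show ?thesis by blast
qed

subsection \<open>Picard iteration for the jump equation\<close>

text \<open>The definition of a Poisson random measure does not exclude point sets that fail to be locally finite
  or have marks on the axes; they form a null set.\<close>

definition clean :: "int set \<Rightarrow> pt set \<Rightarrow> pt set" where
  "clean J S = (if \<forall>n::nat. finite (S \<inter> {0..real n} \<times> {0..real n} \<times> UNIV)
     then {p \<in> S. 0 < fst p \<and> 0 < fst (snd p) \<and> snd (snd p) \<in> J} else {})"

lemma clean_pos: "p \<in> clean J S \<Longrightarrow> 0 < fst p \<and> 0 < fst (snd p) \<and> snd (snd p) \<in> J"
  by (auto simp: clean_def split: if_splits)

lemma clean_finite: "finite {p \<in> clean J S. fst p \<le> t \<and> fst (snd p) \<le> c}"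
proof (cases "\<forall>n::nat. finite (S \<inter> {0..real n} \<times> {0..real n} \<times> UNIV)")
  case True
  obtain n :: nat where n: "t \<le> real n" "c \<le> real n"
    by (metis max.bounded_iff real_arch_simple)
  have "{p \<in> clean J S. fst p \<le> t \<and> fst (snd p) \<le> c} \<subseteq> S \<inter> {0..real n} \<times> {0..real n} \<times> UNIV"
    using n True by (auto simp: clean_def)
  then show ?thesis using True finite_subset by blast
next
  case False
  then have "clean J S = {}" unfolding clean_def by (simp only: if_False)
  then show ?thesis by simp
qed

text \<open>Bounded intervals contain finitely many mark times, so the set of marks up to
  \<open>t\<close> is constant just after and just before each time. Both Picard updates and
  discretised paths have this form.\<close>

lemma step_Dpath:
  assumes fin: "\<And>t. finite {p \<in> A. fst p \<le> t}" and pos: "\<And>p. p \<in> A \<Longrightarrow> 0 < fst p"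
    and F: "\<And>S. F S \<in> Xs"
  shows "Dpath Xs (\<lambda>t. F {p \<in> (A :: pt set). fst p \<le> t})"
  unfolding Dpath_def
proof (intro conjI allI impI)
  fix t :: real
  show "F {p \<in> A. fst p \<le> t} \<in> Xs" by (rule F)
next
  fix t :: real assume "t < 0"
  then have "{p \<in> A. fst p \<le> t} = {p \<in> A. fst p \<le> 0}" using pos by (force dest: pos)
  then show "F {p \<in> A. fst p \<le> t} = F {p \<in> A. fst p \<le> 0}" by simp
next
  fix t :: real
  \<comment> \<open>The sentinel \<open>t + 1\<close> keeps the minimum defined when no mark
    follows.\<close>
  let ?B = "insert (t + 1) (fst ` {p \<in> A. t < fst p \<and> fst p \<le> t + 1})"
  have fB: "finite ?B" using fin[of "t + 1"] by (auto elim!: rev_finite_subset)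
  have "t < Min ?B" using fB by (subst Min_gr_iff) auto
  moreover have "{p \<in> A. fst p \<le> y} = {p \<in> A. fst p \<le> t}" if y: "t < y" "y < Min ?B" for y
  proof -
    have "\<not> (t < fst p \<and> fst p \<le> y)" if "p \<in> A" for p
    proof
      assume a: "t < fst p \<and> fst p \<le> y"
      have "y < t + 1" using y Min_le[OF fB, of "t + 1"] by auto
      then have "fst p \<in> ?B" using a that by auto
      then show False using Min_le[OF fB, of "fst p"] y a by auto
    qed
    then show ?thesis using y by force
  qed
  ultimately have "\<forall>\<^sub>F y in at_right t. F {p \<in> A. fst p \<le> y} = F {p \<in> A. fst p \<le> t}"
    unfolding eventually_at_right_field by (intro exI[of _ "Min ?B"]) simp
  then show "continuous (at_right t) (\<lambda>t. F {p \<in> A. fst p \<le> t})"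
    unfolding continuous_within by (rule tendsto_eventually)
next
  fix t :: real
  let ?B = "insert (t - 1) (fst ` {p \<in> A. fst p < t})"
  have fB: "finite ?B" using fin[of t] by (auto elim!: rev_finite_subset)
  have "Max ?B < t" using fB by (subst Max_less_iff) auto
  moreover have "{p \<in> A. fst p \<le> y} = {p \<in> A. fst p < t}" if y: "Max ?B < y" "y < t" for y
  proof -
    have "fst p \<le> y" if "p \<in> A" "fst p < t" for p
      using Max_ge[OF fB, of "fst p"] y that by auto
    then show ?thesis using y by force
  qed
  ultimately have "\<forall>\<^sub>F y in at_left t. F {p \<in> A. fst p \<le> y} = F {p \<in> A. fst p < t}"
    unfolding eventually_at_left_field by (intro exI[of _ "Max ?B"]) simp
  then show "\<exists>l. ((\<lambda>t. F {p \<in> A. fst p \<le> t}) \<longlongrightarrow> l) (at_left t)"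
    by (intro exI) (rule tendsto_eventually)
qed

lemma Dpath_const: "i \<in> Xs \<Longrightarrow> Dpath Xs (\<lambda>_. i)"
  using step_Dpath[of "{}" "\<lambda>_. i" Xs] by simp

text \<open>\<open>dep E \<eta> T i v t\<close>: some chain of \<open>i\<close> marks with strictly decreasing times ends at \<open>v\<close> before \<open>t\<close>;
  without one, \<open>i\<close> Picard steps forget the starting path at \<open>v\<close> on \<open>[0, t)\<close>.\<close>

primrec dep :: "int set \<Rightarrow> (nat \<Rightarrow> real \<Rightarrow> real) \<Rightarrow> nat set set \<Rightarrow> (nat \<Rightarrow> pt set) \<Rightarrow> real \<Rightarrow> nat \<Rightarrow> nat \<Rightarrow> real \<Rightarrow> bool" where
  "dep J C E \<eta> T 0 v t = True"
| "dep J C E \<eta> T (Suc i) v t = (\<exists>p\<in>clean J (\<eta> v). fst p < t \<and> fst (snd p) \<le> C (card (clos E v)) T \<and>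
     (\<exists>u\<in>clos E v. dep J C E \<eta> T i u (fst p)))"

lemma dep_antimono_Suc: "dep J C E \<eta> T (Suc i) v t \<Longrightarrow> dep J C E \<eta> T i v t"
proof (induction i arbitrary: v t)
  case (Suc i)
  from Suc.prems obtain p u where "p \<in> clean J (\<eta> v)" "fst p < t" "fst (snd p) \<le> C (card (clos E v)) T"
    "u \<in> clos E v" "dep J C E \<eta> T (Suc i) u (fst p)" unfolding dep.simps(2)[of _ _ _ _ _ "Suc i"] by blast
  moreover from this(5) have "dep J C E \<eta> T i u (fst p)" by (rule Suc.IH)
  ultimately show ?case unfolding dep.simps(2)[of _ _ _ _ _ i] by blast
qed simp

lemma dep_antimono: "dep J C E \<eta> T n v t \<Longrightarrow> i \<le> n \<Longrightarrow> dep J C E \<eta> T i v t"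
  by (induction n) (auto simp: le_Suc_eq simp del: dep.simps dest: dep_antimono_Suc)

text \<open>A chain of \<open>i\<close> marks that ends at a vertex of the \<open>q\<close>-ball
  never leaves the ball of radius \<open>q + i\<close>, where the isomorphism matches neighbourhoods
  and noise.\<close>

lemma dep_iso:
  assumes iso: "rooted_iso \<phi> (ballv E r R) E r (ballv E' r' R) E' r'"
    and eta: "\<And>v. v \<in> ballv E r R \<Longrightarrow> \<eta>' (\<phi> v) = \<eta> v"
  shows "v \<in> ballv E r q \<Longrightarrow> q + i \<le> R \<Longrightarrow> dep J C E' \<eta>' T i (\<phi> v) t = dep J C E \<eta> T i v t"
proof (induction i arbitrary: v q t)
  case (Suc i)
  have vR: "v \<in> ballv E r R" using Suc.prems ballv_mono[of q R E r] by auto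
  have cl: "clos E' (\<phi> v) = \<phi> ` clos E v" and cc: "card (clos E' (\<phi> v)) = card (clos E v)"
    using rooted_iso_clos[OF iso Suc.prems(1)] rooted_iso_card_clos[OF iso Suc.prems(1)] Suc.prems(2) by auto
  have "dep J C E' \<eta>' T i (\<phi> u) s = dep J C E \<eta> T i u s" if "u \<in> clos E v" for u s
    using Suc.IH[of u "Suc q" s] clos_ballv[OF Suc.prems(1)] that Suc.prems(2) by auto
  then show ?case unfolding dep.simps cc eta[OF vR] unfolding cl by (simp cong: bex_cong)
qed simp

section \<open>Bounds and invariance of the rates, and the Picard map\<close>

locale jump_model =
  fixes Xs J :: "int set" and \<sigma> :: "int \<Rightarrow> real"
    and rbar :: "('e::polish_space, 'k::polish_space) rbar_fam"
    and C :: "nat \<Rightarrow> real \<Rightarrow> real"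
  assumes setting: "jump_setting Xs J \<sigma>"
    and standing: "standing_rates Xs J rbar"
    and A1: "A1 Xs J rbar C"
begin

abbreviation W :: "('e, 'k \<times> int) mgraph \<Rightarrow> bool" where
  "W \<equiv> wf_graph (init_ok Xs)"

abbreviation paths_on :: "nat set \<Rightarrow> (nat \<Rightarrow> path) \<Rightarrow> bool" where
  "paths_on U x \<equiv> \<forall>u\<in>U. Dpath Xs (x u)"

abbreviation rt :: "('e, 'k \<times> int) mgraph \<Rightarrow> int \<Rightarrow> nat \<Rightarrow> real \<Rightarrow> (nat \<Rightarrow> path) \<Rightarrow> real" where
  "rt H j v s x \<equiv> rate rbar j (edges H) (emark H) (fst \<circ> vmark H) v s x"

text \<open>(A1) quantifies over graphs together with their marks, so it applies to \<open>H\<close>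
  with its marks replaced by arbitrary ones. The comparison of rates under two families of marks
  relies on this.\<close>

lemma rate_le_C:
  assumes H: "W H" "v \<in> verts H" and j: "j \<in> J" and x: "paths_on (verts H) x" and t: "0 \<le> t" "t \<le> T"
  shows "rate rbar j (edges H) eb kap v t x \<le> C (card (clos (edges H) v)) T"
proof -
  let ?H = "\<lparr>verts = verts H, edges = edges H, root = root H, emark = eb, vmark = kap\<rparr>"
  have "wf_graph (\<lambda>_. True) ?H" using H(1) unfolding wf_graph_def by (simp only: mgraph.select_convs) blast
  with A1 have "\<forall>v\<in>verts ?H. \<forall>j\<in>J. \<forall>x. paths_on (verts ?H) x \<longrightarrow> (\<forall>T t. 0 \<le> t \<and> t \<le> T \<longrightarrow>
      rate rbar j (edges ?H) (emark ?H) (vmark ?H) v t x \<le> C (card (clos (edges ?H) v)) T)"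
    unfolding A1_def by blast
  then show ?thesis using assms by simp
qed

lemma rate_pred:
  assumes H: "wf_graph ok H" "v \<in> verts H" and j: "j \<in> J" and t: "0 \<le> t"
    and x: "paths_on (clos (edges H) v) x" "paths_on (clos (edges H) v) y"
    and eq: "\<And>u s. u \<in> clos (edges H) v \<Longrightarrow> 0 \<le> s \<Longrightarrow> s < t \<Longrightarrow> x u s = y u s"
  shows "rate rbar j (edges H) eb kap v t x = rate rbar j (edges H) eb kap v t y"
  unfolding rate_def Let_def
  using standing[unfolded standing_rates_def, rule_format, OF j wf_radius1[OF H],
      THEN conjunct2, THEN conjunct2, THEN conjunct1, rule_format, of t x y] x eq t by blast

text \<open>A rate on \<open>H\<close> is expressed on \<open>G\<close> by pulling marks and paths
  back along \<phi>. In this form it can be compared with the rate on \<open>G\<close>, at whose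
  marks (A2) gives continuity.\<close>

lemma rate_iso:
  assumes iso: "rooted_iso \<phi> (ballv (edges G) (root G) R) (edges G) (root G) (ballv (edges H) (root H) R) (edges H) (root H)"
    and wf: "W G" "W H" and v: "v \<in> ballv (edges G) (root G) q" "Suc q \<le> R"
    and j: "j \<in> J" and t: "0 \<le> t" and y: "paths_on (clos (edges H) (\<phi> v)) y"
  shows "rate rbar j (edges H) eb kap (\<phi> v) t y = rate rbar j (edges G) (eb \<circ> (`) \<phi>) (kap \<circ> \<phi>) v t (y \<circ> \<phi>)"
proof -
  let ?U = "clos (edges G) v" and ?U' = "clos (edges H) (\<phi> v)"
  have cl: "\<phi> ` ?U = ?U'" by (rule rooted_iso_clos[OF iso v])
  have sub: "?U \<subseteq> ballv (edges G) (root G) R" using clos_ballv[OF v(1)] ballv_mono[OF v(2), of "edges G" "root G"] by auto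
  have vG: "v \<in> verts G" using wf_ballv_verts[OF wf(1), of q] v by auto
  have "\<phi> v \<in> ballv (edges H) (root H) q"
    using rooted_iso_ballv[OF rooted_iso_ballv_mono[OF iso, of q]] v by auto
  then have vH: "\<phi> v \<in> verts H" using wf_ballv_verts[OF wf(2), of q] by auto
  have "rooted_iso \<phi> ?U (induced_edges (edges G) ?U) v ?U' (induced_edges (edges H) ?U') (\<phi> v)"
    unfolding rooted_iso_def
  proof (intro conjI ballI)
    show "bij_betw \<phi> ?U ?U'"
      using iso cl sub unfolding rooted_iso_def bij_betw_def by (meson inj_on_subset)
    show "({u, w} \<in> induced_edges (edges G) ?U) = ({\<phi> u, \<phi> w} \<in> induced_edges (edges H) ?U')"
      if "u \<in> ?U" "w \<in> ?U" for u w
    proof -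
      have "{u, w} \<in> edges G \<longleftrightarrow> {\<phi> u, \<phi> w} \<in> edges H"
        using iso sub that unfolding rooted_iso_def by blast
      then show ?thesis using that cl by (auto simp: induced_edges_def)
    qed
  qed simp
  then show ?thesis
    unfolding rate_def Let_def
    using standing[unfolded standing_rates_def, rule_format, OF j wf_radius1[OF wf(1) vG],
      THEN conjunct2, THEN conjunct2, THEN conjunct2, rule_format, of ?U' "induced_edges (edges H) ?U'" "\<phi> v" \<phi> t y]
      wf_radius1[OF wf(2) vH] t y by blast
qed

text \<open>Values outside the state space are reset, so that every Picard iterate is a path.\<close>

definition upd :: "('e, 'k \<times> int) mgraph \<Rightarrow> (nat \<Rightarrow> pt set) \<Rightarrow> (nat \<Rightarrow> path) \<Rightarrow> nat \<Rightarrow> path" where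
  "upd H \<eta> x v t = (let z = snd (vmark H v) + (\<Sum>p\<in>used_pts rbar H (clean J (\<eta> v)) v t x. snd (snd p))
     in if z \<in> Xs then z else snd (vmark H v))"

definition xit :: "('e, 'k \<times> int) mgraph \<Rightarrow> (nat \<Rightarrow> pt set) \<Rightarrow> nat \<Rightarrow> nat \<Rightarrow> path" where
  "xit H \<eta> n = (upd H \<eta> ^^ n) (\<lambda>v t. snd (vmark H v))"

lemma upd_cong:
  "used_pts rbar H (clean J (\<eta> v)) v t x = used_pts rbar H (clean J (\<eta> v)) v t y \<Longrightarrow> upd H \<eta> x v t = upd H \<eta> y v t"
  by (simp add: upd_def)

lemma init_in_Xs: "W H \<Longrightarrow> v \<in> verts H \<Longrightarrow> snd (vmark H v) \<in> Xs"
  by (simp add: wf_graph_def init_ok_def)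

text \<open>The bound of (A1) confines the marks used up to \<open>t\<close> to a bounded region,
  where \<open>clean\<close> leaves finitely many.\<close>

lemma upd_Dpath:
  assumes H: "W H" "v \<in> verts H" and x: "paths_on (verts H) x"
  shows "Dpath Xs (upd H \<eta> x v)"
proof -
  let ?A = "{p \<in> clean J (\<eta> v). 0 < fst p \<and> fst (snd p) \<le> rt H (snd (snd p)) v (fst p) x}"
  let ?F = "\<lambda>S. let z = snd (vmark H v) + (\<Sum>p\<in>S. snd (snd p)) in if z \<in> Xs then z else snd (vmark H v)"
  have used: "used_pts rbar H (clean J (\<eta> v)) v t x = {p \<in> ?A. fst p \<le> t}" for t
    by (auto simp: used_pts_def)
  have "{p \<in> ?A. fst p \<le> t} \<subseteq> {p \<in> clean J (\<eta> v). fst p \<le> t \<and> fst (snd p) \<le> C (card (clos (edges H) v)) t}" for t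
  proof
    fix p assume p: "p \<in> {p \<in> ?A. fst p \<le> t}"
    then have "rt H (snd (snd p)) v (fst p) x \<le> C (card (clos (edges H) v)) t"
      using clean_pos[of p] by (intro rate_le_C[OF H _ x]) auto
    then show "p \<in> {p \<in> clean J (\<eta> v). fst p \<le> t \<and> fst (snd p) \<le> C (card (clos (edges H) v)) t}" using p by simp
  qed
  then have fin: "finite {p \<in> ?A. fst p \<le> t}" for t using clean_finite finite_subset by blast
  have "Dpath Xs (\<lambda>t. ?F {p \<in> ?A. fst p \<le> t})"
    using init_in_Xs[OF H] by (intro step_Dpath fin) (auto simp: Let_def)
  then show ?thesis unfolding upd_def used .
qed

lemma updn_Dpath:
  assumes H: "W H" and x: "paths_on (verts H) x"
  shows "paths_on (verts H) ((upd H \<eta> ^^ n) x)"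
  by (induction n) (use x upd_Dpath[OF H] in auto)

lemma xit_Dpath: "W H \<Longrightarrow> paths_on (verts H) (xit H \<eta> n)"
  unfolding xit_def by (rule updn_Dpath) (auto intro: Dpath_const init_in_Xs)

text \<open>If no chain of \<open>i + 1\<close> marks ends at \<open>v\<close>, then no relevant
  mark at \<open>v\<close> is preceded by a chain of \<open>i\<close> marks at \<open>v\<close> or a
  neighbour, so by induction the rates at that mark receive the same input.\<close>

lemma updn_agree:
  assumes H: "W H" and x: "paths_on (verts H) x" "paths_on (verts H) y"
  shows "v \<in> verts H \<Longrightarrow> t \<le> T \<Longrightarrow> \<not> dep J C (edges H) \<eta> T i v t \<Longrightarrow> s < t \<Longrightarrow>
    (upd H \<eta> ^^ i) x v s = (upd H \<eta> ^^ i) y v s"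
proof (induction i arbitrary: v t s)
  case (Suc i)
  let ?x = "(upd H \<eta> ^^ i) x" and ?y = "(upd H \<eta> ^^ i) y"
  have D: "paths_on (verts H) ?x" "paths_on (verts H) ?y" using updn_Dpath[OF H] x by auto
  have cl: "clos (edges H) v \<subseteq> verts H" by (rule wf_clos_verts[OF H Suc.prems(1)])
  have "fst (snd p) \<le> rt H (snd (snd p)) v (fst p) ?x \<longleftrightarrow> fst (snd p) \<le> rt H (snd (snd p)) v (fst p) ?y"
    if p: "p \<in> clean J (\<eta> v)" "fst p \<le> s" for p
  \<comment> \<open>Below the bound the missing chain and predictability make the two rates equal; a
    mark above the bound exceeds both rates and is used by neither.\<close>
  proof (cases "fst (snd p) \<le> C (card (clos (edges H) v)) T")
    case True
    have "\<not> dep J C (edges H) \<eta> T i u (fst p)" if "u \<in> clos (edges H) v" for u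
      using Suc.prems(3,4) p True that by auto
    then have "rt H (snd (snd p)) v (fst p) ?x = rt H (snd (snd p)) v (fst p) ?y"
      using D cl clean_pos[OF p(1)] p Suc.prems by (intro rate_pred[OF H Suc.prems(1)] Suc.IH[of _ "fst p"]) auto
    then show ?thesis by simp
  next
    case False
    then show ?thesis
      using rate_le_C[OF H Suc.prems(1) _ D(1), of "snd (snd p)" "fst p" T "emark H" "fst \<circ> vmark H"]
        rate_le_C[OF H Suc.prems(1) _ D(2), of "snd (snd p)" "fst p" T "emark H" "fst \<circ> vmark H"] clean_pos[OF p(1)] p(2) Suc.prems(2,4) by auto
  qed
  then have "used_pts rbar H (clean J (\<eta> v)) v s ?x = used_pts rbar H (clean J (\<eta> v)) v s ?y"
    unfolding used_pts_def by blast
  then show ?case unfolding funpow.simps comp_apply by (rule upd_cong)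
qed simp

text \<open>The noise on \<open>H\<close> is transported from \<open>G\<close> along \<open>\<phi>\<close>, and no mark separates the rates computed
  with the marks of \<open>G\<close> from those computed with the marks of \<open>H\<close>.\<close>

lemma coupling:
  assumes wf: "W G" "W H"
    and iso: "rooted_iso \<phi> (ballv (edges G) (root G) R) (edges G) (root G) (ballv (edges H) (root H) R) (edges H) (root H)"
    and init: "\<And>v. v \<in> ballv (edges G) (root G) R \<Longrightarrow> snd (vmark H (\<phi> v)) = snd (vmark G v)"
    and eta: "\<And>v. v \<in> ballv (edges G) (root G) R \<Longrightarrow> \<eta>' (\<phi> v) = \<eta> v"
    and X: "paths_on (verts G) X"
    and eq: "\<And>v t. v \<in> verts G \<Longrightarrow> 0 \<le> t \<Longrightarrow> t \<le> T \<Longrightarrow> X v t = upd G \<eta> X v t"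
    and nohit: "\<And>v p. v \<in> ballv (edges G) (root G) R \<Longrightarrow> p \<in> clean J (\<eta> v) \<Longrightarrow> fst p \<le> T \<Longrightarrow>
       fst (snd p) \<le> rt G (snd (snd p)) v (fst p) X \<longleftrightarrow>
       fst (snd p) \<le> rate rbar (snd (snd p)) (edges G) (emark H \<circ> (`) \<phi>) (fst \<circ> vmark H \<circ> \<phi>) v (fst p) X"
    and v: "v \<in> ballv (edges G) (root G) m" and R: "m + i \<le> R"
    and nd: "\<not> dep J C (edges G) \<eta> T i v T" and n: "i \<le> n" and t: "0 \<le> t" "t < T"
  shows "xit H \<eta>' n (\<phi> v) t = X v t"
proof -
  let ?B = "ballv (edges G) (root G) R"
  have inj: "inj_on \<phi> ?B" and im: "\<phi> ` ?B = ballv (edges H) (root H) R"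
    using iso by (auto simp: rooted_iso_def bij_betw_def)
  have BG: "?B \<subseteq> verts G" and BH: "\<phi> ` ?B \<subseteq> verts H" using wf_ballv_verts[OF wf(1)] wf_ballv_verts[OF wf(2)] im by auto
  \<comment> \<open>\<open>Y\<close> is \<open>X\<close> carried over to the ball in
    \<open>H\<close>. Outside the ball any path with values in the state space serves, and the
    initial state is taken.\<close>
  define Y where "Y w = (if w \<in> \<phi> ` ?B then X (inv_into ?B \<phi> w) else (\<lambda>t. snd (vmark H w)))" for w
  have Y: "Y (\<phi> v) = X v" if "v \<in> ?B" for v using that inj by (auto simp: Y_def)
  have YD: "paths_on (verts H) Y"
  proof
    fix w assume "w \<in> verts H"
    then show "Dpath Xs (Y w)"
      using X BG inv_into_into[of w \<phi> ?B] init_in_Xs[OF wf(2)] by (auto simp: Y_def Dpath_const)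
  qed
  \<comment> \<open>Each update loses one layer at the boundary: after \<open>k\<close> updates
    \<open>Y\<close> still shows \<open>X\<close> wherever the ball extends \<open>k\<close>
    further. Predictability is what lets the values before \<open>s\<close> determine the rate at
    \<open>s\<close>.\<close>
  have step: "v \<in> ballv (edges G) (root G) q \<Longrightarrow> q + k \<le> R \<Longrightarrow> 0 \<le> t \<Longrightarrow> t \<le> T \<Longrightarrow> (upd H \<eta>' ^^ k) Y (\<phi> v) t = X v t" for q k v t
  proof (induction k arbitrary: q v t)
    case 0
    then show ?case using Y ballv_mono[of q R "edges G" "root G"] by auto
  next
    case (Suc k)
    let ?Z = "(upd H \<eta>' ^^ k) Y"
    have vB: "v \<in> ?B" using Suc.prems ballv_mono[of q R "edges G" "root G"] by auto
    then have vG: "v \<in> verts G" and vH: "\<phi> v \<in> verts H" using BG BH by auto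
    have ZD: "paths_on (verts H) ?Z" by (rule updn_Dpath[OF wf(2) YD])
    have cl: "\<phi> ` clos (edges G) v = clos (edges H) (\<phi> v)"
      using rooted_iso_clos[OF iso Suc.prems(1)] Suc.prems(2) by auto
    have clH: "clos (edges H) (\<phi> v) \<subseteq> verts H" by (rule wf_clos_verts[OF wf(2) vH])
    have clG: "clos (edges G) v \<subseteq> verts G" by (rule wf_clos_verts[OF wf(1) vG])
    have rates: "rt H j (\<phi> v) s ?Z = rate rbar j (edges G) (emark H \<circ> (`) \<phi>) (fst \<circ> vmark H \<circ> \<phi>) v s X"
      if j: "j \<in> J" and s: "0 \<le> s" "s \<le> T" for j s
    proof -
      have "rt H j (\<phi> v) s ?Z = rate rbar j (edges G) (emark H \<circ> (`) \<phi>) (fst \<circ> vmark H \<circ> \<phi>) v s (?Z \<circ> \<phi>)"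
        using Suc.prems(2) ZD clH by (intro rate_iso[OF iso wf Suc.prems(1) _ j s(1)]) auto
      also have "\<dots> = rate rbar j (edges G) (emark H \<circ> (`) \<phi>) (fst \<circ> vmark H \<circ> \<phi>) v s X"
      proof (rule rate_pred[OF wf(1) vG j s(1)])
        show "paths_on (clos (edges G) v) (?Z \<circ> \<phi>)" using ZD clH cl by auto
        show "paths_on (clos (edges G) v) X" using X clG by auto
        show "(?Z \<circ> \<phi>) u r = X u r" if "u \<in> clos (edges G) v" "0 \<le> r" "r < s" for u r
          using Suc.IH[of u "Suc q" r] clos_ballv[OF Suc.prems(1)] that s Suc.prems(2) by auto
      qed
      finally show ?thesis .
    qed
    have "used_pts rbar H (clean J (\<eta>' (\<phi> v))) (\<phi> v) t ?Z = used_pts rbar G (clean J (\<eta> v)) v t X"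
      unfolding used_pts_def eta[OF vB]
    proof (rule Collect_cong, rule conj_cong[OF refl], rule conj_cong[OF refl], rule conj_cong[OF refl])
      fix p assume p: "p \<in> clean J (\<eta> v)" "0 < fst p" "fst p \<le> t"
      then have "fst p \<le> T" using Suc.prems by simp
      with p show "(fst (snd p) \<le> rt H (snd (snd p)) (\<phi> v) (fst p) ?Z) = (fst (snd p) \<le> rt G (snd (snd p)) v (fst p) X)"
        using nohit[OF vB p(1)] rates[of "snd (snd p)" "fst p"] clean_pos[OF p(1)] by simp
    qed
    then have "upd H \<eta>' ?Z (\<phi> v) t = upd G \<eta> X v t" unfolding upd_def init[OF vB] by simp
    also have "\<dots> = X v t" using eq[OF vG] Suc.prems by simp
    finally show ?case by simp
  qed
  have vB: "v \<in> ?B" using v R ballv_mono[of m R "edges G" "root G"] by auto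
  then have vH: "\<phi> v \<in> verts H" using BH by auto
  have ndH: "\<not> dep J C (edges H) \<eta>' T i (\<phi> v) T"
    using dep_iso[where \<eta>=\<eta> and \<eta>'=\<eta>', OF iso eta v R] nd by simp
  obtain n' where n': "n = i + n'" using n le_Suc_ex by blast
  \<comment> \<open>Only the last \<open>i\<close> updates count: they forget their starting path,
    so the earlier iterate may be exchanged for \<open>Y\<close>.\<close>
  have "xit H \<eta>' n (\<phi> v) t = (upd H \<eta>' ^^ i) (xit H \<eta>' n') (\<phi> v) t"
    by (simp add: xit_def n' funpow_add)
  also have "\<dots> = (upd H \<eta>' ^^ i) Y (\<phi> v) t"
    by (rule updn_agree[OF wf(2) xit_Dpath[OF wf(2)] YD vH order_refl ndH t(2)])
  also have "\<dots> = X v t" using step[OF v R] t by simp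
  finally show ?thesis .
qed

text \<open>This is \<open>coupling\<close> of \<open>G\<close> with itself along the identity,
  where no mark can separate a rate from itself.\<close>

lemma xit_eventually:
  assumes wf: "W G" and X: "paths_on (verts G) X"
    and eq: "\<And>v t. v \<in> verts G \<Longrightarrow> 0 \<le> t \<Longrightarrow> t \<le> T \<Longrightarrow> X v t = upd G \<eta> X v t"
    and v: "v \<in> verts G" and nd: "\<not> dep J C (edges G) \<eta> T i v T" and n: "i \<le> n" and t: "0 \<le> t" "t < T"
  shows "xit G \<eta> n v t = X v t"
proof -
  obtain m where m: "v \<in> ballv (edges G) (root G) m" using wf_verts_ballv[OF wf v] by blast
  have iso: "rooted_iso id (ballv (edges G) (root G) (m + i)) (edges G) (root G) (ballv (edges G) (root G) (m + i)) (edges G) (root G)"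
    by (auto simp: rooted_iso_def)
  have id: "emark G \<circ> (`) id = emark G" by (simp add: fun_eq_iff)
  have "xit G \<eta> n (id v) t = X v t"
    by (rule coupling[where \<eta>=\<eta> and T=T and i=i, OF wf wf iso _ _ X eq _ m order_refl nd n t])
       (auto simp: id)
  then show ?thesis by simp
qed

text \<open>Time is cut into windows of length \<open>d\<close>. Read backwards, a chain stays
  within one window inside the finite component of active vertices in which it starts and uses up
  finitely many marks there; it enters an earlier window through the finite neighbourhood of that
  component, where the induction hypothesis bounds the rest.\<close>

lemma no_chain:
  assumes wf: "W H" and d: "0 < d"
    and comp: "\<And>l::nat. \<And>v. \<forall>A. A = {v\<in>verts H. \<exists>p\<in>clean J (\<eta> v). real l * d < fst p \<and> fst p \<le> real (Suc l) * d \<and>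
        fst (snd p) \<le> C (card (clos (edges H) v)) T} \<longrightarrow> v \<in> A \<longrightarrow>
        finite (({(u, w). {u, w} \<in> edges H} \<inter> A \<times> A)\<^sup>* `` {v})"
    and v: "v \<in> verts H"
  shows "\<exists>i. \<not> dep J C (edges H) \<eta> T i v t"
proof -
  let ?E = "edges H"
  \<comment> \<open>\<open>depc\<close> is one step of \<open>dep\<close> with \<open>\<le>\<close>
    in place of \<open><\<close> at the latest mark, so that windows are closed on the right, like
    the interval in \<open>active_set\<close>.\<close>
  define depc where "depc i v t = (\<exists>p\<in>clean J (\<eta> v). fst p \<le> t \<and> fst (snd p) \<le> C (card (clos ?E v)) T \<and>
     (\<exists>u\<in>clos ?E v. dep J C ?E \<eta> T i u (fst p)))" for i v t
  have depc_anti: "depc i v t" if "depc n v t" "i \<le> n" for i n v t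
    using that dep_antimono unfolding depc_def by metis
  have main: "\<exists>i. \<not> depc i v (real l * d)" if "v \<in> verts H" for l v
    using that
  proof (induction l arbitrary: v)
    case 0
    have "\<not> depc 0 v (real 0 * d)" unfolding depc_def using clean_pos by force
    then show ?case ..
  next
    case (Suc l)
    define A where "A = {v\<in>verts H. \<exists>p\<in>clean J (\<eta> v). real l * d < fst p \<and> fst p \<le> real (Suc l) * d \<and>
        fst (snd p) \<le> C (card (clos ?E v)) T}"
    show ?case
    proof (cases "v \<in> A")
      case False
      obtain i where "\<not> depc i v (real l * d)" using Suc by blast
      moreover have "fst p \<le> real l * d" if "p \<in> clean J (\<eta> v)" "fst p \<le> real (Suc l) * d" "fst (snd p) \<le> C (card (clos ?E v)) T" for p
        using False that Suc.prems by (force simp: A_def)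
      ultimately have "\<not> depc i v (real (Suc l) * d)" unfolding depc_def by blast
      then show ?thesis ..
    next
      case True
      define K where "K = ({(u, w). {u, w} \<in> ?E} \<inter> A \<times> A)\<^sup>* `` {v}"
      have finK: "finite K" unfolding K_def using comp[of l v] A_def True by blast
      have vK: "v \<in> K" by (auto simp: K_def)
      have KA: "K \<subseteq> A"
      proof
        fix u assume "u \<in> K"
        then have "(v, u) \<in> ({(u, w). {u, w} \<in> ?E} \<inter> A \<times> A)\<^sup>*" by (auto simp: K_def)
        then show "u \<in> A" by (induction rule: rtrancl_induct) (use True in auto)
      qed
      then have KV: "K \<subseteq> verts H" by (auto simp: A_def)
      define L where "L = (\<Union>u\<in>K. clos ?E u)"
      have finL: "finite L" unfolding L_def using finK KV wf_finite_clos[OF wf] by blast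
      have LV: "L \<subseteq> verts H" unfolding L_def using KV wf_clos_verts[OF wf] by blast
      have KL: "u \<in> K" if uL: "u \<in> L" and uA: "u \<in> A" for u
      proof -
        obtain w where w: "w \<in> K" "u \<in> clos ?E w" using uL by (auto simp: L_def)
        then have "u = w \<or> {u, w} \<in> ?E" by (auto simp: clos_def nbrs_def)
        then show ?thesis
        proof
          assume "{u, w} \<in> ?E"
          then have "(w, u) \<in> {(u, w). {u, w} \<in> ?E} \<inter> A \<times> A" using uA w KA by (auto simp: insert_commute)
          then show ?thesis using w by (auto simp: K_def intro: rtrancl_into_rtrancl)
        qed (use w in simp)
      qed
      have "\<forall>u. \<exists>i. u \<in> verts H \<longrightarrow> \<not> depc i u (real l * d)" using Suc.IH by blast
      from choice[OF this] obtain f where f: "\<And>u. u \<in> verts H \<Longrightarrow> \<not> depc (f u) u (real l * d)" by blast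
      \<comment> \<open>Since \<open>L\<close> is finite, one number serves all its vertices at the
        end of the previous window.\<close>
      define i0 where "i0 = Max (insert 0 (f ` L))"
      have i0: "\<not> depc i u (real l * d)" if "u \<in> L" "i0 \<le> i" for u i
      proof -
        have "f u \<le> i0" unfolding i0_def using that finL by (intro Max_ge) auto
        then show ?thesis using f[of u] LV that depc_anti[of i u _ "f u"] by auto
      qed
      define Pt where "Pt t = (SIGMA w : K. {p \<in> clean J (\<eta> w). real l * d < fst p \<and> fst p < t \<and>
          fst (snd p) \<le> C (card (clos ?E w)) T})" for t
      have finP: "finite (Pt t)" for t
        unfolding Pt_def by (intro finite_SigmaI finK finite_subset[OF _ clean_finite[of J _ t]]) auto
      define c where "c t = card (Pt t)" for t
      \<comment> \<open>Induction on the number of marks of \<open>K\<close> in the window before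
        \<open>t\<close>. A mark in the window makes its vertex active, hence a member of
        \<open>K\<close>, and uses up one element of \<open>Pt t\<close>; a mark before the window
        is governed by \<open>i0\<close>.\<close>
      have claim: "\<not> dep J C ?E \<eta> T (Suc (i0 + c t)) u t" if "u \<in> L" "t \<le> real (Suc l) * d" for u t
        using that
      proof (induction "c t" arbitrary: t u rule: less_induct)
        case less
        show ?case
        proof
          assume "dep J C ?E \<eta> T (Suc (i0 + c t)) u t"
          then obtain p w where p: "p \<in> clean J (\<eta> u)" "fst p < t" "fst (snd p) \<le> C (card (clos ?E u)) T"
            and w: "w \<in> clos ?E u" "dep J C ?E \<eta> T (i0 + c t) w (fst p)" by auto
          show False
          proof (cases "fst p \<le> real l * d")
            case True
            then have "depc (i0 + c t) u (real l * d)" unfolding depc_def using p w by blast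
            then show False using i0[OF less.prems(1)] by simp
          next
            case False
            then have "u \<in> A" unfolding A_def using p less.prems LV by force
            then have uK: "u \<in> K" using KL less.prems by blast
            then have wL: "w \<in> L" using w by (auto simp: L_def)
            have "(u, p) \<in> Pt t - Pt (fst p)" using uK p False by (auto simp: Pt_def)
            moreover have "Pt (fst p) \<subseteq> Pt t" using p by (auto simp: Pt_def)
            ultimately have "c (fst p) < c t" unfolding c_def by (intro psubset_card_mono finP) auto
            moreover from this have "\<not> dep J C ?E \<eta> T (Suc (i0 + c (fst p))) w (fst p)"
              using less.hyps[OF _ wL] p less.prems by auto
            ultimately show False using dep_antimono[OF w(2), of "Suc (i0 + c (fst p))"] by auto
          qed
        qed
      qed
      let ?i = "Suc (i0 + c (real (Suc l) * d))"
      have "\<not> depc ?i v (real (Suc l) * d)"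
      proof
        assume "depc ?i v (real (Suc l) * d)"
        then obtain p u where p: "p \<in> clean J (\<eta> v)" "fst p \<le> real (Suc l) * d" and u: "u \<in> clos ?E v"
          and dp: "dep J C ?E \<eta> T ?i u (fst p)" unfolding depc_def by blast
        have uL: "u \<in> L" using u vK by (auto simp: L_def)
        have "c (fst p) \<le> c (real (Suc l) * d)" unfolding c_def using p by (intro card_mono finP) (auto simp: Pt_def)
        then have "dep J C ?E \<eta> T (Suc (i0 + c (fst p))) u (fst p)" by (intro dep_antimono[OF dp]) simp
        then show False using claim[OF uL p(2)] by blast
      qed
      then show ?thesis ..
    qed
  qed
  obtain l :: nat where "t / d < real l" using reals_Archimedean2 by blast
  then have l: "t \<le> real l * d" using d by (simp add: field_simps)
  obtain i where "\<not> depc i v (real l * d)" using main[OF v] by blast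
  then have "\<not> dep J C ?E \<eta> T (Suc i) v t" using l unfolding depc_def by force
  then show ?thesis ..
qed

end

subsection \<open>Counting measures of point sets\<close>

lemma cnt_mono: "A \<subseteq> B \<Longrightarrow> enat k \<le> cnt S A \<Longrightarrow> enat k \<le> cnt S B"
proof (cases "finite (S \<inter> B)")
  case True
  assume a: "A \<subseteq> B" "enat k \<le> cnt S A"
  then have "S \<inter> A \<subseteq> S \<inter> B" by auto
  then have "finite (S \<inter> A)" "card (S \<inter> A) \<le> card (S \<inter> B)"
    by (rule finite_subset[OF _ True], rule card_mono[OF True])
  then show ?thesis using a True by (simp add: cnt_def)
qed (simp add: cnt_def)

text \<open>Finitely many points of an increasing union already lie in one of its members; the
  formulation by lower bounds covers infinite counts as well.\<close>

lemma cnt_incseq: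
  assumes inc: "incseq B"
  shows "enat k \<le> cnt S (\<Union>n. B n) \<longleftrightarrow> (\<exists>n. enat k \<le> cnt S (B n))"
proof
  assume "enat k \<le> cnt S (\<Union>n. B n)"
  then have "\<exists>F. finite F \<and> F \<subseteq> S \<inter> (\<Union>n. B n) \<and> card F = k"
  proof (cases "finite (S \<inter> (\<Union>n. B n))")
    case True
    then have "k \<le> card (S \<inter> (\<Union>n. B n))" using \<open>enat k \<le> cnt S (\<Union>n. B n)\<close> by (simp add: cnt_def del: Int_UN_distrib)
    then show ?thesis by (rule obtain_subset_with_card_n) blast
  next
    case False
    then show ?thesis using infinite_arbitrarily_large[of "S \<inter> (\<Union>n. B n)" k] by blast
  qed
  then obtain F where F: "finite F" "F \<subseteq> S \<inter> (\<Union>n. B n)" "card F = k" by blast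
  have "\<exists>n. F \<subseteq> B n"
    using F(1,2)
  proof (induction F)
    case (insert x F)
    then obtain n m where "F \<subseteq> B n" "x \<in> B m" by auto
    then have "insert x F \<subseteq> B (max n m)"
      using monoD[OF inc, of n "max n m"] monoD[OF inc, of m "max n m"] by auto
    then show ?case ..
  qed simp
  then obtain n where "F \<subseteq> S \<inter> B n" using F by blast
  then have "enat k \<le> cnt S (B n)" unfolding cnt_def using F by (auto intro: card_mono)
  then show "\<exists>n. enat k \<le> cnt S (B n)" ..
next
  assume "\<exists>n. enat k \<le> cnt S (B n)"
  then obtain n where "enat k \<le> cnt S (B n)" ..
  then show "enat k \<le> cnt S (\<Union>n. B n)" by (rule cnt_mono[rotated]) blast
qed

text \<open>Sets of finite measure are the generators because their counts have a prescribed law in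
  \<open>cond_iid_PRM\<close>; \<open>cnt_measurable\<close> recovers the counts of all measurable
  sets.\<close>

definition nsp :: "'a measure \<Rightarrow> 'a set measure" where
  "nsp M = sigma (Pow (space M)) {{S \<in> Pow (space M). cnt S B = k} | B k. B \<in> sets M \<and> emeasure M B < \<infinity>}"

lemma space_nsp: "space (nsp M) = Pow (space M)"
  unfolding nsp_def by (rule space_measure_of) auto

lemma sets_nsp_gen: "B \<in> sets M \<Longrightarrow> emeasure M B < \<infinity> \<Longrightarrow> {S \<in> Pow (space M). cnt S B = k} \<in> sets (nsp M)"
  unfolding nsp_def by (subst sets_measure_of) auto

lemma measurable_nspI:
  assumes "\<And>x. x \<in> space N \<Longrightarrow> f x \<subseteq> space M"
    and "\<And>B k. B \<in> sets M \<Longrightarrow> emeasure M B < \<infinity> \<Longrightarrow> {x \<in> space N. cnt (f x) B = k} \<in> sets N"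
  shows "f \<in> measurable N (nsp M)"
  unfolding nsp_def
proof (rule measurable_measure_of)
  fix y assume "y \<in> {{S \<in> Pow (space M). cnt S B = k} | B k. B \<in> sets M \<and> emeasure M B < \<infinity>}"
  then obtain B k where y: "y = {S \<in> Pow (space M). cnt S B = k}" "B \<in> sets M" "emeasure M B < \<infinity>" by blast
  have "f -` y \<inter> space N = {x \<in> space N. cnt (f x) B = k}" using assms(1) by (auto simp: y)
  then show "f -` y \<inter> space N \<in> sets N" using assms(2) y by simp
qed (use assms(1) in auto)

text \<open>Sigma-finiteness exhausts \<open>B\<close> by sets of finite measure, and by
  \<open>cnt_incseq\<close> the lower bounds on the count pass to the limit.\<close>

lemma cnt_measurable:
  assumes "sigma_finite_measure M" and B: "B \<in> sets M"
  shows "(\<lambda>S. cnt S B) \<in> measurable (nsp M) (count_space UNIV)"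
proof -
  interpret sigma_finite_measure M by fact
  obtain A :: "nat \<Rightarrow> 'a set" where A: "range A \<subseteq> sets M" "(\<Union>i. A i) = space M" "\<And>i. emeasure M (A i) \<noteq> \<infinity>" "incseq A"
    using sigma_finite_incseq by blast
  have BA: "B \<inter> A n \<in> sets M" "emeasure M (B \<inter> A n) < \<infinity>" for n
  proof -
    show "B \<inter> A n \<in> sets M" using A B by auto
    have "emeasure M (B \<inter> A n) \<le> emeasure M (A n)" using A by (intro emeasure_mono) auto
    then show "emeasure M (B \<inter> A n) < \<infinity>" using A(3)[of n] by (auto simp: less_top[symmetric] top_unique)
  qed
  have UN: "(\<Union>n. B \<inter> A n) = B" using A(2) sets.sets_into_space[OF B] by auto
  have inc: "incseq (\<lambda>n. B \<inter> A n)" using A(4) by (auto simp: mono_def)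
  have fin: "(\<lambda>S. cnt S (B \<inter> A n)) \<in> measurable (nsp M) (count_space UNIV)" for n
    unfolding measurable_count_space_eq2_countable
  proof (intro conjI ballI)
    fix k
    have "(\<lambda>S. cnt S (B \<inter> A n)) -` {k} \<inter> space (nsp M) = {S \<in> Pow (space M). cnt S (B \<inter> A n) = k}"
      by (auto simp: space_nsp)
    then show "(\<lambda>S. cnt S (B \<inter> A n)) -` {k} \<inter> space (nsp M) \<in> sets (nsp M)" using sets_nsp_gen[OF BA] by simp
  qed simp
  have ge: "{S \<in> space (nsp M). enat k \<le> cnt S B} \<in> sets (nsp M)" for k
  proof -
    have "{S \<in> space (nsp M). enat k \<le> cnt S B} = (\<Union>n. (\<lambda>S. cnt S (B \<inter> A n)) -` {enat k..} \<inter> space (nsp M))"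
      using cnt_incseq[OF inc, of k] unfolding UN by auto
    also have "\<dots> \<in> sets (nsp M)" by (intro sets.countable_UN) (auto intro: measurable_sets[OF fin])
    finally show ?thesis .
  qed
  show ?thesis unfolding measurable_count_space_eq2_countable
  proof (intro conjI ballI)
    fix k :: enat
    show "(\<lambda>S. cnt S B) -` {k} \<inter> space (nsp M) \<in> sets (nsp M)"
    proof (cases k)
      case (enat m)
      have "(\<lambda>S. cnt S B) -` {k} \<inter> space (nsp M) =
         {S \<in> space (nsp M). enat m \<le> cnt S B} - {S \<in> space (nsp M). enat (Suc m) \<le> cnt S B}"
        unfolding enat by (auto simp: cnt_def split: if_splits)
      then show ?thesis using ge by simp
    next
      case infinity
      have "(\<lambda>S. cnt S B) -` {k} \<inter> space (nsp M) = (\<Inter>m. {S \<in> space (nsp M). enat m \<le> cnt S B})"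
      proof -
        have "cnt S B = \<infinity>" if a: "\<And>m. enat m \<le> cnt S B" for S
        proof (cases "cnt S B")
          case (enat r)
          then show ?thesis using a[of "Suc r"] by simp
        qed
        then show ?thesis unfolding infinity by auto
      qed
      then show ?thesis using ge by auto
    qed
  qed simp
qed

lemma emeasure_cnt: "emeasure (count_space UNIV) (S \<inter> B) = ennreal_of_enat (cnt S B)"
  by (simp add: cnt_def)

lemma cnt_disjoint_sum:
  assumes "finite A" "disjoint_family_on B A"
  shows "cnt S (\<Union>a\<in>A. B a) = (\<Sum>a\<in>A. cnt S (B a))"
proof (cases "\<forall>a\<in>A. finite (S \<inter> B a)")
  case True
  have "S \<inter> (\<Union>a\<in>A. B a) = (\<Union>a\<in>A. S \<inter> B a)" by auto
  moreover have "finite (\<Union>a\<in>A. S \<inter> B a)" by (rule finite_UN_I[OF assms(1)]) (use True in auto)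
  moreover have "card (\<Union>a\<in>A. S \<inter> B a) = (\<Sum>a\<in>A. card (S \<inter> B a))"
    using assms True by (intro card_UN_disjoint) (auto simp: disjoint_family_on_def)
  ultimately have "cnt S (\<Union>a\<in>A. B a) = enat (\<Sum>a\<in>A. card (S \<inter> B a))" by (simp add: cnt_def)
  also have "\<dots> = (\<Sum>a\<in>A. enat (card (S \<inter> B a)))" using assms(1) by (induction A) (simp_all add: zero_enat_def flip: plus_enat_simps(1))
  also have "\<dots> = (\<Sum>a\<in>A. cnt S (B a))" using True by (intro sum.cong) (auto simp: cnt_def)
  finally show ?thesis .
next
  case False
  then obtain a where a: "a \<in> A" "infinite (S \<inter> B a)" by blast
  then have "infinite (S \<inter> (\<Union>a\<in>A. B a))" by (meson UN_upper finite_subset Int_mono order_refl)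
  moreover have "(\<Sum>a\<in>A. cnt S (B a)) = \<infinity>"
    using a assms(1) by (simp add: sum.remove[of A a] cnt_def)
  ultimately show ?thesis by (simp add: cnt_def)
qed

lemma enn2real_count: "finite X \<Longrightarrow> enn2real (emeasure (count_space UNIV) X) = real (card X)"
  by simp

section \<open>The intensity measure and measurable functionals of point configurations\<close>

context jump_model begin

abbreviation pm :: "pt measure" where "pm \<equiv> intensity J \<sigma>"

abbreviation half :: "real measure" where "half \<equiv> restrict_space lborel {0..}"
abbreviation jm :: "int measure" where "jm \<equiv> point_measure J (\<lambda>j. ennreal (\<sigma> j))"

lemma pm_eq: "pm = half \<Otimes>\<^sub>M (half \<Otimes>\<^sub>M jm)"
  by (simp add: intensity_def)

lemma space_pm: "space pm = {0..} \<times> {0..} \<times> J"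
  by (simp add: intensity_def space_pair_measure space_restrict_space space_point_measure)

lemma emeasure_jm_finite: "emeasure jm J < \<infinity>"
proof -
  have pos: "\<forall>j\<in>J. \<sigma> j > 0" and sm: "\<sigma> summable_on J" using setting by (auto simp: jump_setting_def)
  have "(\<lambda>j. norm (\<sigma> j)) summable_on J \<longleftrightarrow> \<sigma> summable_on J" by (rule summable_on_cong) (use pos in force)
  then have "(\<lambda>j. norm (\<sigma> j)) summable_on J" using sm by simp
  then have i: "integrable (count_space J) \<sigma>"
    using abs_summable_on_def abs_summable_equivalent by blast
  have "emeasure jm J = (\<integral>\<^sup>+j. ennreal (\<sigma> j) \<partial>count_space J)"
    by (simp add: point_measure_def emeasure_density nn_integral_count_space_indicator)
       (auto intro!: nn_integral_cong simp: indicator_def)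
  also have "\<dots> = ennreal (\<integral>j. \<sigma> j \<partial>count_space J)"
    using pos i by (intro nn_integral_eq_integral) (auto simp: AE_count_space less_imp_le)
  finally show ?thesis by simp
qed

lemma sf_half: "sigma_finite_measure half"
  by (rule sigma_finite_measure_restrict_space) (auto intro: lborel.sigma_finite_measure_axioms)

lemma fin_jm: "finite_measure jm"
  by (rule finite_measureI) (use emeasure_jm_finite in \<open>auto simp: space_point_measure\<close>)

lemma sf_half_jm: "sigma_finite_measure (half \<Otimes>\<^sub>M jm)"
  by (rule sigma_finite_pair_measure[OF sf_half]) (rule finite_measure.sigma_finite_measure[OF fin_jm])

lemma sf_pm: "sigma_finite_measure pm"
  unfolding pm_eq by (rule sigma_finite_pair_measure[OF sf_half sf_half_jm])

lemma half_borel: "id \<in> measurable half borel"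
  by (rule measurable_restrict_space1) simp

lemma pm_fst [measurable]: "fst \<in> measurable pm borel"
  unfolding pm_eq using measurable_compose[OF measurable_fst half_borel, of "half \<Otimes>\<^sub>M jm"] by (simp add: comp_def)

lemma pm_fst_snd [measurable]: "(\<lambda>p. fst (snd p)) \<in> measurable pm borel"
  unfolding pm_eq
  using measurable_compose[OF measurable_compose[OF measurable_snd measurable_fst] half_borel, of half jm] by simp

lemma pm_snd_snd [measurable]: "(\<lambda>p. snd (snd p)) \<in> measurable pm (count_space UNIV)"
proof -
  have "id \<in> measurable jm (count_space UNIV)" by (simp add: measurable_point_measure_eq1)
  from measurable_compose[OF measurable_compose[OF measurable_snd measurable_snd] this, of half half]
  show ?thesis unfolding pm_eq by simp
qed

text \<open>These boxes have finite intensity and exhaust the mark space; by (A1) the marks used at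
  a vertex up to a fixed time lie in one of them.\<close>

definition tbox :: "nat \<Rightarrow> pt set" where
  "tbox n = {p \<in> space pm. fst p \<le> real n \<and> fst (snd p) \<le> real n}"

lemma tbox_sets [measurable]: "tbox n \<in> sets pm"
  unfolding tbox_def by measurable

lemma rect_pm: "A \<in> sets borel \<Longrightarrow> B \<in> sets borel \<Longrightarrow> D \<subseteq> J \<Longrightarrow>
   emeasure pm ((A \<inter> {0..}) \<times> (B \<inter> {0..}) \<times> D) = emeasure lborel (A \<inter> {0..}) * (emeasure lborel (B \<inter> {0..}) * emeasure jm D)"
  and rect_pm_sets: "A \<in> sets borel \<Longrightarrow> B \<in> sets borel \<Longrightarrow> D \<subseteq> J \<Longrightarrow>
   (A \<inter> {0..}) \<times> (B \<inter> {0..}) \<times> D \<in> sets pm"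
proof -
  assume a: "A \<in> sets borel" "B \<in> sets borel" "D \<subseteq> J"
  have 1: "A \<inter> {0..} \<in> sets half" "B \<inter> {0..} \<in> sets half" "D \<in> sets jm"
    using a by (auto simp: sets_restrict_space sets_point_measure)
  then show "(A \<inter> {0..}) \<times> (B \<inter> {0..}) \<times> D \<in> sets pm" unfolding pm_eq by (intro pair_measureI)
  show "emeasure pm ((A \<inter> {0..}) \<times> (B \<inter> {0..}) \<times> D) = emeasure lborel (A \<inter> {0..}) * (emeasure lborel (B \<inter> {0..}) * emeasure jm D)"
    unfolding pm_eq using 1 a
    by (subst sigma_finite_measure.emeasure_pair_measure_Times[OF sf_half_jm] ;
        (subst sigma_finite_measure.emeasure_pair_measure_Times[OF finite_measure.sigma_finite_measure[OF fin_jm]])?)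
       (auto simp: emeasure_restrict_space)
qed

lemma tbox_eq: "tbox n = ({0..real n} \<inter> {0..}) \<times> ({0..real n} \<inter> {0..}) \<times> J"
  by (auto simp: tbox_def space_pm)

lemma tbox_finite: "emeasure pm (tbox n) < \<infinity>"
  unfolding tbox_eq using emeasure_jm_finite
  by (subst rect_pm) (auto simp: ennreal_mult_less_top Int_absorb2)

lemma sub_box_finite: "emeasure pm (tbox n \<inter> B) < \<infinity>"
  using le_less_trans[OF emeasure_mono[of "tbox n \<inter> B" "tbox n" pm] tbox_finite] by auto

lemma cm_measurable:
  assumes f: "f \<in> measurable N (nsp pm)" and B: "B \<in> sets pm"
  shows "(\<lambda>x. emeasure (count_space UNIV) (f x \<inter> B)) \<in> borel_measurable N"
  unfolding emeasure_cnt
  by (rule measurable_compose[OF measurable_compose[OF f cnt_measurable[OF sf_pm B]]]) simp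

definition locfin :: "pt set \<Rightarrow> bool" where
  "locfin S \<longleftrightarrow> (\<forall>n. finite (S \<inter> tbox n))"

lemma clean_eq:
  assumes "S \<subseteq> space pm"
  shows "clean J S = (if locfin S then {p \<in> S. 0 < fst p \<and> 0 < fst (snd p)} else {})"
proof -
  have "S \<inter> {0..real n} \<times> {0..real n} \<times> UNIV = S \<inter> tbox n" for n using assms by (auto simp: tbox_def space_pm)
  then show ?thesis using assms by (auto simp: clean_def locfin_def space_pm)
qed

lemma clean_sub: "clean J S \<subseteq> S" by (auto simp: clean_def)

lemma pred_locfin: "Measurable.pred (nsp pm) locfin"
proof -
  have "locfin S \<longleftrightarrow> (\<forall>n. cnt S (tbox n) \<noteq> \<infinity>)" for S by (simp add: locfin_def cnt_def)
  moreover have "Measurable.pred (nsp pm) (\<lambda>S. \<forall>n. cnt S (tbox n) \<noteq> \<infinity>)"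
    using cnt_measurable[OF sf_pm tbox_sets] by measurable
  ultimately show ?thesis by (simp cong: measurable_cong)
qed

lemma clean_measurable: "clean J \<in> measurable (nsp pm) (nsp pm)"
proof (rule measurable_nspI)
  show "clean J S \<subseteq> space pm" if "S \<in> space (nsp pm)" for S
    using that clean_sub[of S] by (auto simp: space_nsp)
  fix B k assume B: "B \<in> sets pm"
  let ?B = "B \<inter> {p \<in> space pm. 0 < fst p \<and> 0 < fst (snd p)}"
  have [measurable]: "?B \<in> sets pm" using B by measurable
  have eq: "{S \<in> space (nsp pm). cnt (clean J S) B = k} =
     {S \<in> space (nsp pm). (locfin S \<longrightarrow> cnt S ?B = k) \<and> (\<not> locfin S \<longrightarrow> k = 0)}"
  proof (intro Collect_cong conj_cong refl)
    fix S assume "S \<in> space (nsp pm)"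
    then have S: "S \<subseteq> space pm" by (simp add: space_nsp)
    have "{p \<in> S. 0 < fst p \<and> 0 < fst (snd p)} \<inter> B = S \<inter> ?B" using S by auto
    then show "(cnt (clean J S) B = k) = ((locfin S \<longrightarrow> cnt S ?B = k) \<and> (\<not> locfin S \<longrightarrow> k = 0))"
      unfolding clean_eq[OF S] by (auto simp: cnt_def zero_enat_def)
  qed
  have [measurable]: "(\<lambda>S. cnt S ?B) \<in> measurable (nsp pm) (count_space UNIV)"
    by (rule cnt_measurable[OF sf_pm]) measurable
  note pred_locfin[measurable]
  show "{S \<in> space (nsp pm). cnt (clean J S) B = k} \<in> sets (nsp pm)" unfolding eq by measurable
qed

lemma clean_box_finite: "finite (clean J S \<inter> tbox n)"
  by (rule finite_subset[OF _ clean_finite[of J S "real n" "real n"]]) (auto simp: tbox_def)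

text \<open>Induction from rectangles to all jointly measurable sets. Restriction to
  \<open>clean\<close> and \<open>tbox n\<close> makes the count finite for every configuration,
  which the subtraction in the complement step requires.\<close>

lemma section_measurable:
  assumes f: "f \<in> measurable N (nsp pm)" and A: "A \<in> sets (N \<Otimes>\<^sub>M pm)"
  shows "(\<lambda>x. emeasure (count_space UNIV) (clean J (f x) \<inter> tbox n \<inter> {p. (x, p) \<in> A})) \<in> borel_measurable N"
proof -
  define h where "h A x = emeasure (count_space UNIV) (clean J (f x) \<inter> tbox n \<inter> {p. (x, p) \<in> A})" for A x
  have fc: "(\<lambda>x. clean J (f x)) \<in> measurable N (nsp pm)" by (rule measurable_compose[OF f clean_measurable])
  have sp: "clean J (f x) \<subseteq> space pm" if "x \<in> space N" for x
    using measurable_space[OF fc that] by (simp add: space_nsp)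
  have A': "A \<in> sigma_sets (space N \<times> space pm) {a \<times> b | a b. a \<in> sets N \<and> b \<in> sets pm}"
    using A by (simp add: sets_pair_measure)
  have "h A \<in> borel_measurable N"
    using Int_stable_pair_measure_generator pair_measure_closed A'
  proof (induction A rule: sigma_sets_induct_disjoint)
    case (basic A)
    then obtain a b where ab: "A = a \<times> b" and [measurable]: "a \<in> sets N" "b \<in> sets pm" by blast
    have "h A x = indicator a x * emeasure (count_space UNIV) (clean J (f x) \<inter> (tbox n \<inter> b))" for x
      by (simp add: h_def ab indicator_def Int_assoc)
    moreover have "(\<lambda>x. indicator a x * emeasure (count_space UNIV) (clean J (f x) \<inter> (tbox n \<inter> b))) \<in> borel_measurable N"
      by (intro borel_measurable_times_ennreal cm_measurable[OF fc]) auto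
    ultimately show ?case by (simp cong: measurable_cong)
  next
    case empty
    then show ?case by (simp add: h_def)
  next
    case (compl A)
    have "h (space N \<times> space pm - A) x = emeasure (count_space UNIV) (clean J (f x) \<inter> tbox n) - h A x"
      if x: "x \<in> space N" for x
    proof -
      have "clean J (f x) \<inter> tbox n \<inter> {p. (x, p) \<in> space N \<times> space pm - A} =
        (clean J (f x) \<inter> tbox n) - (clean J (f x) \<inter> tbox n \<inter> {p. (x, p) \<in> A})" using sp[OF x] x by auto
      then show ?thesis unfolding h_def
        by (subst emeasure_Diff[symmetric]) (auto simp: clean_box_finite)
    qed
    moreover have "(\<lambda>x. emeasure (count_space UNIV) (clean J (f x) \<inter> tbox n) - h A x) \<in> borel_measurable N"
      by (intro borel_measurable_minus_ennreal cm_measurable[OF fc] compl) auto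
    ultimately show ?case by (simp cong: measurable_cong)
  next
    case (union A)
    have "h (\<Union>i. A i) x = (\<Sum>i. h (A i) x)" for x
    proof -
      have "clean J (f x) \<inter> tbox n \<inter> {p. (x, p) \<in> (\<Union>i. A i)} = (\<Union>i. clean J (f x) \<inter> tbox n \<inter> {p. (x, p) \<in> A i})" by auto
      then show ?thesis unfolding h_def
        using union(1) by (subst suminf_emeasure) (auto simp: disjoint_family_on_def)
    qed
    moreover have "(\<lambda>x. \<Sum>i. h (A i) x) \<in> borel_measurable N"
      using union by (intro borel_measurable_suminf_order) auto
    ultimately show ?case by (simp cong: measurable_cong)
  qed
  then show ?thesis unfolding h_def .
qed

lemma section_hit_measurable:
  assumes f: "f \<in> measurable N (nsp pm)" and A: "A \<in> sets (N \<Otimes>\<^sub>M pm)"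
  shows "Measurable.pred N (\<lambda>x. \<exists>p\<in>clean J (f x). (x, p) \<in> A)"
proof -
  have sp: "clean J (f x) \<subseteq> space pm" if "x \<in> space N" for x
    using measurable_space[OF f that] clean_sub[of "f x"] by (simp add: space_nsp)
  have "(\<exists>p\<in>clean J (f x). (x, p) \<in> A) \<longleftrightarrow>
     (\<exists>n. emeasure (count_space UNIV) (clean J (f x) \<inter> tbox n \<inter> {p. (x, p) \<in> A}) \<noteq> 0)" if x: "x \<in> space N" for x
  proof
    assume "\<exists>p\<in>clean J (f x). (x, p) \<in> A"
    then obtain p where p: "p \<in> clean J (f x)" "(x, p) \<in> A" by blast
    obtain n :: nat where "max (fst p) (fst (snd p)) \<le> real n" using real_arch_simple by blast
    then have "p \<in> clean J (f x) \<inter> tbox n \<inter> {p. (x, p) \<in> A}" using p sp[OF x] by (auto simp: tbox_def)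
    then show "\<exists>n. emeasure (count_space UNIV) (clean J (f x) \<inter> tbox n \<inter> {p. (x, p) \<in> A}) \<noteq> 0"
      by (intro exI[of _ n]) (subst emeasure_count_space_eq_0, auto)
  next
    assume "\<exists>n. emeasure (count_space UNIV) (clean J (f x) \<inter> tbox n \<inter> {p. (x, p) \<in> A}) \<noteq> 0"
    then obtain n where "emeasure (count_space UNIV) (clean J (f x) \<inter> tbox n \<inter> {p. (x, p) \<in> A}) \<noteq> 0" ..
    then have "clean J (f x) \<inter> tbox n \<inter> {p. (x, p) \<in> A} \<noteq> {}" by (metis emeasure_empty)
    then show "\<exists>p\<in>clean J (f x). (x, p) \<in> A" by blast
  qed
  moreover have "Measurable.pred N (\<lambda>x. \<exists>n. emeasure (count_space UNIV) (clean J (f x) \<inter> tbox n \<inter> {p. (x, p) \<in> A}) \<noteq> 0)"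
    using section_measurable[OF f A] by measurable
  ultimately show ?thesis by (simp cong: measurable_cong)
qed

text \<open>The finite sum is regrouped by jump size, which expresses it through the counts of
  \<open>section_measurable\<close>. Only finitely many sizes occur, so the partial sums become
  stationary; the floor at the end returns from real to integer values.\<close>

lemma section_sum_measurable:
  assumes f: "f \<in> measurable N (nsp pm)" and A: "A \<in> sets (N \<Otimes>\<^sub>M pm)"
  shows "(\<lambda>x. \<Sum>p\<in>clean J (f x) \<inter> tbox n \<inter> {p. (x, p) \<in> A}. snd (snd p)) \<in> measurable N (count_space UNIV)"
proof -
  let ?S = "\<lambda>x. clean J (f x) \<inter> tbox n \<inter> {p. (x, p) \<in> A}"
  have fin: "finite (?S x)" for x using clean_box_finite by (rule finite_subset[rotated]) auto
  have card: "(\<lambda>x. real (card (?S x \<inter> {p. snd (snd p) = j}))) \<in> borel_measurable N" for j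
  proof -
    have [measurable]: "A \<in> sets (N \<Otimes>\<^sub>M pm)" by fact
    let ?A = "A \<inter> {z \<in> space (N \<Otimes>\<^sub>M pm). snd (snd (snd z)) = j}"
    have [measurable]: "(\<lambda>z. snd (snd (snd z))) \<in> measurable (N \<Otimes>\<^sub>M pm) (count_space UNIV)"
      by (rule measurable_compose[OF measurable_snd pm_snd_snd])
    have A': "?A \<in> sets (N \<Otimes>\<^sub>M pm)" by measurable
    have "real (card (?S x \<inter> {p. snd (snd p) = j})) =
        enn2real (emeasure (count_space UNIV) (clean J (f x) \<inter> tbox n \<inter> {p. (x, p) \<in> ?A}))" for x
    proof -
      have "clean J (f x) \<inter> tbox n \<inter> {p. (x, p) \<in> ?A} = ?S x \<inter> {p. snd (snd p) = j}"
        using sets.sets_into_space[OF A] by auto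
      moreover have "finite (?S x \<inter> {p. snd (snd p) = j})" using fin[of x] by blast
      ultimately show ?thesis by (simp only: enn2real_count)
    qed
    then show ?thesis using section_measurable[OF f A', of n] by simp
  qed
  have lim: "(\<lambda>k::nat. \<Sum>j\<in>{-int k..int k}. real_of_int j * real (card (?S x \<inter> {p. snd (snd p) = j})))
     \<longlonglongrightarrow> real_of_int (\<Sum>p\<in>?S x. snd (snd p))" for x
  proof (rule tendsto_eventually)
    let ?T = "(\<lambda>p. snd (snd p)) ` ?S x"
    obtain k0 :: nat where k0: "\<forall>j\<in>?T. \<bar>j\<bar> \<le> int k0"
    proof -
      have "finite (abs ` ?T)" using fin by simp
      then have "\<forall>j\<in>?T. \<bar>j\<bar> \<le> int (nat (Max (insert 0 (abs ` ?T))))" by (auto intro: Max_ge)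
      then show ?thesis using that by blast
    qed
    have "(\<Sum>j\<in>{-int k..int k}. real_of_int j * real (card (?S x \<inter> {p. snd (snd p) = j}))) = real_of_int (\<Sum>p\<in>?S x. snd (snd p))"
      if "k0 \<le> k" for k
    proof -
      have sub: "?T \<subseteq> {-int k..int k}"
      proof
        fix j assume "j \<in> ?T"
        then have "\<bar>j\<bar> \<le> int k0" using k0 by blast
        then show "j \<in> {-int k..int k}" using that by auto
      qed
      have "real_of_int (\<Sum>p\<in>?S x. snd (snd p)) = (\<Sum>p\<in>?S x. real_of_int (snd (snd p)))" by simp
      also have "\<dots> = (\<Sum>j\<in>{-int k..int k}. \<Sum>p\<in>{p \<in> ?S x. snd (snd p) = j}. real_of_int (snd (snd p)))"
        by (rule sum.group[symmetric]) (use fin sub in auto)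
      also have "\<dots> = (\<Sum>j\<in>{-int k..int k}. real_of_int j * real (card (?S x \<inter> {p. snd (snd p) = j})))"
      proof (rule sum.cong[OF refl])
        fix j
        have "{p \<in> ?S x. snd (snd p) = j} = ?S x \<inter> {p. snd (snd p) = j}" by auto
        moreover have "(\<Sum>p\<in>?S x \<inter> {p. snd (snd p) = j}. real_of_int (snd (snd p))) = (\<Sum>p\<in>?S x \<inter> {p. snd (snd p) = j}. real_of_int j)"
          by (rule sum.cong) auto
        ultimately show "(\<Sum>p\<in>{p \<in> ?S x. snd (snd p) = j}. real_of_int (snd (snd p))) =
            real_of_int j * real (card (?S x \<inter> {p. snd (snd p) = j}))" by simp
      qed
      finally show ?thesis by simp
    qed
    then show "\<forall>\<^sub>F k in sequentially. (\<Sum>j\<in>{-int k..int k}. real_of_int j * real (card (?S x \<inter> {p. snd (snd p) = j}))) =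
        real_of_int (\<Sum>p\<in>?S x. snd (snd p))"
      unfolding eventually_sequentially by blast
  qed
  have "(\<lambda>x. real_of_int (\<Sum>p\<in>?S x. snd (snd p))) \<in> borel_measurable N"
    by (rule borel_measurable_LIMSEQ_real[OF lim]) (intro borel_measurable_sum borel_measurable_times card borel_measurable_const)
  then have "(\<lambda>x. \<lfloor>real_of_int (\<Sum>p\<in>?S x. snd (snd p))\<rfloor>) \<in> measurable N (count_space UNIV)"
    by (rule measurable_compose[OF _ measurable_real_floor])
  then show ?thesis by (simp only: floor_of_int)
qed

end

subsection \<open>Laws of Poisson noise\<close>

lemma poisson_sums: "(\<lambda>k. poisson_prob \<mu> k) sums 1"
proof -
  have "(\<lambda>k. exp (- \<mu>) * (\<mu> ^ k /\<^sub>R fact k)) sums (exp (- \<mu>) * exp \<mu>)"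
    by (intro sums_mult exp_converges)
  then show ?thesis by (simp add: poisson_prob_def exp_minus divide_inverse mult_ac)
qed

lemma poisson_nonneg: "0 \<le> \<mu> \<Longrightarrow> 0 \<le> poisson_prob \<mu> k"
  by (simp add: poisson_prob_def)

context jump_model begin

abbreviation npm :: "(nat \<Rightarrow> pt set) measure" where
  "npm \<equiv> PiM UNIV (\<lambda>_. nsp pm)"

abbreviation prm :: "'w measure \<Rightarrow> 'w set set \<Rightarrow> ('w \<Rightarrow> nat set) \<Rightarrow> ('w \<Rightarrow> nat \<Rightarrow> pt set) \<Rightarrow> bool" where
  "prm M F0 V N \<equiv> cond_iid_PRM M F0 V N J \<sigma>"

lemma space_npm: "space npm = {\<eta>. \<forall>v. \<eta> v \<subseteq> space pm}"
  by (auto simp: space_PiM space_nsp)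

lemma cnt_component: "B \<in> sets pm \<Longrightarrow> (\<lambda>\<eta>. cnt (\<eta> v) B) \<in> measurable npm (count_space UNIV)"
  by (rule measurable_compose[OF measurable_component_singleton[of v UNIV "\<lambda>_. nsp pm", OF UNIV_I] cnt_measurable[OF sf_pm]])

lemma prm_sets: "prm M F0 V N \<Longrightarrow> B \<in> sets pm \<Longrightarrow> {\<omega> \<in> space M. v \<in> V \<omega> \<and> cnt (N \<omega> v) B = k} \<in> sets M"
  by (simp add: cond_iid_PRM_def)

lemma prm_space: "prm M F0 V N \<Longrightarrow> \<omega> \<in> space M \<Longrightarrow> v \<in> V \<omega> \<Longrightarrow> N \<omega> v \<subseteq> space pm"
  by (auto simp: cond_iid_PRM_def space_pm)

lemma prm_prob:
  fixes m :: nat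
  assumes "prm M F0 V N" "E \<in> F0" "finite F" "E \<subseteq> {\<omega>. F \<subseteq> V \<omega>}"
    "\<And>i. i < m \<Longrightarrow> B i \<in> sets pm" "\<And>i. i < m \<Longrightarrow> emeasure pm (B i) < \<infinity>" "disjoint_family_on B {..<m}"
  shows "measure M (E \<inter> (\<Inter>v\<in>F. \<Inter>i\<in>{..<m}. {\<omega>. cnt (N \<omega> v) (B i) = enat (k v i)})) =
    measure M E * (\<Prod>v\<in>F. \<Prod>i<m. poisson_prob (measure pm (B i)) (k v i))"
  by (rule assms(1)[unfolded cond_iid_PRM_def, THEN conjunct2, THEN conjunct2, THEN bspec[OF _ assms(2)],
      THEN spec[of _ F], THEN spec[of _ m], THEN spec[of _ B], THEN spec[of _ k], THEN mp]) (use assms in simp)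

lemma prm_single:
  assumes "prm M F0 V N" "E \<in> F0" "E \<subseteq> {\<omega>. v \<in> V \<omega>}" "B \<in> sets pm" "emeasure pm B < \<infinity>"
  shows "measure M (E \<inter> {\<omega>. cnt (N \<omega> v) B = enat k}) = measure M E * poisson_prob (measure pm B) k"
  using prm_prob[OF assms(1,2), of "{v}" "Suc 0" "\<lambda>_. B" "\<lambda>_ _. k"] assms
  by (simp add: lessThan_Suc disjoint_family_on_def)

text \<open>\<open>cond_iid_PRM\<close> prescribes the probabilities of finite counts only. They sum
  to 1, which leaves no mass for an infinite count.\<close>

lemma prm_finite:
  assumes M: "prob_space M" and p: "prm M F0 V N" and E: "E \<in> F0" "E \<in> sets M" "E \<subseteq> {\<omega>. v \<in> V \<omega>}"
    and B: "B \<in> sets pm" "emeasure pm B < \<infinity>"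
  shows "AE \<omega> in M. \<omega> \<in> E \<longrightarrow> cnt (N \<omega> v) B \<noteq> \<infinity>"
proof -
  interpret prob_space M by fact
  let ?X = "\<lambda>k. E \<inter> {\<omega>. cnt (N \<omega> v) B = k}"
  have X: "?X k \<in> sets M" for k
  proof -
    have "?X k = E \<inter> {\<omega> \<in> space M. v \<in> V \<omega> \<and> cnt (N \<omega> v) B = k}" using E sets.sets_into_space[OF E(2)] by auto
    then show ?thesis using prm_sets[OF p B(1)] E by simp
  qed
  have "(\<lambda>k::nat. prob (?X (enat k))) sums prob (\<Union>k::nat. ?X (enat k))"
    by (intro finite_measure_UNION) (auto simp: disjoint_family_on_def X)
  moreover have "(\<lambda>k::nat. prob (?X (enat k))) sums (prob E * 1)"
    unfolding prm_single[OF p E(1,3) B] by (intro sums_mult poisson_sums)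
  ultimately have eq: "prob (\<Union>k::nat. ?X (enat k)) = prob E" using sums_unique2 by fastforce
  have E': "?X \<infinity> = E - (\<Union>k::nat. ?X (enat k))" by auto
  have UNm: "(\<Union>k::nat. ?X (enat k)) \<in> events" using X by blast
  have "prob (?X \<infinity>) = prob E - prob (\<Union>k::nat. ?X (enat k))"
    unfolding E' by (rule finite_measure_Diff[OF E(2) UNm]) blast
  then have "?X \<infinity> \<in> null_sets M" using eq X by (intro null_setsI) (auto simp: emeasure_eq_measure)
  then have "AE \<omega> in M. \<omega> \<notin> ?X \<infinity>" by (rule AE_not_in)
  then show ?thesis by eventually_elim auto
qed

lemma prm_measurable:
  assumes p: "prm M F0 (\<lambda>_. UNIV) N"
  shows "N \<in> measurable M npm"
proof -
  have "(\<lambda>\<omega> v. N \<omega> v) \<in> measurable M npm"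
  proof (rule measurable_PiM_single')
    show "(\<lambda>\<omega>. N \<omega> v) \<in> measurable M (nsp pm)" for v
      using prm_sets[OF p] prm_space[OF p] by (intro measurable_nspI) auto
    show "(\<lambda>\<omega> v. N \<omega> v) \<in> space M \<rightarrow> (\<Pi>\<^sub>E i\<in>UNIV. space (nsp pm))"
      using prm_space[OF p] by (auto simp: space_nsp)
  qed
  then show ?thesis by simp
qed

definition tup :: "nat set \<Rightarrow> nat \<Rightarrow> (nat \<Rightarrow> pt set) \<Rightarrow> (nat \<Rightarrow> pt set) \<Rightarrow> nat \<times> nat \<Rightarrow> enat" where
  "tup F m B S = (\<lambda>(v, i)\<in>F \<times> {..<m}. cnt (S v) (B i))"

text \<open>Almost surely the tuple of counts has finite entries, so it takes countably many values,
  whose probabilities are prescribed. Apart from \<open>emeasure M E\<close> the right-hand side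
  involves neither the space nor the noise; this identifies laws in \<open>prm_law\<close>.\<close>

lemma prm_tup:
  assumes M: "prob_space M" and p: "prm M F0 (\<lambda>_. UNIV) N" and E: "E \<in> F0" "E \<in> sets M" and F: "finite F"
    and B: "\<And>i. i < m \<Longrightarrow> B i \<in> sets pm" "\<And>i. i < m \<Longrightarrow> emeasure pm (B i) < \<infinity>" "disjoint_family_on B {..<m}"
  shows "emeasure M (E \<inter> {\<omega> \<in> space M. tup F m B (N \<omega>) \<in> Z}) = emeasure M E *
    (\<integral>\<^sup>+\<kappa>. ennreal (\<Prod>v\<in>F. \<Prod>i<m. poisson_prob (measure pm (B i)) (\<kappa> (v, i)))
      \<partial>count_space {\<kappa> \<in> (F \<times> {..<m}) \<rightarrow>\<^sub>E (UNIV :: nat set). (\<lambda>d\<in>F \<times> {..<m}. enat (\<kappa> d)) \<in> Z})"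
proof -
  interpret prob_space M by fact
  let ?D = "F \<times> {..<m}"
  let ?K = "{\<kappa> \<in> ?D \<rightarrow>\<^sub>E (UNIV :: nat set). (\<lambda>d\<in>?D. enat (\<kappa> d)) \<in> Z}"
  have "countable (?D \<rightarrow>\<^sub>E (UNIV :: nat set))" using F by (intro countable_PiE) auto
  then have cK: "countable ?K" by (rule countable_subset[rotated]) auto
  define X where "X \<kappa> = E \<inter> (\<Inter>v\<in>F. \<Inter>i\<in>{..<m}. {\<omega>. cnt (N \<omega> v) (B i) = enat (\<kappa> (v, i))})" for \<kappa>
  have Xeq: "X \<kappa> = {\<omega> \<in> space M. \<omega> \<in> E \<and> (\<forall>v\<in>F. \<forall>i\<in>{..<m}. cnt (N \<omega> v) (B i) = enat (\<kappa> (v, i)))}" for \<kappa>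
    using sets.sets_into_space[OF E(2)] by (auto simp: X_def)
  have cm: "(\<lambda>\<omega>. cnt (N \<omega> v) (B i)) \<in> measurable M (count_space UNIV)" if "i < m" for v i
    by (rule measurable_compose[OF prm_measurable[OF p] cnt_component[OF B(1)[OF that]]])
  have Xm: "X \<kappa> \<in> sets M" for \<kappa>
  proof -
    have "Measurable.pred M (\<lambda>\<omega>. \<forall>v\<in>F. \<forall>i\<in>{..<m}. cnt (N \<omega> v) (B i) = enat (\<kappa> (v, i)))"
    proof (intro pred_intros_finite F)
      fix v i assume "i \<in> {..<m}"
      then have [measurable]: "(\<lambda>\<omega>. cnt (N \<omega> v) (B i)) \<in> measurable M (count_space UNIV)" using cm by simp
      show "Measurable.pred M (\<lambda>\<omega>. cnt (N \<omega> v) (B i) = enat (\<kappa> (v, i)))" by measurable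
    qed simp
    then show ?thesis unfolding Xeq using E(2) by measurable
  qed
  have XZ: "tup F m B (N \<omega>) = (\<lambda>d\<in>?D. enat (\<kappa> d))" if "\<omega> \<in> X \<kappa>" for \<omega> \<kappa>
    using that by (auto simp: X_def tup_def fun_eq_iff)
  have fin: "AE \<omega> in M. \<omega> \<in> E \<longrightarrow> (\<forall>v\<in>F. \<forall>i\<in>{..<m}. cnt (N \<omega> v) (B i) \<noteq> \<infinity>)"
  proof -
    have "AE \<omega> in M. \<forall>v\<in>F. \<forall>i\<in>{..<m}. \<omega> \<in> E \<longrightarrow> cnt (N \<omega> v) (B i) \<noteq> \<infinity>"
      using F B by (intro AE_finite_allI prm_finite[OF M p E]) auto
    then show ?thesis by eventually_elim blast
  qed
  have AEeq: "AE \<omega> in M. \<omega> \<in> E \<inter> {\<omega> \<in> space M. tup F m B (N \<omega>) \<in> Z} \<longleftrightarrow> \<omega> \<in> (\<Union>\<kappa>\<in>?K. X \<kappa>)"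
    using fin AE_space
  proof eventually_elim
    case (elim \<omega>)
    show ?case
    proof
      assume a: "\<omega> \<in> E \<inter> {\<omega> \<in> space M. tup F m B (N \<omega>) \<in> Z}"
      define \<kappa> where "\<kappa> = (\<lambda>(v, i)\<in>?D. the_enat (cnt (N \<omega> v) (B i)))"
      have "n = enat (the_enat n)" if "n \<noteq> \<infinity>" for n using that by (cases n) auto
      then have "\<omega> \<in> X \<kappa>" using a elim by (auto simp: X_def \<kappa>_def simp del: not_infinity_eq)
      moreover from this have "\<kappa> \<in> ?K" using XZ[of \<omega> \<kappa>] a by (auto simp: \<kappa>_def)
      ultimately show "\<omega> \<in> (\<Union>\<kappa>\<in>?K. X \<kappa>)" by blast
    next
      assume "\<omega> \<in> (\<Union>\<kappa>\<in>?K. X \<kappa>)"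
      then obtain \<kappa> where "\<kappa> \<in> ?K" "\<omega> \<in> X \<kappa>" by blast
      then show "\<omega> \<in> E \<inter> {\<omega> \<in> space M. tup F m B (N \<omega>) \<in> Z}" using XZ[of \<omega> \<kappa>] elim by (auto simp: X_def)
    qed
  qed
  have tm: "{\<omega> \<in> space M. tup F m B (N \<omega>) \<in> Z} \<in> sets M"
  proof -
    have cD: "countable (?D \<rightarrow>\<^sub>E (UNIV :: enat set))" using F by (intro countable_PiE) auto
    have "(\<lambda>\<omega>. tup F m B (N \<omega>)) \<in> measurable M (count_space (?D \<rightarrow>\<^sub>E (UNIV :: enat set)))"
      unfolding measurable_count_space_eq_countable[OF cD]
    proof (intro conjI ballI)
      fix \<kappa> assume k: "\<kappa> \<in> ?D \<rightarrow>\<^sub>E (UNIV :: enat set)"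
      have "(\<lambda>\<omega>. tup F m B (N \<omega>)) -` {\<kappa>} \<inter> space M =
          {\<omega> \<in> space M. \<forall>v\<in>F. \<forall>i\<in>{..<m}. cnt (N \<omega> v) (B i) = \<kappa> (v, i)}"
        using k by (auto simp: tup_def fun_eq_iff PiE_def extensional_def)
      moreover have "Measurable.pred M (\<lambda>\<omega>. \<forall>v\<in>F. \<forall>i\<in>{..<m}. cnt (N \<omega> v) (B i) = \<kappa> (v, i))"
      proof (intro pred_intros_finite F)
        fix v i assume "i \<in> {..<m}"
        then have [measurable]: "(\<lambda>\<omega>. cnt (N \<omega> v) (B i)) \<in> measurable M (count_space UNIV)" using cm by simp
        show "Measurable.pred M (\<lambda>\<omega>. cnt (N \<omega> v) (B i) = \<kappa> (v, i))" by measurable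
      qed simp
      ultimately show "(\<lambda>\<omega>. tup F m B (N \<omega>)) -` {\<kappa>} \<inter> space M \<in> sets M" by (simp add: pred_def)
    qed (auto simp: tup_def)
    from measurable_sets[OF this, of "Z \<inter> (?D \<rightarrow>\<^sub>E UNIV)"]
    have "(\<lambda>\<omega>. tup F m B (N \<omega>)) -` (Z \<inter> (?D \<rightarrow>\<^sub>E UNIV)) \<inter> space M \<in> sets M" by simp
    also have "(\<lambda>\<omega>. tup F m B (N \<omega>)) -` (Z \<inter> (?D \<rightarrow>\<^sub>E UNIV)) \<inter> space M = {\<omega> \<in> space M. tup F m B (N \<omega>) \<in> Z}"
      by (auto simp: tup_def)
    finally show ?thesis .
  qed
  have "emeasure M (E \<inter> {\<omega> \<in> space M. tup F m B (N \<omega>) \<in> Z}) = emeasure M (\<Union>\<kappa>\<in>?K. X \<kappa>)"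
    by (rule emeasure_eq_AE[OF AEeq]) (use tm E Xm cK in auto)
  also have "\<dots> = (\<integral>\<^sup>+\<kappa>. emeasure M (X \<kappa>) \<partial>count_space ?K)"
  proof (rule emeasure_UN_countable[OF Xm cK])
    show "disjoint_family_on X ?K"
    proof (unfold disjoint_family_on_def, intro ballI impI)
      fix \<kappa> \<kappa>' assume k: "\<kappa> \<in> ?K" "\<kappa>' \<in> ?K" "\<kappa> \<noteq> \<kappa>'"
      show "X \<kappa> \<inter> X \<kappa>' = {}"
      proof (rule ccontr)
        assume "X \<kappa> \<inter> X \<kappa>' \<noteq> {}"
        then obtain \<omega> where "\<omega> \<in> X \<kappa>" "\<omega> \<in> X \<kappa>'" by blast
        then have "\<kappa> d = \<kappa>' d" if "d \<in> ?D" for d using that by (auto simp: X_def)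
        then have "\<kappa> = \<kappa>'" using k by (intro PiE_ext[of \<kappa> ?D "\<lambda>_. UNIV" \<kappa>']) auto
        then show False using k by simp
      qed
    qed
  qed
  also have "\<dots> = (\<integral>\<^sup>+\<kappa>. emeasure M E * ennreal (\<Prod>v\<in>F. \<Prod>i<m. poisson_prob (measure pm (B i)) (\<kappa> (v, i))) \<partial>count_space ?K)"
  proof (rule nn_integral_cong)
    fix \<kappa>
    have "measure M (X \<kappa>) = measure M E * (\<Prod>v\<in>F. \<Prod>i<m. poisson_prob (measure pm (B i)) (\<kappa> (v, i)))"
      unfolding X_def by (rule prm_prob[OF p E(1) F _ B]) auto
    then show "emeasure M (X \<kappa>) = emeasure M E * ennreal (\<Prod>v\<in>F. \<Prod>i<m. poisson_prob (measure pm (B i)) (\<kappa> (v, i)))"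
      by (simp add: emeasure_eq_measure ennreal_mult' )
  qed
  also have "\<dots> = emeasure M E * (\<integral>\<^sup>+\<kappa>. ennreal (\<Prod>v\<in>F. \<Prod>i<m. poisson_prob (measure pm (B i)) (\<kappa> (v, i))) \<partial>count_space ?K)"
    by (rule nn_integral_cmult) simp
  finally show ?thesis .
qed

text \<open>The sets \<open>B i\<close> may overlap, which makes the class stable under
  intersection; \<open>atoms\<close> later cuts them into disjoint pieces.\<close>

definition cylinders :: "(nat \<Rightarrow> pt set) set set" where
  "cylinders = {{\<eta> \<in> space npm. \<forall>v\<in>F. \<forall>i<m. cnt (\<eta> v) (B i) \<in> K v i} | (F :: nat set) (m :: nat) B K.
     finite F \<and> (\<forall>i<m. B i \<in> sets pm \<and> emeasure pm (B i) < \<infinity>)}"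

lemma cylindersI: "finite F \<Longrightarrow> (\<And>i. i < m \<Longrightarrow> B i \<in> sets pm) \<Longrightarrow> (\<And>i. i < m \<Longrightarrow> emeasure pm (B i) < \<infinity>) \<Longrightarrow>
   {\<eta> \<in> space npm. \<forall>v\<in>F. \<forall>i<(m::nat). cnt (\<eta> v) (B i) \<in> K v i} \<in> cylinders"
  unfolding cylinders_def by blast

lemma cylinders_Int_stable: "Int_stable cylinders"
proof (rule Int_stableI)
  fix X Y assume "X \<in> cylinders" "Y \<in> cylinders"
  then obtain F m B K F' m' B' K' where
    X: "X = {\<eta> \<in> space npm. \<forall>v\<in>F. \<forall>i<(m::nat). cnt (\<eta> v) (B i) \<in> K v i}" "finite F" "\<And>i. i < m \<Longrightarrow> B i \<in> sets pm \<and> emeasure pm (B i) < \<infinity>"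
    and Y: "Y = {\<eta> \<in> space npm. \<forall>v\<in>F'. \<forall>i<(m'::nat). cnt (\<eta> v) (B' i) \<in> K' v i}" "finite F'" "\<And>i. i < m' \<Longrightarrow> B' i \<in> sets pm \<and> emeasure pm (B' i) < \<infinity>"
    unfolding cylinders_def by blast
  define C where "C i = (if i < m then B i else B' (i - m))" for i
  define L where "L v i = (if i < m then (if v \<in> F then K v i else UNIV) else (if v \<in> F' then K' v (i - m) else UNIV))" for v i
  have "X \<inter> Y = {\<eta> \<in> space npm. \<forall>v\<in>F \<union> F'. \<forall>i<m + m'. cnt (\<eta> v) (C i) \<in> L v i}" (is "_ = ?R")
  proof (intro equalityI subsetI)
    fix \<eta> assume "\<eta> \<in> X \<inter> Y"
    then show "\<eta> \<in> ?R" unfolding X Y by (auto simp: C_def L_def)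
  next
    fix \<eta> assume r: "\<eta> \<in> ?R"
    have "cnt (\<eta> v) (B i) \<in> K v i" if "v \<in> F" "i < m" for v i
    proof -
      have "cnt (\<eta> v) (C i) \<in> L v i" using r that by simp
      then show ?thesis using that by (simp add: C_def L_def)
    qed
    moreover have "cnt (\<eta> v) (B' i) \<in> K' v i" if "v \<in> F'" "i < m'" for v i
    proof -
      have "cnt (\<eta> v) (C (m + i)) \<in> L v (m + i)" using r that by simp
      then show ?thesis using that by (simp add: C_def L_def)
    qed
    ultimately show "\<eta> \<in> X \<inter> Y" using r unfolding X Y by blast
  qed
  moreover have "\<dots> \<in> cylinders"
  proof (rule cylindersI)
    fix i assume "i < m + m'"
    then show "C i \<in> sets pm" "emeasure pm (C i) < \<infinity>" using X(3)[of i] Y(3)[of "i - m"] by (auto simp: C_def)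
  qed (use X Y in simp)
  ultimately show "X \<inter> Y \<in> cylinders" by simp
qed

lemma sets_npm_cylinders: "sets npm = sigma_sets (space npm) cylinders"
proof (rule antisym)
  have sub: "cylinders \<subseteq> sets npm"
  proof
    fix X assume "X \<in> cylinders"
    then obtain F m B K where X: "X = {\<eta> \<in> space npm. \<forall>v\<in>F. \<forall>i<(m::nat). cnt (\<eta> v) (B i) \<in> K v i}"
      "finite F" "\<And>i. i < m \<Longrightarrow> B i \<in> sets pm" unfolding cylinders_def by blast
    have "Measurable.pred npm (\<lambda>\<eta>. \<forall>v\<in>F. \<forall>i\<in>{..<m}. cnt (\<eta> v) (B i) \<in> K v i)"
    proof (intro pred_intros_finite X(2))
      fix v i assume "i \<in> {..<m}"
      then have "(\<lambda>\<eta>. cnt (\<eta> v) (B i)) \<in> measurable npm (count_space UNIV)"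
        by (intro cnt_component X) auto
      then show "Measurable.pred npm (\<lambda>\<eta>. cnt (\<eta> v) (B i) \<in> K v i)" by measurable
    qed simp
    moreover have "X = {\<eta> \<in> space npm. \<forall>v\<in>F. \<forall>i\<in>{..<m}. cnt (\<eta> v) (B i) \<in> K v i}" unfolding X(1) by auto
    ultimately show "X \<in> sets npm" by (simp only: pred_def)
  qed
  show "sigma_sets (space npm) cylinders \<subseteq> sets npm" by (rule sets.sigma_sets_subset[OF sub])
  let ?N = "sigma (space npm) cylinders"
  have sp: "cylinders \<subseteq> Pow (space npm)" unfolding cylinders_def by blast
  have "(\<lambda>\<eta> v. \<eta> v) \<in> measurable ?N npm"
  proof (rule measurable_PiM_single')
    fix v :: nat
    show "(\<lambda>\<eta>. \<eta> v) \<in> measurable ?N (nsp pm)"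
    proof (rule measurable_nspI)
      fix \<eta> assume "\<eta> \<in> space ?N" then show "\<eta> v \<subseteq> space pm" using sp by (simp add: space_npm)
    next
      fix B k assume B: "B \<in> sets pm" "emeasure pm B < \<infinity>"
      have "{\<eta> \<in> space npm. \<forall>u\<in>{v}. \<forall>i<Suc 0. cnt (\<eta> u) B \<in> {k}} \<in> cylinders" using B by (intro cylindersI) auto
      then have "{\<eta> \<in> space npm. cnt (\<eta> v) B = k} \<in> cylinders" by simp
      then show "{\<eta> \<in> space ?N. cnt (\<eta> v) B = k} \<in> sets ?N" using sp by (simp add: sigma_sets.Basic)
    qed
  next
    show "(\<lambda>\<eta> v. \<eta> v) \<in> space ?N \<rightarrow> (\<Pi>\<^sub>E i\<in>UNIV. space (nsp pm))" using sp by (auto simp: space_npm space_nsp)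
  qed
  then show "sets npm \<subseteq> sigma_sets (space npm) cylinders"
    using measurable_sets[of "\<lambda>\<eta>. \<eta>" ?N npm] sp sets.sets_into_space[of _ npm] by (force simp: Int_absorb2)
qed

text \<open>The atoms are the regions of the Venn diagram of the \<open>B i\<close>: a point belongs
  to the atom of the set of indices \<open>i\<close> with the point in \<open>B i\<close>.\<close>

lemma atoms:
  fixes B :: "nat \<Rightarrow> pt set"
  assumes B: "\<And>i. i < m \<Longrightarrow> B i \<in> sets pm" "\<And>i. i < m \<Longrightarrow> emeasure pm (B i) < \<infinity>"
  shows "\<exists>(n::nat) At b. (\<forall>l<n. At l \<in> sets pm \<and> emeasure pm (At l) < \<infinity>) \<and> disjoint_family_on At {..<n} \<and>
    (\<forall>i<m. b i \<subseteq> {..<n} \<and> B i = (\<Union>l\<in>b i. At l))"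
proof -
  obtain h where h: "bij_betw h {0..<card (Pow {..<m})} (Pow {..<m})" using ex_bij_betw_nat_finite[of "Pow {..<m}"] by auto
  let ?n = "card (Pow {..<m})"
  \<comment> \<open>The region outside all \<open>B i\<close> may have infinite intensity and is
    replaced by the empty set.\<close>
  define At where "At l = (if h l = {} then {} else (\<Inter>i\<in>h l. B i) - (\<Union>i\<in>{..<m} - h l. B i))" for l
  have hs: "h l \<subseteq> {..<m}" if "l < ?n" for l using h that by (auto simp: bij_betw_def)
  have "At l \<in> sets pm \<and> emeasure pm (At l) < \<infinity>" if l: "l < ?n" for l
  proof (cases "h l = {}")
    case False
    then obtain i where i: "i \<in> h l" by blast
    then have im: "i < m" using hs[OF l] by auto
    have fin: "finite (h l)" using hs[OF l] finite_subset by blast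
    have s: "At l \<in> sets pm" using False hs[OF l] fin B(1) unfolding At_def
      by (auto intro!: sets.Diff sets.finite_INT sets.finite_UN)
    have "emeasure pm (At l) \<le> emeasure pm (B i)" using i False B(1)[OF im] by (intro emeasure_mono) (auto simp: At_def)
    then show ?thesis using s B(2)[OF im] by (auto intro: le_less_trans)
  qed (simp add: At_def)
  moreover have "disjoint_family_on At {..<?n}"
  proof (unfold disjoint_family_on_def, intro ballI impI)
    fix l k assume l: "l \<in> {..<?n}" and k: "k \<in> {..<?n}" and "l \<noteq> k"
    then have ne: "h l \<noteq> h k" using h by (auto simp: bij_betw_def inj_on_def)
    have "x \<notin> At k" if x: "x \<in> At l" for x
    proof
      assume xk: "x \<in> At k"
      have "i \<in> h l \<longleftrightarrow> x \<in> B i" "i \<in> h k \<longleftrightarrow> x \<in> B i" if "i < m" for i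
        using x xk that unfolding At_def by (auto split: if_splits)
      then have "h l = h k" using hs[of l] hs[of k] l k by blast
      then show False using ne by simp
    qed
    then show "At l \<inter> At k = {}" by blast
  qed
  moreover have "B i = (\<Union>l\<in>{l. l < ?n \<and> i \<in> h l}. At l)" if i: "i < m" for i
  proof (intro equalityI subsetI)
    fix x assume x: "x \<in> B i"
    have "{i. i < m \<and> x \<in> B i} \<in> Pow {..<m}" by auto
    then obtain l where l: "l < ?n" "h l = {i. i < m \<and> x \<in> B i}" using h unfolding bij_betw_def
      by (metis (no_types, lifting) atLeastLessThan_iff imageE)
    then have "x \<in> At l" "i \<in> h l" using x i by (auto simp: At_def)
    then show "x \<in> (\<Union>l\<in>{l. l < ?n \<and> i \<in> h l}. At l)" using l by blast
  next
    fix x assume "x \<in> (\<Union>l\<in>{l. l < ?n \<and> i \<in> h l}. At l)"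
    then show "x \<in> B i" by (auto simp: At_def split: if_splits)
  qed
  ultimately show ?thesis
    by (intro exI[of _ ?n] exI[of _ At] exI[of _ "\<lambda>i. {l. l < ?n \<and> i \<in> h l}"]) auto
qed

text \<open>The law of i.i.d. Poisson noise on all labels, realised on the configurations
  themselves; the family \<open>{{}, space Q}\<close> makes the conditioning trivial.\<close>

definition canonical :: "(nat \<Rightarrow> pt set) measure \<Rightarrow> bool" where
  "canonical Q \<longleftrightarrow> prob_space Q \<and> sets Q = sets npm \<and> prm Q {{}, space Q} (\<lambda>_. UNIV) (\<lambda>\<eta>. \<eta>)"

text \<open>Both sides are finite measures in \<open>A\<close>, so they need to agree on cylinders
  only. Once its sets are cut into atoms, a cylinder is an event about a tuple of counts of disjoint
  sets, which \<open>prm_tup\<close> evaluates in the same way for \<open>N\<close> and for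
  \<open>Q\<close>.\<close>

lemma prm_law:
  assumes M: "prob_space M" and p: "prm M F0 (\<lambda>_. UNIV) N" and E: "E \<in> F0" "E \<in> sets M"
    and Q: "canonical Q" and A: "A \<in> sets npm"
  shows "emeasure M (E \<inter> {\<omega> \<in> space M. N \<omega> \<in> A}) = emeasure M E * emeasure Q A"
proof -
  interpret prob_space M by fact
  have Qp: "prob_space Q" and Qs: "sets Q = sets npm" and Qprm: "prm Q {{}, space Q} (\<lambda>_. UNIV) (\<lambda>\<eta>. \<eta>)"
    using Q by (auto simp: canonical_def)
  have Qsp: "space Q = space npm" using Qs by (rule sets_eq_imp_space_eq)
  note Nm = prm_measurable[OF p]
  let ?M1 = "distr (density M (indicator E)) npm N" and ?M2 = "scale_measure (emeasure M E) Q"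
  have Nm': "N \<in> measurable (density M (indicator E)) npm" using Nm by simp
  have e1: "emeasure ?M1 A = emeasure M (E \<inter> {\<omega> \<in> space M. N \<omega> \<in> A})" if "A \<in> sets npm" for A
  proof -
    have m: "N -` A \<inter> space M \<in> sets M" using Nm that by (rule measurable_sets)
    have "emeasure ?M1 A = emeasure (density M (indicator E)) (N -` A \<inter> space M)"
      using emeasure_distr[OF Nm' that] by simp
    also have "\<dots> = emeasure M (E \<inter> (N -` A \<inter> space M))" by (rule emeasure_restricted[OF E(2) m])
    also have "E \<inter> (N -` A \<inter> space M) = E \<inter> {\<omega> \<in> space M. N \<omega> \<in> A}" by auto
    finally show ?thesis .
  qed
  have "?M1 = ?M2"
  proof (rule measure_eqI_generator_eq[OF cylinders_Int_stable])
    show sp: "cylinders \<subseteq> Pow (space npm)" unfolding cylinders_def by blast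
    show "sets ?M1 = sigma_sets (space npm) cylinders" by (simp add: sets_npm_cylinders)
    show "sets ?M2 = sigma_sets (space npm) cylinders" by (simp add: Qs sets_npm_cylinders)
    show "range (\<lambda>_::nat. space npm) \<subseteq> cylinders"
      using cylindersI[of "{}" 0 "\<lambda>_. {}" "\<lambda>_ _. {}"] by simp
    show "(\<Union>i::nat. space npm) = space npm" by simp
    show "emeasure ?M1 (space npm) \<noteq> \<infinity>" by (subst e1) (auto simp: emeasure_eq_measure)
    fix X assume Xc: "X \<in> cylinders"
    then obtain F m B K where X: "X = {\<eta> \<in> space npm. \<forall>v\<in>F. \<forall>i<(m::nat). cnt (\<eta> v) (B i) \<in> K v i}"
      "finite F" "\<And>i. i < m \<Longrightarrow> B i \<in> sets pm" "\<And>i. i < m \<Longrightarrow> emeasure pm (B i) < \<infinity>" unfolding cylinders_def by blast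
    obtain n :: nat and At b where *: "(\<forall>l<n. At l \<in> sets pm \<and> emeasure pm (At l) < \<infinity>) \<and> disjoint_family_on At {..<n} \<and>
      (\<forall>i<m. b i \<subseteq> {..<n} \<and> B i = (\<Union>l\<in>b i. At l))"
    proof -
      have "\<exists>(n::nat) At b. (\<forall>l<n. At l \<in> sets pm \<and> emeasure pm (At l) < \<infinity>) \<and> disjoint_family_on At {..<n} \<and>
        (\<forall>i<m. b i \<subseteq> {..<n} \<and> B i = (\<Union>l\<in>b i. At l))"
        by (rule atoms) (use X(3,4) in auto)
      then show ?thesis by (elim exE) (rule that)
    qed
    have At: "\<And>l. l < n \<Longrightarrow> At l \<in> sets pm" "\<And>l. l < n \<Longrightarrow> emeasure pm (At l) < \<infinity>" "disjoint_family_on At {..<n}"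
      and b: "\<And>i. i < m \<Longrightarrow> b i \<subseteq> {..<n}" "\<And>i. i < m \<Longrightarrow> B i = (\<Union>l\<in>b i. At l)"
      using * by simp_all
    define Z where "Z = {\<kappa> :: nat \<times> nat \<Rightarrow> enat. \<forall>v\<in>F. \<forall>i<m. (\<Sum>l\<in>b i. \<kappa> (v, l)) \<in> K v i}"
    have XZ: "(\<forall>v\<in>F. \<forall>i<m. cnt (\<eta> v) (B i) \<in> K v i) \<longleftrightarrow> tup F n At \<eta> \<in> Z" for \<eta>
    proof -
      have "cnt (\<eta> v) (B i) = (\<Sum>l\<in>b i. tup F n At \<eta> (v, l))" if "v \<in> F" "i < m" for v i
      proof -
        have "cnt (\<eta> v) (B i) = (\<Sum>l\<in>b i. cnt (\<eta> v) (At l))"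
          unfolding b(2)[OF that(2)] using b(1)[OF that(2)] At(3)
          by (intro cnt_disjoint_sum) (auto intro: finite_subset disjoint_family_on_mono)
        also have "\<dots> = (\<Sum>l\<in>b i. tup F n At \<eta> (v, l))"
          using b(1)[OF that(2)] that by (intro sum.cong) (auto simp: tup_def)
        finally show ?thesis .
      qed
      then show ?thesis by (simp add: Z_def)
    qed
    have Xs: "X \<in> sets npm" using Xc by (simp add: sets_npm_cylinders sigma_sets.Basic)
    have "{\<omega> \<in> space M. N \<omega> \<in> X} = {\<omega> \<in> space M. tup F n At (N \<omega>) \<in> Z}"
      using measurable_space[OF Nm] by (auto simp: X XZ)
    moreover have "X = space Q \<inter> {\<eta> \<in> space Q. tup F n At \<eta> \<in> Z}"
      by (auto simp: X XZ Qsp)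
    moreover have "emeasure Q (space Q) = 1" using Qp by (rule prob_space.emeasure_space_1)
    ultimately show "emeasure ?M1 X = emeasure ?M2 X"
      using prm_tup[OF M p E X(2) At, of Z] prm_tup[OF Qp Qprm _ _ X(2) At, of "space Q" Z] e1[OF Xs] by simp
  qed
  then have "emeasure ?M1 A = emeasure M E * emeasure Q A" by simp
  then show ?thesis using e1[OF A] by simp
qed

text \<open>As the event in \<open>prm_law\<close> ranges over \<open>F0\<close>, that lemma says
  that the noise has law \<open>Q\<close> and is independent of \<open>F0\<close>; this is its form
  for a random variable \<open>q\<close>.\<close>

lemma prm_joint:
  assumes M: "prob_space M" and p: "prm M F0 (\<lambda>_. UNIV) N" and F0: "F0 \<subseteq> sets M" and Q: "canonical Q"
    and q: "q \<in> measurable M K" "\<And>A. A \<in> sets K \<Longrightarrow> q -` A \<inter> space M \<in> F0"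
  shows "distr M (K \<Otimes>\<^sub>M Q) (\<lambda>\<omega>. (q \<omega>, N \<omega>)) = distr M K q \<Otimes>\<^sub>M Q"
proof -
  interpret M: prob_space M by fact
  have Qp: "prob_space Q" and Qs: "sets Q = sets npm" using Q by (auto simp: canonical_def)
  interpret Q: prob_space Q by fact
  interpret D: prob_space "distr M K q" using q(1) by (rule M.prob_space_distr)
  have Nm: "N \<in> measurable M Q" using prm_measurable[OF p] measurable_cong_sets[OF refl Qs] by blast
  have pair: "(\<lambda>\<omega>. (q \<omega>, N \<omega>)) \<in> measurable M (K \<Otimes>\<^sub>M Q)" using q(1) Nm by measurable
  show ?thesis
  proof (rule pair_measure_eqI[symmetric])
    show "sigma_finite_measure (distr M K q)" by (rule D.sigma_finite_measure_axioms)
    show "sigma_finite_measure Q" by (rule Q.sigma_finite_measure_axioms)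
    show "sets (distr M K q \<Otimes>\<^sub>M Q) = sets (distr M (K \<Otimes>\<^sub>M Q) (\<lambda>\<omega>. (q \<omega>, N \<omega>)))"
      by (simp cong: sets_pair_measure_cong)
    fix A B assume A: "A \<in> sets (distr M K q)" and B: "B \<in> sets Q"
    let ?E = "q -` A \<inter> space M"
    have E: "?E \<in> F0" "?E \<in> sets M" using q(2)[of A] A F0 by auto
    have "emeasure (distr M (K \<Otimes>\<^sub>M Q) (\<lambda>\<omega>. (q \<omega>, N \<omega>))) (A \<times> B) = emeasure M (?E \<inter> {\<omega> \<in> space M. N \<omega> \<in> B})"
      using A B by (subst emeasure_distr[OF pair]) (auto intro!: arg_cong[where f="emeasure M"])
    also have "\<dots> = emeasure M ?E * emeasure Q B" using prm_law[OF M p E Q, of B] B Qs by simp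
    also have "emeasure M ?E = emeasure (distr M K q) A" using A q(1) by (simp add: emeasure_distr)
    finally show "emeasure (distr M K q) A * emeasure Q B = emeasure (distr M (K \<Otimes>\<^sub>M Q) (\<lambda>\<omega>. (q \<omega>, N \<omega>))) (A \<times> B)" by simp
  qed
qed

lemma canonical_distr:
  assumes Q: "canonical Q" and p: "prm Q {{}, space Q} (\<lambda>_. UNIV) S"
  shows "distr Q npm S = Q"
proof -
  have Qp: "prob_space Q" and Qs: "sets Q = sets npm" using Q by (auto simp: canonical_def)
  interpret prob_space Q by fact
  show ?thesis
  proof (rule measure_eqI)
    show "sets (distr Q npm S) = sets Q" by (simp add: Qs)
    fix A assume "A \<in> sets (distr Q npm S)"
    then have A: "A \<in> sets npm" by simp
    have "emeasure (distr Q npm S) A = emeasure Q (space Q \<inter> {\<omega> \<in> space Q. S \<omega> \<in> A})"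
      using emeasure_distr[OF prm_measurable[OF p] A] by (auto intro!: arg_cong[where f="emeasure Q"])
    also have "\<dots> = emeasure Q A" using prm_law[OF Qp p _ _ Q A, of "space Q"] emeasure_space_1 by simp
    finally show "emeasure (distr Q npm S) A = emeasure Q A" .
  qed
qed

text \<open>An injective relabelling merely selects distinct coordinates of an i.i.d.
  family.\<close>

lemma canonical_perm:
  assumes Q: "canonical Q" and inj: "inj \<psi>"
  shows "distr Q npm (\<lambda>\<eta> v. \<eta> (\<psi> v)) = Q"
proof (rule canonical_distr[OF Q])
  have p: "prm Q {{}, space Q} (\<lambda>_. UNIV) (\<lambda>\<eta>. \<eta>)" using Q by (auto simp: canonical_def)
  show "prm Q {{}, space Q} (\<lambda>_. UNIV) (\<lambda>\<eta> v. \<eta> (\<psi> v))"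
    unfolding cond_iid_PRM_def
  proof (intro conjI allI ballI impI, goal_cases)
    case (1 v B k)
    then show ?case using prm_sets[OF p 1, of "\<psi> v" k] by simp
  next
    case (2 \<omega> v)
    then show ?case using prm_space[OF p 2(1), of "\<psi> v"] by (simp add: space_pm)
  next
    case (3 E F m B k)
    have fin: "finite F" using 3 by simp
    have "(\<Inter>v\<in>\<psi> ` F. \<Inter>i\<in>{..<m}. {\<eta>. cnt (\<eta> v) (B i) = enat (k (inv \<psi> v) i)}) =
       (\<Inter>v\<in>F. \<Inter>i\<in>{..<m}. {\<eta>. cnt (\<eta> (\<psi> v)) (B i) = enat (k v i)})" using inj by simp
    moreover have "(\<Prod>v\<in>\<psi> ` F. \<Prod>i<m. poisson_prob (measure pm (B i)) (k (inv \<psi> v) i)) =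
       (\<Prod>v\<in>F. \<Prod>i<m. poisson_prob (measure pm (B i)) (k v i))"
      using inj by (subst prod.reindex) (auto intro: inj_on_subset)
    ultimately show ?case
      using prm_prob[OF p 3(1), of "\<psi> ` F" m B "\<lambda>v. k (inv \<psi> v)"] 3(2) fin by simp
  qed
qed

section \<open>Time shifts of the noise and finite dissociability\<close>

definition tshift :: "real \<Rightarrow> pt set \<Rightarrow> pt set" where
  "tshift a S = {q \<in> space pm. (fst q + a, snd q) \<in> S}"

definition unshift :: "real \<Rightarrow> pt set \<Rightarrow> pt set" where
  "unshift a B = {p \<in> space pm. a \<le> fst p \<and> (fst p - a, snd p) \<in> B}"

lemma unshift_sets:
  assumes a: "0 \<le> a" and B: "B \<in> sets pm" shows "unshift a B \<in> sets pm"
proof -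
  let ?A = "{p \<in> space pm. a \<le> fst p}"
  let ?R = "restrict_space pm ?A"
  have A: "?A \<in> sets pm" by measurable
  have "(\<lambda>p. (fst p - a, snd p)) \<in> measurable ?R pm"
    unfolding pm_eq
  proof (rule measurable_Pair)
    have 1: "(\<lambda>p. fst p - a) \<in> measurable pm borel" by measurable
    show "(\<lambda>p. fst p - a) \<in> measurable (restrict_space (half \<Otimes>\<^sub>M half \<Otimes>\<^sub>M jm) {p \<in> space (half \<Otimes>\<^sub>M half \<Otimes>\<^sub>M jm). a \<le> fst p}) half"
      using measurable_restrict_space1[OF 1, of ?A] unfolding pm_eq
      by (intro measurable_restrict_space2) (auto simp: space_restrict_space)
    have 2: "snd \<in> measurable pm (half \<Otimes>\<^sub>M jm)" unfolding pm_eq by (rule measurable_snd)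
    show "snd \<in> measurable (restrict_space (half \<Otimes>\<^sub>M half \<Otimes>\<^sub>M jm) {p \<in> space (half \<Otimes>\<^sub>M half \<Otimes>\<^sub>M jm). a \<le> fst p}) (half \<Otimes>\<^sub>M jm)"
      using measurable_restrict_space1[OF 2, of ?A] unfolding pm_eq .
  qed
  from measurable_sets[OF this B]
  have "(\<lambda>p. (fst p - a, snd p)) -` B \<inter> space ?R \<in> sets ?R" .
  moreover have "(\<lambda>p. (fst p - a, snd p)) -` B \<inter> space ?R = unshift a B"
    by (auto simp: unshift_def space_restrict_space)
  ultimately show ?thesis using A by (simp add: sets_restrict_space_iff)
qed

text \<open>Fubini reduces this to translation invariance of Lebesgue measure in the time
  coordinate.\<close>

lemma emeasure_unshift:
  assumes a: "0 \<le> a" and B: "B \<in> sets pm" shows "emeasure pm (unshift a B) = emeasure pm B"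
proof -
  interpret hj: sigma_finite_measure "half \<Otimes>\<^sub>M jm" by (rule sf_half_jm)
  let ?g = "\<lambda>x. emeasure (half \<Otimes>\<^sub>M jm) (Pair x -` B)"
  have Bs: "B \<in> sets (half \<Otimes>\<^sub>M (half \<Otimes>\<^sub>M jm))" and Us: "unshift a B \<in> sets (half \<Otimes>\<^sub>M (half \<Otimes>\<^sub>M jm))"
    using B unshift_sets[OF a B] by (simp_all add: pm_eq)
  have gm: "(\<lambda>x. ?g x * indicator {0..} x) \<in> borel_measurable borel"
    using hj.measurable_emeasure_Pair[OF Bs] by (subst (asm) borel_measurable_restrict_space_iff_ennreal) auto
  have sec: "Pair x -` unshift a B = (if a \<le> x then Pair (x - a) -` B else {})" if "0 \<le> x" for x
    using that a sets.sets_into_space[OF B] by (auto simp: unshift_def space_pm)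
  have "emeasure pm (unshift a B) = (\<integral>\<^sup>+x. emeasure (half \<Otimes>\<^sub>M jm) (Pair x -` unshift a B) \<partial>half)"
    unfolding pm_eq by (rule hj.emeasure_pair_measure_alt[OF Us])
  also have "\<dots> = (\<integral>\<^sup>+x. emeasure (half \<Otimes>\<^sub>M jm) (Pair x -` unshift a B) * indicator {0..} x \<partial>lborel)"
    by (subst nn_integral_restrict_space) auto
  also have "\<dots> = (\<integral>\<^sup>+x. ?g (-a + 1 * x) * indicator {0..} (-a + 1 * x) \<partial>lborel)"
    using a by (intro nn_integral_cong) (auto simp: sec indicator_def)
  also have "\<dots> = (\<integral>\<^sup>+x. ?g x * indicator {0..} x \<partial>lborel)"
    using nn_integral_real_affine[OF gm, of 1 "-a"] by simp
  also have "\<dots> = (\<integral>\<^sup>+x. ?g x \<partial>half)"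
    by (subst nn_integral_restrict_space) auto
  also have "\<dots> = emeasure pm B"
    unfolding pm_eq by (rule hj.emeasure_pair_measure_alt[OF Bs, symmetric])
  finally show ?thesis .
qed

lemma cnt_tshift:
  assumes a: "0 \<le> a" and S: "S \<subseteq> space pm" and B: "B \<subseteq> space pm"
  shows "cnt (tshift a S) B = cnt S (unshift a B)"
proof -
  let ?f = "\<lambda>q :: pt. (fst q + a, snd q)"
  have inj: "inj ?f" by (auto simp: inj_def prod_eq_iff)
  have "?f ` (tshift a S \<inter> B) = S \<inter> unshift a B"
  proof (intro equalityI subsetI)
    fix p assume "p \<in> ?f ` (tshift a S \<inter> B)"
    then show "p \<in> S \<inter> unshift a B" using S B a by (auto simp: tshift_def unshift_def space_pm)
  next
    fix p assume p: "p \<in> S \<inter> unshift a B"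
    then have "p = ?f (fst p - a, snd p)" "(fst p - a, snd p) \<in> tshift a S \<inter> B"
      using B by (auto simp: tshift_def unshift_def)
    then show "p \<in> ?f ` (tshift a S \<inter> B)" by blast
  qed
  note im = this
  have io: "inj_on ?f (tshift a S \<inter> B)" by (rule inj_on_subset[OF inj subset_UNIV])
  have "finite (S \<inter> unshift a B) \<longleftrightarrow> finite (tshift a S \<inter> B)" unfolding im[symmetric] by (rule finite_image_iff[OF io])
  moreover have "card (S \<inter> unshift a B) = card (tshift a S \<inter> B)" unfolding im[symmetric] by (rule card_image[OF io])
  ultimately show ?thesis by (simp add: cnt_def)
qed

text \<open>The count of \<open>B\<close> in a shifted configuration is the count of
  \<open>unshift a B\<close> in the original one; \<open>unshift a\<close> preserves intensity and
  disjointness, so the Poisson law is unchanged.\<close>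

lemma canonical_shift:
  assumes Q: "canonical Q" and a: "0 \<le> a"
  shows "prm Q {{}, space Q} (\<lambda>_. UNIV) (\<lambda>\<eta> v. tshift a (\<eta> v))"
proof -
  have p: "prm Q {{}, space Q} (\<lambda>_. UNIV) (\<lambda>\<eta>. \<eta>)" using Q by (auto simp: canonical_def)
  have sp: "\<eta> v \<subseteq> space pm" if "\<eta> \<in> space Q" for \<eta> v using prm_space[OF p that] by simp
  have c: "cnt (tshift a (\<eta> v)) B = cnt (\<eta> v) (unshift a B)" if "\<eta> \<in> space Q" "B \<in> sets pm" for \<eta> v B
    using sp[OF that(1)] sets.sets_into_space[OF that(2)] by (intro cnt_tshift a)
  show "prm Q {{}, space Q} (\<lambda>_. UNIV) (\<lambda>\<eta> v. tshift a (\<eta> v))"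
    unfolding cond_iid_PRM_def
  proof (intro conjI allI ballI impI, goal_cases)
    case (1 v B k)
    have "{\<omega> \<in> space Q. v \<in> UNIV \<and> cnt (tshift a (\<omega> v)) B = k} = {\<omega> \<in> space Q. v \<in> UNIV \<and> cnt (\<omega> v) (unshift a B) = k}"
      using c[OF _ 1] by auto
    then show ?case using prm_sets[OF p unshift_sets[OF a 1], of v k] by simp
  next
    case (2 \<omega> v)
    then show ?case by (auto simp: tshift_def space_pm)
  next
    case (3 E F m B k)
    have eq: "E \<inter> (\<Inter>v\<in>F. \<Inter>i\<in>{..<m}. {\<eta>. cnt (tshift a (\<eta> v)) (B i) = enat (k v i)}) =
        E \<inter> (\<Inter>v\<in>F. \<Inter>i\<in>{..<m}. {\<eta>. cnt (\<eta> v) (unshift a (B i)) = enat (k v i)})"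
      using 3 c by auto
    have me: "measure pm (unshift a (B i)) = measure pm (B i)" if "i < m" for i
      using emeasure_unshift[OF a, of "B i"] 3(2) that by (simp add: measure_def)
    have "disjoint_family_on (\<lambda>i. unshift a (B i)) {..<m}"
      using 3(2) by (auto simp: disjoint_family_on_def unshift_def)
    then have "measure Q (E \<inter> (\<Inter>v\<in>F. \<Inter>i\<in>{..<m}. {\<eta>. cnt (\<eta> v) (unshift a (B i)) = enat (k v i)})) =
       measure Q E * (\<Prod>v\<in>F. \<Prod>i<m. poisson_prob (measure pm (unshift a (B i))) (k v i))"
      using 3(2) emeasure_unshift[OF a] unshift_sets[OF a] by (intro prm_prob[OF p 3(1)]) auto
    then show ?case unfolding eq using me by simp
  qed
qed

text \<open>For a fixed horizon dissociability yields one window length \<open>d\<close>. The noise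
  shifted by \<open>l * d\<close> is again canonical, so almost surely all of the countably many
  windows have finite active components, and \<open>no_chain\<close> applies.\<close>

lemma fin_dissoc_no_chain:
  assumes Q: "canonical Q" and H: "W H" and fd: "fin_dissoc J \<sigma> C H"
  shows "AE \<eta> in Q. \<forall>T::nat. \<forall>v\<in>verts H. \<exists>i. \<not> dep J C (edges H) \<eta> (real (Suc T)) i v (real (Suc T))"
  unfolding AE_all_countable
proof
  fix T0 :: nat
  \<comment> \<open>The horizon is positive, as dissociability demands, and exceeds
    \<open>T0\<close>, so that the strict inequality in \<open>dep\<close> leaves the closed
    interval \<open>[0, T0]\<close> covered.\<close>
  let ?T = "real (Suc T0)"
  have Qp: "prob_space Q" and p: "prm Q {{}, space Q} (\<lambda>_. UNIV) (\<lambda>\<eta>. \<eta>)" and Qs: "sets Q = sets npm"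
    using Q by (auto simp: canonical_def)
  have pV: "prm Q {{}, space Q} (\<lambda>_. verts H) (\<lambda>\<eta>. \<eta>)"
    unfolding cond_iid_PRM_def
  proof (intro conjI allI ballI impI, goal_cases)
    case (1 v B k)
    have "{\<omega> \<in> space Q. v \<in> verts H \<and> cnt (\<omega> v) B = k} = (if v \<in> verts H then {\<omega> \<in> space Q. v \<in> UNIV \<and> cnt (\<omega> v) B = k} else {})"
      by auto
    then show ?case using prm_sets[OF p 1, of v k] by simp
  next
    case (2 \<omega> v)
    then show ?case using prm_space[OF p 2(1), of v] by (simp add: space_pm)
  next
    case (3 E F m B k)
    then show ?case by (intro prm_prob[OF p 3(1)]) auto
  qed
  obtain d where d: "0 < d" "\<And>P :: (nat \<Rightarrow> pt set) measure. prob_space P \<Longrightarrow> prm P {{}, space P} (\<lambda>_. verts H) (\<lambda>\<omega>. \<omega>) \<Longrightarrow>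
        (AE \<omega> in P. \<forall>v\<in>active_set J C ?T d H \<omega>.
           finite (({(u, w). {u, w} \<in> edges H} \<inter> (active_set J C ?T d H \<omega> \<times> active_set J C ?T d H \<omega>))\<^sup>* `` {v}))"
    using fd[unfolded fin_dissoc_def, rule_format, of ?T] by auto
  have AEl: "AE \<eta> in Q. \<forall>l::nat. \<forall>v\<in>active_set J C ?T d H (\<lambda>v. tshift (real l * d) (\<eta> v)).
           finite (({(u, w). {u, w} \<in> edges H} \<inter> (active_set J C ?T d H (\<lambda>v. tshift (real l * d) (\<eta> v)) \<times>
             active_set J C ?T d H (\<lambda>v. tshift (real l * d) (\<eta> v))))\<^sup>* `` {v})"
    unfolding AE_all_countable
  proof
    fix l :: nat
    have pl: "prm Q {{}, space Q} (\<lambda>_. UNIV) (\<lambda>\<eta> v. tshift (real l * d) (\<eta> v))" by (rule canonical_shift[OF Q]) (use d in simp)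
    note sh = canonical_distr[OF Q pl] and m = prm_measurable[OF pl]
    show "AE \<eta> in Q. \<forall>v\<in>active_set J C ?T d H (\<lambda>v. tshift (real l * d) (\<eta> v)).
           finite (({(u, w). {u, w} \<in> edges H} \<inter> (active_set J C ?T d H (\<lambda>v. tshift (real l * d) (\<eta> v)) \<times>
             active_set J C ?T d H (\<lambda>v. tshift (real l * d) (\<eta> v))))\<^sup>* `` {v})"
      by (rule AE_distrD[OF m]) (use d(2)[OF Qp pV] in \<open>simp only: sh\<close>)
  qed
  show "AE \<eta> in Q. \<forall>v\<in>verts H. \<exists>i. \<not> dep J C (edges H) \<eta> ?T i v ?T"
    using AEl AE_space
  proof eventually_elim
    case (elim \<eta>)
    show ?case
    proof
      fix v assume v: "v \<in> verts H"
      show "\<exists>i. \<not> dep J C (edges H) \<eta> ?T i v ?T"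
      proof (rule no_chain[OF H d(1) _ v], intro allI impI)
        fix l :: nat and v A
        let ?act = "active_set J C ?T d H (\<lambda>v. tshift (real l * d) (\<eta> v))"
        assume A: "A = {v \<in> verts H. \<exists>p\<in>clean J (\<eta> v). real l * d < fst p \<and> fst p \<le> real (Suc l) * d \<and>
            fst (snd p) \<le> C (card (clos (edges H) v)) ?T}" and vA: "v \<in> A"
        \<comment> \<open>Cleaning only removes marks, so the components for the clean marks are
          contained in those that dissociability controls.\<close>
        have sub: "A \<subseteq> ?act"
        proof
          fix u assume "u \<in> A"
          then obtain q where u: "u \<in> verts H" and q: "q \<in> clean J (\<eta> u)" "real l * d < fst q" "fst q \<le> real (Suc l) * d"
            "fst (snd q) \<le> C (card (clos (edges H) u)) ?T" unfolding A by blast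
          have "\<eta> u \<subseteq> space pm" using prm_space[OF p elim(2)] by simp
          then have "q \<in> space pm" "q \<in> \<eta> u" using q(1) clean_sub[of "\<eta> u"] by auto
          then have "(fst q - real l * d, snd q) \<in> tshift (real l * d) (\<eta> u) \<inter> ({0<..d} \<times> {0<..C (card (clos (edges H) u)) ?T} \<times> J)"
            using q clean_pos[OF q(1)] by (auto simp: tshift_def space_pm algebra_simps)
          then have "tshift (real l * d) (\<eta> u) \<inter> ({0<..d} \<times> {0<..C (card (clos (edges H) u)) ?T} \<times> J) \<noteq> {}" by (metis empty_iff)
          with u show "u \<in> ?act" unfolding active_set_def mem_Collect_eq by (rule conjI)
        qed
        have "({(u, w). {u, w} \<in> edges H} \<inter> A \<times> A)\<^sup>* \<subseteq> ({(u, w). {u, w} \<in> edges H} \<inter> ?act \<times> ?act)\<^sup>*"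
          using sub by (intro rtrancl_mono) auto
        then have "({(u, w). {u, w} \<in> edges H} \<inter> A \<times> A)\<^sup>* `` {v} \<subseteq> ({(u, w). {u, w} \<in> edges H} \<inter> ?act \<times> ?act)\<^sup>* `` {v}" by auto
        moreover have "finite (({(u, w). {u, w} \<in> edges H} \<inter> ?act \<times> ?act)\<^sup>* `` {v})" using elim(1) sub vA by blast
        ultimately show "finite (({(u, w). {u, w} \<in> edges H} \<inter> A \<times> A)\<^sup>* `` {v})" by (rule finite_subset)
      qed
    qed
  qed
qed

subsection \<open>Existence of the canonical noise and extension of a given noise to all labels\<close>

text \<open>Poisson noise is extracted rather than constructed: conditioned on the event that
  \<open>v0\<close> is a vertex, the given noise at \<open>v0\<close> has the Poisson law, and the
  product of countably many copies of this law is canonical.\<close>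

lemma ex_canonical:
  assumes M: "prob_space M" and p: "prm M F0 V N" and F0: "{\<omega> \<in> space M. v0 \<in> V \<omega>} \<in> F0" "F0 \<subseteq> sets M"
    and pos: "measure M {\<omega> \<in> space M. v0 \<in> V \<omega>} > 0"
  shows "\<exists>Q. canonical Q"
proof -
  interpret prob_space M by fact
  define E0 where "E0 = {\<omega> \<in> space M. v0 \<in> V \<omega>}"
  have E0: "E0 \<in> F0" "E0 \<in> sets M" "E0 \<subseteq> {\<omega>. v0 \<in> V \<omega>}" "measure M E0 > 0" using F0 pos by (auto simp: E0_def)
  let ?U = "uniform_measure M E0"
  have U: "prob_space ?U" using E0 by (intro prob_space_uniform_measure) (auto simp: emeasure_eq_measure)
  define f where "f \<omega> = (if v0 \<in> V \<omega> then N \<omega> v0 else {})" for \<omega>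
  have fm: "f \<in> measurable ?U (nsp pm)"
  proof (rule measurable_nspI)
    fix \<omega> assume "\<omega> \<in> space ?U" then show "f \<omega> \<subseteq> space pm" using prm_space[OF p] by (auto simp: f_def)
  next
    fix B k assume B: "B \<in> sets pm"
    have "{\<omega> \<in> space ?U. cnt (f \<omega>) B = k} = {\<omega> \<in> space M. v0 \<in> V \<omega> \<and> cnt (N \<omega> v0) B = k} \<union>
       (if k = 0 then space M - E0 else {})" by (auto simp: f_def E0_def cnt_def zero_enat_def)
    then show "{\<omega> \<in> space ?U. cnt (f \<omega>) B = k} \<in> sets ?U" using prm_sets[OF p B, of v0 k] E0 by auto
  qed
  define L where "L = distr ?U (nsp pm) f"
  interpret L: prob_space L unfolding L_def using U fm by (rule prob_space.prob_space_distr)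
  have Ls: "sets L = sets (nsp pm)" by (simp add: L_def)
  have Lsp: "space L = space (nsp pm)" by (simp add: L_def)
  define A where "A m B k = {S \<in> space (nsp pm). \<forall>i\<in>{..<m}. cnt S (B i) = enat (k i)}" for m :: nat and B and k :: "nat \<Rightarrow> nat"
  have As: "A m B k \<in> sets (nsp pm)" if "\<And>i. i < m \<Longrightarrow> B i \<in> sets pm" for m B k
  proof -
    have "Measurable.pred (nsp pm) (\<lambda>S. \<forall>i\<in>{..<m}. cnt S (B i) = enat (k i))"
    proof (intro pred_intros_finite)
      fix i assume "i \<in> {..<m}"
      then have [measurable]: "(\<lambda>S. cnt S (B i)) \<in> measurable (nsp pm) (count_space UNIV)" using that by (intro cnt_measurable[OF sf_pm]) auto
      show "Measurable.pred (nsp pm) (\<lambda>S. cnt S (B i) = enat (k i))" by measurable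
    qed simp
    then show ?thesis by (simp add: A_def pred_def)
  qed
  have LA: "measure L (A m B k) = (\<Prod>i<m. poisson_prob (measure pm (B i)) (k i))"
    if B: "\<And>i. i < m \<Longrightarrow> B i \<in> sets pm" "\<And>i. i < m \<Longrightarrow> emeasure pm (B i) < \<infinity>" "disjoint_family_on B {..<m}" for m B k
  proof -
    have m: "f -` A m B k \<inter> space ?U \<in> sets M" using measurable_sets[OF fm As[OF B(1)]] by simp
    have "measure L (A m B k) = measure ?U (f -` A m B k \<inter> space ?U)"
      unfolding L_def by (rule measure_distr[OF fm As[OF B(1)]])
    also have "\<dots> = measure M (E0 \<inter> (f -` A m B k \<inter> space ?U)) / measure M E0"
      using E0 m by (intro measure_uniform_measure) (auto simp: emeasure_eq_measure)
    also have "E0 \<inter> (f -` A m B k \<inter> space ?U) = E0 \<inter> (\<Inter>v\<in>{v0}. \<Inter>i\<in>{..<m}. {\<omega>. cnt (N \<omega> v) (B i) = enat (k i)})"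
      using prm_space[OF p] by (auto simp: A_def f_def E0_def space_nsp)
    also have "measure M \<dots> = measure M E0 * (\<Prod>v\<in>{v0}. \<Prod>i<m. poisson_prob (measure pm (B i)) (k i))"
      using E0 by (intro prm_prob[OF p _ _ _ B]) auto
    finally show ?thesis using E0 by simp
  qed
  let ?Q = "PiM UNIV (\<lambda>_::nat. L)"
  interpret Q: product_prob_space "\<lambda>_::nat. L" UNIV ..
  have Qs: "sets ?Q = sets npm" by (rule sets_PiM_cong) (simp_all add: Ls)
  have Qsp: "space ?Q = space npm" by (rule sets_eq_imp_space_eq[OF Qs])
  have Qp: "prob_space ?Q" by (rule Q.prob_space_axioms)
  have "prm ?Q {{}, space ?Q} (\<lambda>_. UNIV) (\<lambda>\<eta>. \<eta>)"
    unfolding cond_iid_PRM_def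
  proof (intro conjI allI ballI impI, goal_cases)
    case (1 v B k)
    have [measurable]: "(\<lambda>\<eta>. cnt (\<eta> v) B) \<in> measurable npm (count_space UNIV)" by (rule cnt_component[OF 1])
    have "{\<eta> \<in> space npm. cnt (\<eta> v) B = k} \<in> sets npm" by measurable
    then show ?case by (simp add: Qs Qsp)
  next
    case (2 \<omega> v)
    then have "\<omega> v \<subseteq> space pm" using Qsp by (auto simp: space_npm)
    then show ?case by (simp add: space_pm)
  next
    case (3 E F m B k)
    have B: "\<And>i. i < m \<Longrightarrow> B i \<in> sets pm" "\<And>i. i < m \<Longrightarrow> emeasure pm (B i) < \<infinity>" "disjoint_family_on B {..<m}" "finite F"
      using 3(2) by auto
    show ?case
    proof (cases "E = {}")
      case False
      then have E: "E = space ?Q" using 3(1) by simp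
      have "E \<inter> (\<Inter>v\<in>F. \<Inter>i\<in>{..<m}. {\<eta>. cnt (\<eta> v) (B i) = enat (k v i)}) = {\<eta> \<in> space ?Q. \<forall>v\<in>F. \<eta> v \<in> A m B (k v)}"
        unfolding E A_def using Qsp by (auto simp: space_npm space_nsp)
      moreover have "emeasure ?Q {\<eta> \<in> space ?Q. \<forall>v\<in>F. \<eta> v \<in> A m B (k v)} = (\<Prod>v\<in>F. emeasure L (A m B (k v)))"
        using B As[OF B(1)] Ls by (intro Q.emeasure_PiM_Collect) auto
      moreover have "(\<Prod>v\<in>F. emeasure L (A m B (k v))) = ennreal (\<Prod>v\<in>F. \<Prod>i<m. poisson_prob (measure pm (B i)) (k v i))"
        by (simp add: L.emeasure_eq_measure LA[OF B(1-3)] prod_ennreal prod_nonneg poisson_nonneg)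
      ultimately have "measure ?Q (E \<inter> (\<Inter>v\<in>F. \<Inter>i\<in>{..<m}. {\<eta>. cnt (\<eta> v) (B i) = enat (k v i)})) =
          (\<Prod>v\<in>F. \<Prod>i<m. poisson_prob (measure pm (B i)) (k v i))"
        by (simp add: measure_def prod_nonneg poisson_nonneg)
      moreover have "measure ?Q E = 1" unfolding E by (rule prob_space.prob_space[OF Qp])
      ultimately show ?thesis by simp
    qed simp
  qed
  then have "canonical ?Q" using Qp Qs by (simp add: canonical_def)
  then show ?thesis ..
qed

text \<open>The given noise is meaningful on the random vertex set only. Independent noise on the
  remaining labels produces a family on all of \<open>nat\<close>, which can be relabelled without
  regard to the graph.\<close>

definition extend :: "('w \<Rightarrow> nat set) \<Rightarrow> ('w \<Rightarrow> nat \<Rightarrow> pt set) \<Rightarrow> 'w \<times> (nat \<Rightarrow> pt set) \<Rightarrow> nat \<Rightarrow> pt set" where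
  "extend V N z v = (if v \<in> V (fst z) then N (fst z) v else snd z v)"

text \<open>Split by the set of labels in \<open>F\<close> that are vertices, an event of
  \<open>F0\<close>. On each piece the conditional law of \<open>N\<close> and the independent law
  \<open>Q\<close> contribute complementary factors of the same Poisson product, which therefore
  factors out of the sum.\<close>

lemma prm_extend:
  assumes M: "prob_space M" and p: "prm M F0 V N" and F0: "sigma_algebra (space M) F0" "F0 \<subseteq> sets M"
    and V: "\<And>v. {\<omega> \<in> space M. v \<in> V \<omega>} \<in> F0" and Q: "canonical Q"
  shows "prm (M \<Otimes>\<^sub>M Q) {E \<times> space Q | E. E \<in> F0} (\<lambda>_. UNIV) (extend V N)"
proof -
  interpret M: prob_space M by fact
  interpret S: sigma_algebra "space M" F0 by fact
  have Qp: "prob_space Q" and Qs: "sets Q = sets npm" and pQ: "prm Q {{}, space Q} (\<lambda>_. UNIV) (\<lambda>\<eta>. \<eta>)" using Q by (auto simp: canonical_def)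
  interpret Q: prob_space Q by fact
  interpret MQ: pair_prob_space M Q ..
  show ?thesis
    unfolding cond_iid_PRM_def
  proof (intro conjI allI ballI impI, goal_cases)
    case (1 v B k)
    let ?A = "{\<omega> \<in> space M. v \<in> V \<omega>}"
    have "{z \<in> space (M \<Otimes>\<^sub>M Q). v \<in> UNIV \<and> cnt (extend V N z v) B = k} =
       {\<omega> \<in> space M. v \<in> V \<omega> \<and> cnt (N \<omega> v) B = k} \<times> space Q \<union>
       (space M - ?A) \<times> {\<eta> \<in> space Q. v \<in> UNIV \<and> cnt (\<eta> v) B = k}"
      by (auto simp: extend_def space_pair_measure)
    moreover have "?A \<in> sets M" using V F0 by blast
    ultimately show ?case using prm_sets[OF p 1, of v k] prm_sets[OF pQ 1, of v k] by auto
  next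
    case (2 z v)
    then have "fst z \<in> space M" "snd z \<in> space Q" by (auto simp: space_pair_measure)
    then show ?case using prm_space[OF p, of "fst z" v] prm_space[OF pQ, of "snd z" v] by (auto simp: extend_def space_pm)
  next
    case (3 E F m B k)
    have B: "\<And>i. i < m \<Longrightarrow> B i \<in> sets pm" "\<And>i. i < m \<Longrightarrow> emeasure pm (B i) < \<infinity>" "disjoint_family_on B {..<m}" and F: "finite F"
      using 3(2) by auto
    obtain E' where E: "E = E' \<times> space Q" "E' \<in> F0" using 3(1) by blast
    have E's: "E' \<subseteq> space M" using S.sets_into_space E by blast
    define EF where "EF F' = E' \<inter> {\<omega> \<in> space M. \<forall>v\<in>F. v \<in> V \<omega> \<longleftrightarrow> v \<in> F'}" for F'
    have EF: "EF F' \<in> F0" for F'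
    proof -
      have "{\<omega> \<in> space M. \<forall>v\<in>F. v \<in> V \<omega> \<longleftrightarrow> v \<in> F'} \<in> F0"
      proof (rule S.sets_Collect_finite_All[OF _ F])
        fix v
        have "{\<omega> \<in> space M. (v \<in> V \<omega>) = (v \<in> F')} = (if v \<in> F' then {\<omega> \<in> space M. v \<in> V \<omega>} else space M - {\<omega> \<in> space M. v \<in> V \<omega>})" by auto
        then show "{\<omega> \<in> space M. (v \<in> V \<omega>) = (v \<in> F')} \<in> F0" using V[of v] by auto
      qed
      then show ?thesis unfolding EF_def using E by blast
    qed
    define X where "X F' = EF F' \<inter> (\<Inter>v\<in>F'. \<Inter>i\<in>{..<m}. {\<omega>. cnt (N \<omega> v) (B i) = enat (k v i)})" for F'
    define Y where "Y F' = space Q \<inter> (\<Inter>v\<in>F'. \<Inter>i\<in>{..<m}. {\<eta>. cnt (\<eta> v) (B i) = enat (k v i)})" for F'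
    let ?pp = "\<lambda>v. \<Prod>i<m. poisson_prob (measure pm (B i)) (k v i)"
    have X: "measure M (X F') = measure M (EF F') * prod ?pp F'" if "F' \<subseteq> F" for F'
      unfolding X_def using that F by (intro prm_prob[OF p EF _ _ B]) (auto simp: EF_def finite_subset)
    have Y: "measure Q (Y F') = prod ?pp F'" if "F' \<subseteq> F" for F'
      unfolding Y_def using that F prm_prob[OF pQ, of "space Q" F' m B k] B Q.prob_space by (auto simp: finite_subset)
    have Ym: "Y F' \<in> sets Q" if "F' \<subseteq> F" for F'
    proof -
      have "Y F' = {\<eta> \<in> space Q. \<forall>v\<in>F'. \<forall>i\<in>{..<m}. cnt (\<eta> v) (B i) = enat (k v i)}" by (auto simp: Y_def)
      also have "\<dots> \<in> sets Q"
        using prm_sets[OF pQ B(1)] finite_subset[OF that F] by (intro sets.sets_Collect_finite_All) auto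
      finally show ?thesis .
    qed
    have Xm: "X F' \<in> sets M" if "F' \<subseteq> F" for F'
    proof -
      have "{\<omega> \<in> space M. \<forall>v\<in>F'. \<forall>i\<in>{..<m}. v \<in> V \<omega> \<and> cnt (N \<omega> v) (B i) = enat (k v i)} \<in> sets M"
        by (intro sets.sets_Collect_finite_All prm_sets[OF p] B(1) finite_subset[OF that F]) auto
      moreover have "X F' = EF F' \<inter> {\<omega> \<in> space M. \<forall>v\<in>F'. \<forall>i\<in>{..<m}. v \<in> V \<omega> \<and> cnt (N \<omega> v) (B i) = enat (k v i)}"
        using E's that by (auto simp: X_def EF_def)
      moreover have "EF F' \<in> sets M" using EF F0 by blast
      ultimately show ?thesis by simp
    qed
    have eq: "E \<inter> (\<Inter>v\<in>F. \<Inter>i\<in>{..<m}. {z. cnt (extend V N z v) (B i) = enat (k v i)}) = (\<Union>F'\<in>Pow F. X F' \<times> Y (F - F'))"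
    proof (intro equalityI subsetI)
      fix z assume z: "z \<in> E \<inter> (\<Inter>v\<in>F. \<Inter>i\<in>{..<m}. {z. cnt (extend V N z v) (B i) = enat (k v i)})"
      let ?F = "{v \<in> F. v \<in> V (fst z)}"
      have h: "cnt (extend V N z v) (B i) = enat (k v i)" if "v \<in> F" "i < m" for v i using z that by auto
      have h1: "cnt (N (fst z) v) (B i) = enat (k v i)" if "v \<in> F" "v \<in> V (fst z)" "i < m" for v i
        using h[OF that(1,3)] that by (simp add: extend_def)
      have h2: "cnt (snd z v) (B i) = enat (k v i)" if "v \<in> F" "v \<notin> V (fst z)" "i < m" for v i
        using h[OF that(1,3)] that by (simp add: extend_def)
      have zE: "fst z \<in> E'" "snd z \<in> space Q" using z E by auto
      have "fst z \<in> X ?F" unfolding X_def EF_def using zE E's h1 by blast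
      moreover have "snd z \<in> Y (F - ?F)" unfolding Y_def using zE h2 by blast
      ultimately show "z \<in> (\<Union>F'\<in>Pow F. X F' \<times> Y (F - F'))" by (auto intro!: bexI[of _ ?F] simp: mem_Times_iff)
    next
      fix z assume "z \<in> (\<Union>F'\<in>Pow F. X F' \<times> Y (F - F'))"
      then obtain F' where F': "F' \<subseteq> F" "fst z \<in> X F'" "snd z \<in> Y (F - F')" by (auto simp: mem_Times_iff)
      have "cnt (extend V N z v) (B i) = enat (k v i)" if "v \<in> F" "i < m" for v i
        using F' that by (cases "v \<in> F'") (auto simp: extend_def X_def Y_def EF_def)
      moreover have "z \<in> E" using F' E by (auto simp: X_def Y_def EF_def mem_Times_iff)
      ultimately show "z \<in> E \<inter> (\<Inter>v\<in>F. \<Inter>i\<in>{..<m}. {z. cnt (extend V N z v) (B i) = enat (k v i)})" by auto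
    qed
    have disj: "disjoint_family_on (\<lambda>F'. X F' \<times> Y (F - F')) (Pow F)"
      by (auto simp: disjoint_family_on_def X_def EF_def)
    have mt: "measure (M \<Otimes>\<^sub>M Q) (A \<times> A') = measure M A * measure Q A'" if "A \<in> sets M" "A' \<in> sets Q" for A A'
      using Q.emeasure_pair_measure_Times[OF that] by (simp add: measure_def enn2real_mult)
    have "measure (M \<Otimes>\<^sub>M Q) (\<Union>F'\<in>Pow F. X F' \<times> Y (F - F')) = (\<Sum>F'\<in>Pow F. measure (M \<Otimes>\<^sub>M Q) (X F' \<times> Y (F - F')))"
      using F Xm Ym disj by (intro MQ.finite_measure_finite_Union) auto
    also have "\<dots> = (\<Sum>F'\<in>Pow F. measure M (EF F') * prod ?pp F)"
    proof (rule sum.cong[OF refl])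
      fix F' assume "F' \<in> Pow F"
      then have F': "F' \<subseteq> F" by simp
      have "measure (M \<Otimes>\<^sub>M Q) (X F' \<times> Y (F - F')) = measure M (EF F') * (prod ?pp (F - F') * prod ?pp F')"
        using mt[OF Xm Ym, of F' "F - F'"] X[OF F'] Y[of "F - F'"] F' by (simp add: mult_ac)
      also have "prod ?pp (F - F') * prod ?pp F' = prod ?pp F" by (rule prod.subset_diff[OF F' F, symmetric])
      finally show "measure (M \<Otimes>\<^sub>M Q) (X F' \<times> Y (F - F')) = measure M (EF F') * prod ?pp F" .
    qed
    also have "\<dots> = (\<Sum>F'\<in>Pow F. measure M (EF F')) * prod ?pp F" by (rule sum_distrib_right[symmetric])
    also have "(\<Sum>F'\<in>Pow F. measure M (EF F')) = measure M (\<Union>F'\<in>Pow F. EF F')"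
      using F EF F0 by (intro M.finite_measure_finite_Union[symmetric]) (auto simp: disjoint_family_on_def EF_def)
    also have "(\<Union>F'\<in>Pow F. EF F') = E'"
    proof (intro equalityI subsetI)
      fix \<omega> assume "\<omega> \<in> E'"
      then have "\<omega> \<in> EF {v \<in> F. v \<in> V \<omega>}" using E's by (auto simp: EF_def)
      then show "\<omega> \<in> (\<Union>F'\<in>Pow F. EF F')" by (rule UN_I[rotated]) simp
    next
      fix \<omega> assume "\<omega> \<in> (\<Union>F'\<in>Pow F. EF F')"
      then obtain F' where "\<omega> \<in> EF F'" by (rule UN_E)
      then show "\<omega> \<in> E'" by (simp add: EF_def)
    qed
    also have "measure M E' = measure (M \<Otimes>\<^sub>M Q) E"
    proof -
      have "E' \<in> sets M" using E(2) F0(2) by (rule subsetD[rotated])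
      from mt[OF this sets.top] show ?thesis by (simp add: E(1) Q.prob_space)
    qed
    finally show ?case unfolding eq .
  qed
qed

end

subsection \<open>Discretised paths converge in the Skorokhod topology\<close>

text \<open>\<open>skor_conv\<close> asks for one sequence of time changes that serves all horizons.
  At index \<open>n\<close> the time change for the largest horizon already reached is
  taken.\<close>

lemma skor_convI:
  assumes "\<And>K::nat. \<exists>N. \<forall>n\<ge>N. \<exists>lam. time_change lam \<and>
     (\<forall>t\<in>{0..real K}. \<bar>lam t - t\<bar> < 1 / real (Suc K) \<and> xs n (lam t) = x t)"
  shows "skor_conv xs x"
proof -
  have "\<forall>K::nat. \<exists>N. \<forall>n\<ge>N. \<exists>lam. time_change lam \<and>
     (\<forall>t\<in>{0..real K}. \<bar>lam t - t\<bar> < 1 / real (Suc K) \<and> xs n (lam t) = x t)" using assms by blast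
  from choice[OF this] obtain N where N: "\<And>K n. N K \<le> n \<Longrightarrow> \<exists>lam. time_change lam \<and>
     (\<forall>t\<in>{0..real K}. \<bar>lam t - t\<bar> < 1 / real (Suc K) \<and> xs n (lam t) = x t)" by blast
  \<comment> \<open>The bound \<open>K \<le> n\<close> keeps this set finite, so that its maximum
    exists.\<close>
  define A where "A n = {K. K \<le> n \<and> N K \<le> n}" for n
  have fA: "finite (A n)" for n by (rule finite_subset[of _ "{..n}"]) (auto simp: A_def)
  define good where "good n lam \<longleftrightarrow> time_change lam \<and> (A n \<noteq> {} \<longrightarrow>
     (\<forall>t\<in>{0..real (Max (A n))}. \<bar>lam t - t\<bar> < 1 / real (Suc (Max (A n))) \<and> xs n (lam t) = x t))" for n lam
  have "\<exists>lam. good n lam" for n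
  proof (cases "A n = {}")
    case True
    have "time_change (\<lambda>t. t)" by (auto simp: time_change_def strict_mono_on_def)
    then show ?thesis using True by (auto simp: good_def)
  next
    case False
    then have "Max (A n) \<in> A n" using fA by simp
    then have "N (Max (A n)) \<le> n" by (simp add: A_def)
    from N[OF this] show ?thesis by (auto simp: good_def)
  qed
  then have "\<forall>n. \<exists>lam. good n lam" by blast
  from choice[OF this] obtain lams where lams: "\<And>n. good n (lams n)" by blast
  show ?thesis unfolding skor_conv_def
  proof (intro exI[of _ lams] conjI allI impI)
    show "time_change (lams n)" for n using lams by (simp add: good_def)
    fix T \<epsilon> :: real assume T: "0 < T" and e: "0 < \<epsilon>"
    obtain K1 :: nat where K1: "T \<le> real K1" using real_arch_simple by blast
    obtain K2 :: nat where K2: "1 / real (Suc K2) < \<epsilon>" using nat_approx_posE[OF e] by blast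
    let ?K = "max K1 K2"
    show "\<exists>N. \<forall>n\<ge>N. \<forall>t\<in>{0..T}. \<bar>lams n t - t\<bar> < \<epsilon> \<and> real_of_int \<bar>xs n (lams n t) - x t\<bar> < \<epsilon>"
    proof (intro exI[of _ "max ?K (N ?K)"] allI impI ballI)
      fix n t assume n: "max ?K (N ?K) \<le> n" and t: "t \<in> {0..T}"
      have "?K \<in> A n" using n by (simp add: A_def)
      then have ne: "A n \<noteq> {}" and le: "?K \<le> Max (A n)" by (blast, rule Max_ge[OF fA])
      have "t \<le> real (Max (A n))" using t K1 le by auto
      then have "\<bar>lams n t - t\<bar> < 1 / real (Suc (Max (A n)))" "xs n (lams n t) = x t"
        using lams[of n] ne t by (auto simp: good_def)
      moreover have "1 / real (Suc (Max (A n))) \<le> 1 / real (Suc K2)" using le by (intro divide_left_mono) auto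
      ultimately show "\<bar>lams n t - t\<bar> < \<epsilon> \<and> real_of_int \<bar>xs n (lams n t) - x t\<bar> < \<epsilon>" using K2 e by simp
    qed
  qed
qed

lemma skor_conv_eventually:
  assumes "\<And>T::nat. \<forall>\<^sub>F n in sequentially. \<forall>t\<in>{0..real T}. xs n t = x t"
  shows "skor_conv xs x"
proof (rule skor_convI)
  fix K :: nat
  from assms[of K] obtain N where N: "\<And>n t. N \<le> n \<Longrightarrow> t \<in> {0..real K} \<Longrightarrow> xs n t = x t"
    unfolding eventually_sequentially by blast
  have "time_change (\<lambda>t. t)" by (auto simp: time_change_def strict_mono_on_def)
  then show "\<exists>N. \<forall>n\<ge>N. \<exists>lam. time_change lam \<and>
     (\<forall>t\<in>{0..real K}. \<bar>lam t - t\<bar> < 1 / real (Suc K) \<and> xs n (lam t) = x t)"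
    using N by (intro exI[of _ N] allI impI exI[of _ "\<lambda>t. t"]) auto
qed

lemma skor_conv_cong:
  assumes "skor_conv ys x" "\<forall>\<^sub>F n in sequentially. xs n = ys n"
  shows "skor_conv xs x"
proof -
  obtain lams where lams: "\<forall>n. time_change (lams n)" "\<forall>T>0. \<forall>\<epsilon>>0. \<exists>N. \<forall>n\<ge>N. \<forall>t\<in>{0..T}.
        \<bar>lams n t - t\<bar> < \<epsilon> \<and> real_of_int \<bar>ys n (lams n t) - x t\<bar> < \<epsilon>"
    using assms(1) unfolding skor_conv_def by blast
  obtain N0 where N0: "\<And>n. N0 \<le> n \<Longrightarrow> xs n = ys n" using assms(2) unfolding eventually_sequentially by blast
  show ?thesis unfolding skor_conv_def
  proof (intro exI[of _ lams] conjI lams(1) allI impI)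
    fix T \<epsilon> :: real assume "0 < T" "0 < \<epsilon>"
    then obtain N where "\<forall>n\<ge>N. \<forall>t\<in>{0..T}. \<bar>lams n t - t\<bar> < \<epsilon> \<and> real_of_int \<bar>ys n (lams n t) - x t\<bar> < \<epsilon>"
      using lams(2) by blast
    then show "\<exists>N. \<forall>n\<ge>N. \<forall>t\<in>{0..T}. \<bar>lams n t - t\<bar> < \<epsilon> \<and> real_of_int \<bar>xs n (lams n t) - x t\<bar> < \<epsilon>"
      using N0 by (intro exI[of _ "max N N0"]) simp
  qed
qed

text \<open>A sum of tent functions moves the points of \<open>S\<close> as prescribed by \<open>h\<close>; for small displacements the slope
  of the perturbation stays below \<open>1\<close>.\<close>

lemma tent_time_change:
  fixes S :: "real set"
  assumes S: "finite S" and w: "0 < w" "\<And>\<tau>. \<tau> \<in> S \<Longrightarrow> w \<le> \<tau>" "\<And>\<tau> \<tau>'. \<tau> \<in> S \<Longrightarrow> \<tau>' \<in> S \<Longrightarrow> \<tau> \<noteq> \<tau>' \<Longrightarrow> w \<le> \<bar>\<tau> - \<tau>'\<bar>"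
    and h: "\<And>\<tau>. \<tau> \<in> S \<Longrightarrow> \<bar>h \<tau> - \<tau>\<bar> \<le> d" and d: "0 \<le> d" "real (card S) * d < w"
  shows "\<exists>lam. time_change lam \<and> (\<forall>\<tau>\<in>S. lam \<tau> = h \<tau>) \<and> (\<forall>t. \<bar>lam t - t\<bar> \<le> real (card S) * d)"
proof -
  \<comment> \<open>Tents of half-width \<open>w\<close>: by the spacing of \<open>S\<close> each
    vanishes at the other points of \<open>S\<close> and at 0, so the displacements do not interfere
    and 0 stays fixed.\<close>
  define g where "g \<tau> t = max 0 (1 - \<bar>t - \<tau>\<bar> / w)" for \<tau> t
  define lam where "lam t = t + (\<Sum>\<tau>\<in>S. (h \<tau> - \<tau>) * g \<tau> t)" for t
  have g01: "0 \<le> g \<tau> t" "g \<tau> t \<le> 1" for \<tau> t using w(1) by (auto simp: g_def)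
  have glip: "\<bar>g \<tau> t - g \<tau> s\<bar> \<le> \<bar>t - s\<bar> / w" for \<tau> s t
  proof -
    have mx: "\<bar>max 0 a - max 0 b\<bar> \<le> \<bar>a - b\<bar>" for a b :: real by (auto simp: max_def)
    have "\<bar>g \<tau> t - g \<tau> s\<bar> \<le> \<bar>(1 - \<bar>t - \<tau>\<bar> / w) - (1 - \<bar>s - \<tau>\<bar> / w)\<bar>" unfolding g_def by (rule mx)
    also have "\<dots> = \<bar>\<bar>s - \<tau>\<bar> - \<bar>t - \<tau>\<bar>\<bar> / w" using w(1) by (simp add: field_simps abs_if)
    also have "\<dots> \<le> \<bar>t - s\<bar> / w" using w(1) by (intro divide_right_mono) auto
    finally show ?thesis .
  qed
  have near: "\<bar>lam t - t\<bar> \<le> real (card S) * d" for t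
  proof -
    have "\<bar>lam t - t\<bar> \<le> (\<Sum>\<tau>\<in>S. \<bar>(h \<tau> - \<tau>) * g \<tau> t\<bar>)" unfolding lam_def using sum_abs by simp
    also have "\<dots> \<le> (\<Sum>\<tau>\<in>S. d)"
    proof (rule sum_mono)
      fix \<tau> assume "\<tau> \<in> S"
      then have "\<bar>h \<tau> - \<tau>\<bar> * g \<tau> t \<le> d * 1" using h g01 d by (intro mult_mono) auto
      then show "\<bar>(h \<tau> - \<tau>) * g \<tau> t\<bar> \<le> d" using g01[of \<tau> t] by (simp add: abs_mult)
    qed
    finally show ?thesis by simp
  qed
  have mono: "lam s < lam t" if st: "s < t" for s t
  proof -
    have "\<bar>(\<Sum>\<tau>\<in>S. (h \<tau> - \<tau>) * g \<tau> t) - (\<Sum>\<tau>\<in>S. (h \<tau> - \<tau>) * g \<tau> s)\<bar> = \<bar>\<Sum>\<tau>\<in>S. (h \<tau> - \<tau>) * (g \<tau> t - g \<tau> s)\<bar>"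
      by (simp add: sum_subtractf right_diff_distrib)
    also have "\<dots> \<le> (\<Sum>\<tau>\<in>S. \<bar>(h \<tau> - \<tau>) * (g \<tau> t - g \<tau> s)\<bar>)" by (rule sum_abs)
    also have "\<dots> \<le> (\<Sum>\<tau>\<in>S. d * ((t - s) / w))"
    proof (rule sum_mono)
      fix \<tau> assume "\<tau> \<in> S"
      then have "\<bar>h \<tau> - \<tau>\<bar> * \<bar>g \<tau> t - g \<tau> s\<bar> \<le> d * ((t - s) / w)" using h glip[of \<tau> t s] d st by (intro mult_mono) auto
      then show "\<bar>(h \<tau> - \<tau>) * (g \<tau> t - g \<tau> s)\<bar> \<le> d * ((t - s) / w)" by (simp add: abs_mult)
    qed
    also have "\<dots> = (real (card S) * d / w) * (t - s)" by simp
    also have "\<dots> < 1 * (t - s)" using d(2) w(1) st by (intro mult_strict_right_mono) auto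
    finally have *: "\<bar>(\<Sum>\<tau>\<in>S. (h \<tau> - \<tau>) * g \<tau> t) - (\<Sum>\<tau>\<in>S. (h \<tau> - \<tau>) * g \<tau> s)\<bar> < 1 * (t - s)" .
    have aux: "\<bar>A - B\<bar> < 1 * (t - s) \<Longrightarrow> s + B < t + A" for A B :: real by (simp add: abs_less_iff algebra_simps)
    show ?thesis unfolding lam_def by (rule aux[OF *])
  qed
  have at: "lam \<tau> = h \<tau>" if t: "\<tau> \<in> S" for \<tau>
  proof -
    have "(\<Sum>\<tau>'\<in>S. (h \<tau>' - \<tau>') * g \<tau>' \<tau>) = (\<Sum>\<tau>'\<in>S. if \<tau>' = \<tau> then h \<tau> - \<tau> else 0)"
    proof (rule sum.cong[OF refl])
      fix \<tau>' assume "\<tau>' \<in> S"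
      then show "(h \<tau>' - \<tau>') * g \<tau>' \<tau> = (if \<tau>' = \<tau> then h \<tau> - \<tau> else 0)"
        using w(1) w(3)[OF t, of \<tau>'] by (auto simp: g_def field_simps)
    qed
    then show ?thesis using t S by (simp add: lam_def)
  qed
  have lam0: "lam 0 = 0"
  proof -
    have "(h \<tau> - \<tau>) * g \<tau> 0 = 0" if "\<tau> \<in> S" for \<tau> using w(1) w(2)[OF that] by (auto simp: g_def field_simps)
    then have "(\<Sum>\<tau>\<in>S. (h \<tau> - \<tau>) * g \<tau> 0) = 0" by (intro sum.neutral ballI)
    then show ?thesis by (simp add: lam_def)
  qed
  have cont: "continuous_on A lam" for A unfolding lam_def g_def using w(1) by (intro continuous_intros) auto
  have "lam ` {0..} = {0..}"
  proof (intro equalityI subsetI)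
    fix y assume "y \<in> lam ` {0..}"
    then obtain t where "0 \<le> t" "y = lam t" by auto
    then show "y \<in> {0..}" using mono[of 0 t] lam0 by (cases "t = 0") auto
  next
    fix y :: real assume "y \<in> {0..}"
    then have y: "0 \<le> y" by simp
    \<comment> \<open>Points move by at most \<open>card S * d\<close>, so \<open>lam\<close>
      reaches at least \<open>y\<close> here, and the intermediate value theorem gives
      surjectivity.\<close>
    let ?b = "y + real (card S) * d"
    have "y \<le> lam ?b" using near[of ?b] by (auto simp: abs_le_iff)
    then obtain t where "0 \<le> t" "lam t = y"
      using IVT'[of lam 0 y ?b] lam0 y d cont by auto
    then show "y \<in> lam ` {0..}" by auto
  qed
  then have "time_change lam" unfolding time_change_def using mono cont by (auto simp: strict_mono_on_def)
  then show ?thesis using at near by blast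
qed

text \<open>An integer-valued path attains its one-sided limits near each time, so locally the only
  possible jump is at that time itself. The bisection principle \<open>Bolzano\<close> assembles
  finitely many such neighbourhoods.\<close>

lemma Dpath_pieces:
  assumes x: "Dpath Xs x" and T: "0 \<le> T"
  shows "\<exists>S. finite S \<and> S \<subseteq> {0<..} \<and> (\<forall>s s'. 0 \<le> s \<longrightarrow> s \<le> s' \<longrightarrow> s' \<le> T \<longrightarrow> S \<inter> {s<..s'} = {} \<longrightarrow> x s = x s')"
proof -
  define P where "P a b \<longleftrightarrow> (\<exists>S. finite S \<and> (\<forall>s s'. 0 \<le> s \<longrightarrow> a \<le> s \<longrightarrow> s \<le> s' \<longrightarrow> s' \<le> b \<longrightarrow> S \<inter> {s<..s'} = {} \<longrightarrow> x s = x s'))" for a b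
  have "P 0 T"
    using T
  proof (induction rule: Bolzano)
    case (trans a b c)
    obtain S where S: "finite S" "\<And>s s'. 0 \<le> s \<Longrightarrow> a \<le> s \<Longrightarrow> s \<le> s' \<Longrightarrow> s' \<le> b \<Longrightarrow> S \<inter> {s<..s'} = {} \<Longrightarrow> x s = x s'"
      using trans(1) unfolding P_def by blast
    obtain S' where S': "finite S'" "\<And>s s'. 0 \<le> s \<Longrightarrow> b \<le> s \<Longrightarrow> s \<le> s' \<Longrightarrow> s' \<le> c \<Longrightarrow> S' \<inter> {s<..s'} = {} \<Longrightarrow> x s = x s'"
      using trans(2) unfolding P_def by blast
    show ?case unfolding P_def
    proof (intro exI[of _ "S \<union> S'"] conjI allI impI)
      show "finite (S \<union> S')" using S S' by simp
      fix s s' assume h: "0 \<le> s" "a \<le> s" "s \<le> s'" "s' \<le> c" "(S \<union> S') \<inter> {s<..s'} = {}"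
      have h': "S \<inter> {u<..u'} = {}" "S' \<inter> {u<..u'} = {}" if "s \<le> u" "u' \<le> s'" for u u' using h(5) that by auto
      consider "s' \<le> b" | "b \<le> s" | "s < b" "b < s'" by linarith
      then show "x s = x s'"
      proof cases
        case 1 then show ?thesis using h h' by (intro S(2)) auto
      next
        case 2 then show ?thesis using h h' by (intro S'(2)) auto
      next
        case 3
        have "x s = x b" using 3 h h' by (intro S(2)) auto
        also have "x b = x s'" using 3 h h' by (intro S'(2)) auto
        finally show ?thesis .
      qed
    qed
  next
    case (local t)
    have "continuous (at_right t) x" using x local by (simp add: Dpath_def)
    then have "\<forall>\<^sub>F s in at_right t. x s = x t" by (simp add: continuous_within tendsto_discrete)
    then obtain b where b: "t < b" "\<And>s. t < s \<Longrightarrow> s < b \<Longrightarrow> x s = x t" unfolding eventually_at_right_field by blast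
    \<comment> \<open>At time 0 the condition \<open>0 \<le> s\<close> leaves nothing on the left,
      so any negative \<open>a\<close> serves.\<close>
    have "\<exists>a<t. \<exists>l. \<forall>s. 0 \<le> s \<longrightarrow> a < s \<longrightarrow> s < t \<longrightarrow> x s = l"
    proof (cases "t = 0")
      case False
      then have "\<exists>l. (x \<longlongrightarrow> l) (at_left t)" using x local by (simp add: Dpath_def)
      then obtain l where "\<forall>\<^sub>F s in at_left t. x s = l" by (auto simp: tendsto_discrete)
      then show ?thesis unfolding eventually_at_left_field by blast
    qed (auto intro!: exI[of _ "-1"])
    then obtain a l where a: "a < t" "\<And>s. 0 \<le> s \<Longrightarrow> a < s \<Longrightarrow> s < t \<Longrightarrow> x s = l" by blast
    show ?case
    proof (intro exI[of _ "min (b - t) (t - a)"] conjI allI impI)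
      show "0 < min (b - t) (t - a)" using a b by simp
      fix u v assume uv: "u \<le> t \<and> t \<le> v \<and> v - u < min (b - t) (t - a)"
      show "P u v" unfolding P_def
      proof (intro exI[of _ "{t}"] conjI allI impI)
        fix s s' assume h: "0 \<le> s" "u \<le> s" "s \<le> s'" "s' \<le> v" "{t} \<inter> {s<..s'} = {}"
        then consider "s' < t" | "t \<le> s" by force
        then show "x s = x s'"
        proof cases
          case 1 then show ?thesis using a(2)[of s] a(2)[of s'] h uv by auto
        next
          case 2
          then have "x s = x t" "x s' = x t" using b(2)[of s] b(2)[of s'] h uv by (cases "s = t"; cases "s' = t"; auto)+
          then show ?thesis by simp
        qed
      qed simp
    qed
  qed
  then obtain S where S: "finite S" "\<And>s s'. 0 \<le> s \<Longrightarrow> s \<le> s' \<Longrightarrow> s' \<le> T \<Longrightarrow> S \<inter> {s<..s'} = {} \<Longrightarrow> x s = x s'"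
    unfolding P_def by blast
  show ?thesis
  proof (intro exI[of _ "S \<inter> {0<..}"] conjI allI impI)
    fix s s' :: real assume h: "0 \<le> s" "s \<le> s'" "s' \<le> T" "S \<inter> {0<..} \<inter> {s<..s'} = {}"
    then show "x s = x s'" by (intro S(2)) auto
  qed (use S in auto)
qed

definition grid :: "nat \<Rightarrow> real set" where
  "grid n = (\<lambda>i. real i / 2 ^ n) ` {1..n * 2 ^ n}"

definition lastg :: "nat \<Rightarrow> real \<Rightarrow> real" where
  "lastg n t = Max (insert 0 {s \<in> grid n. s \<le> t})"

text \<open>A discretised path is determined by finitely many integers. This is the source of
  measurability in \<open>test_sol_measurable\<close>.\<close>

definition disc :: "nat \<Rightarrow> path \<Rightarrow> path" where
  "disc n x t = x (lastg n t)"

lemma grid_finite: "finite (grid n)" by (simp add: grid_def)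

lemma lastg_in: "lastg n t \<in> insert 0 (grid n)"
  using Max_in[of "insert 0 {s \<in> grid n. s \<le> t}"] grid_finite by (auto simp: lastg_def)

lemma lastg_nonneg: "0 \<le> lastg n t"
  using grid_finite by (auto simp: lastg_def)

text \<open>The grid points play the role of marks in \<open>step_Dpath\<close>; the other two
  coordinates are dummies.\<close>

lemma disc_Dpath:
  assumes "Dpath Xs x" shows "Dpath Xs (disc n x)"
proof -
  let ?A = "(\<lambda>s. (s, 0, 0)) ` grid n :: pt set"
  let ?F = "\<lambda>S :: pt set. x (max 0 (Max (insert 0 (fst ` S))))"
  have "fst ` {p \<in> ?A. fst p \<le> t} = {s \<in> grid n. s \<le> t}" for t by force
  then have "?F {p \<in> ?A. fst p \<le> t} = disc n x t" for t
    using lastg_nonneg[of n t] by (simp add: disc_def lastg_def max_def)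
  moreover have "Dpath Xs (\<lambda>t. ?F {p \<in> ?A. fst p \<le> t})"
  proof (rule step_Dpath)
    show "finite {p \<in> ?A. fst p \<le> t}" for t using grid_finite by simp
    show "0 < fst p" if "p \<in> ?A" for p using that by (auto simp: grid_def)
    show "?F S \<in> Xs" for S using assms by (simp add: Dpath_def)
  qed
  ultimately show ?thesis by (simp add: fun_eq_iff[symmetric])
qed

text \<open>Discretisation delays each jump to the next grid point. For a fine grid the delays are
  small compared with the gaps between jumps, so a tent time change undoes them all and the values
  then agree exactly.\<close>

lemma disc_skor_conv:
  assumes x: "Dpath Xs x" shows "skor_conv (\<lambda>n. disc n x) x"
proof (rule skor_convI)
  fix K :: nat
  have "\<exists>S. finite S \<and> S \<subseteq> {0<..} \<and>
     (\<forall>s s'. 0 \<le> s \<longrightarrow> s \<le> s' \<longrightarrow> s' \<le> real K + 2 \<longrightarrow> S \<inter> {s<..s'} = {} \<longrightarrow> x s = x s')"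
    by (rule Dpath_pieces[OF x]) simp
  then obtain S where S0: "finite S \<and> S \<subseteq> {0<..} \<and>
     (\<forall>s s'. 0 \<le> s \<longrightarrow> s \<le> s' \<longrightarrow> s' \<le> real K + 2 \<longrightarrow> S \<inter> {s<..s'} = {} \<longrightarrow> x s = x s')" by (elim exE) (rule that)
  note S = S0[THEN conjunct1] S0[THEN conjunct2, THEN conjunct1] S0[THEN conjunct2, THEN conjunct2, rule_format]
  define w where "w = Min (insert 1 (S \<union> (\<lambda>(a, b). \<bar>a - b\<bar>) ` {(a, b) \<in> S \<times> S. a \<noteq> b}))"
  have fw: "finite (insert 1 (S \<union> (\<lambda>(a, b). \<bar>a - b\<bar>) ` {(a, b) \<in> S \<times> S. a \<noteq> b}))"
  proof -
    have "finite {(a, b) \<in> S \<times> S. a \<noteq> b}" by (rule finite_subset[of _ "S \<times> S"]) (use S(1) in auto)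
    then show ?thesis unfolding finite_insert finite_Un using S(1) by (intro conjI finite_imageI)
  qed
  have w: "0 < w" "\<And>\<tau>. \<tau> \<in> S \<Longrightarrow> w \<le> \<tau>" "\<And>\<tau> \<tau>'. \<tau> \<in> S \<Longrightarrow> \<tau>' \<in> S \<Longrightarrow> \<tau> \<noteq> \<tau>' \<Longrightarrow> w \<le> \<bar>\<tau> - \<tau>'\<bar>"
  proof -
    show "0 < w" unfolding w_def using fw S(2) by (subst Min_gr_iff) auto
    show "w \<le> \<tau>" if "\<tau> \<in> S" for \<tau> unfolding w_def using fw that by (intro Min_le) auto
    show "w \<le> \<bar>\<tau> - \<tau>'\<bar>" if "\<tau> \<in> S" "\<tau>' \<in> S" "\<tau> \<noteq> \<tau>'" for \<tau> \<tau>' unfolding w_def using fw that by (intro Min_le) auto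
  qed
  have "(\<lambda>n. real (card S) * (1/2) ^ n) \<longlonglongrightarrow> real (card S) * 0"
    by (intro tendsto_mult tendsto_const LIMSEQ_power_zero) auto
  then have "\<forall>\<^sub>F n in sequentially. real (card S) * (1/2) ^ n < min w (1 / real (Suc K))"
    using w(1) by (intro order_tendstoD) auto
  then obtain N where N: "\<And>n. N \<le> n \<Longrightarrow> real (card S) * (1/2) ^ n < min w (1 / real (Suc K))"
    unfolding eventually_sequentially by blast
  show "\<exists>N. \<forall>n\<ge>N. \<exists>lam. time_change lam \<and>
     (\<forall>t\<in>{0..real K}. \<bar>lam t - t\<bar> < 1 / real (Suc K) \<and> disc n x (lam t) = x t)"
  \<comment> \<open>The grid of level \<open>n\<close> ends at \<open>n\<close>; it must contain the
    delayed jumps up to \<open>lam t\<close>, which is at most \<open>K + 1\<close>.\<close>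
  proof (intro exI[of _ "max N (K + 2)"] allI impI)
    fix n assume n: "max N (K + 2) \<le> n"
    define h where "h \<tau> = real_of_int \<lceil>\<tau> * 2 ^ n\<rceil> / 2 ^ n" for \<tau> :: real
    have hle: "\<tau> \<le> h \<tau>" for \<tau> unfolding h_def by (simp add: field_simps)
    have hup: "h \<tau> \<le> \<tau> + (1/2) ^ n" for \<tau>
    proof -
      have "real_of_int \<lceil>\<tau> * 2 ^ n\<rceil> \<le> \<tau> * 2 ^ n + 1" by linarith
      then show ?thesis unfolding h_def by (simp add: field_simps power_one_over)
    qed
    have hd: "\<bar>h \<tau> - \<tau>\<bar> \<le> (1/2) ^ n" if "\<tau> \<in> S" for \<tau> using hle[of \<tau>] hup[of \<tau>] by auto
    have dn: "real (card S) * (1/2) ^ n < w" "real (card S) * (1/2) ^ n < 1 / real (Suc K)" using N[of n] n by auto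
    obtain lam where lam: "time_change lam" "\<And>\<tau>. \<tau> \<in> S \<Longrightarrow> lam \<tau> = h \<tau>" "\<And>t. \<bar>lam t - t\<bar> \<le> real (card S) * (1/2) ^ n"
      using tent_time_change[OF S(1) w hd _ dn(1)] by auto
    have smono: "lam s < lam t" if "0 \<le> s" "s < t" for s t
      using lam(1) that strict_mono_onD[of "{0..}" lam s t] by (simp add: time_change_def)
    have mono: "lam s \<le> lam t" if "0 \<le> s" "s \<le> t" for s t
      using smono[of s t] that by (cases "s = t") auto
    have "disc n x (lam t) = x t" if t: "t \<in> {0..real K}" for t
    proof -
      let ?u = "lastg n (lam t)"
      have "lam ` {0..} = {0..}" using lam(1) by (simp add: time_change_def)
      moreover have "lam t \<in> lam ` {0..}" using t by auto
      ultimately have lt0: "0 \<le> lam t" by simp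
      have lt1: "lam t \<le> real K + 1"
      proof -
        have "1 / real (Suc K) \<le> 1" by simp
        then have "\<bar>lam t - t\<bar> \<le> 1" by (intro order_trans[OF lam(3)] order_trans[OF less_imp_le[OF dn(2)]])
        then show ?thesis using t by auto
      qed
      have u: "0 \<le> ?u" "?u \<le> lam t"
        using lastg_nonneg grid_finite lt0 by (auto simp: lastg_def)
      \<comment> \<open>The time change puts each jump exactly on a grid point, so a jump precedes
        \<open>t\<close> if and only if it precedes the grid point at which \<open>disc\<close>
        reads the path.\<close>
      have sep: "\<tau> \<le> t \<longleftrightarrow> \<tau> \<le> ?u" if \<tau>: "\<tau> \<in> S" for \<tau>
      proof
        assume "\<tau> \<le> t"
        then have hl: "h \<tau> \<le> lam t" using mono[of \<tau> t] lam(2)[OF \<tau>] S(2) \<tau> by auto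
        have c1: "1 \<le> \<lceil>\<tau> * 2 ^ n\<rceil>" using S(2) \<tau> by (auto simp: one_le_ceiling)
        have "real_of_int \<lceil>\<tau> * 2 ^ n\<rceil> \<le> lam t * 2 ^ n" using hl unfolding h_def by (simp add: pos_divide_le_eq)
        also have "\<dots> \<le> (real K + 1) * 2 ^ n" using lt1 by (intro mult_right_mono) auto
        also have "\<dots> \<le> real n * 2 ^ n" using n by (intro mult_right_mono) auto
        also have "\<dots> = real_of_int (int n * 2 ^ n)" by simp
        finally have "\<lceil>\<tau> * 2 ^ n\<rceil> \<le> int n * 2 ^ n" unfolding of_int_le_iff .
        then have "nat \<lceil>\<tau> * 2 ^ n\<rceil> \<le> n * 2 ^ n" by (simp add: nat_le_iff)
        moreover have "1 \<le> nat \<lceil>\<tau> * 2 ^ n\<rceil>" using nat_mono[OF c1] unfolding nat_1 by (simp only: One_nat_def)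
        ultimately have mem: "nat \<lceil>\<tau> * 2 ^ n\<rceil> \<in> {1..n * 2 ^ n}" unfolding atLeastAtMost_iff by (rule conjI[rotated])
        have "real (nat \<lceil>\<tau> * 2 ^ n\<rceil>) = real_of_int \<lceil>\<tau> * 2 ^ n\<rceil>" using c1 by (intro of_nat_nat) linarith
        then have "h \<tau> = real (nat \<lceil>\<tau> * 2 ^ n\<rceil>) / 2 ^ n" by (simp only: h_def)
        then have "h \<tau> \<in> grid n" unfolding grid_def using mem by (rule image_eqI)
        then have "h \<tau> \<le> ?u" unfolding lastg_def using grid_finite hl by (intro Max_ge) auto
        then show "\<tau> \<le> ?u" using hle[of \<tau>] by simp
      next
        assume tu: "\<tau> \<le> ?u"
        show "\<tau> \<le> t"
        proof (rule ccontr)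
          assume "\<not> \<tau> \<le> t"
          then have "lam t < h \<tau>" using smono[of t \<tau>] lam(2)[OF \<tau>] t by simp
          then have uh: "?u < h \<tau>" using u by simp
          have "?u < \<tau>"
          proof (cases "?u = 0")
            case True then show ?thesis using S(2) \<tau> by auto
          next
            case False
            then obtain i :: nat where i: "?u = real i / 2 ^ n" using lastg_in[of n "lam t"] by (auto simp: grid_def)
            then have "real i < real_of_int \<lceil>\<tau> * 2 ^ n\<rceil>" using uh unfolding h_def by (simp add: divide_less_cancel)
            then have "int i < \<lceil>\<tau> * 2 ^ n\<rceil>" by (metis of_int_less_iff of_int_of_nat_eq)
            then have "real i < \<tau> * 2 ^ n" by (simp add: less_ceiling_iff)
            then show ?thesis unfolding i by (simp add: field_simps)
          qed
          then show False using tu by simp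
        qed
      qed
      have "x (min t ?u) = x (max t ?u)"
      proof (rule S(3))
        show "S \<inter> {min t ?u<..max t ?u} = {}"
        proof (intro equals0I)
          fix \<tau> assume "\<tau> \<in> S \<inter> {min t ?u<..max t ?u}"
          then show False using sep[of \<tau>] by (auto simp: min_def max_def split: if_splits)
        qed
      qed (use t u lt1 in \<open>auto simp: min_def max_def\<close>)
      then show ?thesis unfolding disc_def by (auto simp: min_def max_def split: if_splits)
    qed
    then show "\<exists>lam. time_change lam \<and>
      (\<forall>t\<in>{0..real K}. \<bar>lam t - t\<bar> < 1 / real (Suc K) \<and> disc n x (lam t) = x t)"
      using lam(1,3) dn(2) by (intro exI[of _ lam]) (auto intro: le_less_trans)
  qed
qed

context jump_model begin

subsection \<open>Measurability of test functions of random graphs\<close>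

text \<open>A random graph is replaced by the representative of the first cell that contains it: a
  measurable choice among countably many deterministic graphs.\<close>

lemma cells:
  assumes e: "0 < \<epsilon>"
  shows "\<exists>(q :: ('e, 'k \<times> int) mgraph \<Rightarrow> nat) c. q \<in> measurable (graphM borel borel) (count_space UNIV) \<and>
     (\<forall>G. W G \<longrightarrow> W (c (q G)) \<and> close_on m \<epsilon> G (c (q G)) id)"
proof -
  obtain A :: "nat \<Rightarrow> ('e, 'k \<times> int) mgraph set" where A: "\<And>n. A n \<in> sets (graphM borel borel)"
     "\<And>G. W G \<Longrightarrow> \<exists>n. G \<in> A n" "\<And>n G H. G \<in> A n \<Longrightarrow> H \<in> A n \<Longrightarrow> close_on m \<epsilon> G H id"
    using countable_cell_cover[OF e, of "init_ok Xs" m] by (metis (no_types, lifting))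
  define q where "q G = (LEAST n. G \<in> A n)" for G
  define c where "c n = (SOME H. H \<in> A n \<and> W H)" for n
  have "q \<in> measurable (graphM borel borel) (count_space UNIV)"
    unfolding q_def using A(1) by (intro measurable_Least) (auto simp: pred_def)
  moreover have "W (c (q G)) \<and> close_on m \<epsilon> G (c (q G)) id" if "W G" for G
  proof -
    have "G \<in> A (q G)" unfolding q_def using A(2)[OF that] by (rule LeastI_ex)
    moreover from this have "c (q G) \<in> A (q G) \<and> W (c (q G))" unfolding c_def using that by (intro someI[of "\<lambda>H. H \<in> A (q G) \<and> W H"]) simp
    ultimately show ?thesis using A(3) by blast
  qed
  ultimately show ?thesis by blast
qed

lemma wf_sol_graph: "W H \<Longrightarrow> paths_on (verts H) x \<Longrightarrow> wf_graph (path_ok Xs) (sol_graph H x)"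
  unfolding wf_graph_def sol_graph_def path_ok_def mgraph.select_convs snd_conv
  by (elim conjE, intro conjI; assumption)

text \<open>Paths at labels that are not vertices are junk, so measurability is asked on the event
  that \<open>v\<close> is a vertex.\<close>

definition meas_paths :: "'w measure \<Rightarrow> ('w \<Rightarrow> ('e, 'k \<times> int) mgraph) \<Rightarrow> ('w \<Rightarrow> nat \<Rightarrow> path) \<Rightarrow> bool" where
  "meas_paths M G X \<longleftrightarrow> (\<forall>\<omega>\<in>space M. paths_on (verts (G \<omega>)) (X \<omega>)) \<and>
     (\<forall>v t i. 0 \<le> t \<longrightarrow> {\<omega> \<in> space M. v \<in> verts (G \<omega>) \<and> X \<omega> v t = i} \<in> sets M)"

lemma ballv_close_id:
  assumes "close_on m \<epsilon> G H id" "r \<le> m"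
  shows "ballv (edges H) (root H) r = ballv (edges G) (root G) r"
  using close_on_mono[OF assms order_refl] by (auto simp: close_on_def rooted_iso_def bij_betw_def)

lemma close_on_dist:
  assumes "close_on m \<epsilon> G H \<phi>"
  shows "v \<in> ballv (edges G) (root G) m \<Longrightarrow> dist (fst (vmark H (\<phi> v))) (fst (vmark G v)) \<le> \<epsilon>"
    and "v \<in> ballv (edges G) (root G) m \<Longrightarrow> snd (vmark H (\<phi> v)) = snd (vmark G v)"
    and "e \<in> induced_edges (edges G) (ballv (edges G) (root G) m) \<Longrightarrow> dist (emark H (\<phi> ` e)) (emark G e) \<le> \<epsilon>"
    and "rooted_iso \<phi> (ballv (edges G) (root G) m) (edges G) (root G) (ballv (edges H) (root H) m) (edges H) (root H)"
  using assms unfolding close_on_def by blast+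

text \<open>The common form of three limits: cell representatives with discretised paths, Picard
  iterates on a fixed graph, and iterates on near-maximisers of the envelope.\<close>

lemma sol_local_conv:
  assumes wf: "W G"
    and close: "\<And>r. \<forall>\<^sub>F n in sequentially. r \<le> R n \<and> close_on (R n) (\<epsilon> n) G (H n) (\<phi> n)" and e: "\<epsilon> \<longlonglongrightarrow> 0"
    and path: "\<And>v. v \<in> verts G \<Longrightarrow> skor_conv (\<lambda>n. Y n (\<phi> n v)) (X v)"
  shows "local_conv path_mconv (\<lambda>n. sol_graph (H n) (Y n)) (sol_graph G X)"
  unfolding local_conv_def
proof
  fix r :: nat
  let ?B = "ballv (edges G) (root G) r"
  obtain n0 where n0: "\<And>n. n0 \<le> n \<Longrightarrow> r \<le> R n \<and> close_on (R n) (\<epsilon> n) G (H n) (\<phi> n)"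
    using close[of r] unfolding eventually_sequentially by blast
  have c: "close_on r (\<epsilon> n) G (H n) (\<phi> n)" if "n0 \<le> n" for n using n0[OF that] close_on_mono by blast
  have lim: "(\<lambda>n. f n) \<longlonglongrightarrow> l" if "\<And>n. n0 \<le> n \<Longrightarrow> dist (f n) l \<le> \<epsilon> n" for f :: "nat \<Rightarrow> 'z::metric_space" and l
  proof (rule tendstoI)
    fix d :: real assume "0 < d"
    then have "\<forall>\<^sub>F n in sequentially. \<epsilon> n < d" using e by (intro order_tendstoD) auto
    moreover have "\<forall>\<^sub>F n in sequentially. n0 \<le> n" by (rule eventually_ge_at_top)
    ultimately show "\<forall>\<^sub>F n in sequentially. dist (f n) l < d" by eventually_elim (use that in \<open>auto intro: le_less_trans\<close>)
  qed
  show "\<exists>\<phi> n0. (\<forall>n>n0. rooted_iso (\<phi> n) (ballv (edges (sol_graph G X)) (root (sol_graph G X)) r) (edges (sol_graph G X)) (root (sol_graph G X))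
         (ballv (edges (sol_graph (H n) (Y n))) (root (sol_graph (H n) (Y n))) r) (edges (sol_graph (H n) (Y n))) (root (sol_graph (H n) (Y n)))) \<and>
     (\<forall>v\<in>ballv (edges (sol_graph G X)) (root (sol_graph G X)) r. path_mconv (\<lambda>n. vmark (sol_graph (H n) (Y n)) (\<phi> n v)) (vmark (sol_graph G X) v)) \<and>
     (\<forall>e\<in>induced_edges (edges (sol_graph G X)) (ballv (edges (sol_graph G X)) (root (sol_graph G X)) r).
        (\<lambda>n. emark (sol_graph (H n) (Y n)) (\<phi> n ` e)) \<longlonglongrightarrow> emark (sol_graph G X) e)"
    unfolding sol_graph_def mgraph.select_convs path_mconv_def fst_conv snd_conv
  proof (intro exI[of _ \<phi>] exI[of _ n0] conjI allI impI ballI)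
    show "rooted_iso (\<phi> n) ?B (edges G) (root G) (ballv (edges (H n)) (root (H n)) r) (edges (H n)) (root (H n))" if "n0 < n" for n
      using close_on_dist(4)[OF c] that by simp
    fix v assume v: "v \<in> ?B"
    show "(\<lambda>n. fst (vmark (H n) (\<phi> n v))) \<longlonglongrightarrow> fst (vmark G v)"
      by (rule lim) (rule close_on_dist(1)[OF c v])
    show "skor_conv (\<lambda>n. Y n (\<phi> n v)) (X v)" using path wf_ballv_verts[OF wf] v by blast
  next
    fix d assume "d \<in> induced_edges (edges G) ?B"
    then show "(\<lambda>n. emark (H n) (\<phi> n ` d)) \<longlonglongrightarrow> emark G d" by (intro lim close_on_dist(3)[OF c])
  qed
qed

lemma test_fun_conv:
  assumes "test_fun ok mconv f" "\<And>n. wf_graph ok (Gs n)" "wf_graph ok G" "local_conv mconv Gs G"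
  shows "(\<lambda>n. f (Gs n)) \<longlonglongrightarrow> f G"
  using assms unfolding test_fun_def by blast

text \<open>On each label the value is a function of finitely many integers, hence of countably many
  configurations. Therefore \<open>F\<close> may be completely arbitrary.\<close>

lemma measurable_countable_label:
  assumes q: "q \<in> measurable M (count_space UNIV)"
    and h: "\<And>n::nat. \<exists>D F (Z :: 'w \<Rightarrow> 'd \<Rightarrow> int). finite D \<and> (\<forall>\<omega>\<in>space M. q \<omega> = n \<longrightarrow> h \<omega> = (F (restrict (Z \<omega>) D) :: real)) \<and>
       (\<forall>d\<in>D. \<forall>i. {\<omega> \<in> space M. q \<omega> = n \<and> Z \<omega> d = i} \<in> sets M)"
  shows "h \<in> borel_measurable M"
proof -
  have "(\<lambda>\<omega>. (\<lambda>n \<omega>. if q \<omega> = n then h \<omega> else 0) (q \<omega>) \<omega>) \<in> borel_measurable M"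
  proof (rule measurable_compose_countable[where f="\<lambda>n \<omega>. if q \<omega> = n then h \<omega> else 0" and g=q, OF _ q])
    fix n
    obtain D F and Z :: "'w \<Rightarrow> 'd \<Rightarrow> int" where D: "finite D" and F: "\<And>\<omega>. \<omega> \<in> space M \<Longrightarrow> q \<omega> = n \<Longrightarrow> h \<omega> = F (restrict (Z \<omega>) D)"
      and Z: "\<And>d i. d \<in> D \<Longrightarrow> {\<omega> \<in> space M. q \<omega> = n \<and> Z \<omega> d = i} \<in> sets M" using h[of n] by blast
    have qn: "{\<omega> \<in> space M. q \<omega> = n} \<in> sets M" using measurable_sets[OF q, of "{n}"] by (simp add: vimage_def Int_def conj_commute)
    show "(\<lambda>\<omega>. if q \<omega> = n then h \<omega> else 0) \<in> borel_measurable M"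
    proof (rule measurableI)
      fix B :: "real set" assume B: "B \<in> sets borel"
      let ?K = "{z \<in> D \<rightarrow>\<^sub>E (UNIV :: int set). F z \<in> B}"
      have "countable (D \<rightarrow>\<^sub>E (UNIV :: int set))" using D by (intro countable_PiE) auto
      then have cK: "countable ?K" by (rule countable_subset[rotated]) auto
      have "(\<lambda>\<omega>. if q \<omega> = n then h \<omega> else 0) -` B \<inter> space M =
        (\<Union>z\<in>?K. {\<omega> \<in> space M. q \<omega> = n} \<inter> {\<omega> \<in> space M. \<forall>d\<in>D. q \<omega> = n \<and> Z \<omega> d = z d}) \<union> (if 0 \<in> B then space M - {\<omega> \<in> space M. q \<omega> = n} else {})"
      proof (intro equalityI subsetI)
        fix \<omega> assume a: "\<omega> \<in> (\<lambda>\<omega>. if q \<omega> = n then h \<omega> else 0) -` B \<inter> space M"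
        show "\<omega> \<in> (\<Union>z\<in>?K. {\<omega> \<in> space M. q \<omega> = n} \<inter> {\<omega> \<in> space M. \<forall>d\<in>D. q \<omega> = n \<and> Z \<omega> d = z d}) \<union> (if 0 \<in> B then space M - {\<omega> \<in> space M. q \<omega> = n} else {})"
        proof (cases "q \<omega> = n")
          case True
          then have "restrict (Z \<omega>) D \<in> ?K" using a F[of \<omega>] by auto
          moreover have "\<omega> \<in> {\<omega> \<in> space M. q \<omega> = n} \<inter> {\<omega>' \<in> space M. \<forall>d\<in>D. q \<omega>' = n \<and> Z \<omega>' d = restrict (Z \<omega>) D d}" using a True by auto
          ultimately show ?thesis by blast
        qed (use a in auto)
      next
        fix \<omega> assume "\<omega> \<in> (\<Union>z\<in>?K. {\<omega> \<in> space M. q \<omega> = n} \<inter> {\<omega> \<in> space M. \<forall>d\<in>D. q \<omega> = n \<and> Z \<omega> d = z d}) \<union> (if 0 \<in> B then space M - {\<omega> \<in> space M. q \<omega> = n} else {})"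
        then consider z where "z \<in> ?K" "\<omega> \<in> space M" "q \<omega> = n" "\<forall>d\<in>D. Z \<omega> d = z d" | "0 \<in> B" "\<omega> \<in> space M" "q \<omega> \<noteq> n"
          by (auto split: if_splits)
        then show "\<omega> \<in> (\<lambda>\<omega>. if q \<omega> = n then h \<omega> else 0) -` B \<inter> space M"
        proof cases
          case 1
          then have "restrict (Z \<omega>) D = z" by (auto simp: fun_eq_iff PiE_def extensional_def)
          then show ?thesis using 1 F[of \<omega>] by simp
        qed simp
      qed
      moreover have "\<dots> \<in> sets M"
        using cK qn Z D by (intro sets.Un sets.countable_UN' sets.Int sets.sets_Collect_finite_All) auto
      ultimately show "(\<lambda>\<omega>. if q \<omega> = n then h \<omega> else 0) -` B \<inter> space M \<in> sets M" by simp
    qed simp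
  qed
  then show ?thesis by simp
qed

text \<open>A test function is assumed continuous along sequences, not measurable. It is the
  pointwise limit of its values at cell representatives with discretised paths, and these values
  depend on a countable label and finitely many integers.\<close>

lemma test_sol_measurable:
  assumes f: "test_fun (path_ok Xs) path_mconv f"
    and G: "G \<in> measurable M (graphM borel borel)" "\<And>\<omega>. \<omega> \<in> space M \<Longrightarrow> W (G \<omega>)"
    and X: "meas_paths M G X"
  shows "(\<lambda>\<omega>. f (sol_graph (G \<omega>) (X \<omega>))) \<in> borel_measurable M"
proof -
  have "\<forall>m::nat. \<exists>qc. fst qc \<in> measurable (graphM borel borel) (count_space UNIV) \<and>
     (\<forall>G. W G \<longrightarrow> W (snd qc (fst qc G :: nat)) \<and> close_on m (1 / real (Suc m)) G (snd qc (fst qc G)) id)"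
  proof
    fix m :: nat
    obtain q c where "q \<in> measurable (graphM borel borel) (count_space UNIV) \<and>
     (\<forall>G. W G \<longrightarrow> W (c (q G :: nat)) \<and> close_on m (1 / real (Suc m)) G (c (q G)) id)" using cells[of "1 / real (Suc m)" m] by auto
    then show "\<exists>qc. fst qc \<in> measurable (graphM borel borel) (count_space UNIV) \<and>
     (\<forall>G. W G \<longrightarrow> W (snd qc (fst qc G :: nat)) \<and> close_on m (1 / real (Suc m)) G (snd qc (fst qc G)) id)"
      by (intro exI[of _ "(q, c)"]) simp
  qed
  from choice[OF this] obtain qc :: "nat \<Rightarrow> (('e, 'k \<times> int) mgraph \<Rightarrow> nat) \<times> (nat \<Rightarrow> ('e, 'k \<times> int) mgraph)"
    where qc: "\<And>m. fst (qc m) \<in> measurable (graphM borel borel) (count_space UNIV)"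
     "\<And>m G. W G \<Longrightarrow> W (snd (qc m) (fst (qc m) G))" "\<And>m G. W G \<Longrightarrow> close_on m (1 / real (Suc m)) G (snd (qc m) (fst (qc m) G)) id"
    by blast
  define cc where "cc m \<omega> = snd (qc m) (fst (qc m) (G \<omega>))" for m \<omega>
  define Bl where "Bl m H = ballv (edges H) (root H) m" for m and H :: "('e, 'k \<times> int) mgraph"
  define Y where "Y m H z v = (if v \<in> Bl m H then disc m (z v) else (\<lambda>_. snd (vmark H v)))" for m and H :: "('e, 'k \<times> int) mgraph" and z :: "nat \<Rightarrow> path" and v
  have cW: "W (cc m \<omega>)" "close_on m (1 / real (Suc m)) (G \<omega>) (cc m \<omega>) id" if "\<omega> \<in> space M" for m \<omega>
    using qc(2,3)[OF G(2)[OF that]] by (auto simp: cc_def)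
  have Bsub: "Bl m (cc m \<omega>) \<subseteq> verts (G \<omega>)" if "\<omega> \<in> space M" for m \<omega>
    using ballv_close_id[OF cW(2)[OF that] order_refl] wf_ballv_verts[OF G(2)[OF that]] by (simp add: Bl_def)
  have XD: "Dpath Xs (X \<omega> v)" if "\<omega> \<in> space M" "v \<in> verts (G \<omega>)" for \<omega> v using X that by (simp add: meas_paths_def)
  show ?thesis
  proof (rule borel_measurable_LIMSEQ_real)
    fix \<omega> assume w: "\<omega> \<in> space M"
    show "(\<lambda>m. f (sol_graph (cc m \<omega>) (Y m (cc m \<omega>) (X \<omega>)))) \<longlonglongrightarrow> f (sol_graph (G \<omega>) (X \<omega>))"
    proof (rule test_fun_conv[OF f])
      show "wf_graph (path_ok Xs) (sol_graph (cc m \<omega>) (Y m (cc m \<omega>) (X \<omega>)))" for m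
      proof (rule wf_sol_graph[OF cW(1)[OF w]])
        show "paths_on (verts (cc m \<omega>)) (Y m (cc m \<omega>) (X \<omega>))"
          using Bsub[OF w, of m] XD[OF w] init_in_Xs[OF cW(1)[OF w], of _ m] by (auto simp: Y_def intro!: disc_Dpath Dpath_const)
      qed
      show "wf_graph (path_ok Xs) (sol_graph (G \<omega>) (X \<omega>))" using wf_sol_graph[OF G(2)[OF w]] XD[OF w] by blast
      show "local_conv path_mconv (\<lambda>m. sol_graph (cc m \<omega>) (Y m (cc m \<omega>) (X \<omega>))) (sol_graph (G \<omega>) (X \<omega>))"
      proof (rule sol_local_conv[OF G(2)[OF w], where R="\<lambda>m. m" and \<epsilon>="\<lambda>m. 1 / real (Suc m)" and \<phi>="\<lambda>_. id"])
        show "\<forall>\<^sub>F n in sequentially. r \<le> n \<and> close_on n (1 / real (Suc n)) (G \<omega>) (cc n \<omega>) id" for r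
          using eventually_ge_at_top[of r] by eventually_elim (use cW(2)[OF w] in simp)
        show "(\<lambda>m. 1 / real (Suc m)) \<longlonglongrightarrow> 0" by (rule LIMSEQ_inverse_real_of_nat[unfolded inverse_eq_divide])
        fix v assume v: "v \<in> verts (G \<omega>)"
        then obtain r where r: "v \<in> ballv (edges (G \<omega>)) (root (G \<omega>)) r" using wf_verts_ballv[OF G(2)[OF w]] by blast
        have "\<forall>\<^sub>F n in sequentially. Y n (cc n \<omega>) (X \<omega>) (id v) = disc n (X \<omega> v)"
          using eventually_ge_at_top[of r]
        proof eventually_elim
          case (elim n)
          have "v \<in> Bl n (cc n \<omega>)" using r ballv_mono[OF elim, of "edges (G \<omega>)" "root (G \<omega>)"]
              ballv_close_id[OF cW(2)[OF w, of n] order_refl] by (auto simp: Bl_def)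
          then show ?case by (simp add: Y_def)
        qed
        with disc_skor_conv[OF XD[OF w v]] show "skor_conv (\<lambda>n. Y n (cc n \<omega>) (X \<omega>) (id v)) (X \<omega> v)"
          by (rule skor_conv_cong)
      qed
    qed
  next
    fix m
    let ?q = "\<lambda>\<omega>. fst (qc m) (G \<omega>)"
    show "(\<lambda>\<omega>. f (sol_graph (cc m \<omega>) (Y m (cc m \<omega>) (X \<omega>)))) \<in> borel_measurable M"
    proof (rule measurable_countable_label[where q="?q" and 'd="nat \<times> real"])
      show qm: "?q \<in> measurable M (count_space UNIV)" by (rule measurable_compose[OF G(1) qc(1)])
      fix n
      let ?c = "snd (qc m) n"
      \<comment> \<open>A label that is not attained may have an ill-formed representative with an
        infinite ball; for it \<open>D\<close> is empty.\<close>
      define D where "D = (if \<exists>\<omega>\<in>space M. ?q \<omega> = n then Bl m ?c else {}) \<times> insert 0 (grid m)"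
      define F where "F z = f (sol_graph ?c (\<lambda>v. if v \<in> Bl m ?c then (\<lambda>t. z (v, lastg m t)) else (\<lambda>_. snd (vmark ?c v))))" for z :: "nat \<times> real \<Rightarrow> int"
      have "finite D"
      proof (cases "\<exists>\<omega>\<in>space M. ?q \<omega> = n")
        case True
        then obtain \<omega> where "\<omega> \<in> space M" "?q \<omega> = n" by blast
        then have "W ?c" using cW(1)[of \<omega> m] by (simp add: cc_def)
        then have "finite (Bl m ?c)" unfolding Bl_def by (rule wf_finite_ballv)
        then show ?thesis unfolding D_def using grid_finite by simp
      qed (simp add: D_def)
      moreover have "f (sol_graph (cc m \<omega>) (Y m (cc m \<omega>) (X \<omega>))) = F (restrict (\<lambda>(v, s). X \<omega> v s) D)"
        if w: "\<omega> \<in> space M" "?q \<omega> = n" for \<omega>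
      proof -
        have c: "cc m \<omega> = ?c" using w by (simp add: cc_def)
        have "Y m ?c (X \<omega>) v = (if v \<in> Bl m ?c then (\<lambda>t. restrict (\<lambda>(v, s). X \<omega> v s) D (v, lastg m t)) else (\<lambda>_. snd (vmark ?c v)))" for v
          using w lastg_in by (auto simp: Y_def D_def disc_def fun_eq_iff)
        then have "Y m ?c (X \<omega>) = (\<lambda>v. if v \<in> Bl m ?c then (\<lambda>t. restrict (\<lambda>(v, s). X \<omega> v s) D (v, lastg m t)) else (\<lambda>_. snd (vmark ?c v)))"
          by (rule ext)
        then show ?thesis unfolding c F_def by simp
      qed
      moreover have "{\<omega> \<in> space M. ?q \<omega> = n \<and> (case d of (v, s) \<Rightarrow> X \<omega> v s) = i} \<in> sets M" if d: "d \<in> D" for d i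
      proof -
        obtain v s where vs: "d = (v, s)" "v \<in> Bl m ?c" "s \<in> insert 0 (grid m)" using d by (auto simp: D_def split: if_splits)
        then have s0: "0 \<le> s" by (auto simp: grid_def)
        have "v \<in> verts (G \<omega>)" if "\<omega> \<in> space M" "?q \<omega> = n" for \<omega> using Bsub[OF that(1), of m] that vs by (auto simp: cc_def)
        then have "{\<omega> \<in> space M. ?q \<omega> = n \<and> (case d of (v, s) \<Rightarrow> X \<omega> v s) = i} =
           (?q -` {n} \<inter> space M) \<inter> {\<omega> \<in> space M. v \<in> verts (G \<omega>) \<and> X \<omega> v s = i}" by (auto simp: vs)
        moreover have "{\<omega> \<in> space M. v \<in> verts (G \<omega>) \<and> X \<omega> v s = i} \<in> sets M" using X s0 by (simp add: meas_paths_def)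
        ultimately show ?thesis using measurable_sets[OF qm, of "{n}"] by simp
      qed
      ultimately show "\<exists>D F (Z :: _ \<Rightarrow> nat \<times> real \<Rightarrow> int). finite D \<and> (\<forall>\<omega>\<in>space M. ?q \<omega> = n \<longrightarrow> f (sol_graph (cc m \<omega>) (Y m (cc m \<omega>) (X \<omega>))) = (F (restrict (Z \<omega>) D) :: real)) \<and>
       (\<forall>d\<in>D. \<forall>i. {\<omega> \<in> space M. ?q \<omega> = n \<and> Z \<omega> d = i} \<in> sets M)"
        by (intro exI[of _ D] exI[of _ F] exI[of _ "\<lambda>\<omega> (v, s). X \<omega> v s"]) blast
    qed
  qed
qed

subsection \<open>Measurability of the Picard iterates and of dependency chains\<close>

text \<open>The generators of \<open>pathM\<close> include negative times, where a path takes its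
  value at 0.\<close>

lemma pathM_I:
  assumes D: "\<And>z. z \<in> space Z \<Longrightarrow> Dpath Xs (x z)"
    and m: "\<And>t i. 0 \<le> t \<Longrightarrow> {z \<in> space Z. x z t = i} \<in> sets Z"
  shows "x \<in> measurable Z pathM"
  unfolding pathM_def
proof (rule measurable_measure_of)
  fix y assume "y \<in> {{x :: path. x t = i} | t i. True}"
  then obtain t i where y: "y = {x. x t = i}" by blast
  have "x -` y \<inter> space Z = {z \<in> space Z. x z (max 0 t) = i}"
    using D by (cases "0 \<le> t") (auto simp: y Dpath_def max_def)
  then show "x -` y \<inter> space Z \<in> sets Z" using m[of "max 0 t" i] by simp
qed auto

lemma rbar_measurable:
  assumes R: "radius1 (U, EU, v)" and j: "j \<in> J"
    and s: "s \<in> borel_measurable Z" "\<And>z. z \<in> space Z \<Longrightarrow> 0 \<le> s z"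
    and D: "\<And>z u. z \<in> space Z \<Longrightarrow> u \<in> U \<Longrightarrow> Dpath Xs (x z u)"
    and x: "\<And>u t i. u \<in> U \<Longrightarrow> 0 \<le> t \<Longrightarrow> {z \<in> space Z. x z u t = i} \<in> sets Z"
    and eb: "\<And>e. e \<in> EU \<Longrightarrow> (\<lambda>z. eb z e) \<in> borel_measurable Z"
    and kap: "\<And>u. u \<in> U \<Longrightarrow> (\<lambda>z. kap z u) \<in> borel_measurable Z"
  shows "(\<lambda>z. rbar j (U, EU, v) (s z) (restrict (x z) U) (restrict (eb z) EU) (restrict (kap z) U)) \<in> borel_measurable Z"
proof -
  let ?P = "borel \<Otimes>\<^sub>M (PiM U (\<lambda>_. pathM) \<Otimes>\<^sub>M (PiM EU (\<lambda>_. borel :: 'e measure) \<Otimes>\<^sub>M PiM U (\<lambda>_. borel :: 'k measure)))"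
  let ?S = "{(t, x, eb, k). 0 \<le> (t::real) \<and> (\<forall>u\<in>U. Dpath Xs (x u))} :: (real \<times> (nat \<Rightarrow> path) \<times> (nat set \<Rightarrow> 'e) \<times> (nat \<Rightarrow> 'k)) set"
  have 1: "(\<lambda>(t, x, eb, k). rbar j (U, EU, v) t x eb k) \<in> borel_measurable (restrict_space ?P ?S)"
    using standing[unfolded standing_rates_def, rule_format, OF j R, THEN conjunct2, THEN conjunct1] .
  have xm: "(\<lambda>z. restrict (x z) U) \<in> measurable Z (PiM U (\<lambda>_. pathM))"
    by (rule measurable_restrict) (intro pathM_I D x)
  have em: "(\<lambda>z. restrict (eb z) EU) \<in> measurable Z (PiM EU (\<lambda>_. borel))"
    by (rule measurable_restrict) (rule eb)
  have km: "(\<lambda>z. restrict (kap z) U) \<in> measurable Z (PiM U (\<lambda>_. borel))"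
    by (rule measurable_restrict) (rule kap)
  have "(\<lambda>z. (s z, restrict (x z) U, restrict (eb z) EU, restrict (kap z) U)) \<in> measurable Z (restrict_space ?P ?S)"
  proof (rule measurable_restrict_space2)
    show "(\<lambda>z. (s z, restrict (x z) U, restrict (eb z) EU, restrict (kap z) U)) \<in> space Z \<rightarrow> ?S"
      using s(2) D by auto
    show "(\<lambda>z. (s z, restrict (x z) U, restrict (eb z) EU, restrict (kap z) U)) \<in> measurable Z ?P"
      by (intro measurable_Pair s(1) xm em km)
  qed
  from measurable_compose[OF this 1] show ?thesis by simp
qed

text \<open>On this event the rates at \<open>v\<close> are given by one fixed member of the family
  \<open>rbar\<close>, whose joint measurability is assumed.\<close>

definition loc :: "('w \<Rightarrow> ('e, 'k \<times> int) mgraph) \<Rightarrow> nat \<Rightarrow> nat set \<Rightarrow> nat set set \<Rightarrow> 'w \<Rightarrow> bool" where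
  "loc G v U EU \<omega> \<longleftrightarrow> v \<in> verts (G \<omega>) \<and> clos (edges (G \<omega>)) v = U \<and> induced_edges (edges (G \<omega>)) U = EU"

lemma loc_sets:
  assumes G: "G \<in> measurable M (graphM borel borel)" and U: "finite U"
  shows "{\<omega> \<in> space M. loc G v U EU \<omega>} \<in> sets M"
proof -
  have "Measurable.pred (graphM borel borel) (\<lambda>H :: ('e, 'k \<times> int) mgraph. v \<in> verts H \<and> clos (edges H) v = U \<and> induced_edges (edges H) U = EU)"
    by (rule pred_intros_logic(3)[OF graphM_pred(1) pred_intros_logic(3)[OF pred_clos_eq pred_induced_eq[OF U]]])
  from measurable_compose[OF G this] show ?thesis by (simp add: loc_def pred_def)
qed

lemma loc_radius1: "W (G \<omega>) \<Longrightarrow> loc G v U EU \<omega> \<Longrightarrow> radius1 (U, EU, v)"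
  using wf_radius1[of "init_ok Xs" "G \<omega>" v] by (auto simp: loc_def)

lemma loc_rate: "loc G v U EU \<omega> \<Longrightarrow> rate rbar j (edges (G \<omega>)) eb kap v s y =
   rbar j (U, EU, v) s (restrict y U) (restrict eb EU) (restrict kap U)"
  by (auto simp: loc_def rate_def Let_def)

text \<open>A finite neighbourhood with its induced edges has countably many possible values, so
  measurability may be checked on one value at a time.\<close>

lemma loc_decompose:
  assumes G: "G \<in> measurable M (graphM borel borel)" "\<And>\<omega>. \<omega> \<in> space M \<Longrightarrow> W (G \<omega>)"
    and P: "\<And>U EU. finite U \<Longrightarrow> finite EU \<Longrightarrow> {\<omega> \<in> space M. loc G v U EU \<omega> \<and> P \<omega>} \<in> sets M"
  shows "{\<omega> \<in> space M. v \<in> verts (G \<omega>) \<and> P \<omega>} \<in> sets M"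
proof -
  let ?K = "{U :: nat set. finite U} \<times> {F :: nat set set. finite F \<and> F \<subseteq> {e. finite e}}"
  have cK: "countable ?K" by (intro countable_SIGMA countable_Collect_finite countable_Collect_finite_subset)
  have "{\<omega> \<in> space M. v \<in> verts (G \<omega>) \<and> P \<omega>} = (\<Union>(U, EU)\<in>?K. {\<omega> \<in> space M. loc G v U EU \<omega> \<and> P \<omega>})"
  proof (intro equalityI subsetI)
    fix \<omega> assume a: "\<omega> \<in> {\<omega> \<in> space M. v \<in> verts (G \<omega>) \<and> P \<omega>}"
    let ?U = "clos (edges (G \<omega>)) v"
    have fU: "finite ?U" using a G(2) wf_finite_clos by blast
    have "(?U, induced_edges (edges (G \<omega>)) ?U) \<in> ?K"
      using fU finite_induced[OF fU, of "edges (G \<omega>)"] finite_subset[OF _ fU] by (auto simp: induced_edges_def)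
    moreover have "loc G v ?U (induced_edges (edges (G \<omega>)) ?U) \<omega>" using a by (simp add: loc_def)
    ultimately show "\<omega> \<in> (\<Union>(U, EU)\<in>?K. {\<omega> \<in> space M. loc G v U EU \<omega> \<and> P \<omega>})" using a by blast
  next
    fix \<omega> assume "\<omega> \<in> (\<Union>(U, EU)\<in>?K. {\<omega> \<in> space M. loc G v U EU \<omega> \<and> P \<omega>})"
    then show "\<omega> \<in> {\<omega> \<in> space M. v \<in> verts (G \<omega>) \<and> P \<omega>}" by (auto simp: loc_def)
  qed
  also have "\<dots> \<in> sets M" using P by (intro sets.countable_UN' cK) auto
  finally show ?thesis .
qed

lemma emark_meas: "G \<in> measurable M (graphM borel borel) \<Longrightarrow> (\<lambda>\<omega>. emark (G \<omega>) e) \<in> borel_measurable M"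
  by (rule measurable_compose[OF _ measurable_emark])

lemma vmark_fst_meas:
  fixes G :: "'w \<Rightarrow> ('e, 'k \<times> int) mgraph"
  assumes "G \<in> measurable M (graphM borel borel)" shows "(\<lambda>\<omega>. fst (vmark (G \<omega>) v)) \<in> borel_measurable M"
proof (rule measurable_compose[OF measurable_compose[OF assms measurable_vmark]])
  show "fst \<in> borel_measurable (borel :: ('k \<times> int) measure)" by (intro borel_measurable_continuous_onI continuous_intros)
qed

lemma vmark_snd_meas:
  fixes G :: "'w \<Rightarrow> ('e, 'k \<times> int) mgraph"
  assumes "G \<in> measurable M (graphM borel borel)" shows "{\<omega> \<in> space M. snd (vmark (G \<omega>) v) = i} \<in> sets M"
proof -
  have "snd -` {i} \<in> sets (borel :: ('k \<times> int) measure)"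
  proof (rule borel_open)
    have "(snd -` {i} :: ('k \<times> int) set) = UNIV \<times> {i}" by auto
    then show "open (snd -` {i} :: ('k \<times> int) set)"
      by (simp only:) (intro open_Times open_UNIV discrete_topology_class.open_discrete)
  qed
  from measurable_sets[OF measurable_compose[OF assms measurable_vmark] this, of v]
  show ?thesis by (simp add: vimage_def Int_def conj_commute)
qed

text \<open>On the event \<open>loc\<close> the condition that a mark is used is jointly measurable
  in outcome and mark, so the jumps form a section sum to which
  \<open>section_sum_measurable\<close> applies.\<close>

lemma upd_meas:
  assumes G: "G \<in> measurable M (graphM borel borel)" "\<And>\<omega>. \<omega> \<in> space M \<Longrightarrow> W (G \<omega>)"
    and eta: "\<And>v. (\<lambda>\<omega>. \<eta> \<omega> v) \<in> measurable M (nsp pm)" and X: "meas_paths M G X"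
  shows "meas_paths M G (\<lambda>\<omega>. upd (G \<omega>) (\<eta> \<omega>) (X \<omega>))"
  unfolding meas_paths_def
proof (intro conjI ballI allI impI)
  have XD: "paths_on (verts (G \<omega>)) (X \<omega>)" if "\<omega> \<in> space M" for \<omega> using X that by (simp add: meas_paths_def)
  show "Dpath Xs (upd (G \<omega>) (\<eta> \<omega>) (X \<omega>) u)" if "\<omega> \<in> space M" "u \<in> verts (G \<omega>)" for \<omega> u
    using upd_Dpath[OF G(2)[OF that(1)] that(2) XD[OF that(1)]] .
  fix v i and t :: real assume t: "0 \<le> t"
  show "{\<omega> \<in> space M. v \<in> verts (G \<omega>) \<and> upd (G \<omega>) (\<eta> \<omega>) (X \<omega>) v t = i} \<in> sets M"
  proof (rule loc_decompose[OF G])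
    fix U :: "nat set" and EU :: "nat set set" assume fin: "finite U" "finite EU"
    define D where "D = {\<omega> \<in> space M. loc G v U EU \<omega>}"
    have Ds: "D \<in> sets M" unfolding D_def by (rule loc_sets[OF G(1) fin(1)])
    let ?R = "restrict_space M D"
    have spR: "space ?R = D" using sets.sets_into_space[OF Ds] by (auto simp: space_restrict_space)
    have DU: "\<omega> \<in> space M" "loc G v U EU \<omega>" "v \<in> verts (G \<omega>)" "U \<subseteq> verts (G \<omega>)" if "\<omega> \<in> D" for \<omega>
      using that wf_clos_verts[OF G(2), of \<omega> v] by (auto simp: D_def loc_def)
    \<comment> \<open>\<open>n\<close> dominates the time and, through (A1), the rate, so
      \<open>tbox n\<close> contains every used mark.\<close>
    obtain n :: nat where n: "max t (C (card U) t) \<le> real n" using real_arch_simple by blast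
    show "{\<omega> \<in> space M. loc G v U EU \<omega> \<and> upd (G \<omega>) (\<eta> \<omega>) (X \<omega>) v t = i} \<in> sets M"
    proof (cases "D = {}")
      case True
      then have "{\<omega> \<in> space M. loc G v U EU \<omega> \<and> upd (G \<omega>) (\<eta> \<omega>) (X \<omega>) v t = i} = {}" by (auto simp: D_def)
      then show ?thesis by (simp only: sets.empty_sets)
    next
      case False
      then obtain \<omega>0 where w0: "\<omega>0 \<in> D" by blast
      have R1: "radius1 (U, EU, v)" by (rule loc_radius1[of G \<omega>0, OF G(2)[OF DU(1)[OF w0]] DU(2)[OF w0]])
      let ?Z = "?R \<Otimes>\<^sub>M pm"
      have spZ: "space ?Z = D \<times> space pm" by (simp only: space_pair_measure spR)
      have rm: "(\<lambda>z. rbar j (U, EU, v) (fst (snd z)) (restrict (X (fst z)) U) (restrict (emark (G (fst z))) EU)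
          (restrict (\<lambda>u. fst (vmark (G (fst z)) u)) U)) \<in> borel_measurable ?Z" if j: "j \<in> J" for j
      proof (rule rbar_measurable[OF R1 j])
        show "(\<lambda>z. fst (snd z)) \<in> borel_measurable ?Z" by (rule measurable_compose[OF measurable_snd pm_fst])
        show "0 \<le> fst (snd z)" if "z \<in> space ?Z" for z using that by (auto simp: space_pair_measure space_pm)
        show "Dpath Xs (X (fst z) u)" if "z \<in> space ?Z" "u \<in> U" for z u
        proof -
          have zD: "fst z \<in> D" using that(1) unfolding spZ by (simp add: mem_Times_iff)
          show ?thesis by (rule bspec[OF XD[OF DU(1)[OF zD]] subsetD[OF DU(4)[OF zD] that(2)]])
        qed
        show "{z \<in> space ?Z. X (fst z) u r = k} \<in> sets ?Z" if u: "u \<in> U" and r: "0 \<le> r" for u r k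
        proof -
          have "{\<omega> \<in> space M. u \<in> verts (G \<omega>) \<and> X \<omega> u r = k} \<in> sets M" using X r by (simp add: meas_paths_def)
          then have "D \<inter> {\<omega> \<in> space M. u \<in> verts (G \<omega>) \<and> X \<omega> u r = k} \<in> sets ?R" by (auto simp: sets_restrict_space)
          then have "(D \<inter> {\<omega> \<in> space M. u \<in> verts (G \<omega>) \<and> X \<omega> u r = k}) \<times> space pm \<in> sets ?Z" by (intro pair_measureI) auto
          also have "(D \<inter> {\<omega> \<in> space M. u \<in> verts (G \<omega>) \<and> X \<omega> u r = k}) \<times> space pm = {z \<in> space ?Z. X (fst z) u r = k}"
            unfolding spZ using DU(1,4) u by fastforce
          finally show ?thesis .
        qed
        show "(\<lambda>z. emark (G (fst z)) e) \<in> borel_measurable ?Z" for e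
          by (rule measurable_compose[OF measurable_fst measurable_restrict_space1[OF emark_meas[OF G(1)]]])
        show "(\<lambda>z. fst (vmark (G (fst z)) u)) \<in> borel_measurable ?Z" for u
          by (rule measurable_compose[OF measurable_fst measurable_restrict_space1[OF vmark_fst_meas[OF G(1)]]])
      qed
      define A where "A = {z \<in> space ?Z. fst (snd z) \<le> t \<and>
         fst (snd (snd z)) \<le> rt (G (fst z)) (snd (snd (snd z))) v (fst (snd z)) (X (fst z))}"
      have As: "A \<in> sets ?Z"
      proof -
        define Aj where "Aj j = {z \<in> space ?Z. fst (snd z) \<le> t \<and> snd (snd (snd z)) = j \<and>
            fst (snd (snd z)) \<le> rbar j (U, EU, v) (fst (snd z)) (restrict (X (fst z)) U) (restrict (emark (G (fst z))) EU)
          (restrict (\<lambda>u. fst (vmark (G (fst z)) u)) U)}" for j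
        have [measurable]: "(\<lambda>z. fst (snd z)) \<in> borel_measurable ?Z" "(\<lambda>z. fst (snd (snd z))) \<in> borel_measurable ?Z"
          "(\<lambda>z. snd (snd (snd z))) \<in> measurable ?Z (count_space UNIV)"
          by (rule measurable_compose[OF measurable_snd pm_fst] measurable_compose[OF measurable_snd pm_fst_snd]
              measurable_compose[OF measurable_snd pm_snd_snd])+
        have "Aj j \<in> sets ?Z" if j: "j \<in> J" for j
        proof -
          note rm[OF j, measurable]
          show ?thesis unfolding Aj_def by measurable
        qed
        then have "(\<Union>j\<in>J. Aj j) \<in> sets ?Z" by (intro sets.countable_UN') auto
        moreover have "A = (\<Union>j\<in>J. Aj j)"
        proof (intro equalityI subsetI)
          fix z assume z: "z \<in> A"
          then have zD: "fst z \<in> D" "snd (snd (snd z)) \<in> J" unfolding A_def mem_Collect_eq spZ by (simp_all add: mem_Times_iff space_pm)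
          show "z \<in> (\<Union>j\<in>J. Aj j)"
            by (rule UN_I[OF zD(2)]) (use z in \<open>simp add: A_def Aj_def loc_rate[OF DU(2)[OF zD(1)]] comp_def\<close>)
        next
          fix z assume "z \<in> (\<Union>j\<in>J. Aj j)"
          then obtain j where z: "z \<in> Aj j" by blast
          then have zD: "fst z \<in> D" unfolding Aj_def mem_Collect_eq spZ by (simp add: mem_Times_iff)
          show "z \<in> A" using z by (simp add: A_def Aj_def loc_rate[OF DU(2)[OF zD]] comp_def)
        qed
        ultimately show ?thesis by simp
      qed
      have etaR: "(\<lambda>\<omega>. \<eta> \<omega> v) \<in> measurable ?R (nsp pm)" by (rule measurable_restrict_space1[OF eta])
      have used: "used_pts rbar (G \<omega>) (clean J (\<eta> \<omega> v)) v t (X \<omega>) = clean J (\<eta> \<omega> v) \<inter> tbox n \<inter> {p. (\<omega>, p) \<in> A}"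
        if w: "\<omega> \<in> D" for \<omega>
      proof -
        have sub: "clean J (\<eta> \<omega> v) \<subseteq> space pm"
          using measurable_space[OF eta DU(1)[OF w], of v] clean_sub[of "\<eta> \<omega> v"] by (simp add: space_nsp)
        have "p \<in> tbox n" if p: "p \<in> clean J (\<eta> \<omega> v)" "fst p \<le> t" "fst (snd p) \<le> rt (G \<omega>) (snd (snd p)) v (fst p) (X \<omega>)" for p
        proof -
          have "rt (G \<omega>) (snd (snd p)) v (fst p) (X \<omega>) \<le> C (card (clos (edges (G \<omega>)) v)) t"
            using clean_pos[OF p(1)] p(2) by (intro rate_le_C[OF G(2)[OF DU(1)[OF w]] DU(3)[OF w] _ XD[OF DU(1)[OF w]]]) auto
          moreover have "clos (edges (G \<omega>)) v = U" using DU(2)[OF w] by (simp add: loc_def)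
          ultimately show ?thesis using p n sub by (auto simp: tbox_def)
        qed
        then show ?thesis unfolding used_pts_def A_def mem_Collect_eq spZ fst_conv snd_conv using sub w
          by (auto dest: clean_pos)
      qed
      have sm: "(\<lambda>\<omega>. \<Sum>p\<in>clean J (\<eta> \<omega> v) \<inter> tbox n \<inter> {p. (\<omega>, p) \<in> A}. snd (snd p)) \<in> measurable ?R (count_space UNIV)"
        by (rule section_sum_measurable[OF etaR As])
      have vm: "(\<lambda>\<omega>. snd (vmark (G \<omega>) v)) \<in> measurable ?R (count_space UNIV)"
      proof (rule measurable_restrict_space1)
        show "(\<lambda>\<omega>. snd (vmark (G \<omega>) v)) \<in> measurable M (count_space UNIV)"
          using vmark_snd_meas[OF G(1), of v] by (simp add: measurable_count_space_eq2_countable vimage_def Int_def conj_commute)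
      qed
      have "(\<lambda>\<omega>. upd (G \<omega>) (\<eta> \<omega>) (X \<omega>) v t) \<in> measurable ?R (count_space UNIV) \<longleftrightarrow>
         (\<lambda>\<omega>. (\<lambda>(a, b). if a + b \<in> Xs then a + b else a) (snd (vmark (G \<omega>) v), \<Sum>p\<in>clean J (\<eta> \<omega> v) \<inter> tbox n \<inter> {p. (\<omega>, p) \<in> A}. snd (snd p))) \<in> measurable ?R (count_space UNIV)"
        by (rule measurable_cong) (simp add: upd_def used spR Let_def)
      moreover have "(\<lambda>\<omega>. (\<lambda>(a, b). if a + b \<in> Xs then a + b else a) (snd (vmark (G \<omega>) v), \<Sum>p\<in>clean J (\<eta> \<omega> v) \<inter> tbox n \<inter> {p. (\<omega>, p) \<in> A}. snd (snd p))) \<in> measurable ?R (count_space UNIV)"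
      proof (rule measurable_compose[where N="count_space UNIV \<Otimes>\<^sub>M count_space UNIV"])
        show "(\<lambda>\<omega>. (snd (vmark (G \<omega>) v), \<Sum>p\<in>clean J (\<eta> \<omega> v) \<inter> tbox n \<inter> {p. (\<omega>, p) \<in> A}. snd (snd p))) \<in> ?R \<rightarrow>\<^sub>M count_space UNIV \<Otimes>\<^sub>M count_space UNIV"
          by (intro measurable_Pair vm sm)
        show "(\<lambda>(a, b). if a + b \<in> Xs then a + b else a) \<in> count_space UNIV \<Otimes>\<^sub>M count_space UNIV \<rightarrow>\<^sub>M count_space UNIV"
          by (simp add: pair_measure_countable)
      qed
      ultimately have um: "(\<lambda>\<omega>. upd (G \<omega>) (\<eta> \<omega>) (X \<omega>) v t) \<in> measurable ?R (count_space UNIV)" by simp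
      have "(\<lambda>\<omega>. upd (G \<omega>) (\<eta> \<omega>) (X \<omega>) v t) -` {i} \<inter> space ?R \<in> sets ?R" using um by (rule measurable_sets) simp
      then have "(\<lambda>\<omega>. upd (G \<omega>) (\<eta> \<omega>) (X \<omega>) v t) -` {i} \<inter> D \<in> sets M"
        using Ds spR by (simp add: sets_restrict_space_iff)
      moreover have "(\<lambda>\<omega>. upd (G \<omega>) (\<eta> \<omega>) (X \<omega>) v t) -` {i} \<inter> D = {\<omega> \<in> space M. loc G v U EU \<omega> \<and> upd (G \<omega>) (\<eta> \<omega>) (X \<omega>) v t = i}"
        by (auto simp: D_def)
      ultimately show ?thesis by simp
    qed
  qed
qed

lemma xit_meas:
  assumes G: "G \<in> measurable M (graphM borel borel)" "\<And>\<omega>. \<omega> \<in> space M \<Longrightarrow> W (G \<omega>)"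
    and eta: "\<And>v. (\<lambda>\<omega>. \<eta> \<omega> v) \<in> measurable M (nsp pm)"
  shows "meas_paths M G (\<lambda>\<omega>. xit (G \<omega>) (\<eta> \<omega>) n)"
proof (induction n)
  case 0
  have "{\<omega> \<in> space M. v \<in> verts (G \<omega>) \<and> snd (vmark (G \<omega>) v) = i} \<in> sets M" for v i
  proof -
    have "{\<omega> \<in> space M. v \<in> verts (G \<omega>) \<and> snd (vmark (G \<omega>) v) = i} = (G -` {H. v \<in> verts H} \<inter> space M) \<inter> {\<omega> \<in> space M. snd (vmark (G \<omega>) v) = i}" by auto
    then show ?thesis using measurable_sets[OF G(1) graphM_verts, of v] vmark_snd_meas[OF G(1), of v i] by simp
  qed
  then show ?case using init_in_Xs[OF G(2)] by (auto simp: meas_paths_def xit_def Dpath_const)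
next
  case (Suc n)
  have "xit H y (Suc n) = upd H y (xit H y n)" for H y by (simp add: xit_def)
  then show ?case using upd_meas[OF G eta Suc] by simp
qed

lemma dep_mono: "dep J C E \<eta> T i v s \<Longrightarrow> s \<le> t \<Longrightarrow> dep J C E \<eta> T i v t"
  by (cases i) (auto intro: less_le_trans)

text \<open>In the recursion \<open>dep\<close> is evaluated at the random time of a mark.
  Left-continuity in time reduces this to rational times, for which the induction hypothesis of
  \<open>dep_meas\<close> provides measurability.\<close>

lemma dep_left: "dep J C E \<eta> T i v s \<longleftrightarrow> (\<exists>q::rat. real_of_rat q < s \<and> dep J C E \<eta> T i v (real_of_rat q))"
proof
  assume d: "dep J C E \<eta> T i v s"
  show "\<exists>q::rat. real_of_rat q < s \<and> dep J C E \<eta> T i v (real_of_rat q)"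
  proof (cases i)
    case 0
    obtain q :: rat where "real_of_rat q < s" using of_rat_dense[of "s - 1" s] by auto
    then show ?thesis using 0 by auto
  next
    case (Suc i')
    then obtain p where p: "p \<in> clean J (\<eta> v)" "fst p < s" "fst (snd p) \<le> C (card (clos E v)) T" "\<exists>u\<in>clos E v. dep J C E \<eta> T i' u (fst p)"
      using d by auto
    obtain q :: rat where "fst p < real_of_rat q" "real_of_rat q < s" using of_rat_dense[OF p(2)] by auto
    then show ?thesis using p Suc by auto
  qed
qed (auto intro: dep_mono)

lemma dep_meas:
  assumes G: "G \<in> measurable M (graphM borel borel)" "\<And>\<omega>. \<omega> \<in> space M \<Longrightarrow> W (G \<omega>)"
    and eta: "\<And>v. (\<lambda>\<omega>. \<eta> \<omega> v) \<in> measurable M (nsp pm)"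
  shows "{\<omega> \<in> space M. v \<in> verts (G \<omega>) \<and> dep J C (edges (G \<omega>)) (\<eta> \<omega>) T i v t} \<in> sets M"
proof (induction i arbitrary: v t)
  case 0
  have "{\<omega> \<in> space M. v \<in> verts (G \<omega>) \<and> dep J C (edges (G \<omega>)) (\<eta> \<omega>) T 0 v t} = G -` {H. v \<in> verts H} \<inter> space M" by auto
  then show ?case using measurable_sets[OF G(1) graphM_verts, of v] by simp
next
  case (Suc i)
  show ?case
  proof (rule loc_decompose[OF G])
    fix U :: "nat set" and EU :: "nat set set" assume fin: "finite U" "finite EU"
    define D where "D = {\<omega> \<in> space M. loc G v U EU \<omega>}"
    have Ds: "D \<in> sets M" unfolding D_def by (rule loc_sets[OF G(1) fin(1)])
    let ?R = "restrict_space M D"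
    let ?Z = "?R \<Otimes>\<^sub>M pm"
    have spR: "space ?R = D" using sets.sets_into_space[OF Ds] by (auto simp: space_restrict_space)
    have DU: "\<omega> \<in> space M" "clos (edges (G \<omega>)) v = U" "U \<subseteq> verts (G \<omega>)" if "\<omega> \<in> D" for \<omega>
      using that wf_clos_verts[OF G(2), of \<omega> v] by (auto simp: D_def loc_def)
    define A where "A = {z \<in> space ?Z. fst (snd z) < t \<and> fst (snd (snd z)) \<le> C (card U) T \<and>
        (\<exists>u\<in>U. \<exists>q::rat. real_of_rat q < fst (snd z) \<and> (u \<in> verts (G (fst z)) \<and> dep J C (edges (G (fst z))) (\<eta> (fst z)) T i u (real_of_rat q)))}"
    have [measurable]: "(\<lambda>z. fst (snd z)) \<in> borel_measurable ?Z" "(\<lambda>z. fst (snd (snd z))) \<in> borel_measurable ?Z"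
      by (rule measurable_compose[OF measurable_snd pm_fst] measurable_compose[OF measurable_snd pm_fst_snd])+
    have dm: "Measurable.pred ?Z (\<lambda>z. u \<in> verts (G (fst z)) \<and> dep J C (edges (G (fst z))) (\<eta> (fst z)) T i u (real_of_rat q))" for u q
    proof -
      have "Measurable.pred M (\<lambda>\<omega>. u \<in> verts (G \<omega>) \<and> dep J C (edges (G \<omega>)) (\<eta> \<omega>) T i u (real_of_rat q))"
        using Suc.IH[of u "real_of_rat q"] by (simp add: pred_def)
      then have "Measurable.pred ?R (\<lambda>\<omega>. u \<in> verts (G \<omega>) \<and> dep J C (edges (G \<omega>)) (\<eta> \<omega>) T i u (real_of_rat q))" by (rule measurable_restrict_space1)
      from measurable_compose[OF measurable_fst this] show ?thesis .
    qed
    have "Measurable.pred ?Z (\<lambda>z. \<exists>u\<in>U. \<exists>q::rat. real_of_rat q < fst (snd z) \<and> (u \<in> verts (G (fst z)) \<and> dep J C (edges (G (fst z))) (\<eta> (fst z)) T i u (real_of_rat q)))"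
    proof (rule pred_intros_finite(4)[OF fin(1)], rule pred_intros_countable(2))
      fix u and q :: rat
      note dm[of u q, measurable]
      show "Measurable.pred ?Z (\<lambda>z. real_of_rat q < fst (snd z) \<and> (u \<in> verts (G (fst z)) \<and> dep J C (edges (G (fst z))) (\<eta> (fst z)) T i u (real_of_rat q)))"
        by (rule pred_intros_logic(3)) measurable
    qed
    note this[measurable]
    have As: "A \<in> sets ?Z" unfolding A_def by measurable
    have etaR: "(\<lambda>\<omega>. \<eta> \<omega> v) \<in> measurable ?R (nsp pm)" by (rule measurable_restrict_space1[OF eta])
    have "Measurable.pred ?R (\<lambda>\<omega>. \<exists>p\<in>clean J (\<eta> \<omega> v). (\<omega>, p) \<in> A)" by (rule section_hit_measurable[OF etaR As])
    then have "{\<omega> \<in> D. \<exists>p\<in>clean J (\<eta> \<omega> v). (\<omega>, p) \<in> A} \<in> sets ?R" by (simp add: pred_def spR)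
    then have "{\<omega> \<in> D. \<exists>p\<in>clean J (\<eta> \<omega> v). (\<omega>, p) \<in> A} \<in> sets M" using Ds by (simp add: sets_restrict_space_iff)
    moreover have "{\<omega> \<in> D. \<exists>p\<in>clean J (\<eta> \<omega> v). (\<omega>, p) \<in> A} =
       {\<omega> \<in> space M. loc G v U EU \<omega> \<and> dep J C (edges (G \<omega>)) (\<eta> \<omega>) T (Suc i) v t}"
    proof -
      have "(\<exists>p\<in>clean J (\<eta> \<omega> v). (\<omega>, p) \<in> A) \<longleftrightarrow> dep J C (edges (G \<omega>)) (\<eta> \<omega>) T (Suc i) v t" if w: "\<omega> \<in> D" for \<omega>
      proof -
        have sub: "clean J (\<eta> \<omega> v) \<subseteq> space pm"
          using measurable_space[OF eta DU(1)[OF w], of v] clean_sub[of "\<eta> \<omega> v"] by (simp add: space_nsp)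
        have "(\<omega>, p) \<in> A \<longleftrightarrow> fst p < t \<and> fst (snd p) \<le> C (card U) T \<and> (\<exists>u\<in>U. dep J C (edges (G \<omega>)) (\<eta> \<omega>) T i u (fst p))"
          if "p \<in> clean J (\<eta> \<omega> v)" for p
        proof -
          have ex: "(\<exists>u\<in>U. \<exists>q::rat. real_of_rat q < fst p \<and> (u \<in> verts (G \<omega>) \<and> dep J C (edges (G \<omega>)) (\<eta> \<omega>) T i u (real_of_rat q))) \<longleftrightarrow>
             (\<exists>u\<in>U. dep J C (edges (G \<omega>)) (\<eta> \<omega>) T i u (fst p))"
            unfolding dep_left[of _ _ _ i _ "fst p"] by (rule bex_cong[OF refl]) (use DU(3)[OF w] in auto)
          have "(\<omega>, p) \<in> space ?Z" using sub that w spR by (auto simp: space_pair_measure)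
          then show ?thesis unfolding A_def mem_Collect_eq fst_conv snd_conv ex by blast
        qed
        then show ?thesis unfolding dep.simps DU(2)[OF w] by blast
      qed
      then have "{\<omega> \<in> D. \<exists>p\<in>clean J (\<eta> \<omega> v). (\<omega>, p) \<in> A} = {\<omega> \<in> D. dep J C (edges (G \<omega>)) (\<eta> \<omega>) T (Suc i) v t}"
        by (intro Collect_cong conj_cong refl)
      also have "\<dots> = {\<omega> \<in> space M. loc G v U EU \<omega> \<and> dep J C (edges (G \<omega>)) (\<eta> \<omega>) T (Suc i) v t}"
        by (simp only: D_def mem_Collect_eq conj_assoc)
      finally show ?thesis .
    qed
    ultimately show "{\<omega> \<in> space M. loc G v U EU \<omega> \<and> dep J C (edges (G \<omega>)) (\<eta> \<omega>) T (Suc i) v t} \<in> sets M" by simp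
  qed
qed

end

subsection \<open>The compensator of the noise\<close>

lemma poisson_mean: "(\<lambda>k. real k * poisson_prob \<mu> k) sums \<mu>"
proof -
  have "(\<lambda>k. real (Suc k) * poisson_prob \<mu> (Suc k)) = (\<lambda>k. \<mu> * poisson_prob \<mu> k)"
    by (rule ext) (simp add: poisson_prob_def field_simps del: of_nat_Suc)
  moreover have "(\<lambda>k. \<mu> * poisson_prob \<mu> k) sums (\<mu> * 1)" by (intro sums_mult poisson_sums)
  ultimately show ?thesis using sums_Suc_iff[of "\<lambda>k. real k * poisson_prob \<mu> k" \<mu>] by simp
qed

lemma cnt_finite: "cnt S B \<noteq> \<infinity> \<longleftrightarrow> finite (S \<inter> B)"
  by (simp add: cnt_def)

context jump_model begin

lemma prm_null:
  assumes M: "prob_space M" and p: "prm M F0 V N" and E: "E \<in> F0" "E \<in> sets M" "E \<subseteq> {\<omega>. v \<in> V \<omega>}"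
    and B: "B \<in> sets pm" "emeasure pm B = 0"
  shows "AE \<omega> in M. \<omega> \<in> E \<longrightarrow> N \<omega> v \<inter> B = {}"
proof -
  interpret prob_space M by fact
  let ?X = "E \<inter> {\<omega>. cnt (N \<omega> v) B = enat 0}"
  have X: "?X \<in> sets M"
  proof -
    have "?X = E \<inter> {\<omega> \<in> space M. v \<in> V \<omega> \<and> cnt (N \<omega> v) B = enat 0}" using E sets.sets_into_space[OF E(2)] by auto
    then show ?thesis using prm_sets[OF p B(1)] E by simp
  qed
  have "prob ?X = prob E * poisson_prob (measure pm B) 0" using B by (intro prm_single[OF p E(1,3)]) auto
  also have "\<dots> = prob E" using B(2) by (simp add: poisson_prob_def measure_def)
  finally have "prob (E - ?X) = 0" using finite_measure_Diff[OF E(2) X] by simp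
  then have "E - ?X \<in> null_sets M" using E(2) X by (intro null_setsI) (auto simp: emeasure_eq_measure)
  then have "AE \<omega> in M. \<omega> \<notin> E - ?X" by (rule AE_not_in)
  moreover have "N \<omega> v \<inter> B = {}" if "cnt (N \<omega> v) B = enat 0" for \<omega> using that by (auto simp: cnt_def split: if_splits)
  ultimately show ?thesis by (auto elim: AE_mp)
qed

lemma clean_AE:
  assumes M: "prob_space M" and p: "prm M F0 V N" and V: "\<And>v. {\<omega> \<in> space M. v \<in> V \<omega>} \<in> F0" and F0: "F0 \<subseteq> sets M"
  shows "AE \<omega> in M. \<forall>v\<in>V \<omega>. clean J (N \<omega> v) = N \<omega> v"
proof -
  let ?E = "\<lambda>v. {\<omega> \<in> space M. v \<in> V \<omega>}"
  have z1: "emeasure pm ({0} \<times> {0..} \<times> J) = 0" "{0} \<times> {0..} \<times> J \<in> sets pm"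
    using rect_pm[of "{0}" UNIV J] rect_pm_sets[of "{0}" UNIV J] by (simp_all add: Int_absorb1)
  have z2: "emeasure pm ({0..} \<times> {0} \<times> J) = 0" "{0..} \<times> {0} \<times> J \<in> sets pm"
    using rect_pm[of UNIV "{0}" J] rect_pm_sets[of UNIV "{0}" J] by (simp_all add: Int_absorb1)
  have "AE \<omega> in M. \<forall>v. v \<in> V \<omega> \<longrightarrow> clean J (N \<omega> v) = N \<omega> v"
    unfolding AE_all_countable
  proof
    fix v
    have E: "?E v \<in> F0" "?E v \<in> sets M" "?E v \<subseteq> {\<omega>. v \<in> V \<omega>}" using V F0 by auto
    have lf: "AE \<omega> in M. \<forall>n. \<omega> \<in> ?E v \<longrightarrow> cnt (N \<omega> v) (tbox n) \<noteq> \<infinity>"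
      unfolding AE_all_countable by (intro allI prm_finite[OF M p E] tbox_sets tbox_finite)
    have n1: "AE \<omega> in M. \<omega> \<in> ?E v \<longrightarrow> N \<omega> v \<inter> ({0} \<times> {0..} \<times> J) = {}" by (rule prm_null[OF M p E z1(2,1)])
    have n2: "AE \<omega> in M. \<omega> \<in> ?E v \<longrightarrow> N \<omega> v \<inter> ({0..} \<times> {0} \<times> J) = {}" by (rule prm_null[OF M p E z2(2,1)])
    show "AE \<omega> in M. v \<in> V \<omega> \<longrightarrow> clean J (N \<omega> v) = N \<omega> v"
      using lf n1 n2 AE_space
    proof eventually_elim
      case (elim \<omega>)
      show ?case
      proof
        assume v: "v \<in> V \<omega>"
        have sub: "N \<omega> v \<subseteq> space pm" using prm_space[OF p] elim(4) v by blast
        have "locfin (N \<omega> v)" using elim(1,4) v by (auto simp: locfin_def cnt_finite simp del: not_infinity_eq)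
        moreover have "0 < fst q \<and> 0 < fst (snd q)" if q: "q \<in> N \<omega> v" for q
        proof -
          obtain s r j where qq: "q = (s, r, j)" by (cases q)
          have "(s, r, j) \<in> space pm" using q sub qq by auto
          then have "0 \<le> s" "0 \<le> r" "j \<in> J" by (auto simp: space_pm)
          moreover have "s \<noteq> 0" using elim(2,4) v q qq calculation by auto
          moreover have "r \<noteq> 0" using elim(3,4) v q qq calculation by auto
          ultimately show ?thesis by (simp add: qq)
        qed
        ultimately show "clean J (N \<omega> v) = N \<omega> v" unfolding clean_eq[OF sub] by auto
      qed
    qed
  qed
  then show ?thesis by eventually_elim blast
qed

section \<open>Consequences of being a strong solution\<close>

lemma strong_solD:
  assumes "strong_solution Xs J \<sigma> rbar M F G N X"
  shows "usual_filtration M F" and "prob_space M" and "\<And>\<omega>. \<omega> \<in> space M \<Longrightarrow> W (G \<omega>)"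
    and "G \<in> measurable M (graphM borel borel)"
    and "\<And>S. S \<in> sets (graphM borel borel) \<Longrightarrow> G -` S \<inter> space M \<in> F 0"
    and "prm M (F 0) (\<lambda>\<omega>. verts (G \<omega>)) N"
    and "meas_paths M G X"
    and "\<And>t. 0 \<le> t \<Longrightarrow> sigma_algebra (space M) (F t)" "\<And>t. 0 \<le> t \<Longrightarrow> F t \<subseteq> sets M"
    and "\<And>s t. 0 \<le> s \<Longrightarrow> s \<le> t \<Longrightarrow> F s \<subseteq> F t"
    and "\<And>v t s i. 0 \<le> s \<Longrightarrow> s \<le> t \<Longrightarrow> {\<omega> \<in> space M. v \<in> verts (G \<omega>) \<and> X \<omega> v s = i} \<in> F t"
    and "\<And>v. {\<omega> \<in> space M. v \<in> verts (G \<omega>)} \<in> F 0"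
proof -
  note s0 = assms[unfolded strong_solution_def]
  note s1 = s0[THEN conjunct2] note s2 = s1[THEN conjunct2] note s3 = s2[THEN conjunct2] note s4 = s3[THEN conjunct2]
  note s5 = s4[THEN conjunct2] note s6 = s5[THEN conjunct2] note s7 = s6[THEN conjunct2]
  show uf: "usual_filtration M F" by (rule s0[THEN conjunct1])
  then show pM: "prob_space M" by (simp add: usual_filtration_def)
  have ok: "(\<lambda>(k, i). i \<in> Xs) = (init_ok Xs :: 'k \<times> int \<Rightarrow> bool)" by (auto simp: init_ok_def fun_eq_iff)
  show WG: "W (G \<omega>)" if "\<omega> \<in> space M" for \<omega> by (rule s1[THEN conjunct1, unfolded ok, rule_format, OF that])
  have ge: "graph_events M G \<subseteq> F 0" by (rule s2[THEN conjunct1])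
  show pre: "G -` S \<inter> space M \<in> F 0" if "S \<in> sets (graphM borel borel)" for S
  proof -
    have "G -` S \<inter> space M = {\<omega> \<in> space M. G \<omega> \<in> S}" by auto
    also have "\<dots> \<in> graph_events M G" using that unfolding graph_events_def by blast
    finally show ?thesis using ge by blast
  qed
  note u2 = uf[unfolded usual_filtration_def, THEN conjunct2, THEN conjunct2]
  show sa: "sigma_algebra (space M) (F t)" if "0 \<le> t" for t
    by (rule u2[THEN conjunct1, rule_format, OF that, THEN conjunct1])
  show Ft: "F t \<subseteq> sets M" if "0 \<le> t" for t
    by (rule u2[THEN conjunct1, rule_format, OF that, THEN conjunct2])
  show mono: "F s \<subseteq> F t" if "0 \<le> s" "s \<le> t" for s t
    by (rule u2[THEN conjunct2, THEN conjunct1, rule_format]) (use that in simp)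
  show Gm: "G \<in> measurable M (graphM borel borel)"
    using pre Ft[of 0] by (intro measurableI) auto
  show "prm M (F 0) (\<lambda>\<omega>. verts (G \<omega>)) N" by (rule s3[THEN conjunct1])
  show ad: "{\<omega> \<in> space M. v \<in> verts (G \<omega>) \<and> X \<omega> v s = i} \<in> F t" if "0 \<le> s" "s \<le> t" for v t s i
    by (rule s7[THEN conjunct1, rule_format]) (use that in simp)
  have "\<forall>\<omega>\<in>space M. \<forall>v\<in>verts (G \<omega>). Dpath Xs (X \<omega> v)" by (rule s6[THEN conjunct1])
  then show "meas_paths M G X" using ad[OF _ order_refl] Ft by (simp add: meas_paths_def subset_iff)
  have "{\<omega> \<in> space M. v \<in> verts (G \<omega>)} = G -` {H. v \<in> verts H} \<inter> space M" for v by auto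
  then show "{\<omega> \<in> space M. v \<in> verts (G \<omega>)} \<in> F 0" for v using pre[OF graphM_verts, of v] by simp
qed

text \<open>The quantifier over \<eta> stands inside the almost sure event, because the equation is
  later applied to the extended noise, which depends on a further coordinate.\<close>

lemma strong_sol_fixpoint:
  assumes sol: "strong_solution Xs J \<sigma> rbar M F G N X"
  shows "AE \<omega> in M. \<forall>\<eta>. (\<forall>v\<in>verts (G \<omega>). \<eta> v = N \<omega> v) \<longrightarrow> (\<forall>v\<in>verts (G \<omega>). \<forall>t\<ge>0. X \<omega> v t = upd (G \<omega>) \<eta> (X \<omega>) v t)"
proof -
  note d = strong_solD[OF sol]
  have eq: "AE \<omega> in M. \<forall>v\<in>verts (G \<omega>). \<forall>t\<ge>0.
        finite (used_pts rbar (G \<omega>) (N \<omega> v) v t (X \<omega>)) \<and>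
        X \<omega> v t = snd (vmark (G \<omega>) v) + (\<Sum>p\<in>used_pts rbar (G \<omega>) (N \<omega> v) v t (X \<omega>). snd (snd p))"
    by (rule sol[unfolded strong_solution_def, THEN conjunct2, THEN conjunct2, THEN conjunct2, THEN conjunct2,
      THEN conjunct2, THEN conjunct2, THEN conjunct2, THEN conjunct2, THEN conjunct1])
  have cl: "AE \<omega> in M. \<forall>v\<in>verts (G \<omega>). clean J (N \<omega> v) = N \<omega> v"
    by (rule clean_AE[OF d(2,6,12) d(9)[OF order_refl]])
  show ?thesis using eq cl AE_space
  proof eventually_elim
    case (elim \<omega>)
    show ?case
    proof (intro allI impI ballI)
      fix \<eta> v and t :: real assume h: "\<forall>v\<in>verts (G \<omega>). \<eta> v = N \<omega> v" "v \<in> verts (G \<omega>)" "0 \<le> t"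
      have "clean J (\<eta> v) = N \<omega> v" using h elim(2) by simp
      moreover have "X \<omega> v t = snd (vmark (G \<omega>) v) + (\<Sum>p\<in>used_pts rbar (G \<omega>) (N \<omega> v) v t (X \<omega>). snd (snd p))" using elim(1) h by blast
      \<comment> \<open>Hence the reset built into \<open>upd\<close> is not triggered by a
        solution.\<close>
      moreover have "X \<omega> v t \<in> Xs" using d(7) elim(3) h by (auto simp: meas_paths_def Dpath_def)
      ultimately show "X \<omega> v t = upd (G \<omega>) \<eta> (X \<omega>) v t" by (simp add: upd_def Let_def)
    qed
  qed
qed

text \<open>The assumed independence from the past is conditional on \<open>F 0\<close>. Given
  \<open>F 0\<close>, a future count has the fixed Poisson law on the event that \<open>v\<close> is
  a vertex, so the conditional statement becomes a product formula.\<close>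

lemma noise_indep:
  assumes sol: "strong_solution Xs J \<sigma> rbar M F G N X"
    and a: "0 \<le> a" and E: "E \<in> F a" and R: "R \<in> sets pm" "emeasure pm R < \<infinity>" "R \<subseteq> {a<..} \<times> UNIV"
  shows "measure M {\<omega> \<in> E. v \<in> verts (G \<omega>) \<and> cnt (N \<omega> v) R = enat k} =
    measure M {\<omega> \<in> E. v \<in> verts (G \<omega>)} * poisson_prob (measure pm R) k"
proof -
  note d = strong_solD[OF sol]
  interpret prob_space M by (rule d(2))
  let ?V = "{\<omega> \<in> space M. v \<in> verts (G \<omega>)}"
  have Es: "E \<subseteq> space M" "E \<in> sets M" using E d(9)[OF a] sets.sets_into_space by blast+
  interpret F0: sigma_algebra "space M" "F 0" by (rule d(8)) simp
  show ?thesis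
  \<comment> \<open>Conditional independence is assumed at positive times; at time 0 the event lies
    in \<open>F 0\<close> and the conditional law of the noise applies directly.\<close>
  proof (cases "a = 0")
    case True
    then have "E \<inter> ?V \<in> F 0" using E d(12) by blast
    from prm_single[OF d(6) this _ R(1,2), of v k]
    have "measure M (E \<inter> ?V \<inter> {\<omega>. cnt (N \<omega> v) R = enat k}) = measure M (E \<inter> ?V) * poisson_prob (measure pm R) k" by blast
    moreover have "E \<inter> ?V \<inter> {\<omega>. cnt (N \<omega> v) R = enat k} = {\<omega> \<in> E. v \<in> verts (G \<omega>) \<and> cnt (N \<omega> v) R = enat k}" using Es by auto
    moreover have "E \<inter> ?V = {\<omega> \<in> E. v \<in> verts (G \<omega>)}" using Es by auto
    ultimately show ?thesis by simp
  next
    case False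
    then have a0: "0 < a" using a by simp
    let ?S = "sigma (space M) (F 0)"
    have sS: "sets ?S = F 0" "space ?S = space M" by (auto simp: F0.sigma_sets_eq F0.space_closed)
    have sub: "subalgebra M ?S" using d(9)[of 0] by (simp add: subalgebra_def sS)
    interpret finite_measure_subalgebra M ?S by unfold_locales (rule sub)
    let ?E1 = "{\<omega> \<in> space M. v \<in> verts (G \<omega>) \<and> cnt (N \<omega> v) R = enat k}"
    let ?p = "poisson_prob (measure pm R) k"
    have E1: "?E1 \<in> sets M" using prm_sets[OF d(6) R(1)] by simp
    have Vm: "?V \<in> sets M" "?V \<in> F 0" using d(12) d(9)[of 0] by auto
    have ci: "cond_indep M (F 0) (sigma_sets (space M) (graph_events M G \<union> noise_events M (\<lambda>\<omega>. verts (G \<omega>)) N R)) (F a)"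
      by (rule sol[unfolded strong_solution_def, THEN conjunct2, THEN conjunct2, THEN conjunct2, THEN conjunct2,
        THEN conjunct1, rule_format, OF a0 R(1,3)])
    have "?E1 \<in> noise_events M (\<lambda>\<omega>. verts (G \<omega>)) N R" unfolding noise_events_def by blast
    then have "?E1 \<in> sigma_sets (space M) (graph_events M G \<union> noise_events M (\<lambda>\<omega>. verts (G \<omega>)) N R)" by (intro sigma_sets.Basic) simp
    then have c1: "AE \<omega> in M. real_cond_exp M ?S (indicator (?E1 \<inter> E)) \<omega> =
        real_cond_exp M ?S (indicator ?E1) \<omega> * real_cond_exp M ?S (indicator E) \<omega>"
      using ci E unfolding cond_indep_def by blast
    have c2: "AE \<omega> in M. real_cond_exp M ?S (indicator ?E1) \<omega> = ?p * indicator ?V \<omega>"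
    proof (rule real_cond_exp_charact)
      fix A assume "A \<in> sets ?S"
      then have A: "A \<in> F 0" "A \<in> sets M" using sS d(9)[of 0] by auto
      have "A \<inter> ?V \<in> F 0" using A Vm by blast
      from prm_single[OF d(6) this _ R(1,2), of v k]
      have m: "measure M (A \<inter> ?V \<inter> {\<omega>. cnt (N \<omega> v) R = enat k}) = measure M (A \<inter> ?V) * ?p" by blast
      have s1: "A \<inter> ?V \<inter> {\<omega>. cnt (N \<omega> v) R = enat k} = A \<inter> ?E1" by auto
      have "(LINT x:A|M. indicator ?E1 x) = measure M (A \<inter> ?E1)"
        unfolding set_lebesgue_integral_def using A E1 sets.sets_into_space[OF A(2)]
        by (simp add: indicator_inter_arith[symmetric] Int_absorb1 Int_absorb2)
      moreover have "(LINT x:A|M. ?p * indicator ?V x) = ?p * measure M (A \<inter> ?V)"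
      proof -
        have "(LINT x:A|M. ?p * indicator ?V x) = (LINT x|M. ?p * indicator (A \<inter> ?V) x)"
          unfolding set_lebesgue_integral_def by (intro Bochner_Integration.integral_cong) (auto simp: indicator_def)
        also have "\<dots> = ?p * measure M (A \<inter> ?V)" using A Vm sets.sets_into_space[OF A(2)] by (simp add: Int_absorb2 Int_absorb1 Int_assoc)
        finally show ?thesis .
      qed
      ultimately show "(LINT x:A|M. indicator ?E1 x) = (LINT x:A|M. ?p * indicator ?V x)" using m unfolding s1 by (simp only: mult.commute)
    next
      show "integrable M (indicator ?E1 :: _ \<Rightarrow> real)" using E1 by (intro integrable_real_indicator) (auto simp: emeasure_eq_measure)
      show "integrable M (\<lambda>x. ?p * indicator ?V x)" using Vm by (intro integrable_mult_right integrable_real_indicator) (auto simp: emeasure_eq_measure)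
      show "(\<lambda>x. ?p * indicator ?V x) \<in> borel_measurable ?S" using Vm sS by (intro borel_measurable_times borel_measurable_indicator) auto
    qed
    have i: "integrable M (indicator A :: _ \<Rightarrow> real)" if "A \<in> sets M" for A
      using that by (intro integrable_real_indicator) (auto simp: emeasure_eq_measure)
    have "measure M (?E1 \<inter> E) = (LINT x|M. indicator (?E1 \<inter> E) x)" using E1 Es by (simp add: Int_absorb2 Int_assoc Int_absorb1)
    also have "\<dots> = (LINT x|M. real_cond_exp M ?S (indicator (?E1 \<inter> E)) x)" using i[of "?E1 \<inter> E"] E1 Es by (intro real_cond_exp_int(2)[symmetric]) auto
    also have "\<dots> = (LINT x|M. (?p * indicator ?V x) * real_cond_exp M ?S (indicator E) x)"
      using c1 c2 Vm Es E1 by (intro integral_cong_AE) auto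
    also have "\<dots> = (LINT x|M. (?p * indicator ?V x) * indicator E x)"
    proof (rule real_cond_exp_intg(2))
      have "(\<lambda>x. ?p * indicator ?V x * indicator E x) = (\<lambda>x. ?p * indicator (?V \<inter> E) x :: real)" by (auto simp: indicator_def fun_eq_iff)
      then show "integrable M (\<lambda>x. ?p * indicator ?V x * indicator E x)" using i[of "?V \<inter> E"] Vm Es by simp
      show "(\<lambda>x. ?p * indicator ?V x) \<in> borel_measurable ?S" using Vm sS by (intro borel_measurable_times borel_measurable_indicator) auto
    qed (use Es in simp)
    also have "\<dots> = (LINT x|M. ?p * indicator (?V \<inter> E) x)" by (intro Bochner_Integration.integral_cong) (auto simp: indicator_def)
    also have "\<dots> = ?p * measure M (?V \<inter> E)" using Vm Es by (simp add: Int_absorb2 Int_assoc Int_absorb1)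
    finally have "measure M (?E1 \<inter> E) = ?p * measure M (?V \<inter> E)" .
    moreover have "?E1 \<inter> E = {\<omega> \<in> E. v \<in> verts (G \<omega>) \<and> cnt (N \<omega> v) R = enat k}" "?V \<inter> E = {\<omega> \<in> E. v \<in> verts (G \<omega>)}" using Es by auto
    ultimately show ?thesis by simp
  qed
qed

text \<open>The usual predictable rectangles: \<open>E\<close> is known at time \<open>a\<close> and
  the time interval starts strictly after it. They generate the sets whose marks have a
  compensator.\<close>

definition pred_gen :: "'w measure \<Rightarrow> (real \<Rightarrow> 'w set set) \<Rightarrow> ('w \<times> pt) set set" where
  "pred_gen M F = {E \<times> {p \<in> space pm. a < fst p \<and> fst p \<le> b \<and> snd p \<in> B} | E a b B. 0 \<le> a \<and> E \<in> F a \<and> B \<in> sets (half \<Otimes>\<^sub>M jm)}"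

text \<open>Time 0 is left out because every generator starts strictly after some
  \<open>a \<ge> 0\<close>.\<close>

definition pred_space :: "'w measure \<Rightarrow> ('w \<times> pt) set" where
  "pred_space M = space M \<times> {p \<in> space pm. 0 < fst p}"

definition live :: "('w \<Rightarrow> ('e, 'k \<times> int) mgraph) \<Rightarrow> ('w \<Rightarrow> nat \<Rightarrow> pt set) \<Rightarrow> nat \<Rightarrow> 'w \<Rightarrow> pt set" where
  "live G N v \<omega> = (if v \<in> verts (G \<omega>) then N \<omega> v else {})"

lemma strip_sets: "B \<in> sets (half \<Otimes>\<^sub>M jm) \<Longrightarrow> {p \<in> space pm. a < fst p \<and> fst p \<le> b \<and> snd p \<in> B} \<in> sets pm"
proof -
  assume B: "B \<in> sets (half \<Otimes>\<^sub>M jm)"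
  have "snd \<in> measurable pm (half \<Otimes>\<^sub>M jm)" unfolding pm_eq by (rule measurable_snd)
  note [measurable] = this B
  show ?thesis by measurable
qed

lemma live_measurable:
  assumes sol: "strong_solution Xs J \<sigma> rbar M F G N X"
  shows "live G N v \<in> measurable M (nsp pm)"
proof (rule measurable_nspI)
  note d = strong_solD[OF sol]
  show "live G N v \<omega> \<subseteq> space pm" if "\<omega> \<in> space M" for \<omega> using prm_space[OF d(6) that] by (auto simp: live_def)
  fix B k assume B: "B \<in> sets pm"
  have "{\<omega> \<in> space M. cnt (live G N v \<omega>) B = k} = {\<omega> \<in> space M. v \<in> verts (G \<omega>) \<and> cnt (N \<omega> v) B = k} \<union>
     (if k = 0 then space M - {\<omega> \<in> space M. v \<in> verts (G \<omega>)} else {})" by (auto simp: live_def cnt_def zero_enat_def)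
  moreover have "{\<omega> \<in> space M. v \<in> verts (G \<omega>)} \<in> sets M" using d(12)[of v] d(9)[of 0] by auto
  ultimately show "{\<omega> \<in> space M. cnt (live G N v \<omega>) B = k} \<in> sets M" using prm_sets[OF d(6) B, of v k] by (cases "k = 0") auto
qed

lemma pred_gen_Int_stable:
  assumes mono: "\<And>s t. 0 \<le> s \<Longrightarrow> s \<le> t \<Longrightarrow> F s \<subseteq> F t" and sa: "\<And>t. 0 \<le> t \<Longrightarrow> sigma_algebra (space M) (F t)"
  shows "Int_stable (pred_gen M F)"
proof (rule Int_stableI)
  fix A A' assume "A \<in> pred_gen M F" "A' \<in> pred_gen M F"
  then obtain E a b B E' a' b' B' where
    A: "A = E \<times> {p \<in> space pm. a < fst p \<and> fst p \<le> b \<and> snd p \<in> B}" "0 \<le> a" "E \<in> F a" "B \<in> sets (half \<Otimes>\<^sub>M jm)" and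
    A': "A' = E' \<times> {p \<in> space pm. a' < fst p \<and> fst p \<le> b' \<and> snd p \<in> B'}" "0 \<le> a'" "E' \<in> F a'" "B' \<in> sets (half \<Otimes>\<^sub>M jm)"
    unfolding pred_gen_def by blast
  have "A \<inter> A' = (E \<inter> E') \<times> {p \<in> space pm. max a a' < fst p \<and> fst p \<le> min b b' \<and> snd p \<in> B \<inter> B'}"
    unfolding A(1) A'(1) by auto
  moreover have "E \<inter> E' \<in> F (max a a')"
  proof -
    interpret sigma_algebra "space M" "F (max a a')" using A(2) by (intro sa) simp
    have "E \<in> F (max a a')" "E' \<in> F (max a a')" using mono[of a "max a a'"] mono[of a' "max a a'"] A A' by auto
    then show ?thesis by blast
  qed
  moreover have "B \<inter> B' \<in> sets (half \<Otimes>\<^sub>M jm)" using A(4) A'(4) by (rule sets.Int)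
  moreover have "0 \<le> max a a'" using A(2) by simp
  ultimately show "A \<inter> A' \<in> pred_gen M F" unfolding pred_gen_def by blast
qed

lemma pred_gen_closed:
  assumes "\<And>t. 0 \<le> t \<Longrightarrow> F t \<subseteq> sets M"
  shows "pred_gen M F \<subseteq> Pow (pred_space M)"
proof
  fix A assume "A \<in> pred_gen M F"
  then obtain E a b B where A: "A = E \<times> {p \<in> space pm. a < fst p \<and> fst p \<le> b \<and> snd p \<in> B}" "0 \<le> a" "E \<in> F a"
    unfolding pred_gen_def by blast
  have "E \<subseteq> space M" using assms[OF A(2)] A(3) sets.sets_into_space by blast
  then show "A \<in> Pow (pred_space M)" using A by (auto simp: pred_space_def)
qed

lemma pred_sets_pair:
  assumes F: "\<And>t. 0 \<le> t \<Longrightarrow> F t \<subseteq> sets M" and A: "A \<in> sigma_sets (pred_space M) (pred_gen M F)"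
  shows "A \<in> sets (M \<Otimes>\<^sub>M pm)"
proof -
  have sp: "pred_space M \<in> sets (M \<Otimes>\<^sub>M pm)"
    unfolding pred_space_def by (intro pair_measureI) measurable
  let ?R = "restrict_space (M \<Otimes>\<^sub>M pm) (pred_space M)"
  have spR: "space ?R = pred_space M" using sets.sets_into_space[OF sp] by (auto simp: space_restrict_space)
  have closed: "pred_gen M F \<subseteq> Pow (pred_space M)" by (rule pred_gen_closed) (rule F)
  have "pred_gen M F \<subseteq> sets ?R"
  proof
    fix A assume A': "A \<in> pred_gen M F"
    then obtain E a b B where A: "A = E \<times> {p \<in> space pm. a < fst p \<and> fst p \<le> b \<and> snd p \<in> B}" "0 \<le> a" "E \<in> F a" "B \<in> sets (half \<Otimes>\<^sub>M jm)"
      unfolding pred_gen_def by blast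
    have "A \<in> sets (M \<Otimes>\<^sub>M pm)" unfolding A(1) using F[OF A(2)] A(3) strip_sets[OF A(4)] by (intro pair_measureI) auto
    then show "A \<in> sets ?R" using closed A' sp by (auto simp: sets_restrict_space_iff)
  qed
  then have "sigma_sets (space ?R) (pred_gen M F) \<subseteq> sets ?R" by (rule sets.sigma_sets_subset)
  then have "A \<in> sets ?R" using A unfolding spR by blast
  then show ?thesis using sp by (simp add: sets_restrict_space_iff)
qed

text \<open>On a predictable rectangle the count is Poisson and independent of the past event, so
  its mean is the intensity; an induction over the predictable sets extends the identity. The box
  keeps all masses finite.\<close>

lemma compensator:
  assumes sol: "strong_solution Xs J \<sigma> rbar M F G N X"
    and A: "A \<in> sigma_sets (pred_space M) (pred_gen M F)"
  shows "(\<integral>\<^sup>+\<omega>. emeasure (count_space UNIV) (clean J (live G N v \<omega>) \<inter> tbox n \<inter> {p. (\<omega>, p) \<in> A}) \<partial>M) =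
    (\<integral>\<^sup>+\<omega>. indicator {\<omega>. v \<in> verts (G \<omega>)} \<omega> * emeasure pm (tbox n \<inter> {p. (\<omega>, p) \<in> A}) \<partial>M)"
proof -
  note d = strong_solD[OF sol]
  interpret prob_space M by (rule d(2))
  let ?V = "{\<omega> \<in> space M. v \<in> verts (G \<omega>)}"
  have Vm: "?V \<in> sets M" "?V \<in> F 0" using d(12)[of v] d(9)[of 0] by auto
  define cs where "cs A \<omega> = emeasure (count_space UNIV) (clean J (live G N v \<omega>) \<inter> tbox n \<inter> {p. (\<omega>, p) \<in> A})" for A \<omega>
  define es where "es A \<omega> = indicator {\<omega>. v \<in> verts (G \<omega>)} \<omega> * emeasure pm (tbox n \<inter> {p. (\<omega>, p) \<in> A})" for A \<omega>
  note lm = live_measurable[OF sol, of v]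
  have pair: "A \<in> sigma_sets (pred_space M) (pred_gen M F) \<Longrightarrow> A \<in> sets (M \<Otimes>\<^sub>M pm)" for A
    by (rule pred_sets_pair[where F=F]) (rule d(9))
  have closed: "pred_gen M F \<subseteq> Pow (pred_space M)" by (rule pred_gen_closed) (rule d(9))
  have stable: "Int_stable (pred_gen M F)" by (rule pred_gen_Int_stable) (rule d(10) d(8); assumption)+
  have csm: "cs A \<in> borel_measurable M" if "A \<in> sigma_sets (pred_space M) (pred_gen M F)" for A
    unfolding cs_def by (rule section_measurable[OF lm pair[OF that]])
  have sec: "{p. (\<omega>, p) \<in> A} \<in> sets pm" if "A \<in> sigma_sets (pred_space M) (pred_gen M F)" for A \<omega>
  proof -
    have "{p. (\<omega>, p) \<in> A} = Pair \<omega> -` A" by auto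
    then show ?thesis using sets_Pair1[OF pair[OF that], of \<omega>] by simp
  qed
  have esm: "es A \<in> borel_measurable M" if "A \<in> sigma_sets (pred_space M) (pred_gen M F)" for A
  proof -
    interpret pm: sigma_finite_measure pm by (rule sf_pm)
    have T: "(space M \<times> tbox n) \<inter> A \<in> sets (M \<Otimes>\<^sub>M pm)" using pair[OF that] by (intro sets.Int pair_measureI) auto
    have "(\<lambda>\<omega>. emeasure pm (Pair \<omega> -` ((space M \<times> tbox n) \<inter> A))) \<in> borel_measurable M"
      by (rule pm.measurable_emeasure_Pair[OF T])
    then have "(\<lambda>\<omega>. indicator ?V \<omega> * emeasure pm (Pair \<omega> -` ((space M \<times> tbox n) \<inter> A))) \<in> borel_measurable M"
      using Vm by (intro borel_measurable_times_ennreal) auto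
    moreover have "es A \<omega> = indicator ?V \<omega> * emeasure pm (Pair \<omega> -` ((space M \<times> tbox n) \<inter> A))" if "\<omega> \<in> space M" for \<omega>
    proof -
      have "Pair \<omega> -` ((space M \<times> tbox n) \<inter> A) = tbox n \<inter> {p. (\<omega>, p) \<in> A}" using that by auto
      then show ?thesis using that by (simp add: es_def indicator_def)
    qed
    ultimately show ?thesis by (simp cong: measurable_cong)
  qed
  have cl: "AE \<omega> in M. \<forall>v\<in>verts (G \<omega>). clean J (N \<omega> v) = N \<omega> v"
    by (rule clean_AE[OF d(2,6,12) d(9)[OF order_refl]])
  have es_fin: "(\<integral>\<^sup>+\<omega>. es A \<omega> \<partial>M) < \<infinity>" for A
  proof -
    have "(\<integral>\<^sup>+\<omega>. es A \<omega> \<partial>M) \<le> (\<integral>\<^sup>+\<omega>. emeasure pm (tbox n) \<partial>M)"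
      unfolding es_def by (intro nn_integral_mono) (auto simp: indicator_def intro!: emeasure_mono)
    also have "\<dots> < \<infinity>" using tbox_finite by (simp add: emeasure_space_1)
    finally show ?thesis .
  qed
  have basic: "(\<integral>\<^sup>+\<omega>. cs A \<omega> \<partial>M) = (\<integral>\<^sup>+\<omega>. es A \<omega> \<partial>M)" if Ag: "A \<in> pred_gen M F" for A
  proof -
    obtain E a b B where A: "A = E \<times> {p \<in> space pm. a < fst p \<and> fst p \<le> b \<and> snd p \<in> B}" "0 \<le> a" "E \<in> F a" "B \<in> sets (half \<Otimes>\<^sub>M jm)"
      using Ag unfolding pred_gen_def by blast
    let ?R = "tbox n \<inter> {p \<in> space pm. a < fst p \<and> fst p \<le> b \<and> snd p \<in> B}"
    have R: "?R \<in> sets pm" "emeasure pm ?R < \<infinity>" "?R \<subseteq> {a<..} \<times> UNIV"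
    proof -
      show "?R \<in> sets pm" by (rule sets.Int[OF tbox_sets strip_sets[OF A(4)]])
      show "emeasure pm ?R < \<infinity>" by (rule sub_box_finite)
      show "?R \<subseteq> {a<..} \<times> UNIV"
      proof
        fix p assume "p \<in> ?R"
        then have "a < fst p" by simp
        then show "p \<in> {a<..} \<times> UNIV" by (simp add: mem_Times_iff)
      qed
    qed
    let ?EV = "{\<omega> \<in> E. v \<in> verts (G \<omega>)}"
    have Es: "E \<in> sets M" "E \<subseteq> space M" using A d(9) sets.sets_into_space by blast+
    have EVm: "?EV \<in> sets M"
    proof -
      have "?EV = E \<inter> ?V" using Es by auto
      then show ?thesis using Es Vm by simp
    qed
    define Ck where "Ck k = {\<omega> \<in> E. v \<in> verts (G \<omega>) \<and> cnt (N \<omega> v) ?R = enat k}" for k :: nat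
    have Ckm: "Ck k \<in> sets M" for k
    proof -
      have "Ck k = E \<inter> {\<omega> \<in> space M. v \<in> verts (G \<omega>) \<and> cnt (N \<omega> v) ?R = enat k}" using Es by (auto simp: Ck_def)
      then show ?thesis using Es prm_sets[OF d(6) R(1)] by simp
    qed
    have fin: "AE \<omega> in M. \<omega> \<in> ?V \<longrightarrow> cnt (N \<omega> v) ?R \<noteq> \<infinity>"
      using Vm R by (intro prm_finite[OF d(2,6)]) auto
    have "AE \<omega> in M. cs A \<omega> = (\<Sum>k. of_nat k * indicator (Ck k) \<omega>)"
      using cl fin AE_space
    proof eventually_elim
      case (elim \<omega>)
      show ?case
      proof (cases "\<omega> \<in> ?EV")
        case True
        then obtain m where m: "cnt (N \<omega> v) ?R = enat m" using elim by auto
        have "clean J (live G N v \<omega>) \<inter> tbox n \<inter> {p. (\<omega>, p) \<in> A} = N \<omega> v \<inter> ?R" using True elim by (auto simp: live_def A(1))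
        then have "cs A \<omega> = of_nat m" unfolding cs_def emeasure_cnt[symmetric] by (simp only: emeasure_cnt m ennreal_of_enat_enat)
        moreover have "(\<Sum>k. of_nat k * indicator (Ck k) \<omega>) = (\<Sum>k\<in>{m}. of_nat k * indicator (Ck k) \<omega> :: ennreal)"
          using True m by (intro suminf_finite) (auto simp: Ck_def)
        moreover have "\<omega> \<in> Ck m" using True m by (simp add: Ck_def)
        ultimately show ?thesis by simp
      next
        case False
        then have "clean J (live G N v \<omega>) \<inter> tbox n \<inter> {p. (\<omega>, p) \<in> A} = {}" using clean_sub[of "{}"] by (auto simp: live_def A(1))
        then have "cs A \<omega> = 0" unfolding cs_def by simp
        moreover have "\<omega> \<notin> Ck k" for k using False by (auto simp: Ck_def)
        ultimately show ?thesis by simp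
      qed
    qed
    then have "(\<integral>\<^sup>+\<omega>. cs A \<omega> \<partial>M) = (\<integral>\<^sup>+\<omega>. (\<Sum>k. of_nat k * indicator (Ck k) \<omega>) \<partial>M)" by (rule nn_integral_cong_AE)
    also have "\<dots> = (\<Sum>k. \<integral>\<^sup>+\<omega>. of_nat k * indicator (Ck k) \<omega> \<partial>M)"
      using Ckm by (intro nn_integral_suminf) auto
    also have "\<dots> = (\<Sum>k. ennreal (measure M ?EV * (real k * poisson_prob (measure pm ?R) k)))"
    proof (rule suminf_cong)
      fix k
      have "(\<integral>\<^sup>+\<omega>. of_nat k * indicator (Ck k) \<omega> \<partial>M) = of_nat k * emeasure M (Ck k)" using Ckm by (rule nn_integral_cmult_indicator)
      also have "\<dots> = ennreal (real k * measure M (Ck k))" by (simp add: emeasure_eq_measure ennreal_mult' ennreal_of_nat_eq_real_of_nat)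
      also have "measure M (Ck k) = measure M ?EV * poisson_prob (measure pm ?R) k"
        unfolding Ck_def by (rule noise_indep[OF sol A(2,3) R])
      finally show "(\<integral>\<^sup>+\<omega>. of_nat k * indicator (Ck k) \<omega> \<partial>M) = ennreal (measure M ?EV * (real k * poisson_prob (measure pm ?R) k))"
        by (simp add: mult_ac)
    qed
    also have "\<dots> = ennreal (measure M ?EV * measure pm ?R)"
      using sums_mult[OF poisson_mean, of "measure M ?EV" "measure pm ?R"]
      by (intro suminf_ennreal_eq) (simp_all add: poisson_nonneg)
    also have "\<dots> = emeasure pm ?R * emeasure M ?EV"
      using R(2) by (simp add: emeasure_eq_measure ennreal_mult' emeasure_eq_ennreal_measure mult.commute)
    also have "\<dots> = (\<integral>\<^sup>+\<omega>. emeasure pm ?R * indicator ?EV \<omega> \<partial>M)" using EVm by (rule nn_integral_cmult_indicator[symmetric])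
    also have "\<dots> = (\<integral>\<^sup>+\<omega>. es A \<omega> \<partial>M)"
      by (intro nn_integral_cong) (auto simp: es_def A(1) indicator_def)
    finally show ?thesis .
  qed
  \<comment> \<open>The whole space is not a rectangle, but inside the box it coincides with the one
    over \<open>(0, n]\<close>.\<close>
  have top: "(\<integral>\<^sup>+\<omega>. cs (pred_space M) \<omega> \<partial>M) = (\<integral>\<^sup>+\<omega>. es (pred_space M) \<omega> \<partial>M)"
  proof -
    interpret F0: sigma_algebra "space M" "F 0" by (rule d(8)) simp
    let ?T = "space M \<times> {p \<in> space pm. 0 < fst p \<and> fst p \<le> real n \<and> snd p \<in> space (half \<Otimes>\<^sub>M jm)}"
    have "?T \<in> pred_gen M F" unfolding pred_gen_def using F0.top sets.top[of "half \<Otimes>\<^sub>M jm"] by blast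
    moreover have "tbox n \<inter> {p. (\<omega>, p) \<in> ?T} = tbox n \<inter> {p. (\<omega>, p) \<in> pred_space M}" for \<omega>
      by (auto simp: pred_space_def tbox_def space_pm space_pair_measure space_restrict_space space_point_measure)
    then have "cs ?T = cs (pred_space M)" "es ?T = es (pred_space M)" unfolding cs_def es_def by (simp_all only: Int_assoc)
    ultimately show ?thesis using basic[of ?T] by simp
  qed
  have "(\<integral>\<^sup>+\<omega>. cs A \<omega> \<partial>M) = (\<integral>\<^sup>+\<omega>. es A \<omega> \<partial>M)"
    using stable closed A
  proof (induction A rule: sigma_sets_induct_disjoint)
    case (basic A)
    then show ?case by (rule \<open>\<And>A. A \<in> pred_gen M F \<Longrightarrow> (\<integral>\<^sup>+\<omega>. cs A \<omega> \<partial>M) = (\<integral>\<^sup>+\<omega>. es A \<omega> \<partial>M)\<close>)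
  next
    case empty
    then show ?case by (simp add: cs_def es_def)
  next
    case (compl A)
    have As: "A \<subseteq> pred_space M" using sigma_sets_into_sp[OF closed compl(1)] .
    have Om: "pred_space M \<in> sigma_sets (pred_space M) (pred_gen M F)" by (rule sigma_sets_top)
    have Sm: "pred_space M - A \<in> sigma_sets (pred_space M) (pred_gen M F)" by (rule sigma_sets.Compl[OF compl(1)])
    have c: "cs (pred_space M) \<omega> = cs (pred_space M - A) \<omega> + cs A \<omega>" for \<omega>
      unfolding cs_def using As by (subst plus_emeasure) (auto intro!: arg_cong[where f="emeasure (count_space UNIV)"])
    have e: "es (pred_space M) \<omega> = es (pred_space M - A) \<omega> + es A \<omega>" for \<omega>
    proof -
      have "emeasure pm (tbox n \<inter> {p. (\<omega>, p) \<in> pred_space M - A}) + emeasure pm (tbox n \<inter> {p. (\<omega>, p) \<in> A}) =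
         emeasure pm (tbox n \<inter> {p. (\<omega>, p) \<in> pred_space M})"
        using As sec[OF compl(1), of \<omega>] sec[OF Sm, of \<omega>]
        by (subst plus_emeasure) (auto intro!: arg_cong[where f="emeasure pm"])
      then show ?thesis unfolding es_def by (simp add: distrib_left[symmetric])
    qed
    have "(\<integral>\<^sup>+\<omega>. cs (pred_space M - A) \<omega> \<partial>M) + (\<integral>\<^sup>+\<omega>. cs A \<omega> \<partial>M) = (\<integral>\<^sup>+\<omega>. cs (pred_space M) \<omega> \<partial>M)"
      unfolding c by (rule nn_integral_add[symmetric, OF csm[OF Sm] csm[OF compl(1)]])
    moreover have "(\<integral>\<^sup>+\<omega>. es (pred_space M - A) \<omega> \<partial>M) + (\<integral>\<^sup>+\<omega>. es A \<omega> \<partial>M) = (\<integral>\<^sup>+\<omega>. es (pred_space M) \<omega> \<partial>M)"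
      unfolding e by (rule nn_integral_add[symmetric, OF esm[OF Sm] esm[OF compl(1)]])
    \<comment> \<open>The box makes the mass of \<open>A\<close> finite, so it may be
      cancelled.\<close>
    ultimately show ?case using top compl(2) es_fin[of A]
      by (metis ennreal_add_left_cancel infinity_ennreal_def less_irrefl add.commute)
  next
    case (union A)
    have Am: "A i \<in> sigma_sets (pred_space M) (pred_gen M F)" for i using union(2) by auto
    have c: "cs (\<Union>i. A i) \<omega> = (\<Sum>i. cs (A i) \<omega>)" for \<omega>
    proof -
      have "clean J (live G N v \<omega>) \<inter> tbox n \<inter> {p. (\<omega>, p) \<in> (\<Union>i. A i)} = (\<Union>i. clean J (live G N v \<omega>) \<inter> tbox n \<inter> {p. (\<omega>, p) \<in> A i})" by auto
      then show ?thesis unfolding cs_def using union(1) by (subst suminf_emeasure) (auto simp: disjoint_family_on_def)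
    qed
    have e: "es (\<Union>i. A i) \<omega> = (\<Sum>i. es (A i) \<omega>)" for \<omega>
    proof -
      have "tbox n \<inter> {p. (\<omega>, p) \<in> (\<Union>i. A i)} = (\<Union>i. tbox n \<inter> {p. (\<omega>, p) \<in> A i})" by auto
      moreover have "(\<Sum>i. emeasure pm (tbox n \<inter> {p. (\<omega>, p) \<in> A i})) = emeasure pm (\<Union>i. tbox n \<inter> {p. (\<omega>, p) \<in> A i})"
        using union(1) sec[OF Am, of \<omega>] by (intro suminf_emeasure) (auto simp: disjoint_family_on_def)
      ultimately show ?thesis unfolding es_def by simp
    qed
    show ?case unfolding c e using csm[OF Am] esm[OF Am] union(3) by (simp add: nn_integral_suminf)
  qed
  then show ?thesis unfolding cs_def es_def .
qed

end

lemma tendsto_funI: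
  fixes f :: "'n \<Rightarrow> 'i \<Rightarrow> 'a::topological_space"
  assumes "\<And>i. ((\<lambda>n. f n i) \<longlongrightarrow> l i) F"
  shows "(f \<longlongrightarrow> l) F"
proof -
  have "limitin (product_topology (\<lambda>i. euclidean) UNIV) f l F"
    unfolding limitin_componentwise using assms by simp
  then show ?thesis by (simp add: euclidean_product_topology)
qed

subsection \<open>Paths stopped just before a time\<close>

definition lval :: "path \<Rightarrow> real \<Rightarrow> int" where
  "lval x s = (SOME l. \<forall>\<^sub>F u in at_left s. x u = l)"

text \<open>By predictability of the rates, the rate at \<open>s\<close> may be computed from the
  path stopped just before \<open>s\<close>. Its values involve \<open>X\<close> strictly before
  \<open>s\<close> only, which makes them predictable in outcome and time.\<close>

definition stop :: "real \<Rightarrow> path \<Rightarrow> path" where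
  "stop s x t = (if t < s then x t else lval x s)"

lemma lval:
  assumes "Dpath Xs x" "0 < s" shows "\<forall>\<^sub>F u in at_left s. x u = lval x s"
proof -
  obtain l where "(x \<longlongrightarrow> l) (at_left s)" using assms by (auto simp: Dpath_def)
  then have "\<exists>l. \<forall>\<^sub>F u in at_left s. x u = l" by (auto simp: tendsto_discrete)
  then show ?thesis unfolding lval_def by (rule someI_ex)
qed

lemma lval_in:
  assumes "Dpath Xs x" "0 < s" shows "lval x s \<in> Xs"
proof -
  from lval[OF assms] obtain b where b: "b < s" "\<And>y. b < y \<Longrightarrow> y < s \<Longrightarrow> x y = lval x s"
    unfolding eventually_at_left_field by blast
  have "max b 0 < s" using b assms by simp
  then obtain y where "max b 0 < y" "y < s" using dense by blast
  then have "x y = lval x s" "0 \<le> y" using b by auto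
  then show ?thesis using assms(1) by (metis Dpath_def)
qed

lemma stop_Dpath:
  assumes x: "Dpath Xs x" and s: "0 < s" shows "Dpath Xs (stop s x)"
  unfolding Dpath_def
proof (intro conjI allI impI)
  show "stop s x t \<in> Xs" if "0 \<le> t" for t
    using x lval_in[OF x s] that by (simp add: stop_def Dpath_def)
  show "stop s x t = stop s x 0" if "t < 0" for t
    using x s that by (simp add: stop_def Dpath_def)
  show "continuous (at_right t) (stop s x)" if t: "0 \<le> t" for t
  proof -
    have "\<forall>\<^sub>F y in at_right t. stop s x y = stop s x t"
    proof (cases "t < s")
      case True
      have "continuous (at_right t) x" using x t by (simp add: Dpath_def)
      then have "\<forall>\<^sub>F y in at_right t. x y = x t" by (simp add: continuous_within tendsto_discrete)
      moreover have "\<forall>\<^sub>F y in at_right t. y < s" using True unfolding eventually_at_right_field by blast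
      ultimately show ?thesis by eventually_elim (use True in \<open>simp add: stop_def\<close>)
    next
      case False
      have "\<forall>\<^sub>F y in at_right t. t < y" unfolding eventually_at_right_field by (intro exI[of _ "t + 1"]) auto
      then show ?thesis by eventually_elim (use False in \<open>simp add: stop_def\<close>)
    qed
    then show ?thesis unfolding continuous_within by (rule tendsto_eventually)
  qed
  show "\<exists>l. (stop s x \<longlongrightarrow> l) (at_left t)" if t: "0 < t" for t
  proof (cases "t \<le> s")
    case True
    obtain l where "(x \<longlongrightarrow> l) (at_left t)" using x t by (auto simp: Dpath_def)
    then have "\<forall>\<^sub>F y in at_left t. x y = l" by (simp add: tendsto_discrete)
    moreover have "\<forall>\<^sub>F y in at_left t. y < t" unfolding eventually_at_left_field by (intro exI[of _ "t - 1"]) auto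
    ultimately have "\<forall>\<^sub>F y in at_left t. stop s x y = l" by eventually_elim (use True in \<open>simp add: stop_def\<close>)
    then show ?thesis by (auto intro: tendsto_eventually)
  next
    case False
    then have "\<forall>\<^sub>F y in at_left t. s < y" unfolding eventually_at_left_field by (intro exI[of _ s]) auto
    then have "\<forall>\<^sub>F y in at_left t. stop s x y = lval x s" by eventually_elim (simp add: stop_def)
    then show ?thesis by (auto intro: tendsto_eventually)
  qed
qed

text \<open>The largest multiple of \<open>1 / 2 ^ m\<close> strictly below \<open>s\<close>;
  subtracting 1 from the ceiling enforces strictness when \<open>s\<close> is itself such a
  multiple.\<close>

definition predg :: "nat \<Rightarrow> real \<Rightarrow> real" where
  "predg m s = (real_of_int \<lceil>s * 2 ^ m\<rceil> - 1) / 2 ^ m"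

lemma predg_bounds: "predg m s < s" "s - (1/2) ^ m \<le> predg m s"
proof -
  have a: "real_of_int \<lceil>s * 2 ^ m\<rceil> - 1 < s * 2 ^ m" by linarith
  then show "predg m s < s" unfolding predg_def by (simp add: pos_divide_less_eq)
  have "s * 2 ^ m - 1 \<le> real_of_int \<lceil>s * 2 ^ m\<rceil> - 1" by linarith
  then have "(s * 2 ^ m - 1) / 2 ^ m \<le> predg m s" unfolding predg_def by (intro divide_right_mono) auto
  moreover have "(s * 2 ^ m - 1) / 2 ^ m = s - (1/2) ^ m" by (simp add: diff_divide_distrib power_one_over)
  ultimately show "s - (1/2) ^ m \<le> predg m s" by simp
qed

text \<open>An integer path attains its left limit before \<open>s\<close>, so the limit is read off
  along dyadic times that approach \<open>s\<close> from the left.\<close>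

lemma lval_predg:
  assumes "Dpath Xs x" "0 < s"
  shows "lval x s = i \<longleftrightarrow> (\<exists>N. \<forall>m\<ge>N. x (predg m s) = i)"
proof -
  from lval[OF assms] obtain b where b: "b < s" "\<And>y. b < y \<Longrightarrow> y < s \<Longrightarrow> x y = lval x s"
    unfolding eventually_at_left_field by blast
  have "(\<lambda>m. (1/2::real) ^ m) \<longlonglongrightarrow> 0" by (rule LIMSEQ_power_zero) simp
  then have "\<forall>\<^sub>F m in sequentially. (1/2::real) ^ m < s - b" using b by (intro order_tendstoD) auto
  then obtain N where N: "\<And>m. N \<le> m \<Longrightarrow> (1/2::real) ^ m < s - b" unfolding eventually_sequentially by blast
  have *: "x (predg m s) = lval x s" if "N \<le> m" for m
    using N[OF that] predg_bounds[where m=m and s=s] by (intro b(2)) auto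
  show ?thesis
  proof
    assume "lval x s = i"
    then show "\<exists>N. \<forall>m\<ge>N. x (predg m s) = i" using * by blast
  next
    assume "\<exists>N. \<forall>m\<ge>N. x (predg m s) = i"
    then obtain N' where "\<And>m. N' \<le> m \<Longrightarrow> x (predg m s) = i" by blast
    from this[of "max N N'"] *[of "max N N'"] show "lval x s = i" by simp
  qed
qed

section \<open>The predictable sigma-algebra and left limits of the solution\<close>

context jump_model begin

abbreviation predM :: "'w measure \<Rightarrow> (real \<Rightarrow> 'w set set) \<Rightarrow> ('w \<times> pt) measure" where
  "predM M F \<equiv> sigma (pred_space M) (pred_gen M F)"

lemma predM_space_sets:
  assumes sol: "strong_solution Xs J \<sigma> rbar M F G N X"
  shows "space (predM M F) = pred_space M" "sets (predM M F) = sigma_sets (pred_space M) (pred_gen M F)"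
proof -
  have c: "pred_gen M F \<subseteq> Pow (pred_space M)" by (rule pred_gen_closed) (rule strong_solD(9)[OF sol])
  show "space (predM M F) = pred_space M" using c by (rule space_measure_of)
  show "sets (predM M F) = sigma_sets (pred_space M) (pred_gen M F)" using c by (rule sets_measure_of)
qed

lemma pred_spaceD: "z \<in> pred_space M \<Longrightarrow> fst z \<in> space M \<and> snd z \<in> space pm \<and> 0 < fst (snd z) \<and> snd (snd z) \<in> space (half \<Otimes>\<^sub>M jm)"
  unfolding pred_space_def by (auto simp: space_pm space_pair_measure space_restrict_space space_point_measure)

lemma predM_gen:
  assumes sol: "strong_solution Xs J \<sigma> rbar M F G N X" and a: "0 \<le> a" "E \<in> F a" and B: "B \<in> sets (half \<Otimes>\<^sub>M jm)"
  shows "{z \<in> pred_space M. fst z \<in> E \<and> a < fst (snd z) \<and> fst (snd z) \<le> b \<and> snd (snd z) \<in> B} \<in> sets (predM M F)"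
    and "{z \<in> pred_space M. fst z \<in> E \<and> a < fst (snd z) \<and> snd (snd z) \<in> B} \<in> sets (predM M F)"
proof -
  have ss: "\<And>b. E \<times> {p \<in> space pm. a < fst p \<and> fst p \<le> b \<and> snd p \<in> B} \<in> sets (predM M F)"
  proof -
    fix b
    have "E \<times> {p \<in> space pm. a < fst p \<and> fst p \<le> b \<and> snd p \<in> B} \<in> pred_gen M F"
      unfolding pred_gen_def mem_Collect_eq using a B by (intro exI[of _ E] exI[of _ a] exI[of _ b] exI[of _ B]) simp
    then show "E \<times> {p \<in> space pm. a < fst p \<and> fst p \<le> b \<and> snd p \<in> B} \<in> sets (predM M F)"
      unfolding predM_space_sets(2)[OF sol] by (rule sigma_sets.Basic)
  qed
  have "E \<subseteq> space M" using strong_solD(9)[OF sol a(1)] a(2) sets.sets_into_space by blast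
  then have eq: "E \<times> {p \<in> space pm. a < fst p \<and> fst p \<le> b \<and> snd p \<in> B} =
     {z \<in> pred_space M. fst z \<in> E \<and> a < fst (snd z) \<and> fst (snd z) \<le> b \<and> snd (snd z) \<in> B}" for b
    using a(1) by (auto simp: pred_space_def)
  show 1: "{z \<in> pred_space M. fst z \<in> E \<and> a < fst (snd z) \<and> fst (snd z) \<le> b \<and> snd (snd z) \<in> B} \<in> sets (predM M F)" for b
    using ss[of b] unfolding eq .
  have "{z \<in> pred_space M. fst z \<in> E \<and> a < fst (snd z) \<and> snd (snd z) \<in> B} =
     (\<Union>n::nat. {z \<in> pred_space M. fst z \<in> E \<and> a < fst (snd z) \<and> fst (snd z) \<le> real n \<and> snd (snd z) \<in> B})"
  proof (intro equalityI subsetI)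
    fix z assume z: "z \<in> {z \<in> pred_space M. fst z \<in> E \<and> a < fst (snd z) \<and> snd (snd z) \<in> B}"
    obtain n :: nat where "fst (snd z) \<le> real n" using real_arch_simple by blast
    then show "z \<in> (\<Union>n::nat. {z \<in> pred_space M. fst z \<in> E \<and> a < fst (snd z) \<and> fst (snd z) \<le> real n \<and> snd (snd z) \<in> B})" using z by auto
  qed auto
  also have "\<dots> \<in> sets (predM M F)" using 1 by (intro sets.countable_UN) auto
  finally show "{z \<in> pred_space M. fst z \<in> E \<and> a < fst (snd z) \<and> snd (snd z) \<in> B} \<in> sets (predM M F)" .
qed

lemma predM_adapted:
  assumes sol: "strong_solution Xs J \<sigma> rbar M F G N X" and a: "0 \<le> a" "E \<in> F a"
  shows "{z \<in> pred_space M. fst z \<in> E \<and> a < fst (snd z) \<and> fst (snd z) \<le> b} \<in> sets (predM M F)"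
    and "{z \<in> pred_space M. fst z \<in> E \<and> a < fst (snd z)} \<in> sets (predM M F)"
proof -
  have "{z \<in> pred_space M. fst z \<in> E \<and> a < fst (snd z) \<and> fst (snd z) \<le> b} =
    {z \<in> pred_space M. fst z \<in> E \<and> a < fst (snd z) \<and> fst (snd z) \<le> b \<and> snd (snd z) \<in> space (half \<Otimes>\<^sub>M jm)}"
    using pred_spaceD by blast
  then show "{z \<in> pred_space M. fst z \<in> E \<and> a < fst (snd z) \<and> fst (snd z) \<le> b} \<in> sets (predM M F)"
    using predM_gen(1)[OF sol a sets.top, of b] by simp
  have "{z \<in> pred_space M. fst z \<in> E \<and> a < fst (snd z)} =
    {z \<in> pred_space M. fst z \<in> E \<and> a < fst (snd z) \<and> snd (snd z) \<in> space (half \<Otimes>\<^sub>M jm)}"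
    using pred_spaceD by blast
  then show "{z \<in> pred_space M. fst z \<in> E \<and> a < fst (snd z)} \<in> sets (predM M F)"
    using predM_gen(2)[OF sol a sets.top] by simp
qed

lemma predM_F0:
  assumes sol: "strong_solution Xs J \<sigma> rbar M F G N X" and E: "E \<in> F 0"
  shows "{z \<in> pred_space M. fst z \<in> E} \<in> sets (predM M F)"
proof -
  have "{z \<in> pred_space M. fst z \<in> E} = {z \<in> pred_space M. fst z \<in> E \<and> 0 < fst (snd z)}" using pred_spaceD by blast
  then show ?thesis using predM_adapted(2)[OF sol order_refl E] by simp
qed

lemma predM_time:
  assumes sol: "strong_solution Xs J \<sigma> rbar M F G N X"
  shows "(\<lambda>z. fst (snd z)) \<in> borel_measurable (predM M F)"
  unfolding borel_measurable_iff_greater predM_space_sets(1)[OF sol]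
proof
  fix a :: real
  interpret sigma_algebra "space M" "F (max a 0)" by (rule strong_solD(8)[OF sol]) simp
  have "{w \<in> pred_space M. a < fst (snd w)} = {z \<in> pred_space M. fst z \<in> space M \<and> max a 0 < fst (snd z)}"
  proof (rule Collect_cong, rule conj_cong[OF refl])
    fix z assume "z \<in> pred_space M"
    from pred_spaceD[OF this] show "(a < fst (snd z)) = (fst z \<in> space M \<and> max a 0 < fst (snd z))" by simp
  qed
  then show "{w \<in> pred_space M. a < fst (snd w)} \<in> sets (predM M F)"
    using predM_adapted(2)[OF sol, of "max a 0" "space M"] top by simp
qed

lemma predM_snd:
  assumes sol: "strong_solution Xs J \<sigma> rbar M F G N X"
  shows "(\<lambda>z. snd (snd z)) \<in> measurable (predM M F) (half \<Otimes>\<^sub>M jm)"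
proof (rule measurableI)
  show "snd (snd z) \<in> space (half \<Otimes>\<^sub>M jm)" if "z \<in> space (predM M F)" for z
    using that pred_spaceD unfolding predM_space_sets(1)[OF sol] by blast
  fix B assume B: "B \<in> sets (half \<Otimes>\<^sub>M jm)"
  interpret sigma_algebra "space M" "F 0" by (rule strong_solD(8)[OF sol]) simp
  have "(\<lambda>z. snd (snd z)) -` B \<inter> space (predM M F) = {z \<in> pred_space M. fst z \<in> space M \<and> 0 < fst (snd z) \<and> snd (snd z) \<in> B}"
    unfolding predM_space_sets(1)[OF sol] using pred_spaceD by blast
  then show "(\<lambda>z. snd (snd z)) -` B \<inter> space (predM M F) \<in> sets (predM M F)"
    using predM_gen(2)[OF sol order_refl top B] by simp
qed

text \<open>On the strip between two consecutive dyadic times \<open>predg m\<close> is constant and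
  equal to the left end, where \<open>X\<close> is already known; the left limit is a countable
  combination of such events.\<close>

lemma predM_lval:
  assumes sol: "strong_solution Xs J \<sigma> rbar M F G N X"
  shows "{z \<in> pred_space M. u \<in> verts (G (fst z)) \<and> lval (X (fst z) u) (fst (snd z)) = i} \<in> sets (predM M F)"
proof -
  note d = strong_solD[OF sol]
  let ?Q = "\<lambda>m z. u \<in> verts (G (fst z)) \<and> X (fst z) u (predg m (fst (snd z))) = i"
  have Q: "{z \<in> space (predM M F). ?Q m z} \<in> sets (predM M F)" for m
  proof -
    have "{z \<in> space (predM M F). ?Q m z} = (\<Union>k::nat. {z \<in> pred_space M. fst z \<in> {\<omega> \<in> space M. u \<in> verts (G \<omega>) \<and> X \<omega> u (real k / 2 ^ m) = i} \<and>
        real k / 2 ^ m < fst (snd z) \<and> fst (snd z) \<le> real (Suc k) / 2 ^ m})"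
      unfolding predM_space_sets(1)[OF sol]
    proof (intro equalityI subsetI)
      fix z assume z: "z \<in> {z \<in> pred_space M. ?Q m z}"
      let ?s = "fst (snd z)"
      have s: "0 < ?s" and zM: "fst z \<in> space M" using z pred_spaceD[of z M] by auto
      define k where "k = nat (\<lceil>?s * 2 ^ m\<rceil> - 1)"
      have "0 < ?s * 2 ^ m" using s by simp
      then have "0 < \<lceil>?s * 2 ^ m\<rceil>" by (simp only: zero_less_ceiling)
      then have k: "real k = real_of_int \<lceil>?s * 2 ^ m\<rceil> - 1" unfolding k_def by simp
      have pk: "predg m ?s = real k / 2 ^ m" by (simp add: predg_def k)
      have "?s * 2 ^ m \<le> real (Suc k)" using k by simp
      then have "?s \<le> real (Suc k) / 2 ^ m" by (simp add: pos_le_divide_eq)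
      moreover have "real k / 2 ^ m < ?s" using predg_bounds(1)[of m ?s] pk by simp
      ultimately show "z \<in> (\<Union>k::nat. {z \<in> pred_space M. fst z \<in> {\<omega> \<in> space M. u \<in> verts (G \<omega>) \<and> X \<omega> u (real k / 2 ^ m) = i} \<and>
        real k / 2 ^ m < fst (snd z) \<and> fst (snd z) \<le> real (Suc k) / 2 ^ m})"
        using z zM pk by (intro UN_I[of k]) simp_all
    next
      fix z assume "z \<in> (\<Union>k::nat. {z \<in> pred_space M. fst z \<in> {\<omega> \<in> space M. u \<in> verts (G \<omega>) \<and> X \<omega> u (real k / 2 ^ m) = i} \<and>
        real k / 2 ^ m < fst (snd z) \<and> fst (snd z) \<le> real (Suc k) / 2 ^ m})"
      then obtain k :: nat where z: "z \<in> pred_space M" "u \<in> verts (G (fst z))" "X (fst z) u (real k / 2 ^ m) = i"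
        and k: "real k / 2 ^ m < fst (snd z)" "fst (snd z) \<le> real (Suc k) / 2 ^ m" by auto
      have "real k < fst (snd z) * 2 ^ m" "fst (snd z) * 2 ^ m \<le> real (Suc k)"
        using k by (simp_all only: pos_divide_less_eq pos_le_divide_eq zero_less_power zero_less_numeral)
      then have "\<lceil>fst (snd z) * 2 ^ m\<rceil> = int k + 1" by (intro ceiling_unique) auto
      then have "predg m (fst (snd z)) = real k / 2 ^ m" by (simp add: predg_def)
      then show "z \<in> {z \<in> pred_space M. ?Q m z}" using z by simp
    qed
    also have "\<dots> \<in> sets (predM M F)"
    proof (intro sets.countable_UN image_subsetI)
      fix k :: nat
      have "0 \<le> real k / 2 ^ m" by simp
      from predM_adapted(1)[OF sol this d(11)[OF this order_refl], where b="real (Suc k) / 2 ^ m"]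
      show "{z \<in> pred_space M. fst z \<in> {\<omega> \<in> space M. u \<in> verts (G \<omega>) \<and> X \<omega> u (real k / 2 ^ m) = i} \<and>
        real k / 2 ^ m < fst (snd z) \<and> fst (snd z) \<le> real (Suc k) / 2 ^ m} \<in> sets (predM M F)" .
    qed
    finally show ?thesis .
  qed
  have "{z \<in> pred_space M. u \<in> verts (G (fst z)) \<and> lval (X (fst z) u) (fst (snd z)) = i} =
     {z \<in> space (predM M F). \<exists>N. \<forall>m. N \<le> m \<longrightarrow> ?Q m z}"
    unfolding predM_space_sets(1)[OF sol]
  proof (rule Collect_cong, rule conj_cong[OF refl])
    fix z assume z: "z \<in> pred_space M"
    show "(u \<in> verts (G (fst z)) \<and> lval (X (fst z) u) (fst (snd z)) = i) = (\<exists>N. \<forall>m. N \<le> m \<longrightarrow> ?Q m z)"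
    proof (cases "u \<in> verts (G (fst z))")
      case True
      then have "Dpath Xs (X (fst z) u)" using d(7) pred_spaceD[OF z] by (auto simp: meas_paths_def)
      from lval_predg[OF this, of "fst (snd z)" i] show ?thesis using True pred_spaceD[OF z] by simp
    qed auto
  qed
  also have "\<dots> \<in> sets (predM M F)"
    by (intro sets.sets_Collect_countable_Ex sets.sets_Collect_countable_All sets.sets_Collect_imp sets.sets_Collect_const Q)
  finally show ?thesis .
qed

subsection \<open>Marks that separate two rates\<close>

text \<open>A mark in this set is accepted under one family of graph marks and rejected under the
  other. Both rates use the same path \<open>X\<close>, so the set can be predictable.\<close>

definition bad :: "'w measure \<Rightarrow> ('w \<Rightarrow> ('e, 'k \<times> int) mgraph) \<Rightarrow> ('w \<Rightarrow> nat \<Rightarrow> path) \<Rightarrow> nat \<Rightarrow> nat set \<Rightarrow> nat set set \<Rightarrow>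
    ('w \<Rightarrow> nat set \<Rightarrow> 'e) \<Rightarrow> ('w \<Rightarrow> nat \<Rightarrow> 'k) \<Rightarrow> ('w \<times> pt) set" where
  "bad M G X v U EU eb kap = {z \<in> pred_space M. loc G v U EU (fst z) \<and>
     \<not> (fst (snd (snd z)) \<le> rt (G (fst z)) (snd (snd (snd z))) v (fst (snd z)) (X (fst z)) \<longleftrightarrow>
        fst (snd (snd z)) \<le> rate rbar (snd (snd (snd z))) (edges (G (fst z))) (eb (fst z)) (kap (fst z)) v (fst (snd z)) (X (fst z)))}"

lemma loc_F0:
  assumes sol: "strong_solution Xs J \<sigma> rbar M F G N X" and U: "finite U"
  shows "{\<omega> \<in> space M. loc G v U EU \<omega>} \<in> F 0"
proof -
  have "id \<in> measurable (graphM borel borel) (graphM borel borel :: ('e, 'k \<times> int) mgraph measure)" by simp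
  from loc_sets[OF this U, of v EU]
  have "{H :: ('e, 'k \<times> int) mgraph. loc id v U EU H} \<in> sets (graphM borel borel)" by simp
  from strong_solD(5)[OF sol this]
  have "G -` {H. loc id v U EU H} \<inter> space M \<in> F 0" .
  moreover have "G -` {H. loc id v U EU H} \<inter> space M = {\<omega> \<in> space M. loc G v U EU \<omega>}" by (auto simp: loc_def)
  ultimately show ?thesis by simp
qed

lemma F0_comp_predM:
  assumes sol: "strong_solution Xs J \<sigma> rbar M F G N X"
    and f: "\<And>B. B \<in> sets K \<Longrightarrow> f -` B \<inter> space M \<in> F 0" "\<And>\<omega>. \<omega> \<in> space M \<Longrightarrow> f \<omega> \<in> space K"
  shows "(\<lambda>z. f (fst z)) \<in> measurable (predM M F) K"
proof (rule measurableI)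
  show "f (fst z) \<in> space K" if "z \<in> space (predM M F)" for z
    using that f(2) pred_spaceD[of z M] unfolding predM_space_sets(1)[OF sol] by blast
  fix B assume B: "B \<in> sets K"
  have "(\<lambda>z. f (fst z)) -` B \<inter> space (predM M F) = {z \<in> pred_space M. fst z \<in> f -` B \<inter> space M}"
    unfolding predM_space_sets(1)[OF sol] using pred_spaceD by blast
  then show "(\<lambda>z. f (fst z)) -` B \<inter> space (predM M F) \<in> sets (predM M F)" using predM_F0[OF sol f(1)[OF B]] by simp
qed

lemma rate_stop:
  assumes "wf_graph ok H" "v \<in> verts H" "j \<in> J" "0 < s" "paths_on (clos (edges H) v) x"
  shows "rate rbar j (edges H) eb kap v s x = rate rbar j (edges H) eb kap v s (\<lambda>u. stop s (x u))"
  using assms by (intro rate_pred[where ok=ok]) (auto simp: stop_def intro: stop_Dpath)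

text \<open>In both rates \<open>X\<close> may be replaced by its stopped version, whose values are
  predictable, and the graph marks are known at time 0. Measurability of \<open>rbar\<close> then
  passes to the rates.\<close>

lemma bad_predictable:
  assumes sol: "strong_solution Xs J \<sigma> rbar M F G N X" and U: "finite U"
    and eb: "\<And>e B. B \<in> sets borel \<Longrightarrow> (\<lambda>\<omega>. eb \<omega> e) -` B \<inter> space M \<in> F 0"
    and kap: "\<And>u B. B \<in> sets borel \<Longrightarrow> (\<lambda>\<omega>. kap \<omega> u) -` B \<inter> space M \<in> F 0"
  shows "bad M G X v U EU eb kap \<in> sets (predM M F)"
proof -
  note d = strong_solD[OF sol]
  define D where "D = {z \<in> pred_space M. loc G v U EU (fst z)}"
  have Ds: "D \<in> sets (predM M F)"
  proof -
    have "D = {z \<in> pred_space M. fst z \<in> {\<omega> \<in> space M. loc G v U EU \<omega>}}" unfolding D_def using pred_spaceD by blast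
    then show ?thesis using predM_F0[OF sol loc_F0[OF sol U]] by simp
  qed
  have Dl: "z \<in> pred_space M" "loc G v U EU (fst z)" "fst z \<in> space M" "v \<in> verts (G (fst z))"
    "clos (edges (G (fst z))) v = U" "U \<subseteq> verts (G (fst z))" "0 < fst (snd z)" if "z \<in> D" for z
  proof -
    show 1: "z \<in> pred_space M" "loc G v U EU (fst z)" using that by (simp_all add: D_def)
    show 2: "fst z \<in> space M" "0 < fst (snd z)" using pred_spaceD[OF 1(1)] by simp_all
    show 3: "v \<in> verts (G (fst z))" "clos (edges (G (fst z))) v = U" using 1(2) by (simp_all add: loc_def)
    show "U \<subseteq> verts (G (fst z))" using wf_clos_verts[OF d(3)[OF 2(1)] 3(1)] 3(2) by simp
  qed
  let ?Z = "restrict_space (predM M F) D"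
  have spZ: "space ?Z = D" using sets.sets_into_space[OF Ds] by (auto simp: space_restrict_space)
  show ?thesis
  proof (cases "D = {}")
    case True
    then have "bad M G X v U EU eb kap = {}" unfolding bad_def D_def by blast
    then show ?thesis by (simp only: sets.empty_sets)
  next
    case False
    then obtain z0 where z0: "z0 \<in> D" by blast
    have R1: "radius1 (U, EU, v)" by (rule loc_radius1[of G "fst z0", OF d(3)[OF Dl(3)[OF z0]] Dl(2)[OF z0]])
    have XD: "Dpath Xs (X (fst z) u)" if "z \<in> D" "u \<in> U" for z u
      using d(7) Dl(3)[OF that(1)] Dl(6)[OF that(1)] that(2) unfolding meas_paths_def by blast
    have rm: "(\<lambda>z. rbar j (U, EU, v) (fst (snd z)) (restrict (\<lambda>u. stop (fst (snd z)) (X (fst z) u)) U) (restrict (ebb (fst z)) EU) (restrict (kapp (fst z)) U)) \<in> borel_measurable ?Z"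
      if j: "j \<in> J" and ebb: "\<And>e B. B \<in> sets borel \<Longrightarrow> (\<lambda>\<omega>. ebb \<omega> e) -` B \<inter> space M \<in> F 0"
       and kapp: "\<And>u B. B \<in> sets borel \<Longrightarrow> (\<lambda>\<omega>. kapp \<omega> u) -` B \<inter> space M \<in> F 0" for j ebb kapp
    proof (rule rbar_measurable[OF R1 j])
      show "(\<lambda>z. fst (snd z)) \<in> borel_measurable ?Z" by (rule measurable_restrict_space1[OF predM_time[OF sol]])
      show "0 \<le> fst (snd z)" if "z \<in> space ?Z" for z using that Dl(7)[of z] unfolding spZ by simp
      show "Dpath Xs (stop (fst (snd z)) (X (fst z) u))" if "z \<in> space ?Z" "u \<in> U" for z u
        using that Dl(7)[of z] XD[of z u] unfolding spZ by (intro stop_Dpath) auto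
      show "{z \<in> space ?Z. stop (fst (snd z)) (X (fst z) u) t = i} \<in> sets ?Z" if u: "u \<in> U" and t: "0 \<le> t" for u t i
      proof -
        let ?A = "{z \<in> pred_space M. fst z \<in> {\<omega> \<in> space M. u \<in> verts (G \<omega>) \<and> X \<omega> u t = i} \<and> t < fst (snd z)}"
        let ?B = "{z \<in> pred_space M. u \<in> verts (G (fst z)) \<and> lval (X (fst z) u) (fst (snd z)) = i}"
        let ?T = "{z \<in> pred_space M. fst z \<in> space M \<and> t < fst (snd z)}"
        have A: "?A \<in> sets (predM M F)" by (rule predM_adapted(2)[OF sol t d(11)[OF t order_refl]])
        have B: "?B \<in> sets (predM M F)" by (rule predM_lval[OF sol])
        have T: "?T \<in> sets (predM M F)"
        proof -
          interpret sigma_algebra "space M" "F t" by (rule d(8)[OF t])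
          show ?thesis by (rule predM_adapted(2)[OF sol t top])
        qed
        \<comment> \<open>Where \<open>t\<close> precedes the mark, the stopped path shows
          \<open>X\<close> at \<open>t\<close>, known before the mark; otherwise it shows the left
          limit at the mark.\<close>
        have "{z \<in> space ?Z. stop (fst (snd z)) (X (fst z) u) t = i} = D \<inter> (?A \<union> (?B - ?T))"
          unfolding spZ
        proof (intro equalityI subsetI)
          fix z assume z: "z \<in> {z \<in> D. stop (fst (snd z)) (X (fst z) u) t = i}"
          then have zD: "z \<in> D" by simp
          have "u \<in> verts (G (fst z))" using Dl(6)[OF zD] u by blast
          then show "z \<in> D \<inter> (?A \<union> (?B - ?T))" using z Dl(1,3)[OF zD] by (cases "t < fst (snd z)") (simp_all add: stop_def)
        next
          fix z assume z: "z \<in> D \<inter> (?A \<union> (?B - ?T))"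
          then have zD: "z \<in> D" by simp
          show "z \<in> {z \<in> D. stop (fst (snd z)) (X (fst z) u) t = i}" using z Dl(1,3)[OF zD] by (auto simp: stop_def)
        qed
        moreover have "D \<inter> (?A \<union> (?B - ?T)) \<in> sets ?Z" unfolding sets_restrict_space using A B T by blast
        ultimately show ?thesis by simp
      qed
      show "(\<lambda>z. ebb (fst z) e) \<in> borel_measurable ?Z" for e
        by (rule measurable_restrict_space1) (rule F0_comp_predM[OF sol], auto intro: ebb)
      show "(\<lambda>z. kapp (fst z) u) \<in> borel_measurable ?Z" for u
        by (rule measurable_restrict_space1) (rule F0_comp_predM[OF sol], auto intro: kapp)
    qed
    have em: "(\<lambda>\<omega>. emark (G \<omega>) e) -` B \<inter> space M \<in> F 0" if "B \<in> sets borel" for e B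
    proof -
      have "(\<lambda>\<omega>. emark (G \<omega>) e) -` B \<inter> space M = G -` {H. emark H e \<in> B} \<inter> space M" by auto
      then show ?thesis using d(5)[OF graphM_emark[OF that]] by simp
    qed
    have vm: "(\<lambda>\<omega>. fst (vmark (G \<omega>) u)) -` B \<inter> space M \<in> F 0" if "B \<in> sets borel" for u B
    proof -
      have "(\<lambda>H. fst (vmark H u)) -` B \<inter> space (graphM borel borel) \<in> sets (graphM borel borel :: ('e, 'k \<times> int) mgraph measure)"
        using vmark_fst_meas[of id "graphM borel borel" u] that by (intro measurable_sets) simp_all
      then have "{H. fst (vmark H u) \<in> B} \<in> sets (graphM borel borel :: ('e, 'k \<times> int) mgraph measure)"
        by (simp add: vimage_def graphM_def space_measure_of_conv)
      from d(5)[OF this] have "G -` {H. fst (vmark H u) \<in> B} \<inter> space M \<in> F 0" .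
      moreover have "(\<lambda>\<omega>. fst (vmark (G \<omega>) u)) -` B \<inter> space M = G -` {H. fst (vmark H u) \<in> B} \<inter> space M" by auto
      ultimately show ?thesis by simp
    qed
    define f where "f j z = rbar j (U, EU, v) (fst (snd z)) (restrict (\<lambda>u. stop (fst (snd z)) (X (fst z) u)) U) (restrict (emark (G (fst z))) EU) (restrict (\<lambda>u. fst (vmark (G (fst z)) u)) U)" for j and z :: "'a \<times> pt"
    define g where "g j z = rbar j (U, EU, v) (fst (snd z)) (restrict (\<lambda>u. stop (fst (snd z)) (X (fst z) u)) U) (restrict (eb (fst z)) EU) (restrict (kap (fst z)) U)" for j and z :: "'a \<times> pt"
    have fm: "f j \<in> borel_measurable ?Z" and gm: "g j \<in> borel_measurable ?Z" if "j \<in> J" for j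
      unfolding f_def g_def using rm[OF that, of "\<lambda>\<omega>. emark (G \<omega>)" "\<lambda>\<omega> u. fst (vmark (G \<omega>) u)"] rm[OF that, of eb kap] em vm eb kap by blast+
    have fg: "rt (G (fst z)) j v (fst (snd z)) (X (fst z)) = f j z"
      "rate rbar j (edges (G (fst z))) (eb (fst z)) (kap (fst z)) v (fst (snd z)) (X (fst z)) = g j z" if z: "z \<in> D" and j: "j \<in> J" for z j
    proof -
      have st: "rate rbar j (edges (G (fst z))) e k v (fst (snd z)) (X (fst z)) =
         rbar j (U, EU, v) (fst (snd z)) (restrict (\<lambda>u. stop (fst (snd z)) (X (fst z) u)) U) (restrict e EU) (restrict k U)" for e k
        using rate_stop[OF d(3)[OF Dl(3)[OF z]] Dl(4)[OF z] j Dl(7)[OF z], of "X (fst z)" e k] XD[OF z] Dl(5)[OF z]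
        unfolding loc_rate[OF Dl(2)[OF z]] by simp
      show "rt (G (fst z)) j v (fst (snd z)) (X (fst z)) = f j z" unfolding st f_def comp_def ..
      show "rate rbar j (edges (G (fst z))) (eb (fst z)) (kap (fst z)) v (fst (snd z)) (X (fst z)) = g j z" unfolding st g_def ..
    qed
    have rj: "(\<lambda>z. fst (snd (snd z))) \<in> borel_measurable ?Z" "(\<lambda>z. snd (snd (snd z))) \<in> measurable ?Z (count_space UNIV)"
    proof -
      have "(\<lambda>q. fst q) \<in> borel_measurable (half \<Otimes>\<^sub>M jm)" using measurable_compose[OF measurable_fst half_borel, of jm] by simp
      from measurable_restrict_space1[OF measurable_compose[OF predM_snd[OF sol] this]] show "(\<lambda>z. fst (snd (snd z))) \<in> borel_measurable ?Z" .
      have "id \<in> measurable jm (count_space UNIV)" by (simp add: measurable_point_measure_eq1)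
      then have "(\<lambda>q. snd q) \<in> measurable (half \<Otimes>\<^sub>M jm) (count_space UNIV)" using measurable_compose[OF measurable_snd, of id jm "count_space UNIV" half] by simp
      from measurable_restrict_space1[OF measurable_compose[OF predM_snd[OF sol] this]] show "(\<lambda>z. snd (snd (snd z))) \<in> measurable ?Z (count_space UNIV)" .
    qed
    define Bj where "Bj j = {z \<in> space ?Z. snd (snd (snd z)) = j \<and> \<not> (fst (snd (snd z)) \<le> f j z \<longleftrightarrow> fst (snd (snd z)) \<le> g j z)}" for j
    have "Bj j \<in> sets ?Z" if "j \<in> J" for j
    proof -
      note [measurable] = rj fm[OF that] gm[OF that]
      show ?thesis unfolding Bj_def by measurable
    qed
    then have "(\<Union>j\<in>J. Bj j) \<in> sets ?Z" by (intro sets.countable_UN') auto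
    then have "(\<Union>j\<in>J. Bj j) \<in> sets (predM M F)" using Ds by (auto simp: sets_restrict_space)
    moreover have "bad M G X v U EU eb kap = (\<Union>j\<in>J. Bj j)"
    proof (intro equalityI subsetI)
      fix z assume z: "z \<in> bad M G X v U EU eb kap"
      then have zD: "z \<in> D" by (simp add: bad_def D_def)
      have j: "snd (snd (snd z)) \<in> J" using pred_spaceD[OF Dl(1)[OF zD]] by (simp add: space_pm mem_Times_iff)
      show "z \<in> (\<Union>j\<in>J. Bj j)"
      proof (rule UN_I[OF j])
        show "z \<in> Bj (snd (snd (snd z)))" using z zD unfolding Bj_def spZ bad_def mem_Collect_eq fg[OF zD j] by simp
      qed
    next
      fix z assume "z \<in> (\<Union>j\<in>J. Bj j)"
      then obtain j where j: "j \<in> J" "z \<in> Bj j" by (rule UN_E)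
      have zD: "z \<in> D" and jz: "snd (snd (snd z)) = j" using j(2) by (simp_all add: Bj_def spZ)
      show "z \<in> bad M G X v U EU eb kap"
        unfolding bad_def mem_Collect_eq jz fg[OF zD j(1)] using j(2) Dl(1,2)[OF zD] by (simp add: Bj_def)
    qed
    ultimately show ?thesis by simp
  qed
qed

text \<open>The probability of at least one mark is at most the expected number of marks, which the
  compensator turns into a product measure.\<close>

lemma hit_bound:
  assumes sol: "strong_solution Xs J \<sigma> rbar M F G N X" and A: "A \<in> sets (predM M F)"
  shows "{\<omega> \<in> space M. v \<in> verts (G \<omega>) \<and> (\<exists>p\<in>clean J (N \<omega> v) \<inter> tbox n. (\<omega>, p) \<in> A)} \<in> sets M"
    and "emeasure M {\<omega> \<in> space M. v \<in> verts (G \<omega>) \<and> (\<exists>p\<in>clean J (N \<omega> v) \<inter> tbox n. (\<omega>, p) \<in> A)} \<le>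
       emeasure (M \<Otimes>\<^sub>M pm) ((space M \<times> tbox n) \<inter> A)"
proof -
  note d = strong_solD[OF sol]
  have A': "A \<in> sigma_sets (pred_space M) (pred_gen M F)" using A unfolding predM_space_sets(2)[OF sol] .
  have Ap: "A \<in> sets (M \<Otimes>\<^sub>M pm)" by (rule pred_sets_pair[where F=F]) (rule d(9), assumption, rule A')
  have T: "(space M \<times> tbox n) \<inter> A \<in> sets (M \<Otimes>\<^sub>M pm)" by (intro sets.Int pair_measureI Ap) auto
  let ?H = "{\<omega> \<in> space M. v \<in> verts (G \<omega>) \<and> (\<exists>p\<in>clean J (N \<omega> v) \<inter> tbox n. (\<omega>, p) \<in> A)}"
  have c0: "clean J {} = {}" using clean_sub[of "{}"] by blast
  have Heq: "?H = {\<omega> \<in> space M. \<exists>p\<in>clean J (live G N v \<omega>). (\<omega>, p) \<in> (space M \<times> tbox n) \<inter> A}"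
    by (auto simp: live_def c0 split: if_splits)
  show Hs: "?H \<in> sets M"
    unfolding Heq using section_hit_measurable[OF live_measurable[OF sol] T] by (simp only: pred_def)
  have "emeasure M ?H = (\<integral>\<^sup>+\<omega>. indicator ?H \<omega> \<partial>M)" using Hs by (rule nn_integral_indicator[symmetric])
  also have "\<dots> \<le> (\<integral>\<^sup>+\<omega>. emeasure (count_space UNIV) (clean J (live G N v \<omega>) \<inter> tbox n \<inter> {p. (\<omega>, p) \<in> A}) \<partial>M)"
  proof (rule nn_integral_mono)
    fix \<omega> assume w: "\<omega> \<in> space M"
    show "indicator ?H \<omega> \<le> emeasure (count_space UNIV) (clean J (live G N v \<omega>) \<inter> tbox n \<inter> {p. (\<omega>, p) \<in> A})"
    proof (cases "\<omega> \<in> ?H")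
      case True
      then obtain p where "p \<in> clean J (live G N v \<omega>) \<inter> tbox n \<inter> {p. (\<omega>, p) \<in> A}" by (auto simp: live_def)
      then have "emeasure (count_space UNIV) {p} \<le> emeasure (count_space UNIV) (clean J (live G N v \<omega>) \<inter> tbox n \<inter> {p. (\<omega>, p) \<in> A})"
        by (intro emeasure_mono) auto
      then show ?thesis using True by simp
    qed simp
  qed
  also have "\<dots> = (\<integral>\<^sup>+\<omega>. indicator {\<omega>. v \<in> verts (G \<omega>)} \<omega> * emeasure pm (tbox n \<inter> {p. (\<omega>, p) \<in> A}) \<partial>M)"
    by (rule compensator[OF sol A'])
  also have "\<dots> \<le> (\<integral>\<^sup>+\<omega>. emeasure pm (Pair \<omega> -` ((space M \<times> tbox n) \<inter> A)) \<partial>M)"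
  proof (rule nn_integral_mono)
    fix \<omega> assume "\<omega> \<in> space M"
    then have "Pair \<omega> -` ((space M \<times> tbox n) \<inter> A) = tbox n \<inter> {p. (\<omega>, p) \<in> A}" by auto
    then show "indicator {\<omega>. v \<in> verts (G \<omega>)} \<omega> * emeasure pm (tbox n \<inter> {p. (\<omega>, p) \<in> A}) \<le> emeasure pm (Pair \<omega> -` ((space M \<times> tbox n) \<inter> A))"
      by (simp add: indicator_def)
  qed
  also have "\<dots> = emeasure (M \<Otimes>\<^sub>M pm) ((space M \<times> tbox n) \<inter> A)"
    by (rule sigma_finite_measure.emeasure_pair_measure_alt[OF sf_pm T, symmetric])
  finally show "emeasure M ?H \<le> emeasure (M \<Otimes>\<^sub>M pm) ((space M \<times> tbox n) \<inter> A)" .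
qed

end

section \<open>Almost sure absence of separating marks along a subsequence\<close>

text \<open>The \<open>m\<close>-th index is chosen such that the families \<open>0, ..., m\<close>
  all have measure below \<open>(1/2) ^ m\<close>. Each family is then summable along the
  subsequence, up to finitely many terms, and Borel-Cantelli applies.\<close>

lemma subseq_AE:
  assumes M: "finite_measure M" and s: "\<And>a k. A a k \<in> sets M"
    and lim: "\<And>a::nat. (\<lambda>k. measure M (A a k)) \<longlonglongrightarrow> 0"
  shows "\<exists>s::nat \<Rightarrow> nat. strict_mono s \<and> (AE \<omega> in M. \<forall>a. \<forall>\<^sub>F m in sequentially. \<omega> \<notin> A a (s m))"
proof -
  interpret finite_measure M by fact
  have ex: "\<exists>k>k0. \<forall>a\<le>m. measure M (A a k) < (1/2) ^ m" for k0 m :: nat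
  proof -
    have "\<forall>\<^sub>F k in sequentially. \<forall>a\<in>{..m}. measure M (A a k) < (1/2) ^ m"
      by (intro eventually_ball_finite ballI order_tendstoD(2)[OF lim]) simp_all
    moreover have "\<forall>\<^sub>F k in sequentially. k0 < k" by (rule eventually_gt_at_top)
    ultimately have "\<forall>\<^sub>F k in sequentially. k0 < k \<and> (\<forall>a\<in>{..m}. measure M (A a k) < (1/2) ^ m)"
      by (rule eventually_conj[rotated])
    then obtain k where "k0 < k \<and> (\<forall>a\<in>{..m}. measure M (A a k) < (1/2) ^ m)"
      using eventually_happens'[OF sequentially_bot] by blast
    then show ?thesis by auto
  qed
  define s where "s = rec_nat 0 (\<lambda>m k0. SOME k. k0 < k \<and> (\<forall>a\<le>m. measure M (A a k) < (1/2) ^ m))"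
  have sS: "s (Suc m) = (SOME k. s m < k \<and> (\<forall>a\<le>m. measure M (A a k) < (1/2) ^ m))" for m by (simp add: s_def)
  have P: "s m < s (Suc m) \<and> (\<forall>a\<le>m. measure M (A a (s (Suc m))) < (1/2) ^ m)" for m
    unfolding sS using ex[of "s m" m] by (rule someI_ex)
  \<comment> \<open>The starting value \<open>s 0\<close> carries no bound, hence the shift by
    one.\<close>
  define t where "t m = s (Suc m)" for m
  have "strict_mono t" unfolding strict_mono_Suc_iff t_def using P by blast
  moreover have "AE \<omega> in M. \<forall>a. \<forall>\<^sub>F m in sequentially. \<omega> \<notin> A a (t m)"
    unfolding AE_all_countable
  proof
    fix a
    have "summable (\<lambda>m. (1/2::real) ^ m)" by (simp add: summable_geometric)
    then have "summable (\<lambda>m. measure M (A a (t m)))"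
    proof (rule summable_comparison_test_ev[rotated])
      show "\<forall>\<^sub>F m in sequentially. norm (measure M (A a (t m))) \<le> (1/2) ^ m"
        using eventually_ge_at_top[of a] by eventually_elim (use P in \<open>auto simp: t_def less_imp_le\<close>)
    qed
    from borel_cantelli_AE1[OF _ _ this] have "AE x in M. \<forall>\<^sub>F n in sequentially. x \<in> space M - A a (t n)"
      using s by (simp add: emeasure_finite less_top[symmetric])
    then show "AE \<omega> in M. \<forall>\<^sub>F m in sequentially. \<omega> \<notin> A a (t m)"
    proof (rule AE_mp)
      show "AE x in M. (\<forall>\<^sub>F n in sequentially. x \<in> space M - A a (t n)) \<longrightarrow> (\<forall>\<^sub>F m in sequentially. x \<notin> A a (t m))"
        by (rule AE_I2, rule impI, erule eventually_mono) blast
    qed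
  qed
  ultimately show ?thesis by blast
qed

context jump_model begin

text \<open>Lebesgue measure has no atoms and there are countably many jumps, so the height of a
  mark hits none of the given values.\<close>

lemma graph_fiber_AE:
  "AE q in half \<Otimes>\<^sub>M jm. \<forall>j\<in>J. fst q \<noteq> (f j :: real)"
proof (rule AE_ball_countable')
  show "AE q in half \<Otimes>\<^sub>M jm. fst q \<noteq> f j" for j
  proof -
    let ?N = "({f j} \<inter> {0..}) \<times> J"
    have h: "{f j} \<inter> {0..} \<in> sets half" 
      unfolding sets_restrict_space by (rule image_eqI[of _ _ "{f j}"]) (simp_all add: Int_commute)
    have "emeasure half ({f j} \<inter> {0..}) = emeasure lborel ({f j} \<inter> {0..})" by (rule emeasure_restrict_space) auto
    also have "\<dots> = 0" by (rule emeasure_lborel_countable) simp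
    finally have z: "emeasure half ({f j} \<inter> {0..}) = 0" .
    have Js: "J \<in> sets jm" by (simp add: sets_point_measure)
    have "emeasure (half \<Otimes>\<^sub>M jm) ?N = 0"
      using sigma_finite_measure.emeasure_pair_measure_Times[OF finite_measure.sigma_finite_measure[OF fin_jm] h Js] z by simp
    then have N: "?N \<in> null_sets (half \<Otimes>\<^sub>M jm)" using pair_measureI[OF h Js] by (rule null_setsI)
    have "{q \<in> space (half \<Otimes>\<^sub>M jm). \<not> fst q \<noteq> f j} \<subseteq> ?N"
      by (rule subsetI) (simp add: space_pair_measure space_restrict_space space_point_measure mem_Times_iff)
    from AE_I'[OF N this] show "AE q in half \<Otimes>\<^sub>M jm. fst q \<noteq> f j" .
  qed
qed simp

text \<open>(A2) concerns convergence of all marks of the graph, whereas only those near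
  \<open>v\<close> are known to converge. The others are reset to their limits, which the rate at
  \<open>v\<close> does not see.\<close>

lemma rate_cont:
  assumes lim: "((\<lambda>(eb, kap). rate rbar j E eb kap v s x) \<longlongrightarrow> rate rbar j E e0 k0 v s x) (at (e0, k0))"
    and e: "\<And>e. e \<in> induced_edges E (clos E v) \<Longrightarrow> (\<lambda>k. ebs k e) \<longlonglongrightarrow> e0 e"
    and k: "\<And>u. u \<in> clos E v \<Longrightarrow> (\<lambda>k. kaps k u) \<longlonglongrightarrow> k0 u"
  shows "(\<lambda>k. rate rbar j E (ebs k) (kaps k) v s x) \<longlonglongrightarrow> rate rbar j E e0 k0 v s x"
proof -
  let ?z = "\<lambda>k. (\<lambda>e. if e \<in> induced_edges E (clos E v) then ebs k e else e0 e, \<lambda>u. if u \<in> clos E v then kaps k u else k0 u)"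
  have "(\<lambda>k. if e \<in> induced_edges E (clos E v) then ebs k e else e0 e) \<longlonglongrightarrow> e0 e" for e
    using assms(2)[of e] by (cases "e \<in> induced_edges E (clos E v)") simp_all
  moreover have "(\<lambda>k. if u \<in> clos E v then kaps k u else k0 u) \<longlonglongrightarrow> k0 u" for u
    using assms(3)[of u] by (cases "u \<in> clos E v") simp_all
  ultimately have "?z \<longlonglongrightarrow> (e0, k0)" by (intro tendsto_Pair tendsto_funI)
  from tendsto_compose_at[OF this lim]
  have "((\<lambda>(eb, kap). rate rbar j E eb kap v s x) \<circ> ?z) \<longlonglongrightarrow> rate rbar j E e0 k0 v s x" by simp
  moreover have "((\<lambda>(eb, kap). rate rbar j E eb kap v s x) \<circ> ?z) = (\<lambda>k. rate rbar j E (ebs k) (kaps k) v s x)"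
    by (rule ext) (simp add: rate_def Let_def comp_def cong: restrict_cong)
  ultimately show ?thesis by simp
qed

text \<open>For almost every outcome and mark the rates converge by (A2) and the height of the mark
  differs from the limiting rate; such a point lies in finitely many of the sets. Fubini and
  dominated convergence on the box of finite measure conclude.\<close>

lemma bad_tend:
  assumes sol: "strong_solution Xs J \<sigma> rbar M F G N X" and A2: "A2 J rbar M G X" and U: "finite U"
    and eb: "\<And>k e B. B \<in> sets borel \<Longrightarrow> (\<lambda>\<omega>. eb k \<omega> e) -` B \<inter> space M \<in> F 0"
    and kap: "\<And>k u B. B \<in> sets borel \<Longrightarrow> (\<lambda>\<omega>. kap k \<omega> u) -` B \<inter> space M \<in> F 0"
    and ebl: "\<And>\<omega> e. \<omega> \<in> space M \<Longrightarrow> loc G v U EU \<omega> \<Longrightarrow> e \<in> EU \<Longrightarrow> (\<lambda>k. eb k \<omega> e) \<longlonglongrightarrow> emark (G \<omega>) e"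
    and kapl: "\<And>\<omega> u. \<omega> \<in> space M \<Longrightarrow> loc G v U EU \<omega> \<Longrightarrow> u \<in> U \<Longrightarrow> (\<lambda>k. kap k \<omega> u) \<longlonglongrightarrow> fst (vmark (G \<omega>) u)"
  shows "(\<lambda>k. measure (M \<Otimes>\<^sub>M pm) ((space M \<times> tbox n) \<inter> bad M G X v U EU (eb k) (kap k))) \<longlonglongrightarrow> 0"
proof -
  note d = strong_solD[OF sol]
  interpret M: prob_space M by (rule d(2))
  interpret half: sigma_finite_measure half by (rule sf_half)
  interpret hj: sigma_finite_measure "half \<Otimes>\<^sub>M jm" by (rule sf_half_jm)
  interpret pm: sigma_finite_measure pm by (rule sf_pm)
  interpret hp: pair_sigma_finite half "half \<Otimes>\<^sub>M jm" ..
  interpret Mp: pair_sigma_finite M pm ..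
  define A where "A k = (space M \<times> tbox n) \<inter> bad M G X v U EU (eb k) (kap k)" for k
  have As: "A k \<in> sets (M \<Otimes>\<^sub>M pm)" for k
  proof -
    have "bad M G X v U EU (eb k) (kap k) \<in> sigma_sets (pred_space M) (pred_gen M F)"
      using bad_predictable[OF sol U eb kap] unfolding predM_space_sets(2)[OF sol] .
    then have "bad M G X v U EU (eb k) (kap k) \<in> sets (M \<Otimes>\<^sub>M pm)"
      by (intro pred_sets_pair[where F=F]) (rule d(9))
    then show ?thesis unfolding A_def by (intro sets.Int pair_measureI) auto
  qed
  let ?S = "space M \<times> tbox n"
  have Ss: "?S \<in> sets (M \<Otimes>\<^sub>M pm)" by (intro pair_measureI) auto
  have Sf: "emeasure (M \<Otimes>\<^sub>M pm) ?S < \<infinity>"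
    using tbox_finite[of n] by (subst pm.emeasure_pair_measure_Times) (auto simp: M.emeasure_space_1)
  define P where "P z \<longleftrightarrow> (\<exists>K::nat. \<forall>k. K \<le> k \<longrightarrow> z \<notin> A k)" for z
  have Ps: "{z \<in> space (M \<Otimes>\<^sub>M pm). P z} \<in> sets (M \<Otimes>\<^sub>M pm)"
    unfolding P_def
    by (intro sets.sets_Collect_countable_Ex sets.sets_Collect_countable_All sets.sets_Collect_imp sets.sets_Collect_const sets.sets_Collect_neg)
       (use As in \<open>auto simp: Int_def[symmetric] Collect_conj_eq sets.Int_space_eq1\<close>)
  have main: "AE \<omega> in M. AE p in pm. P (\<omega>, p)"
    using A2[unfolded A2_def] AE_space
  proof eventually_elim
    fix \<omega> assume a2: "\<forall>j\<in>J. \<forall>v\<in>verts (G \<omega>). AE t in lborel. 0 \<le> t \<longrightarrow>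
     ((\<lambda>(eb, kap). rate rbar j (edges (G \<omega>)) eb kap v t (X \<omega>)) \<longlongrightarrow>
        rate rbar j (edges (G \<omega>)) (emark (G \<omega>)) (fst \<circ> vmark (G \<omega>)) v t (X \<omega>))
       (at (emark (G \<omega>), fst \<circ> vmark (G \<omega>)))" and w: "\<omega> \<in> space M"
    show "AE p in pm. P (\<omega>, p)"
    proof (cases "loc G v U EU \<omega>")
      case False
      then have "P (\<omega>, p)" for p by (auto simp: P_def A_def bad_def)
      then show ?thesis by simp
    next
      case True
      then have vV: "v \<in> verts (G \<omega>)" and cl: "clos (edges (G \<omega>)) v = U" "induced_edges (edges (G \<omega>)) U = EU" by (simp_all add: loc_def)
      have sec: "{p \<in> space pm. P (\<omega>, p)} \<in> sets pm"
      proof -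
        have "Pair \<omega> -` {z \<in> space (M \<Otimes>\<^sub>M pm). P z} \<in> sets pm" by (rule sets_Pair1[OF Ps])
        moreover have "Pair \<omega> -` {z \<in> space (M \<Otimes>\<^sub>M pm). P z} = {p \<in> space pm. P (\<omega>, p)}" using w by (auto simp: space_pair_measure)
        ultimately show ?thesis by simp
      qed
      have c: "AE s in half. \<forall>j\<in>J. ((\<lambda>(eb, kap). rate rbar j (edges (G \<omega>)) eb kap v s (X \<omega>)) \<longlongrightarrow>
          rate rbar j (edges (G \<omega>)) (emark (G \<omega>)) (fst \<circ> vmark (G \<omega>)) v s (X \<omega>))
          (at (emark (G \<omega>), fst \<circ> vmark (G \<omega>)))"
      proof (rule AE_ball_countable')
          fix j assume "j \<in> J"
          with a2 vV have "AE t in lborel. 0 \<le> t \<longrightarrow>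
             ((\<lambda>(eb, kap). rate rbar j (edges (G \<omega>)) eb kap v t (X \<omega>)) \<longlongrightarrow>
                rate rbar j (edges (G \<omega>)) (emark (G \<omega>)) (fst \<circ> vmark (G \<omega>)) v t (X \<omega>))
               (at (emark (G \<omega>), fst \<circ> vmark (G \<omega>)))" by blast
          then show "AE s in half. ((\<lambda>(eb, kap). rate rbar j (edges (G \<omega>)) eb kap v s (X \<omega>)) \<longlongrightarrow>
            rate rbar j (edges (G \<omega>)) (emark (G \<omega>)) (fst \<circ> vmark (G \<omega>)) v s (X \<omega>))
            (at (emark (G \<omega>), fst \<circ> vmark (G \<omega>)))" by (subst AE_restrict_space_iff) auto
      qed simp
      have "AE s in half. AE q in half \<Otimes>\<^sub>M jm. P (\<omega>, (s, q))"
        using c AE_space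
      proof eventually_elim
        fix s assume cs: "\<forall>j\<in>J. ((\<lambda>(eb, kap). rate rbar j (edges (G \<omega>)) eb kap v s (X \<omega>)) \<longlongrightarrow>
          rate rbar j (edges (G \<omega>)) (emark (G \<omega>)) (fst \<circ> vmark (G \<omega>)) v s (X \<omega>))
          (at (emark (G \<omega>), fst \<circ> vmark (G \<omega>)))"
        have conv: "(\<lambda>k. rate rbar j (edges (G \<omega>)) (eb k \<omega>) (kap k \<omega>) v s (X \<omega>)) \<longlonglongrightarrow> rt (G \<omega>) j v s (X \<omega>)" if j: "j \<in> J" for j
          by (rule rate_cont[OF cs[rule_format, OF j]]) (use ebl[OF w True] kapl[OF w True] in \<open>simp_all add: cl\<close>)
        show "AE q in half \<Otimes>\<^sub>M jm. P (\<omega>, (s, q))"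
          using graph_fiber_AE[of "\<lambda>j. rt (G \<omega>) j v s (X \<omega>)"] AE_space
        proof eventually_elim
          fix q assume ne: "\<forall>j\<in>J. fst q \<noteq> rt (G \<omega>) j v s (X \<omega>)" and "q \<in> space (half \<Otimes>\<^sub>M jm)"
          then have j: "snd q \<in> J" by (auto simp: space_pair_measure space_point_measure)
          have "\<forall>\<^sub>F k in sequentially. fst q \<le> rt (G \<omega>) (snd q) v s (X \<omega>) \<longleftrightarrow>
              fst q \<le> rate rbar (snd q) (edges (G \<omega>)) (eb k \<omega>) (kap k \<omega>) v s (X \<omega>)"
          proof (cases "fst q < rt (G \<omega>) (snd q) v s (X \<omega>)")
            case True
            from order_tendstoD(1)[OF conv[OF j] this] show ?thesis by eventually_elim (use True in simp)
          next
            case False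
            then have lt: "rt (G \<omega>) (snd q) v s (X \<omega>) < fst q" using ne j by (metis linorder_neqE_linordered_idom)
            from order_tendstoD(2)[OF conv[OF j] this] show ?thesis by eventually_elim (use lt in simp)
          qed
          then obtain K where K: "\<And>k. K \<le> k \<Longrightarrow> fst q \<le> rt (G \<omega>) (snd q) v s (X \<omega>) \<longleftrightarrow>
              fst q \<le> rate rbar (snd q) (edges (G \<omega>)) (eb k \<omega>) (kap k \<omega>) v s (X \<omega>)"
            unfolding eventually_sequentially by blast
          have "(\<omega>, s, q) \<notin> A k" if "K \<le> k" for k
            unfolding A_def bad_def using K[OF that] by simp
          then show "P (\<omega>, (s, q))" unfolding P_def by blast
        qed
      qed
      then show ?thesis unfolding pm_eq
        by (intro hp.AE_pair_measure) (use sec in \<open>simp add: pm_eq\<close>)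
    qed
  qed
  have aeP: "AE z in M \<Otimes>\<^sub>M pm. P z" by (rule Mp.AE_pair_measure[OF Ps]) (use main in simp)
  have "(\<lambda>k. \<integral>z. indicator (A k) z \<partial>(M \<Otimes>\<^sub>M pm)) \<longlonglongrightarrow> (\<integral>z. (0::real) \<partial>(M \<Otimes>\<^sub>M pm))"
  proof (rule integral_dominated_convergence[where w="indicator ?S"])
    show "integrable (M \<Otimes>\<^sub>M pm) (indicator ?S :: _ \<Rightarrow> real)"
      using Ss Sf by (intro integrable_real_indicator) auto
    show "AE z in M \<Otimes>\<^sub>M pm. norm (indicator (A k) z :: real) \<le> indicator ?S z" for k
      by (rule AE_I2) (auto simp: A_def indicator_def)
    show "AE z in M \<Otimes>\<^sub>M pm. (\<lambda>k. indicator (A k) z :: real) \<longlonglongrightarrow> 0"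
      using aeP
    proof eventually_elim
      fix z assume "P z"
      then have "\<forall>\<^sub>F k in sequentially. z \<notin> A k" unfolding P_def eventually_sequentially .
      then have "\<forall>\<^sub>F k in sequentially. (indicator (A k) z :: real) = 0" by eventually_elim simp
      then show "(\<lambda>k. indicator (A k) z :: real) \<longlonglongrightarrow> 0" by (rule tendsto_eventually)
    qed
  qed (use As in auto)
  then show ?thesis using As by (simp add: A_def)
qed

definition hits :: "'w measure \<Rightarrow> ('w \<Rightarrow> ('e, 'k \<times> int) mgraph) \<Rightarrow> ('w \<Rightarrow> nat \<Rightarrow> pt set) \<Rightarrow> nat \<Rightarrow> nat \<Rightarrow> ('w \<times> pt) set \<Rightarrow> 'w set" where
  "hits M G N v n A = {\<omega> \<in> space M. v \<in> verts (G \<omega>) \<and> (\<exists>p\<in>clean J (N \<omega> v) \<inter> tbox n. (\<omega>, p) \<in> A)}"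

lemma hits_tend:
  assumes sol: "strong_solution Xs J \<sigma> rbar M F G N X" and A2: "A2 J rbar M G X" and U: "finite U"
    and eb: "\<And>k e B. B \<in> sets borel \<Longrightarrow> (\<lambda>\<omega>. eb k \<omega> e) -` B \<inter> space M \<in> F 0"
    and kap: "\<And>k u B. B \<in> sets borel \<Longrightarrow> (\<lambda>\<omega>. kap k \<omega> u) -` B \<inter> space M \<in> F 0"
    and ebl: "\<And>\<omega> e. \<omega> \<in> space M \<Longrightarrow> loc G v U EU \<omega> \<Longrightarrow> e \<in> EU \<Longrightarrow> (\<lambda>k. eb k \<omega> e) \<longlonglongrightarrow> emark (G \<omega>) e"
    and kapl: "\<And>\<omega> u. \<omega> \<in> space M \<Longrightarrow> loc G v U EU \<omega> \<Longrightarrow> u \<in> U \<Longrightarrow> (\<lambda>k. kap k \<omega> u) \<longlonglongrightarrow> fst (vmark (G \<omega>) u)"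
  shows "hits M G N v n (bad M G X v U EU (eb k) (kap k)) \<in> sets M"
    and "(\<lambda>k. measure M (hits M G N v n (bad M G X v U EU (eb k) (kap k)))) \<longlonglongrightarrow> 0"
proof -
  have b: "bad M G X v U EU (eb k) (kap k) \<in> sets (predM M F)" for k by (rule bad_predictable[OF sol U eb kap])
  show "hits M G N v n (bad M G X v U EU (eb k) (kap k)) \<in> sets M" unfolding hits_def by (rule hit_bound(1)[OF sol b])
  interpret prob_space M by (rule strong_solD(2)[OF sol])
  have fin: "emeasure (M \<Otimes>\<^sub>M pm) ((space M \<times> tbox n) \<inter> B) < \<top>" for B
  proof -
    have "emeasure (M \<Otimes>\<^sub>M pm) ((space M \<times> tbox n) \<inter> B) \<le> emeasure (M \<Otimes>\<^sub>M pm) (space M \<times> tbox n)"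
      by (rule emeasure_mono) (auto intro: pair_measureI)
    also have "\<dots> < \<top>" using tbox_finite[of n]
      by (subst sigma_finite_measure.emeasure_pair_measure_Times[OF sf_pm]) (auto simp: emeasure_space_1)
    finally show ?thesis .
  qed
  show "(\<lambda>k. measure M (hits M G N v n (bad M G X v U EU (eb k) (kap k)))) \<longlonglongrightarrow> 0"
  proof (rule tendsto_sandwich[OF _ _ tendsto_const bad_tend[OF sol A2 U eb kap ebl kapl, where n=n]])
    show "\<forall>\<^sub>F k in sequentially. measure M (hits M G N v n (bad M G X v U EU (eb k) (kap k))) \<le>
        measure (M \<Otimes>\<^sub>M pm) ((space M \<times> tbox n) \<inter> bad M G X v U EU (eb k) (kap k))"
    proof (rule always_eventually, rule allI)
      fix k
      show "measure M (hits M G N v n (bad M G X v U EU (eb k) (kap k))) \<le>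
        measure (M \<Otimes>\<^sub>M pm) ((space M \<times> tbox n) \<inter> bad M G X v U EU (eb k) (kap k))"
        unfolding measure_def hits_def by (rule enn2real_mono[OF hit_bound(2)[OF sol b] fin])
    qed
  qed simp_all
qed

subsection \<open>Integrals over the extended noise\<close>

lemma canonicalD:
  assumes "canonical Q" shows "prob_space Q" "sets Q = sets npm" "space Q = space npm"
  using assms sets_eq_imp_space_eq[of Q npm] by (auto simp: canonical_def)

lemma AE_lift_fst:
  assumes Q: "canonical Q" and ae: "AE \<omega> in M. P \<omega>"
  shows "AE z in M \<Otimes>\<^sub>M Q. P (fst z)"
proof -
  interpret Q: prob_space Q by (rule canonicalD(1)[OF Q])
  have "AE \<omega> in distr (M \<Otimes>\<^sub>M Q) M fst. P \<omega>" using ae unfolding Q.distr_pair_fst .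
  from AE_distrD[OF measurable_fst this] show ?thesis .
qed

lemma integral_lift_fst:
  assumes Q: "canonical Q" and h: "h \<in> borel_measurable M"
  shows "(\<integral>z. (h (fst z) :: real) \<partial>(M \<Otimes>\<^sub>M Q)) = (\<integral>\<omega>. h \<omega> \<partial>M)"
proof -
  interpret Q: prob_space Q by (rule canonicalD(1)[OF Q])
  have "(\<integral>\<omega>. h \<omega> \<partial>distr (M \<Otimes>\<^sub>M Q) M fst) = (\<integral>z. h (fst z) \<partial>(M \<Otimes>\<^sub>M Q))"
    by (rule integral_distr[OF measurable_fst h])
  then show ?thesis unfolding Q.distr_pair_fst by simp
qed

abbreviation noise' :: "('w \<Rightarrow> ('e, 'k \<times> int) mgraph) \<Rightarrow> ('w \<Rightarrow> nat \<Rightarrow> pt set) \<Rightarrow> 'w \<times> (nat \<Rightarrow> pt set) \<Rightarrow> nat \<Rightarrow> pt set" where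
  "noise' G N \<equiv> extend (\<lambda>\<omega>. verts (G \<omega>)) N"

lemma prm_noise':
  assumes sol: "strong_solution Xs J \<sigma> rbar M F G N X" and Q: "canonical Q"
  shows "prm (M \<Otimes>\<^sub>M Q) {E \<times> space Q | E. E \<in> F 0} (\<lambda>_. UNIV) (noise' G N)"
    and "noise' G N \<in> measurable (M \<Otimes>\<^sub>M Q) Q"
proof -
  show p: "prm (M \<Otimes>\<^sub>M Q) {E \<times> space Q | E. E \<in> F 0} (\<lambda>_. UNIV) (noise' G N)"
    using strong_solD(8)[OF sol order_refl] strong_solD(9)[OF sol order_refl]
    by (intro prm_extend[OF strong_solD(2)[OF sol] strong_solD(6)[OF sol] _ _ strong_solD(12)[OF sol] Q])
  show "noise' G N \<in> measurable (M \<Otimes>\<^sub>M Q) Q"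
    using prm_measurable[OF p] canonicalD(2)[OF Q] by (simp cong: measurable_cong_sets)
qed

text \<open>The variable \<open>q\<close> of the graph is known at time 0, hence independent of the
  extended noise, which may be integrated out first. It will be the graph itself or the label of its
  cell.\<close>

lemma joint_integral:
  fixes h :: "'x \<times> (nat \<Rightarrow> pt set) \<Rightarrow> real"
  assumes sol: "strong_solution Xs J \<sigma> rbar M F G N X" and Q: "canonical Q"
    and q: "q \<in> measurable M K" "\<And>A. A \<in> sets K \<Longrightarrow> q -` A \<inter> space M \<in> F 0"
    and h: "h \<in> borel_measurable (K \<Otimes>\<^sub>M Q)" and B: "\<And>x. x \<in> space (K \<Otimes>\<^sub>M Q) \<Longrightarrow> \<bar>h x\<bar> \<le> B"
  shows "(\<integral>z. h (q (fst z), noise' G N z) \<partial>(M \<Otimes>\<^sub>M Q)) = (\<integral>\<omega>. (\<integral>\<eta>. h (q \<omega>, \<eta>) \<partial>Q) \<partial>M)"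
    and "(\<lambda>z. h (q (fst z), noise' G N z)) \<in> borel_measurable (M \<Otimes>\<^sub>M Q)"
    and "(\<lambda>\<omega>. \<integral>\<eta>. h (q \<omega>, \<eta>) \<partial>Q) \<in> borel_measurable M"
proof -
  note d = strong_solD[OF sol]
  interpret M: prob_space M by (rule d(2))
  interpret Q: prob_space Q by (rule canonicalD(1)[OF Q])
  interpret MQ: pair_prob_space M Q ..
  let ?M = "M \<Otimes>\<^sub>M Q" and ?D = "distr M K q"
  interpret D: prob_space ?D by (rule M.prob_space_distr[OF q(1)])
  interpret DQ: pair_prob_space ?D Q ..
  have qm: "(\<lambda>z. q (fst z)) \<in> measurable ?M K" by (rule measurable_compose[OF measurable_fst q(1)])
  have pre: "(\<lambda>z. q (fst z)) -` A \<inter> space ?M \<in> {E \<times> space Q | E. E \<in> F 0}" if "A \<in> sets K" for A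
  proof -
    have "(\<lambda>z. q (fst z)) -` A \<inter> space ?M = (q -` A \<inter> space M) \<times> space Q" by (auto simp: space_pair_measure)
    then show ?thesis using q(2)[OF that] by blast
  qed
  have sub: "{E \<times> space Q | E. E \<in> F 0} \<subseteq> sets ?M" using d(9)[OF order_refl] by auto
  have "distr ?M (K \<Otimes>\<^sub>M Q) (\<lambda>z. (q (fst z), noise' G N z)) = distr ?M K (\<lambda>z. q (fst z)) \<Otimes>\<^sub>M Q"
    by (rule prm_joint[OF MQ.prob_space_axioms prm_noise'(1)[OF sol Q] sub Q qm]) (rule pre)
  also have "distr ?M K (\<lambda>z. q (fst z)) = distr (distr ?M M fst) K q"
    using distr_distr[OF q(1) measurable_fst, of Q] by (simp add: comp_def)
  also have "\<dots> = ?D" unfolding Q.distr_pair_fst ..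
  finally have law: "distr ?M (K \<Otimes>\<^sub>M Q) (\<lambda>z. (q (fst z), noise' G N z)) = ?D \<Otimes>\<^sub>M Q" .
  have jm': "(\<lambda>z. (q (fst z), noise' G N z)) \<in> measurable ?M (K \<Otimes>\<^sub>M Q)"
    by (rule measurable_Pair[OF qm prm_noise'(2)[OF sol Q]])
  show "(\<lambda>z. h (q (fst z), noise' G N z)) \<in> borel_measurable ?M" by (rule measurable_compose[OF jm' h])
  have im: "(\<lambda>x. \<integral>\<eta>. h (x, \<eta>) \<partial>Q) \<in> borel_measurable K"
    using h by (intro Q.borel_measurable_lebesgue_integral) (simp add: case_prod_beta')
  show "(\<lambda>\<omega>. \<integral>\<eta>. h (q \<omega>, \<eta>) \<partial>Q) \<in> borel_measurable M" by (rule measurable_compose[OF q(1) im])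
  have seq: "sets (?D \<Otimes>\<^sub>M Q) = sets (K \<Otimes>\<^sub>M Q)" by (intro sets_pair_measure_cong) simp_all
  have hD: "h \<in> borel_measurable (?D \<Otimes>\<^sub>M Q)" using h seq by (simp cong: measurable_cong_sets)
  have int: "integrable (?D \<Otimes>\<^sub>M Q) h"
  proof (rule DQ.integrable_const_bound[OF _ hD])
    show "AE x in ?D \<Otimes>\<^sub>M Q. norm (h x) \<le> B"
      by (rule AE_I2) (use B sets_eq_imp_space_eq[OF seq] in simp)
  qed
  have "(\<integral>z. h (q (fst z), noise' G N z) \<partial>?M) = (\<integral>x. h x \<partial>(?D \<Otimes>\<^sub>M Q))"
    unfolding law[symmetric] by (rule integral_distr[OF jm' h, symmetric])
  also have "\<dots> = (\<integral>x. (\<integral>\<eta>. h (x, \<eta>) \<partial>Q) \<partial>?D)" by (rule DQ.integral_fst'[OF int, symmetric])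
  also have "\<dots> = (\<integral>\<omega>. (\<integral>\<eta>. h (q \<omega>, \<eta>) \<partial>Q) \<partial>M)" by (rule integral_distr[OF q(1) im])
  finally show "(\<integral>z. h (q (fst z), noise' G N z) \<partial>?M) = (\<integral>\<omega>. (\<integral>\<eta>. h (q \<omega>, \<eta>) \<partial>Q) \<partial>M)" .
qed

text \<open>Restricting the space makes well-formedness hold at each of its points, as the
  measurability lemmas for random graphs demand.\<close>

abbreviation KW :: "('e, 'k \<times> int) mgraph measure" where
  "KW \<equiv> restrict_space (graphM borel borel) {H. W H}"

lemma KW_fst_snd:
  assumes Q: "canonical Q"
  shows "fst \<in> measurable (KW \<Otimes>\<^sub>M Q) (graphM borel borel)"
    and "\<And>x. x \<in> space (KW \<Otimes>\<^sub>M Q) \<Longrightarrow> W (fst x)"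
    and "\<And>v. (\<lambda>x. snd x v) \<in> measurable (KW \<Otimes>\<^sub>M Q) (nsp pm)"
proof -
  have "id \<in> measurable KW (graphM borel borel)" by (rule measurable_restrict_space1) simp
  from measurable_compose[OF measurable_fst this] show "fst \<in> measurable (KW \<Otimes>\<^sub>M Q) (graphM borel borel)" by simp
  show "W (fst x)" if "x \<in> space (KW \<Otimes>\<^sub>M Q)" for x using that by (auto simp: space_pair_measure space_restrict_space)
  have "snd \<in> measurable (KW \<Otimes>\<^sub>M Q) npm" using measurable_snd[of KW Q] canonicalD(2)[OF Q] by (simp cong: measurable_cong_sets)
  from measurable_compose[OF this measurable_component_singleton[OF UNIV_I]]
  show "(\<lambda>x. snd x v) \<in> measurable (KW \<Otimes>\<^sub>M Q) (nsp pm)" for v .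
qed

lemma sol_KW:
  assumes sol: "strong_solution Xs J \<sigma> rbar M F G N X"
  shows "G \<in> measurable M KW" and "\<And>A. A \<in> sets KW \<Longrightarrow> G -` A \<inter> space M \<in> F 0"
proof -
  note d = strong_solD[OF sol]
  show "G \<in> measurable M KW" by (rule measurable_restrict_space2) (use d(3,4) in auto)
  fix A assume "A \<in> sets KW"
  then obtain A' where A': "A' \<in> sets (graphM borel borel)" "A = {H. W H} \<inter> A'" by (auto simp: sets_restrict_space)
  have "G -` A \<inter> space M = G -` A' \<inter> space M" unfolding A'(2) using d(3) by auto
  then show "G -` A \<inter> space M \<in> F 0" using d(5)[OF A'(1)] by simp
qed

lemma noise'_live:
  fixes z :: "'w \<times> (nat \<Rightarrow> pt set)"
  shows "v \<in> verts (G (fst z)) \<Longrightarrow> noise' G N z v = N (fst z) v"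
  by (simp add: extend_def)

text \<open>\<open>fin_dissoc_no_chain\<close> speaks of one deterministic graph. Noise and graph
  are independent, so integrating the indicator of the exceptional set over the noise first
  transfers it to a random graph.\<close>

lemma no_chain_AE:
  assumes sol: "strong_solution Xs J \<sigma> rbar M F G N X" and Q: "canonical Q"
    and fd: "AE \<omega> in M. fin_dissoc J \<sigma> C (G \<omega>)"
  shows "AE z in M \<Otimes>\<^sub>M Q. \<forall>T::nat. \<forall>v\<in>verts (G (fst z)). \<exists>i. \<not> dep J C (edges (G (fst z))) (noise' G N z) (real (Suc T)) i v (real (Suc T))"
proof -
  note d = strong_solD[OF sol]
  interpret M: prob_space M by (rule d(2))
  interpret Q: prob_space Q by (rule canonicalD(1)[OF Q])
  interpret MQ: pair_prob_space M Q ..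
  define Z where "Z = {x \<in> space (KW \<Otimes>\<^sub>M Q). \<exists>T::nat. \<exists>v. \<forall>i. v \<in> verts (fst x) \<and> dep J C (edges (fst x)) (snd x) (real (Suc T)) i v (real (Suc T))}"
  have "{x \<in> space (KW \<Otimes>\<^sub>M Q). v \<in> verts (fst x) \<and> dep J C (edges (fst x)) (snd x) T i v t} \<in> sets (KW \<Otimes>\<^sub>M Q)" for v T i t
    by (rule dep_meas[OF KW_fst_snd[OF Q]])
  then have Zs: "Z \<in> sets (KW \<Otimes>\<^sub>M Q)"
    unfolding Z_def by (intro sets.sets_Collect_countable_Ex sets.sets_Collect_countable_All)
  have h: "(indicator Z :: _ \<Rightarrow> real) \<in> borel_measurable (KW \<Otimes>\<^sub>M Q)" using Zs by simp
  have b: "\<bar>indicator Z x :: real\<bar> \<le> 1" for x by (simp add: indicator_def)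
  note j = joint_integral[OF sol Q sol_KW[OF sol] h b]
  have "AE \<omega> in M. (\<integral>\<eta>. indicator Z (G \<omega>, \<eta>) \<partial>Q) = (0::real)"
    using fd AE_space
  proof eventually_elim
    fix \<omega> assume f: "fin_dissoc J \<sigma> C (G \<omega>)" and w: "\<omega> \<in> space M"
    have "AE \<eta> in Q. (indicator Z (G \<omega>, \<eta>) :: real) = 0"
      using fin_dissoc_no_chain[OF Q d(3)[OF w] f]
    proof eventually_elim
      fix \<eta> assume a: "\<forall>T::nat. \<forall>v\<in>verts (G \<omega>). \<exists>i. \<not> dep J C (edges (G \<omega>)) \<eta> (real (Suc T)) i v (real (Suc T))"
      have "(G \<omega>, \<eta>) \<notin> Z"
      proof
        assume "(G \<omega>, \<eta>) \<in> Z"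
        then obtain T :: nat and v where c: "\<forall>i. v \<in> verts (G \<omega>) \<and> dep J C (edges (G \<omega>)) \<eta> (real (Suc T)) i v (real (Suc T))"
          unfolding Z_def mem_Collect_eq fst_conv snd_conv by (elim conjE exE) (rule that)
        then have "v \<in> verts (G \<omega>)" by simp
        from a[rule_format, OF this, of T] c show False by simp
      qed
      then show "(indicator Z (G \<omega>, \<eta>) :: real) = 0" by simp
    qed
    then show "(\<integral>\<eta>. indicator Z (G \<omega>, \<eta>) \<partial>Q) = (0::real)" by (rule integral_eq_zero_AE)
  qed
  then have "(\<integral>\<omega>. (\<integral>\<eta>. indicator Z (G \<omega>, \<eta>) \<partial>Q) \<partial>M) = (0::real)" by (rule integral_eq_zero_AE)
  then have 0: "(\<integral>z. (indicator Z (G (fst z), noise' G N z) :: real) \<partial>(M \<Otimes>\<^sub>M Q)) = 0" using j(1) by simp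
  have int: "integrable (M \<Otimes>\<^sub>M Q) (\<lambda>z. indicator Z (G (fst z), noise' G N z) :: real)"
    by (rule MQ.integrable_const_bound[OF _ j(2), where B=1]) (simp add: b)
  have "AE z in M \<Otimes>\<^sub>M Q. (indicator Z (G (fst z), noise' G N z) :: real) = 0"
    using integral_nonneg_eq_0_iff_AE[OF int] 0 by simp
  then show ?thesis
    using AE_space
  proof eventually_elim
    fix z assume i: "(indicator Z (G (fst z), noise' G N z) :: real) = 0" and z: "z \<in> space (M \<Otimes>\<^sub>M Q)"
    have "(G (fst z), noise' G N z) \<in> space (KW \<Otimes>\<^sub>M Q)"
      using z d(3) measurable_space[OF prm_noise'(2)[OF sol Q] z] by (auto simp: space_pair_measure space_restrict_space)
    moreover have "(G (fst z), noise' G N z) \<notin> Z" using i by (simp add: indicator_def split: if_splits)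
    ultimately have n: "\<not> (\<exists>T::nat. \<exists>v. \<forall>i. v \<in> verts (G (fst z)) \<and> dep J C (edges (G (fst z))) (noise' G N z) (real (Suc T)) i v (real (Suc T)))"
      unfolding Z_def by simp
    show "\<forall>T::nat. \<forall>v\<in>verts (G (fst z)). \<exists>i. \<not> dep J C (edges (G (fst z))) (noise' G N z) (real (Suc T)) i v (real (Suc T))"
    proof (intro allI ballI, rule ccontr)
      fix T :: nat and v assume v: "v \<in> verts (G (fst z))"
        and "\<not> (\<exists>i. \<not> dep J C (edges (G (fst z))) (noise' G N z) (real (Suc T)) i v (real (Suc T)))"
      then have "\<forall>i. v \<in> verts (G (fst z)) \<and> dep J C (edges (G (fst z))) (noise' G N z) (real (Suc T)) i v (real (Suc T))" by simp
      then have "\<exists>T::nat. \<exists>v. \<forall>i. v \<in> verts (G (fst z)) \<and> dep J C (edges (G (fst z))) (noise' G N z) (real (Suc T)) i v (real (Suc T))" by (intro exI)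
      then show False using n by (rule notE[rotated])
    qed
  qed
qed

lemma fixpoint_lift:
  fixes M :: "'w measure"
  assumes sol: "strong_solution Xs J \<sigma> rbar M F G N X" and Q: "canonical Q"
  shows "AE z in M \<Otimes>\<^sub>M Q. \<forall>v\<in>verts (G (fst z)). \<forall>t\<ge>0. X (fst z) v t = upd (G (fst z)) (noise' G N z) (X (fst z)) v t"
  using AE_lift_fst[OF Q strong_sol_fixpoint[OF sol]]
proof eventually_elim
  fix z :: "'w \<times> (nat \<Rightarrow> pt set)" assume a: "\<forall>\<eta>. (\<forall>v\<in>verts (G (fst z)). \<eta> v = N (fst z) v) \<longrightarrow> (\<forall>v\<in>verts (G (fst z)). \<forall>t\<ge>0. X (fst z) v t = upd (G (fst z)) \<eta> (X (fst z)) v t)"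
  show "\<forall>v\<in>verts (G (fst z)). \<forall>t\<ge>0. X (fst z) v t = upd (G (fst z)) (noise' G N z) (X (fst z)) v t"
    by (rule mp[OF spec[OF a, of "noise' G N z"]], rule ballI, rule noise'_live)
qed

subsection \<open>Expectations of the Picard iterates\<close>

abbreviation pf :: "(('e, 'k \<times> path) mgraph \<Rightarrow> real) \<Rightarrow> bool" where
  "pf f \<equiv> test_fun (path_ok Xs) path_mconv f"

definition mean_it :: "(('e, 'k \<times> path) mgraph \<Rightarrow> real) \<Rightarrow> (nat \<Rightarrow> pt set) measure \<Rightarrow> nat \<Rightarrow> ('e, 'k \<times> int) mgraph \<Rightarrow> real" where
  "mean_it f Q i H = (\<integral>\<eta>. f (sol_graph H (xit H \<eta> i)) \<partial>Q)"

lemma pf_bound: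
  assumes "pf f" obtains B where "0 \<le> B" "\<And>H x. W H \<Longrightarrow> paths_on (verts H) x \<Longrightarrow> \<bar>f (sol_graph H x)\<bar> \<le> B"
proof -
  obtain B where B: "\<forall>G. wf_graph (path_ok Xs) G \<longrightarrow> \<bar>f G\<bar> \<le> B" using assms unfolding test_fun_def by (elim conjE exE) (rule that)
  have "\<bar>f (sol_graph H x)\<bar> \<le> max B 0" if "W H" "paths_on (verts H) x" for H x
    using B[rule_format, OF wf_sol_graph[OF that]] by simp
  then show thesis using that[of "max B 0"] by simp
qed

lemma pf_xit_measurable:
  assumes f: "pf f" and Q: "canonical Q"
  shows "(\<lambda>x. f (sol_graph (fst x) (xit (fst x) (snd x) i))) \<in> borel_measurable (KW \<Otimes>\<^sub>M Q)"
  by (rule test_sol_measurable[OF f KW_fst_snd(1,2)[OF Q] xit_meas[OF KW_fst_snd[OF Q]]])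

lemma pf_xit_measurable1:
  assumes f: "pf f" and Q: "canonical Q" and H: "W H"
  shows "(\<lambda>\<eta>. f (sol_graph H (xit H \<eta> i))) \<in> borel_measurable Q"
proof -
  have "H \<in> space KW" using H by (simp add: space_restrict_space)
  from measurable_compose[OF measurable_Pair1'[OF this] pf_xit_measurable[OF f Q, of i]] show ?thesis by simp
qed

lemma mean_it_bound:
  assumes Q: "canonical Q" and f: "pf f" and B: "\<And>H x. W H \<Longrightarrow> paths_on (verts H) x \<Longrightarrow> \<bar>f (sol_graph H x)\<bar> \<le> B" and H: "W H"
  shows "\<bar>mean_it f Q i H\<bar> \<le> B"
proof -
  interpret Q: prob_space Q by (rule canonicalD(1)[OF Q])
  have b: "\<bar>f (sol_graph H (xit H \<eta> i))\<bar> \<le> B" for \<eta> by (rule B[OF H xit_Dpath[OF H]])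
  have int: "integrable Q (\<lambda>\<eta>. f (sol_graph H (xit H \<eta> i)))"
    by (rule Q.integrable_const_bound[OF _ pf_xit_measurable1[OF f Q H], where B=B]) (simp add: b)
  have "mean_it f Q i H \<le> B" unfolding mean_it_def by (rule Q.integral_le_const[OF int]) (use b in \<open>simp add: abs_le_iff\<close>)
  moreover have "- B \<le> mean_it f Q i H" unfolding mean_it_def
    by (rule Q.integral_ge_const[OF int]) (use b in \<open>simp add: abs_le_iff minus_le_iff\<close>)
  ultimately show ?thesis by simp
qed

text \<open>Almost surely the chains at each vertex are bounded up to every horizon, so the iterates
  eventually equal \<open>X\<close> there. With the identity as isomorphism this is local
  convergence, and \<open>f\<close> is bounded.\<close>

lemma mean_it_limit:
  assumes sol: "strong_solution Xs J \<sigma> rbar M F G N X" and Q: "canonical Q"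
    and fd: "AE \<omega> in M. fin_dissoc J \<sigma> C (G \<omega>)" and f: "pf f"
  shows "(\<lambda>i. \<integral>\<omega>. mean_it f Q i (G \<omega>) \<partial>M) \<longlonglongrightarrow> (\<integral>\<omega>. f (sol_graph (G \<omega>) (X \<omega>)) \<partial>M)"
    and "(\<lambda>\<omega>. mean_it f Q i (G \<omega>)) \<in> borel_measurable M"
proof -
  note d = strong_solD[OF sol]
  interpret M: prob_space M by (rule d(2))
  interpret Q: prob_space Q by (rule canonicalD(1)[OF Q])
  interpret MQ: pair_prob_space M Q ..
  obtain B where B: "0 \<le> B" "\<And>H x. W H \<Longrightarrow> paths_on (verts H) x \<Longrightarrow> \<bar>f (sol_graph H x)\<bar> \<le> B" using pf_bound[OF f] by blast
  have hb: "\<bar>f (sol_graph (fst x) (xit (fst x) (snd x) i))\<bar> \<le> B" if "x \<in> space (KW \<Otimes>\<^sub>M Q)" for x i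
    by (rule B(2)[OF _ xit_Dpath]) (use KW_fst_snd(2)[OF Q that] in auto)
  note j = joint_integral[OF sol Q sol_KW[OF sol] pf_xit_measurable[OF f Q] hb, unfolded fst_conv snd_conv]
  show "(\<lambda>\<omega>. mean_it f Q i (G \<omega>)) \<in> borel_measurable M" unfolding mean_it_def by (rule j(3))
  have fm: "(\<lambda>\<omega>. f (sol_graph (G \<omega>) (X \<omega>))) \<in> borel_measurable M"
    by (rule test_sol_measurable[OF f d(4,3,7)])
  have "(\<lambda>i. \<integral>z. f (sol_graph (G (fst z)) (xit (G (fst z)) (noise' G N z) i)) \<partial>(M \<Otimes>\<^sub>M Q)) \<longlonglongrightarrow>
      (\<integral>z. f (sol_graph (G (fst z)) (X (fst z))) \<partial>(M \<Otimes>\<^sub>M Q))"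
  proof (rule integral_dominated_convergence[where w="\<lambda>_. B"])
    show "(\<lambda>z. f (sol_graph (G (fst z)) (X (fst z)))) \<in> borel_measurable (M \<Otimes>\<^sub>M Q)"
      by (rule measurable_compose[OF measurable_fst fm])
    show "(\<lambda>z. f (sol_graph (G (fst z)) (xit (G (fst z)) (noise' G N z) i))) \<in> borel_measurable (M \<Otimes>\<^sub>M Q)" for i by (rule j(2))
    show "AE z in M \<Otimes>\<^sub>M Q. norm (f (sol_graph (G (fst z)) (xit (G (fst z)) (noise' G N z) i))) \<le> B" for i
    proof (rule AE_I2)
      fix z assume "z \<in> space (M \<Otimes>\<^sub>M Q)"
      then have "W (G (fst z))" using d(3) by (auto simp: space_pair_measure)
      from B(2)[OF this xit_Dpath[OF this]] show "norm (f (sol_graph (G (fst z)) (xit (G (fst z)) (noise' G N z) i))) \<le> B" by simp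
    qed
    show "AE z in M \<Otimes>\<^sub>M Q. (\<lambda>i. f (sol_graph (G (fst z)) (xit (G (fst z)) (noise' G N z) i))) \<longlonglongrightarrow> f (sol_graph (G (fst z)) (X (fst z)))"
      using no_chain_AE[OF sol Q fd] fixpoint_lift[OF sol Q] AE_space
    proof eventually_elim
      fix z assume nc: "\<forall>T::nat. \<forall>v\<in>verts (G (fst z)). \<exists>i. \<not> dep J C (edges (G (fst z))) (noise' G N z) (real (Suc T)) i v (real (Suc T))"
        and fx: "\<forall>v\<in>verts (G (fst z)). \<forall>t\<ge>0. X (fst z) v t = upd (G (fst z)) (noise' G N z) (X (fst z)) v t"
        and z: "z \<in> space (M \<Otimes>\<^sub>M Q)"
      have zM: "fst z \<in> space M" using z by (auto simp: space_pair_measure)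
      have wf: "W (G (fst z))" by (rule d(3)[OF zM])
      have Xp: "paths_on (verts (G (fst z))) (X (fst z))" using d(7) zM by (auto simp: meas_paths_def)
      have "local_conv path_mconv (\<lambda>i. sol_graph (G (fst z)) (xit (G (fst z)) (noise' G N z) i)) (sol_graph (G (fst z)) (X (fst z)))"
      proof (rule sol_local_conv[OF wf, where R="\<lambda>n. n" and \<epsilon>="\<lambda>_. 0" and \<phi>="\<lambda>_. id"])
        show "\<forall>\<^sub>F n in sequentially. r \<le> n \<and> close_on n 0 (G (fst z)) (G (fst z)) id" for r
          using eventually_ge_at_top[of r] by eventually_elim (simp add: close_on_id)
        fix v assume v: "v \<in> verts (G (fst z))"
        show "skor_conv (\<lambda>n. xit (G (fst z)) (noise' G N z) n (id v)) (X (fst z) v)"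
        proof (rule skor_conv_eventually)
          fix T :: nat
          obtain i where i: "\<not> dep J C (edges (G (fst z))) (noise' G N z) (real (Suc T)) i v (real (Suc T))" using nc v by blast
          show "\<forall>\<^sub>F n in sequentially. \<forall>t\<in>{0..real T}. xit (G (fst z)) (noise' G N z) n (id v) t = X (fst z) v t"
            using eventually_ge_at_top[of i]
          proof eventually_elim
            fix n assume n: "i \<le> n"
            show "\<forall>t\<in>{0..real T}. xit (G (fst z)) (noise' G N z) n (id v) t = X (fst z) v t"
            proof
              fix t assume t: "t \<in> {0..real T}"
              show "xit (G (fst z)) (noise' G N z) n (id v) t = X (fst z) v t"
                unfolding id_apply
                by (rule xit_eventually[OF wf Xp _ v i n]) (use fx t in auto)
            qed
          qed
        qed
      qed simp
      then show "(\<lambda>i. f (sol_graph (G (fst z)) (xit (G (fst z)) (noise' G N z) i))) \<longlonglongrightarrow> f (sol_graph (G (fst z)) (X (fst z)))"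
        by (rule test_fun_conv[OF f wf_sol_graph[OF wf xit_Dpath[OF wf]] wf_sol_graph[OF wf Xp]])
    qed
  qed (rule MQ.integrable_const)
  moreover have "(\<integral>z. f (sol_graph (G (fst z)) (xit (G (fst z)) (noise' G N z) i)) \<partial>(M \<Otimes>\<^sub>M Q)) = (\<integral>\<omega>. mean_it f Q i (G \<omega>) \<partial>M)" for i
    unfolding mean_it_def by (rule j(1))
  ultimately show "(\<lambda>i. \<integral>\<omega>. mean_it f Q i (G \<omega>) \<partial>M) \<longlonglongrightarrow> (\<integral>\<omega>. f (sol_graph (G \<omega>) (X \<omega>)) \<partial>M)"
    by (simp only: integral_lift_fst[OF Q fm])
qed

subsection \<open>Lipschitz upper envelopes\<close>

text \<open>Lipschitz in \<open>gdist\<close>, hence a test function, although \<open>g i\<close> itself need not be continuous.\<close>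

definition lenv :: "(nat \<Rightarrow> ('e, 'k \<times> int) mgraph \<Rightarrow> real) \<Rightarrow> nat \<Rightarrow> ('e, 'k \<times> int) mgraph \<Rightarrow> real" where
  "lenv g k H = (SUP y\<in>{y. W (fst y) \<and> k \<le> snd y}. g (snd y) (fst y) - real k * gdist (fst y) H)"

context
  fixes g :: "nat \<Rightarrow> ('e, 'k \<times> int) mgraph \<Rightarrow> real" and B :: real
  assumes g: "\<And>i y. W y \<Longrightarrow> \<bar>g i y\<bar> \<le> B"
begin

lemma lenv_le_B: "W y \<Longrightarrow> g i y - real k * gdist y H \<le> B"
  using g[of y i] gdist_nonneg[of y H] by (smt (verit) mult_nonneg_nonneg of_nat_0_le_iff)

lemma lenv_bdd: "bdd_above ((\<lambda>y. g (snd y) (fst y) - real k * gdist (fst y) H) ` {y. W (fst y) \<and> k \<le> snd y})"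
  by (rule bdd_aboveI2[where M=B]) (simp add: lenv_le_B)

lemma lenv_upper: "W y \<Longrightarrow> k \<le> i \<Longrightarrow> g i y - real k * gdist y H \<le> lenv g k H"
  unfolding lenv_def using cSUP_upper[OF _ lenv_bdd, of "(y, i)"] by simp

lemma lenv_ge: "W H \<Longrightarrow> k \<le> i \<Longrightarrow> g i H \<le> lenv g k H"
  using lenv_upper[of H k i H] by (simp add: gdist_self)

lemma lenv_least:
  assumes "W H" "\<And>y i. W y \<Longrightarrow> k \<le> i \<Longrightarrow> g i y - real k * gdist y H' \<le> c" shows "lenv g k H' \<le> c"
  unfolding lenv_def
proof (rule cSUP_least)
  show "{y. W (fst y) \<and> k \<le> snd y} \<noteq> {}" using assms(1) by (intro ex_in_conv[THEN iffD1] exI[of _ "(H, k)"]) simp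
qed (use assms(2) in auto)

lemma lenv_le: "W H \<Longrightarrow> lenv g k H \<le> B"
  by (rule lenv_least[of H], assumption) (rule lenv_le_B)

lemma lenv_lip:
  assumes H: "W H" "W H'" shows "lenv g k H \<le> lenv g k H' + real k * gdist H H'"
proof (rule lenv_least[OF H(1)])
  fix y i assume y: "W y" "k \<le> i"
  have "real k * gdist y H' \<le> real k * (gdist y H + gdist H H')"
    by (intro mult_left_mono gdist_triangle[OF y(1) H(1)]) simp
  then show "g i y - real k * gdist y H \<le> lenv g k H' + real k * gdist H H'"
    using lenv_upper[OF y, of H'] by (simp add: distrib_left)
qed

lemma lenv_near:
  assumes "W H" "0 < e"
  shows "\<exists>y i. W y \<and> k \<le> i \<and> lenv g k H - e < g i y - real k * gdist y H"
proof (rule ccontr)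
  assume a: "\<nexists>y i. W y \<and> k \<le> i \<and> lenv g k H - e < g i y - real k * gdist y H"
  have "lenv g k H \<le> lenv g k H - e"
  proof (rule lenv_least[OF assms(1)])
    fix y i assume y: "W y" "k \<le> i"
    show "g i y - real k * gdist y H \<le> lenv g k H - e"
    proof (rule ccontr)
      assume "\<not> g i y - real k * gdist y H \<le> lenv g k H - e"
      then have "W y \<and> k \<le> i \<and> lenv g k H - e < g i y - real k * gdist y H" using y by simp
      then have "\<exists>y i. W y \<and> k \<le> i \<and> lenv g k H - e < g i y - real k * gdist y H" by (intro exI)
      then show False using a by (rule notE[rotated])
    qed
  qed
  then show False using assms(2) by simp
qed

lemma lenv_abs: "W H \<Longrightarrow> \<bar>lenv g k H\<bar> \<le> B"
  using lenv_le[of H k] lenv_ge[of H k k] g[of H k] by linarith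

lemma lenv_abs_lip:
  assumes H: "W H" "W H'" shows "\<bar>lenv g k H - lenv g k H'\<bar> \<le> real k * gdist H H'"
  using lenv_lip[OF H, of k] lenv_lip[OF H(2,1), of k] gdist_sym[OF H] by simp

lemma lenv_test: "test_fun (init_ok Xs) (\<lambda>ms m. ms \<longlonglongrightarrow> m) (lenv g k)"
  unfolding test_fun_def
proof (intro conjI allI impI)
  show "\<exists>B. \<forall>G. W G \<longrightarrow> \<bar>lenv g k G\<bar> \<le> B" using lenv_abs by blast
  show "lenv g k G = lenv g k H" if "W G \<and> W H \<and> marked_iso G H" for G H
  proof -
    have w: "W G" "W H" and m: "marked_iso G H" using that by auto
    from lenv_abs_lip[OF w, of k] marked_iso_gdist[OF m w] show ?thesis by simp
  qed
  show "(\<lambda>n. lenv g k (Gs n)) \<longlonglongrightarrow> lenv g k G" if "(\<forall>n. W (Gs n)) \<and> W G \<and> local_conv (\<lambda>ms m. ms \<longlonglongrightarrow> m) Gs G" for Gs G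
  proof -
    have w: "\<And>n. W (Gs n)" "W G" and lc: "local_conv (\<lambda>ms m. ms \<longlonglongrightarrow> m) Gs G" using that by auto
    have 0: "(\<lambda>n. real k * gdist G (Gs n)) \<longlonglongrightarrow> 0" using local_conv_gdist[OF lc w(2)] by (intro tendsto_mult_right_zero)
    have "(\<lambda>n. lenv g k (Gs n) - lenv g k G) \<longlonglongrightarrow> 0"
    proof (rule tendsto_rabs_zero_cancel, rule tendsto_sandwich[OF _ _ tendsto_const 0])
      show "\<forall>\<^sub>F n in sequentially. \<bar>lenv g k (Gs n) - lenv g k G\<bar> \<le> real k * gdist G (Gs n)"
        using lenv_abs_lip[OF w(2) w(1), of k] by (simp add: abs_minus_commute)
    qed simp
    then show ?thesis by (simp add: LIM_zero_iff)
  qed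
qed

text \<open>The envelope at the cell representatives is a function of a countable label; the
  Lipschitz bound makes it converge to the envelope at the random graph.\<close>

lemma lenv_measurable:
  assumes G: "G \<in> measurable M (graphM borel borel)" and w: "\<And>\<omega>. \<omega> \<in> space M \<Longrightarrow> W (G \<omega>)"
  shows "(\<lambda>\<omega>. lenv g k (G \<omega>)) \<in> borel_measurable M"
proof -
  define \<epsilon> where "\<epsilon> m = 1 / real (Suc m)" for m
  have e: "0 < \<epsilon> m" for m by (simp add: \<epsilon>_def)
  have "\<forall>m. \<exists>q c. q \<in> measurable (graphM borel borel) (count_space UNIV) \<and>
     (\<forall>G. W G \<longrightarrow> W (c (q G)) \<and> close_on (nat \<lceil>1 / \<epsilon> m\<rceil>) (\<epsilon> m) G (c (q G :: nat)) id)"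
    using cells[OF e] by (rule allI)
  then obtain q c where qc: "\<And>m. q m \<in> measurable (graphM borel borel) (count_space UNIV) \<and>
     (\<forall>G. W G \<longrightarrow> W (c m (q m G)) \<and> close_on (nat \<lceil>1 / \<epsilon> m\<rceil>) (\<epsilon> m) G (c m (q m G :: nat)) id)"
    unfolding choice_iff by (elim exE) (rule that, erule spec)
  show ?thesis
  proof (rule borel_measurable_LIMSEQ_real)
    show "(\<lambda>\<omega>. lenv g k (c m (q m (G \<omega>)))) \<in> borel_measurable M" for m
      by (rule measurable_compose[OF measurable_compose[OF G conjunct1[OF qc]]]) simp
    fix \<omega> assume "\<omega> \<in> space M"
    then have W: "W (G \<omega>)" by (rule w)
    have cc: "W (c m (q m (G \<omega>)))" "gdist (G \<omega>) (c m (q m (G \<omega>))) \<le> \<epsilon> m" for m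
    proof -
      have c: "W (c m (q m (G \<omega>))) \<and> close_on (nat \<lceil>1 / \<epsilon> m\<rceil>) (\<epsilon> m) (G \<omega>) (c m (q m (G \<omega>))) id"
        using conjunct2[OF qc[of m]] W by blast
      then show "W (c m (q m (G \<omega>)))" ..
      have "gclose (\<epsilon> m) (G \<omega>) (c m (q m (G \<omega>)))" unfolding gclose_def by (rule exI[of _ id]) (rule conjunct2[OF c])
      then show "gdist (G \<omega>) (c m (q m (G \<omega>))) \<le> \<epsilon> m" by (rule gdist_le[OF e])
    qed
    have e0: "(\<lambda>m. real k * \<epsilon> m) \<longlonglongrightarrow> 0" unfolding \<epsilon>_def
      using LIMSEQ_inverse_real_of_nat by (intro tendsto_mult_right_zero) (simp add: inverse_eq_divide)
    have "(\<lambda>m. lenv g k (c m (q m (G \<omega>))) - lenv g k (G \<omega>)) \<longlonglongrightarrow> 0"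
    proof (rule tendsto_rabs_zero_cancel, rule tendsto_sandwich[OF _ _ tendsto_const e0])
      show "\<forall>\<^sub>F m in sequentially. \<bar>lenv g k (c m (q m (G \<omega>))) - lenv g k (G \<omega>)\<bar> \<le> real k * \<epsilon> m"
      proof (rule always_eventually, rule allI)
        fix m
        have "\<bar>lenv g k (c m (q m (G \<omega>))) - lenv g k (G \<omega>)\<bar> \<le> real k * gdist (G \<omega>) (c m (q m (G \<omega>)))"
          using lenv_abs_lip[OF W cc(1)[of m], of k] by (simp add: abs_minus_commute)
        also have "\<dots> \<le> real k * \<epsilon> m" by (intro mult_left_mono cc(2)) simp
        finally show "\<bar>lenv g k (c m (q m (G \<omega>))) - lenv g k (G \<omega>)\<bar> \<le> real k * \<epsilon> m" .
      qed
    qed simp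
    then show "(\<lambda>m. lenv g k (c m (q m (G \<omega>)))) \<longlonglongrightarrow> lenv g k (G \<omega>)" by (simp add: LIM_zero_iff)
  qed
qed

end

text \<open>Taking the graph itself as competitor, every mean with index at least \<open>k\<close>
  lies below the envelope, and the expectations of these means converge to the left-hand
  side.\<close>

lemma sol_le_lenv:
  assumes sol: "strong_solution Xs J \<sigma> rbar M F G N X" and Q: "canonical Q"
    and fd: "AE \<omega> in M. fin_dissoc J \<sigma> C (G \<omega>)" and f: "pf f"
  shows "(\<integral>\<omega>. f (sol_graph (G \<omega>) (X \<omega>)) \<partial>M) \<le> (\<integral>\<omega>. lenv (mean_it f Q) k (G \<omega>) \<partial>M)"
proof -
  note d = strong_solD[OF sol]
  interpret M: prob_space M by (rule d(2))
  obtain B where B: "0 \<le> B" "\<And>H x. W H \<Longrightarrow> paths_on (verts H) x \<Longrightarrow> \<bar>f (sol_graph H x)\<bar> \<le> B" using pf_bound[OF f] by blast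
  have mb: "\<bar>mean_it f Q i y\<bar> \<le> B" if "W y" for i y by (rule mean_it_bound[OF Q f B(2) that])
  note le = lenv_abs[where g="mean_it f Q" and B=B, OF mb] and lm = lenv_measurable[where g="mean_it f Q" and B=B, OF mb d(4,3)]
    and lg = lenv_ge[where g="mean_it f Q" and B=B, OF mb]
  show ?thesis
  proof (rule tendsto_upperbound[OF mean_it_limit(1)[OF sol Q fd f]])
    show "\<forall>\<^sub>F i in sequentially. (\<integral>\<omega>. mean_it f Q i (G \<omega>) \<partial>M) \<le> (\<integral>\<omega>. lenv (mean_it f Q) k (G \<omega>) \<partial>M)"
      using eventually_ge_at_top[of k]
    proof eventually_elim
      fix i assume i: "k \<le> i"
      show "(\<integral>\<omega>. mean_it f Q i (G \<omega>) \<partial>M) \<le> (\<integral>\<omega>. lenv (mean_it f Q) k (G \<omega>) \<partial>M)"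
      proof (rule integral_mono)
        show "integrable M (\<lambda>\<omega>. mean_it f Q i (G \<omega>))"
          by (rule M.integrable_const_bound[OF _ mean_it_limit(2)[OF sol Q fd f], where B=B], rule AE_I2) (simp add: mb d(3))
        show "integrable M (\<lambda>\<omega>. lenv (mean_it f Q) k (G \<omega>))"
          by (rule M.integrable_const_bound[OF _ lm, where B=B], rule AE_I2) (simp add: le d(3))
        show "mean_it f Q i (G \<omega>) \<le> lenv (mean_it f Q) k (G \<omega>)" if "\<omega> \<in> space M" for \<omega>
          by (rule lg[OF _ d(3)[OF that] i])
      qed
    qed
  qed simp
qed

end

text \<open>\<open>canonical_perm\<close> needs an injection of all labels, while an isomorphism of
  balls inverts on a finite set only. Labels outside its image are shifted beyond \<open>A\<close>,
  so that no collision occurs.\<close>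

lemma ex_inj_inverse:
  fixes \<phi> :: "nat \<Rightarrow> nat"
  assumes A: "finite A" and inj: "inj_on \<phi> A"
  shows "\<exists>\<psi>::nat \<Rightarrow> nat. inj \<psi> \<and> (\<forall>v\<in>A. \<psi> (\<phi> v) = v)"
proof -
  obtain K where K: "\<And>v. v \<in> A \<Longrightarrow> v < K" using finite_nat_set_iff_bounded[of A] A by blast
  define \<psi> where "\<psi> x = (if x \<in> \<phi> ` A then the_inv_into A \<phi> x else x + K)" for x
  have in_A: "\<psi> x \<in> A" if "x \<in> \<phi> ` A" for x
    using that the_inv_into_into[OF inj that subset_refl] by (simp add: \<psi>_def)
  have f_inv: "\<phi> (\<psi> x) = x" if "x \<in> \<phi> ` A" for x
    using that f_the_inv_into_f[OF inj that] by (simp add: \<psi>_def)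
  have "inj \<psi>"
  proof (rule injI)
    fix x y assume e: "\<psi> x = \<psi> y"
    consider "x \<in> \<phi> ` A" "y \<in> \<phi> ` A" | "x \<in> \<phi> ` A" "y \<notin> \<phi> ` A" | "x \<notin> \<phi> ` A" "y \<in> \<phi> ` A" | "x \<notin> \<phi> ` A" "y \<notin> \<phi> ` A" by blast
    then show "x = y"
    proof cases
      case 1
      have "x = \<phi> (\<psi> x)" by (rule f_inv[OF 1(1), symmetric])
      also have "\<dots> = y" unfolding e by (rule f_inv[OF 1(2)])
      finally show ?thesis .
    next
      case 2
      then have "\<psi> x < K" "\<psi> y = y + K" using K[OF in_A[OF 2(1)]] by (simp_all add: \<psi>_def)
      then show ?thesis using e by simp
    next
      case 3
      then have "\<psi> y < K" "\<psi> x = x + K" using K[OF in_A[OF 3(2)]] by (simp_all add: \<psi>_def)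
      then show ?thesis using e by simp
    next
      case 4 then show ?thesis using e by (simp add: \<psi>_def)
    qed
  qed
  moreover have "\<psi> (\<phi> v) = v" if "v \<in> A" for v using that inj by (simp add: \<psi>_def the_inv_into_f_f)
  ultimately show ?thesis by blast
qed

context jump_model begin

subsection \<open>Approximation by countably many deterministic graphs\<close>

text \<open>A random graph is replaced by one of countably many deterministic graphs \<open>y l\<close>; \<open>\<phi> l\<close> embeds its ball into
  \<open>y l\<close>, and relabelling the noise by the injection \<open>\<psi> l\<close> transports it along \<open>\<phi> l\<close>.\<close>

definition cell_family :: "(('e, 'k \<times> path) mgraph \<Rightarrow> real) \<Rightarrow> (nat \<Rightarrow> pt set) measure \<Rightarrow> nat \<Rightarrow> real \<Rightarrow>
    (('e, 'k \<times> int) mgraph \<Rightarrow> nat) \<Rightarrow> (nat \<Rightarrow> ('e, 'k \<times> int) mgraph) \<Rightarrow> (nat \<Rightarrow> nat) \<Rightarrow>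
    (nat \<Rightarrow> nat \<Rightarrow> nat) \<Rightarrow> (nat \<Rightarrow> nat \<Rightarrow> nat) \<Rightarrow> bool" where
  "cell_family f Q K \<delta> q y i \<phi> \<psi> \<longleftrightarrow> q \<in> measurable (graphM borel borel) (count_space UNIV) \<and>
    (\<forall>l. W (y l) \<and> K \<le> i l \<and> inj (\<psi> l)) \<and>
    (\<forall>H. W H \<longrightarrow> close_on (nat \<lceil>1 / \<delta>\<rceil>) (\<delta> + \<delta>) H (y (q H)) (\<phi> (q H)) \<and>
      (\<forall>v\<in>ballv (edges H) (root H) (nat \<lceil>1 / \<delta>\<rceil>). \<psi> (q H) (\<phi> (q H) v) = v) \<and>
      lenv (mean_it f Q) K H \<le> mean_it f Q (i (q H)) (y (q H)) + 2 / real K)"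

text \<open>The means lie in \<open>[-B, B]\<close>, so a maximiser up to \<open>1 / K\<close>
  satisfies \<open>K * gdist < 2 * B + 1\<close> and is close to the representative of the cell
  within \<delta>. It is selected once per cell, which keeps the choice countable.\<close>

lemma choose_cells:
  assumes Q: "canonical Q" and f: "pf f" and B: "0 \<le> B" "\<And>H x. W H \<Longrightarrow> paths_on (verts H) x \<Longrightarrow> \<bar>f (sol_graph H x)\<bar> \<le> B"
    and K: "1 \<le> K" "\<delta> = (2 * B + 2) / real K" "\<delta> \<le> 1" and H0: "W H0"
  shows "\<exists>q y i \<phi> \<psi>. cell_family f Q K \<delta> q y i \<phi> \<psi>"
proof -
  let ?R = "nat \<lceil>1 / \<delta>\<rceil>"
  have Kp: "0 < real K" using K(1) by simp
  have d0: "0 < \<delta>" using K(2) B(1) Kp by simp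
  have mb: "\<bar>mean_it f Q i y\<bar> \<le> B" if "W y" for i y by (rule mean_it_bound[OF Q f B(2) that])
  note near = lenv_near[where g="mean_it f Q" and B=B, OF mb] and labs = lenv_abs[where g="mean_it f Q" and B=B, OF mb]
    and lip = lenv_lip[where g="mean_it f Q" and B=B, OF mb]
  \<comment> \<open>With cells of this size the \<open>K\<close>-Lipschitz envelope changes by at
    most \<open>1 / K\<close> between a graph and its representative; together with the slack
    \<open>1 / K\<close> of the maximiser this is the error \<open>2 / K\<close>.\<close>
  define \<epsilon> where "\<epsilon> = 1 / (real K * real K)"
  have e0: "0 < \<epsilon>" using Kp by (simp add: \<epsilon>_def)
  have Ke: "real K * \<epsilon> = 1 / real K" using Kp by (simp add: \<epsilon>_def)
  have ed: "\<epsilon> \<le> \<delta>"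
  proof -
    have "\<epsilon> = (1 / real K) / real K" by (simp add: \<epsilon>_def)
    also have "\<dots> \<le> \<delta>" unfolding K(2)
    proof (rule divide_right_mono)
      have "1 / real K \<le> 1" using K(1) by simp
      then show "1 / real K \<le> 2 * B + 2" using B(1) by linarith
    qed simp
    finally show ?thesis .
  qed
  obtain q c where q: "q \<in> measurable (graphM borel borel) (count_space UNIV)"
    and qc: "\<forall>G. W G \<longrightarrow> W (c (q G)) \<and> close_on (nat \<lceil>1 / \<epsilon>\<rceil>) \<epsilon> G (c (q G :: nat)) id"
    using cells[OF e0, of "nat \<lceil>1 / \<epsilon>\<rceil>"] by (elim exE conjE) (rule that)
  define P where "P l t \<longleftrightarrow> W (fst t) \<and> K \<le> fst (snd t) \<and> inj (snd (snd (snd t)) :: nat \<Rightarrow> nat) \<and>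
     (W (c l) \<longrightarrow> close_on ?R \<delta> (c l) (fst t) (fst (snd (snd t))) \<and>
       (\<forall>v\<in>ballv (edges (c l)) (root (c l)) ?R. snd (snd (snd t)) (fst (snd (snd t)) v) = v) \<and>
       lenv (mean_it f Q) K (c l) \<le> mean_it f Q (fst (snd t)) (fst t) + 1 / real K)" for l :: nat and t
  have ex: "\<exists>t. P l t" for l
  proof (cases "W (c l)")
    case False
    \<comment> \<open>A label with an ill-formed representative belongs to no well-formed graph and
      gets a placeholder.\<close>
    then have "P l (H0, K, id, id)" using H0 by (simp add: P_def)
    then show ?thesis by (rule exI)
  next
    case True
    have nx: "\<exists>y i. W y \<and> K \<le> i \<and> lenv (mean_it f Q) K (c l) - 1 / real K < mean_it f Q i y - real K * gdist y (c l)"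
      by (rule near[OF _ True]) (use Kp in simp_all)
    obtain y i where yi: "W y \<and> K \<le> i \<and> lenv (mean_it f Q) K (c l) - 1 / real K < mean_it f Q i y - real K * gdist y (c l)"
      using nx by (elim exE) (rule that)
    have "real K * gdist y (c l) < mean_it f Q i y - lenv (mean_it f Q) K (c l) + 1 / real K" using yi by linarith
    also have "\<dots> \<le> 2 * B + 1"
    proof -
      have "mean_it f Q i y \<le> B" using mb[of y i] yi by simp
      moreover have "- B \<le> lenv (mean_it f Q) K (c l)" using labs[OF _ True, of K] by simp
      moreover have "1 / real K \<le> 1" using K(1) by simp
      ultimately show ?thesis by linarith
    qed
    finally have "gdist y (c l) < \<delta>" unfolding K(2) using Kp by (simp add: pos_less_divide_eq mult.commute)
    then have "gdist (c l) y < \<delta>" using gdist_sym[of "init_ok Xs" y "init_ok Xs" "c l"] yi True by simp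
    from gdist_less_gclose[OF this K(3)] obtain \<phi> where \<phi>: "close_on ?R \<delta> (c l) y \<phi>"
      unfolding gclose_def by (elim exE[OF _ that])
    have "inj_on \<phi> (ballv (edges (c l)) (root (c l)) ?R)"
      using close_on_dist(4)[OF \<phi>] by (simp add: rooted_iso_def bij_betw_def)
    from ex_inj_inverse[OF wf_finite_ballv[OF True] this]
    obtain \<psi> :: "nat \<Rightarrow> nat" where \<psi>: "inj \<psi> \<and> (\<forall>v\<in>ballv (edges (c l)) (root (c l)) ?R. \<psi> (\<phi> v) = v)" by (elim exE[OF _ that])
    have "0 \<le> real K * gdist y (c l)" using gdist_nonneg[of y "c l"] by simp
    then have "P l (y, i, \<phi>, \<psi>)" using yi \<phi> \<psi> unfolding P_def by simp
    then show ?thesis by (rule exI)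
  qed
  then have "\<forall>l. \<exists>t. P l t" by (rule allI)
  from choice[OF this] obtain \<tau> where \<tau>: "\<forall>l. P l (\<tau> l)" by (elim exE[OF _ that])
  have main: "close_on ?R (\<delta> + \<delta>) H (fst (\<tau> (q H))) (fst (snd (snd (\<tau> (q H))))) \<and>
      (\<forall>v\<in>ballv (edges H) (root H) ?R. snd (snd (snd (\<tau> (q H)))) (fst (snd (snd (\<tau> (q H)))) v) = v) \<and>
      lenv (mean_it f Q) K H \<le> mean_it f Q (fst (snd (\<tau> (q H)))) (fst (\<tau> (q H))) + 2 / real K" if H: "W H" for H
  proof -
    have c: "W (c (q H))" "close_on (nat \<lceil>1 / \<epsilon>\<rceil>) \<epsilon> H (c (q H)) id" using qc H by auto
    have p: "W (fst (\<tau> (q H)))" "close_on ?R \<delta> (c (q H)) (fst (\<tau> (q H))) (fst (snd (snd (\<tau> (q H)))))"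
       "\<forall>v\<in>ballv (edges (c (q H))) (root (c (q H))) ?R. snd (snd (snd (\<tau> (q H)))) (fst (snd (snd (\<tau> (q H)))) v) = v"
       "lenv (mean_it f Q) K (c (q H)) \<le> mean_it f Q (fst (snd (\<tau> (q H)))) (fst (\<tau> (q H))) + 1 / real K"
      using \<tau>[rule_format, of "q H"] c(1) unfolding P_def by simp_all
    have Rr: "?R \<le> nat \<lceil>1 / \<epsilon>\<rceil>" by (rule radius_antimono[OF e0 ed])
    have "close_on ?R (\<delta> + \<delta>) H (fst (\<tau> (q H))) (fst (snd (snd (\<tau> (q H)))) \<circ> id)"
      by (rule close_on_trans[OF close_on_mono[OF c(2) Rr ed] p(2) H c(1)])
    moreover have "ballv (edges (c (q H))) (root (c (q H))) ?R = ballv (edges H) (root H) ?R"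
      by (rule ballv_close_id[OF c(2) Rr])
    moreover have "lenv (mean_it f Q) K H \<le> mean_it f Q (fst (snd (\<tau> (q H)))) (fst (\<tau> (q H))) + 2 / real K"
    proof -
      have "gclose \<epsilon> H (c (q H))" unfolding gclose_def using c(2) by (rule exI[of _ id])
      then have "gdist H (c (q H)) \<le> \<epsilon>" by (rule gdist_le[OF e0])
      then have "gdist (c (q H)) H \<le> \<epsilon>" using gdist_sym[OF H c(1)] by simp
      then have "real K * gdist H (c (q H)) \<le> 1 / real K"
        unfolding Ke[symmetric] using gdist_sym[OF H c(1)] Kp by simp
      then show ?thesis using lip[OF _ H c(1), of K] p(4) by simp
    qed
    ultimately show ?thesis using p(3) by simp
  qed
  show ?thesis
    by (rule exI[of _ q], rule exI[of _ "\<lambda>l. fst (\<tau> l)"], rule exI[of _ "\<lambda>l. fst (snd (\<tau> l))"],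
        rule exI[of _ "\<lambda>l. fst (snd (snd (\<tau> l)))"], rule exI[of _ "\<lambda>l. snd (snd (snd (\<tau> l)))"])
       (use q \<tau> main in \<open>simp add: P_def cell_family_def\<close>)
qed

text \<open>Once the label is fixed, the noise relabelled by the injection \<psi> is again
  canonical, so the iterate on the selected graph has its own mean although it is driven by the
  noise of \<open>G\<close>.\<close>

lemma label_mean:
  assumes sol: "strong_solution Xs J \<sigma> rbar M F G N X" and Q: "canonical Q" and f: "pf f"
    and B: "\<And>H x. W H \<Longrightarrow> paths_on (verts H) x \<Longrightarrow> \<bar>f (sol_graph H x)\<bar> \<le> B"
    and q: "q \<in> measurable (graphM borel borel) (count_space UNIV)"
    and y: "\<And>l::nat. W (y l)" and inj: "\<And>l. inj (\<psi> l)"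
  shows "(\<integral>z. f (sol_graph (y (q (G (fst z)))) (xit (y (q (G (fst z)))) (\<lambda>v. noise' G N z (\<psi> (q (G (fst z))) v)) (i (q (G (fst z)))))) \<partial>(M \<Otimes>\<^sub>M Q)) =
      (\<integral>\<omega>. mean_it f Q (i (q (G \<omega>))) (y (q (G \<omega>))) \<partial>M)"
    and "(\<lambda>z. f (sol_graph (y (q (G (fst z)))) (xit (y (q (G (fst z)))) (\<lambda>v. noise' G N z (\<psi> (q (G (fst z))) v)) (i (q (G (fst z)))))))
      \<in> borel_measurable (M \<Otimes>\<^sub>M Q)"
    and "(\<lambda>\<omega>. mean_it f Q (i (q (G \<omega>))) (y (q (G \<omega>)))) \<in> borel_measurable M"
proof -
  note d = strong_solD[OF sol]
  have qG: "(\<lambda>\<omega>. q (G \<omega>)) \<in> measurable M (count_space UNIV)" by (rule measurable_compose[OF d(4) q])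
  have pre: "(\<lambda>\<omega>. q (G \<omega>)) -` A \<inter> space M \<in> F 0" for A
  proof -
    have "q -` A \<in> sets (graphM borel borel)" using measurable_sets[OF q, of A] by simp
    from d(5)[OF this] show ?thesis by (simp add: vimage_def)
  qed
  let ?h = "\<lambda>x. f (sol_graph (y (fst x)) (xit (y (fst x)) (\<lambda>v. snd x (\<psi> (fst x) v)) (i (fst x))))"
  have perm: "(\<lambda>\<eta> v. \<eta> (\<psi> l v)) \<in> measurable Q Q" for l
  proof -
    have "(\<lambda>\<eta> v. \<eta> (\<psi> l v)) \<in> measurable npm npm"
      by (rule measurable_PiM_single') (auto simp: space_PiM)
    then show ?thesis using canonicalD(2)[OF Q] by (simp cong: measurable_cong_sets)
  qed
  \<comment> \<open>The label is countable, so measurability in the noise for each fixed label is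
    enough.\<close>
  have hm: "?h \<in> borel_measurable (count_space UNIV \<Otimes>\<^sub>M Q)"
  proof (rule measurable_pair_measure_countable1)
    show "(\<lambda>\<eta>. ?h (l, \<eta>)) \<in> borel_measurable Q" for l
      using measurable_compose[OF perm[of l] pf_xit_measurable1[OF f Q y[of l], of "i l"]] by simp
  qed simp
  have hb: "\<bar>?h x\<bar> \<le> B" for x by (rule B[OF y xit_Dpath[OF y]])
  note j = joint_integral[OF sol Q qG pre hm hb, unfolded fst_conv snd_conv]
  have eq: "(\<integral>\<eta>. f (sol_graph (y l) (xit (y l) (\<lambda>v. \<eta> (\<psi> l v)) (i l))) \<partial>Q) = mean_it f Q (i l) (y l)" for l
  proof -
    have npmQ: "distr Q npm (\<lambda>\<eta> v. \<eta> (\<psi> l v)) = distr Q Q (\<lambda>\<eta> v. \<eta> (\<psi> l v))"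
      by (rule distr_cong) (simp_all add: canonicalD(2)[OF Q])
    have "(\<integral>\<eta>. f (sol_graph (y l) (xit (y l) \<eta> (i l))) \<partial>distr Q Q (\<lambda>\<eta> v. \<eta> (\<psi> l v))) =
       (\<integral>\<eta>. f (sol_graph (y l) (xit (y l) (\<lambda>v. \<eta> (\<psi> l v)) (i l))) \<partial>Q)"
      by (rule integral_distr[OF perm pf_xit_measurable1[OF f Q y]])
    then show ?thesis unfolding npmQ[symmetric] canonical_perm[OF Q inj] mean_it_def by simp
  qed
  show "(\<integral>z. f (sol_graph (y (q (G (fst z)))) (xit (y (q (G (fst z)))) (\<lambda>v. noise' G N z (\<psi> (q (G (fst z))) v)) (i (q (G (fst z)))))) \<partial>(M \<Otimes>\<^sub>M Q)) =
      (\<integral>\<omega>. mean_it f Q (i (q (G \<omega>))) (y (q (G \<omega>))) \<partial>M)"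
    unfolding eq[symmetric] by (rule j(1))
  show "(\<lambda>z. f (sol_graph (y (q (G (fst z)))) (xit (y (q (G (fst z)))) (\<lambda>v. noise' G N z (\<psi> (q (G (fst z))) v)) (i (q (G (fst z)))))))
      \<in> borel_measurable (M \<Otimes>\<^sub>M Q)" by (rule j(2))
  show "(\<lambda>\<omega>. mean_it f Q (i (q (G \<omega>))) (y (q (G \<omega>)))) \<in> borel_measurable M"
    unfolding eq[symmetric] by (rule j(3))
qed

text \<open>Separating marks have vanishing probability for each vertex, box and neighbourhood, so
  along one subsequence they eventually disappear for all of these at once. At a given vertex and
  horizon the value of \<open>X\<close> depends on a finite ball, and \<open>coupling\<close> makes
  the iterates equal to \<open>X\<close> there.\<close>

lemma couple:
  fixes q :: "nat \<Rightarrow> ('e, 'k \<times> int) mgraph \<Rightarrow> nat" and y :: "nat \<Rightarrow> nat \<Rightarrow> ('e, 'k \<times> int) mgraph"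
    and i :: "nat \<Rightarrow> nat \<Rightarrow> nat" and \<phi> \<psi> :: "nat \<Rightarrow> nat \<Rightarrow> nat \<Rightarrow> nat" and R :: "nat \<Rightarrow> nat" and \<epsilon> :: "nat \<Rightarrow> real"
  assumes sol: "strong_solution Xs J \<sigma> rbar M F G N X" and Q: "canonical Q"
    and fd: "AE \<omega> in M. fin_dissoc J \<sigma> C (G \<omega>)" and A2: "A2 J rbar M G X" and f: "pf f"
    and q: "\<And>n. q n \<in> measurable (graphM borel borel) (count_space UNIV)"
    and y: "\<And>n l. W (y n l)" and i: "\<And>n l. n \<le> i n l"
    and cl: "\<And>n H. W H \<Longrightarrow> close_on (R n) (\<epsilon> n) H (y n (q n H)) (\<phi> n (q n H))"
    and psi: "\<And>n H v. W H \<Longrightarrow> v \<in> ballv (edges H) (root H) (R n) \<Longrightarrow> \<psi> n (q n H) (\<phi> n (q n H) v) = v"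
    and R: "\<And>r. \<forall>\<^sub>F n in sequentially. r \<le> R n" and e: "\<epsilon> \<longlonglongrightarrow> 0"
  shows "\<exists>s. strict_mono s \<and> (AE z in M \<Otimes>\<^sub>M Q. (\<lambda>m. f (sol_graph (y (s m) (q (s m) (G (fst z))))
     (xit (y (s m) (q (s m) (G (fst z)))) (\<lambda>v. noise' G N z (\<psi> (s m) (q (s m) (G (fst z))) v)) (i (s m) (q (s m) (G (fst z)))))))
     \<longlonglongrightarrow> f (sol_graph (G (fst z)) (X (fst z))))"
proof -
  note d = strong_solD[OF sol]
  interpret M: prob_space M by (rule d(2))
  \<comment> \<open>The marks of the selected graph, pulled back to the labels of \<open>G\<close>.
    They are functions of a cell label determined by the graph, hence known at time 0, as
    \<open>bad_predictable\<close> asks.\<close>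
  define eb where "eb n \<omega> = emark (y n (q n (G \<omega>))) \<circ> (`) (\<phi> n (q n (G \<omega>)))" for n \<omega>
  define kap where "kap n \<omega> = fst \<circ> vmark (y n (q n (G \<omega>))) \<circ> \<phi> n (q n (G \<omega>))" for n \<omega>
  have pre: "{\<omega> \<in> space M. Z (q n (G \<omega>))} \<in> F 0" for n Z
  proof -
    have "q n -` {l. Z l} \<in> sets (graphM borel borel)" using measurable_sets[OF q[of n], of "{l. Z l}"] by simp
    from d(5)[OF this] have "G -` (q n -` {l. Z l}) \<inter> space M \<in> F 0" .
    moreover have "G -` (q n -` {l. Z l}) \<inter> space M = {\<omega> \<in> space M. Z (q n (G \<omega>))}" by auto
    ultimately show ?thesis by simp
  qed
  have ebm: "(\<lambda>\<omega>. eb n \<omega> e) -` S \<inter> space M \<in> F 0" for n e S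
  proof -
    have "(\<lambda>\<omega>. eb n \<omega> e) -` S \<inter> space M = {\<omega> \<in> space M. emark (y n (q n (G \<omega>))) (\<phi> n (q n (G \<omega>)) ` e) \<in> S}"
      by (auto simp: eb_def)
    then show ?thesis using pre[of "\<lambda>l. emark (y n l) (\<phi> n l ` e) \<in> S" n] by simp
  qed
  have kapm: "(\<lambda>\<omega>. kap n \<omega> u) -` S \<inter> space M \<in> F 0" for n u S
  proof -
    have "(\<lambda>\<omega>. kap n \<omega> u) -` S \<inter> space M = {\<omega> \<in> space M. fst (vmark (y n (q n (G \<omega>))) (\<phi> n (q n (G \<omega>)) u)) \<in> S}"
      by (auto simp: kap_def)
    then show ?thesis using pre[of "\<lambda>l. fst (vmark (y n l) (\<phi> n l u)) \<in> S" n] by simp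
  qed
  have conv: "(e' \<in> EU \<longrightarrow> (\<lambda>n. eb n \<omega> e') \<longlonglongrightarrow> emark (G \<omega>) e') \<and> (u \<in> U \<longrightarrow> (\<lambda>n. kap n \<omega> u) \<longlonglongrightarrow> fst (vmark (G \<omega>) u))"
    if w: "\<omega> \<in> space M" and l: "loc G v U EU \<omega>" for \<omega> v U EU e' u
  proof -
    have W: "W (G \<omega>)" by (rule d(3)[OF w])
    have v: "v \<in> verts (G \<omega>)" and U: "clos (edges (G \<omega>)) v = U" and EU: "induced_edges (edges (G \<omega>)) U = EU"
      using l by (simp_all add: loc_def)
    obtain m where m: "v \<in> ballv (edges (G \<omega>)) (root (G \<omega>)) m" using wf_verts_ballv[OF W v] by (elim exE[OF _ that])
    have Ub: "U \<subseteq> ballv (edges (G \<omega>)) (root (G \<omega>)) (Suc m)" using clos_ballv[OF m] U by simp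
    have Ub': "U \<subseteq> ballv (edges (G \<omega>)) (root (G \<omega>)) (R n)" if "Suc m \<le> R n" for n
      using Ub ballv_mono[OF that] by blast
    have "(\<lambda>n. eb n \<omega> e') \<longlonglongrightarrow> emark (G \<omega>) e'" if e': "e' \<in> EU"
    proof -
      have "\<forall>\<^sub>F n in sequentially. dist (eb n \<omega> e') (emark (G \<omega>) e') \<le> \<epsilon> n"
        using R[of "Suc m"]
      proof eventually_elim
        fix n assume "Suc m \<le> R n"
        then have "e' \<in> induced_edges (edges (G \<omega>)) (ballv (edges (G \<omega>)) (root (G \<omega>)) (R n))"
          using e' Ub'[of n] unfolding EU[symmetric] induced_edges_def by blast
        from close_on_dist(3)[OF cl[OF W] this] show "dist (eb n \<omega> e') (emark (G \<omega>) e') \<le> \<epsilon> n" by (simp add: eb_def)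
      qed
      then have "(\<lambda>n. dist (eb n \<omega> e') (emark (G \<omega>) e')) \<longlonglongrightarrow> 0"
        by (rule tendsto_sandwich[OF _ _ tendsto_const e, rotated]) simp
      then show ?thesis by (simp only: tendsto_dist_iff[of "\<lambda>n. eb n \<omega> e'"])
    qed
    moreover have "(\<lambda>n. kap n \<omega> u) \<longlonglongrightarrow> fst (vmark (G \<omega>) u)" if u: "u \<in> U"
    proof -
      have "\<forall>\<^sub>F n in sequentially. dist (kap n \<omega> u) (fst (vmark (G \<omega>) u)) \<le> \<epsilon> n"
        using R[of "Suc m"]
      proof eventually_elim
        fix n assume "Suc m \<le> R n"
        then have "u \<in> ballv (edges (G \<omega>)) (root (G \<omega>)) (R n)" using u Ub'[of n] by blast
        from close_on_dist(1)[OF cl[OF W] this] show "dist (kap n \<omega> u) (fst (vmark (G \<omega>) u)) \<le> \<epsilon> n" by (simp add: kap_def)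
      qed
      then have "(\<lambda>n. dist (kap n \<omega> u) (fst (vmark (G \<omega>) u))) \<longlonglongrightarrow> 0"
        by (rule tendsto_sandwich[OF _ _ tendsto_const e, rotated]) simp
      then show ?thesis by (simp only: tendsto_dist_iff[of "\<lambda>n. kap n \<omega> u"])
    qed
    ultimately show ?thesis by simp
  qed
  have ht: "hits M G N v n (bad M G X v U EU (eb k) (kap k)) \<in> sets M"
    "(\<lambda>k. measure M (hits M G N v n (bad M G X v U EU (eb k) (kap k)))) \<longlonglongrightarrow> 0" if "finite U" for v n U EU k
    using hits_tend[OF sol A2 that, of eb kap v EU n] ebm kapm conv by blast+
  \<comment> \<open>Vertices, boxes and finite neighbourhoods are enumerated through lists, so that
    a single application of \<open>subseq_AE\<close> treats all of them.\<close>
  define HH where "HH a k = (case from_nat a of (v :: nat, n :: nat, us :: nat list, es :: nat list list) \<Rightarrow>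
     hits M G N v n (bad M G X v (set us) (set ` set es) (eb k) (kap k)))" for a k
  obtain s where s: "strict_mono s \<and> (AE \<omega> in M. \<forall>a. \<forall>\<^sub>F m in sequentially. \<omega> \<notin> HH a (s m))"
  proof (rule exE[OF subseq_AE[of M HH]])
    show "finite_measure M" by (rule M.finite_measure_axioms)
    show "HH a k \<in> sets M" for a k unfolding HH_def by (simp split: prod.split add: ht(1))
    show "(\<lambda>k. measure M (HH a k)) \<longlonglongrightarrow> 0" for a
      by (cases "from_nat a :: nat \<times> nat \<times> nat list \<times> nat list list") (simp add: HH_def ht(2))
  qed (rule that)
  have "AE z in M \<Otimes>\<^sub>M Q. (\<lambda>m. f (sol_graph (y (s m) (q (s m) (G (fst z))))
     (xit (y (s m) (q (s m) (G (fst z)))) (\<lambda>v. noise' G N z (\<psi> (s m) (q (s m) (G (fst z))) v)) (i (s m) (q (s m) (G (fst z)))))))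
     \<longlonglongrightarrow> f (sol_graph (G (fst z)) (X (fst z)))"
    using AE_lift_fst[OF Q conjunct2[OF s]] no_chain_AE[OF sol Q fd] fixpoint_lift[OF sol Q] AE_space
  proof eventually_elim
    fix z assume nh: "\<forall>a. \<forall>\<^sub>F m in sequentially. fst z \<notin> HH a (s m)"
      and nc: "\<forall>T::nat. \<forall>v\<in>verts (G (fst z)). \<exists>i. \<not> dep J C (edges (G (fst z))) (noise' G N z) (real (Suc T)) i v (real (Suc T))"
      and fx: "\<forall>v\<in>verts (G (fst z)). \<forall>t\<ge>0. X (fst z) v t = upd (G (fst z)) (noise' G N z) (X (fst z)) v t"
      and z: "z \<in> space (M \<Otimes>\<^sub>M Q)"
    define \<omega> where "\<omega> = fst z"
    have w: "\<omega> \<in> space M" using z by (auto simp: space_pair_measure \<omega>_def)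
    have W: "W (G \<omega>)" by (rule d(3)[OF w])
    have Xp: "paths_on (verts (G \<omega>)) (X \<omega>)" using d(7) w by (auto simp: meas_paths_def)
    define Y where "Y m = y (s m) (q (s m) (G \<omega>))" for m
    define \<Phi> where "\<Phi> m = \<phi> (s m) (q (s m) (G \<omega>))" for m
    define \<Psi> where "\<Psi> m = \<psi> (s m) (q (s m) (G \<omega>))" for m
    define I where "I m = i (s m) (q (s m) (G \<omega>))" for m
    have YW: "W (Y m)" for m by (simp add: Y_def y)
    have YC: "close_on (R (s m)) (\<epsilon> (s m)) (G \<omega>) (Y m) (\<Phi> m)" for m unfolding Y_def \<Phi>_def by (rule cl[OF W])
    have YP: "\<Psi> m (\<Phi> m v) = v" if "v \<in> ballv (edges (G \<omega>)) (root (G \<omega>)) (R (s m))" for m v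
      unfolding \<Psi>_def \<Phi>_def by (rule psi[OF W that])
    have Ii: "m \<le> I m" for m using i[of "s m" "q (s m) (G \<omega>)"] seq_suble[OF conjunct1[OF s], of m] by (simp add: I_def)
    have mk: "eb (s m) \<omega> = emark (Y m) \<circ> (`) (\<Phi> m)" "kap (s m) \<omega> = fst \<circ> vmark (Y m) \<circ> \<Phi> m" for m
      by (simp_all add: eb_def kap_def Y_def \<Phi>_def)
    have Rs: "\<forall>\<^sub>F m in sequentially. r \<le> R (s m)" for r by (rule eventually_subseq[OF conjunct1[OF s] R])
    have nohit: "\<forall>\<^sub>F m in sequentially. \<forall>p\<in>clean J (noise' G N z u). fst p \<le> T \<longrightarrow>
       (fst (snd p) \<le> rt (G \<omega>) (snd (snd p)) u (fst p) (X \<omega>) \<longleftrightarrow>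
        fst (snd p) \<le> rate rbar (snd (snd p)) (edges (G \<omega>)) (emark (Y m) \<circ> (`) (\<Phi> m)) (fst \<circ> vmark (Y m) \<circ> \<Phi> m) u (fst p) (X \<omega>))"
      if u: "u \<in> verts (G \<omega>)" for u T
    proof -
      let ?U = "clos (edges (G \<omega>)) u"
      have Uf: "finite ?U" by (rule wf_finite_clos[OF W u])
      obtain us where us: "set us = ?U" using finite_list[OF Uf] by (elim exE[OF _ that])
      obtain es0 where es0: "set es0 = induced_edges (edges (G \<omega>)) ?U" using finite_list[OF finite_induced[OF Uf, of "edges (G \<omega>)"]] by (elim exE[OF _ that])
      define es where "es = map sorted_list_of_set es0"
      have es: "set ` set es = induced_edges (edges (G \<omega>)) ?U"
      proof -
        have "set (sorted_list_of_set e) = e" if "e \<in> set es0" for e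
        proof -
          have "e \<subseteq> ?U" using that es0 by (simp add: induced_edges_def)
          then show ?thesis using Uf by (simp add: finite_subset)
        qed
        then have "set ` set es = set es0" unfolding es_def by (simp add: image_image)
        then show ?thesis using es0 by simp
      qed
      \<comment> \<open>Up to time \<open>T\<close> both rates are at most \<open>n\<close> by (A1),
        so every mark that separates them lies in the box; \<open>max T 0\<close> keeps the time
        argument of \<open>C\<close> in its range.\<close>
      define n where "n = nat \<lceil>max T (C (card ?U) (max T 0))\<rceil>"
      have n: "T \<le> real n" "C (card ?U) (max T 0) \<le> real n" unfolding n_def by linarith+
      have l: "loc G u (set us) (set ` set es) \<omega>" unfolding loc_def us es using u by simp
      have "\<forall>\<^sub>F m in sequentially. \<omega> \<notin> HH (to_nat (u, n, us, es)) (s m)" using nh unfolding \<omega>_def by simp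
      then show ?thesis
      proof eventually_elim
        fix m assume nH: "\<omega> \<notin> HH (to_nat (u, n, us, es)) (s m)"
        show "\<forall>p\<in>clean J (noise' G N z u). fst p \<le> T \<longrightarrow>
         (fst (snd p) \<le> rt (G \<omega>) (snd (snd p)) u (fst p) (X \<omega>) \<longleftrightarrow>
          fst (snd p) \<le> rate rbar (snd (snd p)) (edges (G \<omega>)) (emark (Y m) \<circ> (`) (\<Phi> m)) (fst \<circ> vmark (Y m) \<circ> \<Phi> m) u (fst p) (X \<omega>))"
        proof (intro ballI impI, rule ccontr)
          fix p assume p: "p \<in> clean J (noise' G N z u)" and pT: "fst p \<le> T"
            and neq: "\<not> (fst (snd p) \<le> rt (G \<omega>) (snd (snd p)) u (fst p) (X \<omega>) \<longleftrightarrow>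
              fst (snd p) \<le> rate rbar (snd (snd p)) (edges (G \<omega>)) (emark (Y m) \<circ> (`) (\<Phi> m)) (fst \<circ> vmark (Y m) \<circ> \<Phi> m) u (fst p) (X \<omega>))"
          have pN: "p \<in> clean J (N \<omega> u)" using p u by (simp add: noise'_live \<omega>_def)
          have pos: "0 < fst p \<and> 0 < fst (snd p) \<and> snd (snd p) \<in> J" by (rule clean_pos[OF pN])
          have le: "rate rbar (snd (snd p)) (edges (G \<omega>)) ebb kk u (fst p) (X \<omega>) \<le> real n" for ebb kk
            by (rule order_trans[OF rate_le_C[OF W u _ Xp, where T="max T 0"] n(2)]) (use pos pT in auto)
          have "fst (snd p) \<le> real n" using neq le by (meson order_trans)
          moreover have "p \<in> space pm" using prm_space[OF d(6) w u] pN clean_sub by blast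
          ultimately have "p \<in> tbox n" using pT n(1) by (simp add: tbox_def)
          moreover have "(\<omega>, p) \<in> bad M G X u (set us) (set ` set es) (eb (s m)) (kap (s m))"
            unfolding bad_def mem_Collect_eq fst_conv snd_conv mk
            using neq l \<open>p \<in> space pm\<close> pos w by (simp add: pred_space_def)
          ultimately have "\<omega> \<in> hits M G N u n (bad M G X u (set us) (set ` set es) (eb (s m)) (kap (s m)))"
            unfolding hits_def using w u pN by blast
          then show False using nH by (simp add: HH_def)
        qed
      qed
    qed
    have "local_conv path_mconv (\<lambda>m. sol_graph (Y m) (xit (Y m) (\<lambda>v. noise' G N z (\<Psi> m v)) (I m))) (sol_graph (G \<omega>) (X \<omega>))"
    proof (rule sol_local_conv[OF W, where R="\<lambda>m. R (s m)" and \<epsilon>="\<lambda>m. \<epsilon> (s m)" and \<phi>=\<Phi>])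
      show "\<forall>\<^sub>F m in sequentially. r \<le> R (s m) \<and> close_on (R (s m)) (\<epsilon> (s m)) (G \<omega>) (Y m) (\<Phi> m)" for r
        using Rs[of r] by eventually_elim (simp add: YC)
      show "(\<lambda>m. \<epsilon> (s m)) \<longlonglongrightarrow> 0" using LIMSEQ_subseq_LIMSEQ[OF e conjunct1[OF s]] by (simp add: comp_def)
      fix v assume v: "v \<in> verts (G \<omega>)"
      show "skor_conv (\<lambda>m. xit (Y m) (\<lambda>v. noise' G N z (\<Psi> m v)) (I m) (\<Phi> m v)) (X \<omega> v)"
      proof (rule skor_conv_eventually)
        fix T :: nat
        obtain m0 where m0: "v \<in> ballv (edges (G \<omega>)) (root (G \<omega>)) m0" using wf_verts_ballv[OF W v] by (elim exE[OF _ that])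
        obtain i0 where i0: "\<not> dep J C (edges (G \<omega>)) (noise' G N z) (real (Suc T)) i0 v (real (Suc T))"
          using nc v unfolding \<omega>_def by blast
        let ?B = "ballv (edges (G \<omega>)) (root (G \<omega>)) (m0 + i0)"
        have "\<forall>\<^sub>F m in sequentially. \<forall>u\<in>?B. \<forall>p\<in>clean J (noise' G N z u). fst p \<le> real (Suc T) \<longrightarrow>
          (fst (snd p) \<le> rt (G \<omega>) (snd (snd p)) u (fst p) (X \<omega>) \<longleftrightarrow>
          fst (snd p) \<le> rate rbar (snd (snd p)) (edges (G \<omega>)) (emark (Y m) \<circ> (`) (\<Phi> m)) (fst \<circ> vmark (Y m) \<circ> \<Phi> m) u (fst p) (X \<omega>))"
          by (rule eventually_ball_finite[OF wf_finite_ballv[OF W]], rule ballI, rule nohit)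
             (use wf_ballv_verts[OF W] in blast)
        then show "\<forall>\<^sub>F m in sequentially. \<forall>t\<in>{0..real T}. xit (Y m) (\<lambda>v. noise' G N z (\<Psi> m v)) (I m) (\<Phi> m v) t = X \<omega> v t"
          using Rs[of "m0 + i0"] eventually_ge_at_top[of i0]
        proof eventually_elim
          fix m assume nh': "\<forall>u\<in>?B. \<forall>p\<in>clean J (noise' G N z u). fst p \<le> real (Suc T) \<longrightarrow>
              (fst (snd p) \<le> rt (G \<omega>) (snd (snd p)) u (fst p) (X \<omega>) \<longleftrightarrow>
              fst (snd p) \<le> rate rbar (snd (snd p)) (edges (G \<omega>)) (emark (Y m) \<circ> (`) (\<Phi> m)) (fst \<circ> vmark (Y m) \<circ> \<Phi> m) u (fst p) (X \<omega>))"
            and Rm: "m0 + i0 \<le> R (s m)" and im: "i0 \<le> m"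
          have bsub: "?B \<subseteq> ballv (edges (G \<omega>)) (root (G \<omega>)) (R (s m))" by (rule ballv_mono[OF Rm])
          show "\<forall>t\<in>{0..real T}. xit (Y m) (\<lambda>v. noise' G N z (\<Psi> m v)) (I m) (\<Phi> m v) t = X \<omega> v t"
          proof
            fix t assume t: "t \<in> {0..real T}"
            show "xit (Y m) (\<lambda>v. noise' G N z (\<Psi> m v)) (I m) (\<Phi> m v) t = X \<omega> v t"
            proof (rule coupling[where R="m0 + i0" and m=m0 and i=i0 and T="real (Suc T)" and \<eta>="noise' G N z" and G="G \<omega>", OF W YW])
              show "rooted_iso (\<Phi> m) ?B (edges (G \<omega>)) (root (G \<omega>)) (ballv (edges (Y m)) (root (Y m)) (m0 + i0)) (edges (Y m)) (root (Y m))"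
                by (rule rooted_iso_ballv_mono[OF close_on_dist(4)[OF YC] Rm])
              show "snd (vmark (Y m) (\<Phi> m v)) = snd (vmark (G \<omega>) v)" if "v \<in> ?B" for v
                by (rule close_on_dist(2)[OF YC]) (use that bsub in blast)
              show "noise' G N z (\<Psi> m (\<Phi> m v)) = noise' G N z v" if "v \<in> ?B" for v
                using YP[of v m] that bsub by (simp add: subsetD)
              show "paths_on (verts (G \<omega>)) (X \<omega>)" by (rule Xp)
              show "X \<omega> v t = upd (G \<omega>) (noise' G N z) (X \<omega>) v t" if "v \<in> verts (G \<omega>)" "0 \<le> t" for v t
                using fx that unfolding \<omega>_def by blast
              show "(fst (snd p) \<le> rt (G \<omega>) (snd (snd p)) u (fst p) (X \<omega>)) =
                (fst (snd p) \<le> rate rbar (snd (snd p)) (edges (G \<omega>)) (emark (Y m) \<circ> (`) (\<Phi> m)) (fst \<circ> vmark (Y m) \<circ> \<Phi> m) u (fst p) (X \<omega>))"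
                if "u \<in> ?B" "p \<in> clean J (noise' G N z u)" "fst p \<le> real (Suc T)" for u p
                using nh'[rule_format, OF that] .
              show "v \<in> ballv (edges (G \<omega>)) (root (G \<omega>)) m0" by (rule m0)
              show "\<not> dep J C (edges (G \<omega>)) (noise' G N z) (real (Suc T)) i0 v (real (Suc T))" by (rule i0)
              show "i0 \<le> I m" using im Ii[of m] by simp
            qed (use t in auto)
          qed
        qed
      qed
    qed
    then have "(\<lambda>m. f (sol_graph (Y m) (xit (Y m) (\<lambda>v. noise' G N z (\<Psi> m v)) (I m)))) \<longlonglongrightarrow> f (sol_graph (G \<omega>) (X \<omega>))"
      by (rule test_fun_conv[OF f wf_sol_graph[OF YW xit_Dpath[OF YW]] wf_sol_graph[OF W Xp]])
    then show "(\<lambda>m. f (sol_graph (y (s m) (q (s m) (G (fst z))))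
     (xit (y (s m) (q (s m) (G (fst z)))) (\<lambda>v. noise' G N z (\<psi> (s m) (q (s m) (G (fst z))) v)) (i (s m) (q (s m) (G (fst z)))))))
     \<longlonglongrightarrow> f (sol_graph (G (fst z)) (X (fst z)))"
      unfolding Y_def \<Psi>_def I_def \<omega>_def .
  qed
  then show ?thesis using conjunct1[OF s] by (intro exI[of _ s] conjI)
qed

subsection \<open>The upper bound\<close>

text \<open>A well-formed graph contains its root, so one of the countably many labels is a vertex
  with positive probability; the noise there is the input of \<open>ex_canonical\<close>.\<close>

lemma ex_canonical_sol:
  assumes sol: "strong_solution Xs J \<sigma> rbar M F G N X"
  shows "\<exists>Q. canonical Q"
proof -
  note d = strong_solD[OF sol]
  interpret M: prob_space M by (rule d(2))
  let ?V = "\<lambda>v. {\<omega> \<in> space M. v \<in> verts (G \<omega>)}"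
  have Vs: "?V v \<in> sets M" for v using d(12) d(9)[OF order_refl] by blast
  have "\<exists>v. 0 < measure M (?V v)"
  proof (rule ccontr)
    assume a: "\<nexists>v. 0 < measure M (?V v)"
    have "measure M (?V v) = 0" for v using a measure_nonneg[of M "?V v"] by (meson antisym_conv2 not_less)
    then have "?V v \<in> null_sets M" for v using Vs[of v] by (intro null_setsI) (simp_all add: M.emeasure_eq_measure)
    then have "(\<Union>v. ?V v) \<in> null_sets M" by (intro null_sets_UN') auto
    moreover have "(\<Union>v. ?V v) = space M"
    proof (intro equalityI subsetI)
      fix \<omega> assume w: "\<omega> \<in> space M"
      have r: "root (G \<omega>) \<in> verts (G \<omega>)" using d(3)[OF w] unfolding wf_graph_def by (rule conjunct1)
      show "\<omega> \<in> (\<Union>v. ?V v)" using w r by (intro UN_I[of "root (G \<omega>)"]) simp_all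
    qed auto
    ultimately show False using M.emeasure_space_1 by (simp add: null_sets_def)
  qed
  then obtain v0 where "0 < measure M (?V v0)" by (elim exE) (rule that)
  from ex_canonical[OF d(2) d(6) d(12) d(9)[OF order_refl] this] show ?thesis .
qed

text \<open>The expected envelope at the limit is bounded by means on the selected graphs, which the
  coupling brings close to the expectation under \<open>X\<close>. Fixing a good envelope, weak
  convergence transports this bound to the sequence.\<close>

lemma upper_bound:
  assumes sols: "\<And>n. strong_solution Xs J \<sigma> rbar (Ms n) (Fs n) (Gs n) (Ns n) (Xsol n)"
    and sol: "strong_solution Xs J \<sigma> rbar M F G N X"
    and fds: "\<And>n. AE \<omega> in Ms n. fin_dissoc J \<sigma> C (Gs n \<omega>)"
    and fd: "AE \<omega> in M. fin_dissoc J \<sigma> C (G \<omega>)"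
    and A2: "A2 J rbar M G X"
    and conv: "conv_distr (init_ok Xs) (\<lambda>ms m. ms \<longlonglongrightarrow> m) Ms Gs M G"
    and f: "pf f" and e: "0 < e"
  shows "\<forall>\<^sub>F n in sequentially. (\<integral>\<omega>. f (sol_graph (Gs n \<omega>) (Xsol n \<omega>)) \<partial>Ms n) < (\<integral>\<omega>. f (sol_graph (G \<omega>) (X \<omega>)) \<partial>M) + e"
proof -
  note d = strong_solD[OF sol]
  interpret M: prob_space M by (rule d(2))
  obtain Q where Q: "canonical Q" using ex_canonical_sol[OF sol] by (elim exE) (rule that)
  interpret Q: prob_space Q by (rule canonicalD(1)[OF Q])
  interpret MQ: pair_prob_space M Q ..
  obtain B where B: "0 \<le> B" "\<And>H x. W H \<Longrightarrow> paths_on (verts H) x \<Longrightarrow> \<bar>f (sol_graph H x)\<bar> \<le> B" using pf_bound[OF f] by blast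
  have mb: "\<bar>mean_it f Q i y\<bar> \<le> B" if "W y" for i y by (rule mean_it_bound[OF Q f B(2) that])
  obtain \<omega>0 where "\<omega>0 \<in> space M" using M.not_empty by blast
  then have H0: "W (G \<omega>0)" by (rule d(3))
  \<comment> \<open>The constant summand makes the radius \<delta> at most 1, as
    \<open>choose_cells\<close> asks.\<close>
  define K where "K n = n + nat \<lceil>2 * B + 2\<rceil>" for n
  define \<delta> where "\<delta> n = (2 * B + 2) / real (K n)" for n
  have KB: "2 * B + 2 \<le> real (K n)" for n unfolding K_def by linarith
  have K1: "1 \<le> K n" for n using KB[of n] B(1) by (cases "K n") auto
  have Kp: "0 < real (K n)" for n using K1[of n] by simp
  have d1: "\<delta> n \<le> 1" for n using KB[of n] Kp[of n] by (simp add: \<delta>_def)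
  have d0: "0 < \<delta> n" for n using Kp[of n] B(1) by (simp add: \<delta>_def)
  have Kinf: "filterlim (\<lambda>n. real (K n)) at_top sequentially"
    by (rule filterlim_at_top_mono[OF filterlim_real_sequentially]) (simp add: K_def)
  have K0: "(\<lambda>n. c / real (K n)) \<longlonglongrightarrow> 0" for c :: real
    by (rule real_tendsto_divide_at_top[OF tendsto_const Kinf])
  have "\<forall>n. \<exists>q y i \<phi> \<psi>. cell_family f Q (K n) (\<delta> n) q y i \<phi> \<psi>"
    by (rule allI) (rule choose_cells[OF Q f B K1 \<delta>_def d1 H0])
  then obtain q y i \<phi> \<psi> where "\<forall>n. cell_family f Q (K n) (\<delta> n) (q n) (y n) (i n) (\<phi> n) (\<psi> n)"
    unfolding choice_iff by (elim exE) (rule that)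
  note cf = this[unfolded cell_family_def, rule_format]
  have qm: "q n \<in> measurable (graphM borel borel) (count_space UNIV)" for n by (rule cf[THEN conjunct1])
  have l: "W (y n l)" "K n \<le> i n l" "inj (\<psi> n l)" for n l using cf[of n] by simp_all
  have c: "close_on (nat \<lceil>1 / \<delta> n\<rceil>) (\<delta> n + \<delta> n) H (y n (q n H)) (\<phi> n (q n H))"
    "lenv (mean_it f Q) (K n) H \<le> mean_it f Q (i n (q n H)) (y n (q n H)) + 2 / real (K n)" if "W H" for n H
    using cf[of n] that by simp_all
  have c2: "\<psi> n (q n H) (\<phi> n (q n H) v) = v" if "W H" "v \<in> ballv (edges H) (root H) (nat \<lceil>1 / \<delta> n\<rceil>)" for n H v
    using cf[of n] that by simp
  have R: "\<forall>\<^sub>F n in sequentially. r \<le> nat \<lceil>1 / \<delta> n\<rceil>" for r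
  proof -
    have "\<forall>\<^sub>F n in sequentially. real r * (2 * B + 2) \<le> real (K n)" using Kinf by (simp add: filterlim_at_top)
    then show ?thesis
    proof eventually_elim
      fix n assume "real r * (2 * B + 2) \<le> real (K n)"
      then have "real r \<le> 1 / \<delta> n" using B(1) by (simp add: \<delta>_def pos_le_divide_eq)
      then show "r \<le> nat \<lceil>1 / \<delta> n\<rceil>" by linarith
    qed
  qed
  have d2: "(\<lambda>n. \<delta> n + \<delta> n) \<longlonglongrightarrow> 0" using tendsto_add[OF K0 K0, of "2 * B + 2" "2 * B + 2"] by (simp add: \<delta>_def)
  have i': "n \<le> i n l" for n l using l(2)[of n l] by (simp add: K_def)
  define h where "h m z = f (sol_graph (y m (q m (G (fst z)))) (xit (y m (q m (G (fst z)))) (\<lambda>v. noise' G N z (\<psi> m (q m (G (fst z))) v)) (i m (q m (G (fst z))))))"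
    for m z
  have "\<exists>s. strict_mono s \<and> (AE z in M \<Otimes>\<^sub>M Q. (\<lambda>m. h (s m) z) \<longlonglongrightarrow> f (sol_graph (G (fst z)) (X (fst z))))"
    unfolding h_def by (rule couple[OF sol Q fd A2 f qm l(1) i' c(1) c2 R d2])
  then obtain s where s: "strict_mono s" "AE z in M \<Otimes>\<^sub>M Q. (\<lambda>m. h (s m) z) \<longlonglongrightarrow> f (sol_graph (G (fst z)) (X (fst z)))"
    by (elim exE conjE) (rule that)
  have hm: "h m \<in> borel_measurable (M \<Otimes>\<^sub>M Q)" for m
    unfolding h_def by (rule label_mean(2)[OF sol Q f B(2) qm l(1) l(3)])
  have hint: "(\<integral>z. h m z \<partial>(M \<Otimes>\<^sub>M Q)) = (\<integral>\<omega>. mean_it f Q (i m (q m (G \<omega>))) (y m (q m (G \<omega>))) \<partial>M)" for m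
    unfolding h_def by (rule label_mean(1)[OF sol Q f B(2) qm l(1) l(3)])
  have fm: "(\<lambda>\<omega>. f (sol_graph (G \<omega>) (X \<omega>))) \<in> borel_measurable M"
    by (rule test_sol_measurable[OF f d(4,3,7)])
  have "(\<lambda>m. \<integral>z. h (s m) z \<partial>(M \<Otimes>\<^sub>M Q)) \<longlonglongrightarrow> (\<integral>z. f (sol_graph (G (fst z)) (X (fst z))) \<partial>(M \<Otimes>\<^sub>M Q))"
  proof (rule integral_dominated_convergence[where w="\<lambda>_. B"])
    show "(\<lambda>z. f (sol_graph (G (fst z)) (X (fst z)))) \<in> borel_measurable (M \<Otimes>\<^sub>M Q)"
      by (rule measurable_compose[OF measurable_fst fm])
    show "AE z in M \<Otimes>\<^sub>M Q. norm (h (s m) z) \<le> B" for m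
      unfolding h_def by (rule AE_I2) (simp add: B(2)[OF l(1) xit_Dpath[OF l(1)]])
  qed (rule hm, rule MQ.integrable_const, rule s(2))
  then have "(\<lambda>m. (\<integral>z. h (s m) z \<partial>(M \<Otimes>\<^sub>M Q)) + 2 / real (K (s m))) \<longlonglongrightarrow> (\<integral>\<omega>. f (sol_graph (G \<omega>) (X \<omega>)) \<partial>M) + 0"
    unfolding integral_lift_fst[OF Q fm]
    using LIMSEQ_subseq_LIMSEQ[OF K0[of 2] s(1)] by (intro tendsto_add) (simp_all add: comp_def)
  then have "\<forall>\<^sub>F m in sequentially. (\<integral>z. h (s m) z \<partial>(M \<Otimes>\<^sub>M Q)) + 2 / real (K (s m)) < (\<integral>\<omega>. f (sol_graph (G \<omega>) (X \<omega>)) \<partial>M) + e"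
    by (rule order_tendstoD(2)) (use e in simp)
  \<comment> \<open>One index suffices, so convergence along the subsequence \<open>s\<close> is
    enough. From here on the envelope is fixed and only \<open>n\<close> tends to infinity.\<close>
  then obtain m where m: "(\<integral>z. h (s m) z \<partial>(M \<Otimes>\<^sub>M Q)) + 2 / real (K (s m)) < (\<integral>\<omega>. f (sol_graph (G \<omega>) (X \<omega>)) \<partial>M) + e"
    using eventually_happens'[OF sequentially_bot] by blast
  let ?k = "K (s m)" and ?u = "lenv (mean_it f Q) (K (s m))"
  have um: "(\<lambda>\<omega>. ?u (G \<omega>)) \<in> borel_measurable M" by (rule lenv_measurable[where B=B, OF mb d(4,3)])
  have ub: "\<bar>?u H\<bar> \<le> B" if "W H" for H by (rule lenv_abs[OF mb that])
  have "(\<integral>\<omega>. ?u (G \<omega>) \<partial>M) \<le> (\<integral>\<omega>. mean_it f Q (i (s m) (q (s m) (G \<omega>))) (y (s m) (q (s m) (G \<omega>))) + 2 / real ?k \<partial>M)"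
  proof (rule integral_mono)
    show "integrable M (\<lambda>\<omega>. ?u (G \<omega>))"
      by (rule M.integrable_const_bound[OF _ um, where B=B], rule AE_I2) (simp add: ub d(3))
    have "integrable M (\<lambda>\<omega>. mean_it f Q (i (s m) (q (s m) (G \<omega>))) (y (s m) (q (s m) (G \<omega>))))"
      by (rule M.integrable_const_bound[OF _ label_mean(3)[OF sol Q f B(2) qm l(1) l(3)], where B=B], rule AE_I2) (simp add: mb l(1))
    then show "integrable M (\<lambda>\<omega>. mean_it f Q (i (s m) (q (s m) (G \<omega>))) (y (s m) (q (s m) (G \<omega>))) + 2 / real ?k)" by simp
    show "?u (G \<omega>) \<le> mean_it f Q (i (s m) (q (s m) (G \<omega>))) (y (s m) (q (s m) (G \<omega>))) + 2 / real ?k" if "\<omega> \<in> space M" for \<omega>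
      by (rule c(2)[OF d(3)[OF that]])
  qed
  also have "\<dots> = (\<integral>z. h (s m) z \<partial>(M \<Otimes>\<^sub>M Q)) + 2 / real ?k"
  proof -
    have "integrable M (\<lambda>\<omega>. mean_it f Q (i (s m) (q (s m) (G \<omega>))) (y (s m) (q (s m) (G \<omega>))))"
      by (rule M.integrable_const_bound[OF _ label_mean(3)[OF sol Q f B(2) qm l(1) l(3)], where B=B], rule AE_I2) (simp add: mb l(1))
    then show ?thesis unfolding hint by (simp add: M.prob_space)
  qed
  finally have "(\<integral>\<omega>. ?u (G \<omega>) \<partial>M) < (\<integral>\<omega>. f (sol_graph (G \<omega>) (X \<omega>)) \<partial>M) + e" using m by simp
  \<comment> \<open>The assumed convergence in distribution enters here, for this one
    envelope.\<close>
  moreover have "test_fun (init_ok Xs) (\<lambda>ms m. ms \<longlonglongrightarrow> m) ?u" by (rule lenv_test[OF mb])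
  then have "(\<lambda>n. \<integral>\<omega>. ?u (Gs n \<omega>) \<partial>Ms n) \<longlonglongrightarrow> (\<integral>\<omega>. ?u (G \<omega>) \<partial>M)" using conv unfolding conv_distr_def by simp
  ultimately have "\<forall>\<^sub>F n in sequentially. (\<integral>\<omega>. ?u (Gs n \<omega>) \<partial>Ms n) < (\<integral>\<omega>. f (sol_graph (G \<omega>) (X \<omega>)) \<partial>M) + e"
    by (intro order_tendstoD(2))
  then show ?thesis
  proof eventually_elim
    fix n assume "(\<integral>\<omega>. ?u (Gs n \<omega>) \<partial>Ms n) < (\<integral>\<omega>. f (sol_graph (G \<omega>) (X \<omega>)) \<partial>M) + e"
    with sol_le_lenv[OF sols[of n] Q fds[of n] f, of ?k]
    show "(\<integral>\<omega>. f (sol_graph (Gs n \<omega>) (Xsol n \<omega>)) \<partial>Ms n) < (\<integral>\<omega>. f (sol_graph (G \<omega>) (X \<omega>)) \<partial>M) + e" by simp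
  qed
qed

lemma pf_uminus: "pf f \<Longrightarrow> pf (\<lambda>G. - f G)"
  unfolding test_fun_def by (simp add: tendsto_minus)

end

theorem mainTheorem3:
  fixes Xs J :: "int set" and \<sigma> :: "int \<Rightarrow> real"
    and rbar :: "('e::polish_space, 'k::polish_space) rbar_fam"
    and C :: "nat \<Rightarrow> real \<Rightarrow> real"
    and Ms :: "nat \<Rightarrow> 'w measure" and Fs :: "nat \<Rightarrow> real \<Rightarrow> 'w set set"
    and Gs :: "nat \<Rightarrow> 'w \<Rightarrow> ('e, 'k \<times> int) mgraph"
    and Ns :: "nat \<Rightarrow> 'w \<Rightarrow> nat \<Rightarrow> pt set" and Xsol :: "nat \<Rightarrow> 'w \<Rightarrow> nat \<Rightarrow> path"
    and M :: "'v measure" and F :: "real \<Rightarrow> 'v set set"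
    and G :: "'v \<Rightarrow> ('e, 'k \<times> int) mgraph"
    and N :: "'v \<Rightarrow> nat \<Rightarrow> pt set" and X :: "'v \<Rightarrow> nat \<Rightarrow> path"
  assumes setting: "jump_setting Xs J \<sigma>"
    and standing: "standing_rates Xs J rbar"
    and A1: "A1 Xs J rbar C"
    and sols: "\<And>n. strong_solution Xs J \<sigma> rbar (Ms n) (Fs n) (Gs n) (Ns n) (Xsol n)"
    and sol: "strong_solution Xs J \<sigma> rbar M F G N X"
    and fds: "\<And>n. AE \<omega> in Ms n. fin_dissoc J \<sigma> C (Gs n \<omega>)"
    and fd: "AE \<omega> in M. fin_dissoc J \<sigma> C (G \<omega>)"
    and A2: "A2 J rbar M G X"
    and conv: "conv_distr (init_ok Xs) (\<lambda>ms m. ms \<longlonglongrightarrow> m) Ms Gs M G"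
  shows "conv_distr (path_ok Xs) path_mconv Ms (\<lambda>n \<omega>. sol_graph (Gs n \<omega>) (Xsol n \<omega>))
           M (\<lambda>\<omega>. sol_graph (G \<omega>) (X \<omega>))"
proof -
  interpret jump_model Xs J \<sigma> rbar C by unfold_locales (fact setting standing A1)+
  show ?thesis
    unfolding conv_distr_def
  proof (intro allI impI)
    fix f :: "('e, 'k \<times> path) mgraph \<Rightarrow> real" assume f: "test_fun (path_ok Xs) path_mconv f"
    note up = upper_bound[OF sols sol fds fd A2 conv]
    show "(\<lambda>n. \<integral>\<omega>. f (sol_graph (Gs n \<omega>) (Xsol n \<omega>)) \<partial>Ms n) \<longlonglongrightarrow> (\<integral>\<omega>. f (sol_graph (G \<omega>) (X \<omega>)) \<partial>M)"
    proof (rule tendstoI)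
      fix e :: real assume e: "0 < e"
      from up[OF f e] up[OF pf_uminus[OF f] e]
      show "\<forall>\<^sub>F n in sequentially. dist (\<integral>\<omega>. f (sol_graph (Gs n \<omega>) (Xsol n \<omega>)) \<partial>Ms n) (\<integral>\<omega>. f (sol_graph (G \<omega>) (X \<omega>)) \<partial>M) < e"
        by eventually_elim (simp add: dist_real_def abs_less_iff)
    qed
  qed
qed

end
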